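(* Let $1<p<+\infty$, $1<q<+\infty$, $s\ge0$, let $w$ be an $A_p$-weight on $\mathbf{S}^n$, and let $f$ be a holomorphic function on $\mathbf{B}^n$. Then the following assertions are equivalent: (i) $f\in HF_s^{pq}(w)$. (ii) $A_{\alpha,k,q,s}(f)\in L^p(w)$ for some $\alpha\ge 1$ and some integer $k>s$. (iii) $A_{\alpha,k,q,s}(f)\in L^p(w)$ for all $\alpha\ge 1$ and all integers $k>s$.
   Context: $\mathbf{B}^n$ is the open unit ball of $\mathbf{C}^n$, $\mathbf{S}^n$ the unit sphere, $\sigma$ the normalized Lebesgue measure on $\mathbf{S}^n$, $dv$ Lebesgue measure on $\mathbf{B}^n$, $z\overline{\zeta}=\sum_i z_i\overline{\zeta_i}$, and $L^p(w)=L^p(\mathbf{S}^n,w\,d\sigma)$. Nonisotropic balls are $B(\zeta,r)=\{\eta\in\mathbf{S}^n: |1-\zeta\overline{\eta}|<r\}$. A weight $w\ge 0$ on $\mathbf{S}^n$ is an $A_p$-weight if there is $C>0$ with $\left(\frac1{|B|}\int_B w\,d\sigma\right)\left(\frac1{|B|}\int_B w^{-1/(p-1)}d\sigma\right)^{p-1}\le C$ for every nonisotropic ball $B$ ($|B|$ is its Lebesgue measure). For $f=\sum_kf_k$ the homogeneous polynomial expansion of a holomorphic function, $(I+R)^tf=\sum_k(1+k)^tf_k$. Let $k>s\geq 0$ with $k$ an integer and $\zeta\in\mathbf{S}^n$. For $\alpha=1$, $$A_{1,k,q,s}(f)(\zeta)=\left(\int_0^1|(I+R)^kf(r\zeta)|^q(1-r^2)^{(k-s)q-1}dr\right)^{1/q},$$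 and for $\alpha>1$, with $D_\alpha(\zeta)=\{z\in\mathbf{B}^n:|1-z\overline{\zeta}|<\alpha(1-|z|)\}$, $$A_{\alpha,k,q,s}(f)(\zeta)=\left(\int_{D_\alpha(\zeta)}|(I+R)^kf(z)|^q(1-|z|^2)^{(k-s)q-n-1}dv(z)\right)^{1/q}.$$ Let $[s]^+$ denote the integer part of $s$ plus $1$. $HF_s^{pq}(w)$ is the space of holomorphic functions $f$ in $\mathbf{B}^n$ with $$\|f\|_{HF_s^{pq}(w)}=\left(\int_{\mathbf{S}^n}\left(\int_0^1|((I+R)^{[s]^+}f)(r\zeta)|^q(1-r^2)^{([s]^+-s)q-1}dr\right)^{p/q}w(\zeta)\,d\sigma(\zeta)\right)^{1/p}<+\infty.$$ *)

theory Defs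
  imports "HOL-Analysis.Analysis"
begin

text \<open>
  Complex Euclidean space is \<^typ>\<open>complex ^ 'n\<close>, with dimension \<open>n = CARD('n) \<ge> 1\<close>; the open unit
  ball and the unit sphere are \<open>ball 0 1\<close> and \<open>sphere 0 1\<close>. Its \<^const>\<open>lborel\<close> is Lebesgue measure
  on the underlying real space of dimension \<open>2n\<close>.
\<close>

definition hermitian :: "complex ^ 'n \<Rightarrow> complex ^ 'n \<Rightarrow> complex" where
  "hermitian z \<zeta> = (\<Sum>i\<in>UNIV. z $ i * cnj (\<zeta> $ i))"

text \<open>
  Normalized surface measure, in polar coordinates: \<open>\<sigma>(E)\<close> is the proportion of the volume of the
  unit ball occupied by the points \<open>z \<noteq> 0\<close> with \<open>z / |z| \<in> E\<close>. The origin, which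
  is mapped to itself, is removed by the restriction to the sphere and is a null set. The completion
  makes all Lebesgue measurable functions on the sphere measurable.
\<close>
definition sphere_measure :: "(complex ^ 'n) measure" where
  "sphere_measure = completion (restrict_space
     (distr (uniform_measure lborel (ball 0 1)) borel (\<lambda>z. z /\<^sub>R norm z)) (sphere 0 1))"

text \<open>
  Real powers of extended nonnegative numbers, with \<open>0\<^sup>a = \<infinity>\<close> and \<open>\<infinity>\<^sup>a = 0\<close> for \<open>a < 0\<close>, whereas
  \<open>0 powr a = 0\<close> on the reals. Only exponents \<open>a \<noteq> 0\<close> are used below.
\<close>
definition ennpowr :: "ennreal \<Rightarrow> real \<Rightarrow> ennreal" where
  "ennpowr x a = (if (x = 0 \<and> a < 0) \<or> (x = \<infinity> \<and> a > 0) then \<infinity> else ennreal (enn2real x powr a))"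

definition nonisotropic_ball :: "complex ^ 'n \<Rightarrow> real \<Rightarrow> (complex ^ 'n) set" where
  "nonisotropic_ball \<zeta> r = {\<eta> \<in> sphere 0 1. norm (1 - hermitian \<zeta> \<eta>) < r}"

definition ball_average :: "(complex ^ 'n) set \<Rightarrow> (complex ^ 'n \<Rightarrow> ennreal) \<Rightarrow> ennreal" where
  "ball_average B g = (\<integral>\<^sup>+\<eta>\<in>B. g \<eta> \<partial>sphere_measure) / emeasure sphere_measure B"

text \<open>
  Where the weight vanishes, its negative power is \<open>\<infinity>\<close>. In a product of averages \<open>0 * \<infinity> = 0\<close>; on
  the full sphere, which is a nonisotropic ball, this occurs only if the weight is 0 almost everywhere.
\<close>
definition Ap_weight :: "real \<Rightarrow> (complex ^ 'n \<Rightarrow> real) \<Rightarrow> bool" where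
  "Ap_weight p w \<longleftrightarrow>
     w \<in> borel_measurable sphere_measure \<and> (\<forall>\<zeta>\<in>sphere 0 1. 0 \<le> w \<zeta>) \<and>
     (\<exists>C::real. C > 0 \<and> (\<forall>\<zeta>\<in>sphere 0 1. \<forall>r>0.
        ball_average (nonisotropic_ball \<zeta> r) (\<lambda>\<eta>. ennreal (w \<eta>)) *
        ennpowr (ball_average (nonisotropic_ball \<zeta> r)
                   (\<lambda>\<eta>. ennpowr (ennreal (w \<eta>)) (- 1 / (p - 1)))) (p - 1)
        \<le> ennreal C))"

definition in_Lp :: "real \<Rightarrow> (complex ^ 'n \<Rightarrow> real) \<Rightarrow> (complex ^ 'n \<Rightarrow> ennreal) \<Rightarrow> bool" where
  "in_Lp p w g \<longleftrightarrow> g \<in> borel_measurable sphere_measure \<and>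
     (\<integral>\<^sup>+\<zeta>. ennpowr (g \<zeta>) p * ennreal (w \<zeta>) \<partial>sphere_measure) < \<infinity>"

definition holomorphic_on_ball :: "(complex ^ 'n \<Rightarrow> complex) \<Rightarrow> bool" where
  "holomorphic_on_ball f \<longleftrightarrow> (\<forall>z\<in>ball 0 1. \<exists>f'. (f has_derivative f') (at z) \<and>
     (\<forall>c v. f' (c *s v) = c * f' v))"

definition homogeneous_polynomial :: "nat \<Rightarrow> (complex ^ 'n \<Rightarrow> complex) \<Rightarrow> bool" where
  "homogeneous_polynomial d P \<longleftrightarrow> (\<exists>c :: ('n \<Rightarrow> nat) \<Rightarrow> complex. \<forall>z.
     P z = (\<Sum>m | sum m UNIV = d. c m * (\<Prod>i\<in>UNIV. (z $ i) ^ m i)))"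

definition homogeneous_expansion ::
    "(complex ^ 'n \<Rightarrow> complex) \<Rightarrow> (nat \<Rightarrow> complex ^ 'n \<Rightarrow> complex) \<Rightarrow> bool" where
  "homogeneous_expansion f F \<longleftrightarrow> (\<forall>d. homogeneous_polynomial d (F d)) \<and>
     (\<forall>z\<in>ball 0 1. (\<lambda>d. F d z) sums f z)"

text \<open>The expansion of a holomorphic function exists and is unique.\<close>
definition homogeneous_part :: "(complex ^ 'n \<Rightarrow> complex) \<Rightarrow> nat \<Rightarrow> complex ^ 'n \<Rightarrow> complex" where
  "homogeneous_part f = (THE F. homogeneous_expansion f F)"

text \<open>The operator \<open>(I + R)\<^sup>t\<close>; only its values in the ball are meaningful.\<close>
definition IR_power :: "real \<Rightarrow> (complex ^ 'n \<Rightarrow> complex) \<Rightarrow> complex ^ 'n \<Rightarrow> complex" where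
  "IR_power t f z = (\<Sum>d. complex_of_real ((1 + real d) powr t) * homogeneous_part f d z)"

definition admissible_region :: "real \<Rightarrow> complex ^ 'n \<Rightarrow> (complex ^ 'n) set" where
  "admissible_region \<alpha> \<zeta> = {z \<in> ball 0 1. norm (1 - hermitian z \<zeta>) < \<alpha> * (1 - norm z)}"

text \<open>The integral of the \<open>q\<close>-th power in the radial case, which the norm below uses as well.\<close>
definition radial_integral ::
    "nat \<Rightarrow> real \<Rightarrow> real \<Rightarrow> (complex ^ 'n \<Rightarrow> complex) \<Rightarrow> complex ^ 'n \<Rightarrow> ennreal" where
  "radial_integral k q s f \<zeta> =
     (\<integral>\<^sup>+r\<in>{0<..<1}. ennreal (norm (IR_power (real k) f (r *\<^sub>R \<zeta>)) powr q
                          * (1 - r\<^sup>2) powr ((real k - s) * q - 1)) \<partial>lborel)"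

definition area_integral ::
    "real \<Rightarrow> nat \<Rightarrow> real \<Rightarrow> real \<Rightarrow> (complex ^ 'n \<Rightarrow> complex) \<Rightarrow> complex ^ 'n \<Rightarrow> ennreal" where
  "area_integral \<alpha> k q s f \<zeta> =
     (\<integral>\<^sup>+z\<in>admissible_region \<alpha> \<zeta>. ennreal (norm (IR_power (real k) f z) powr q
          * (1 - (norm z)\<^sup>2) powr ((real k - s) * q - real CARD('n) - 1)) \<partial>lborel)"

text \<open>Intended for \<open>\<alpha> \<ge> 1\<close> and \<open>k > s\<close>.\<close>
definition A_functional ::
    "real \<Rightarrow> nat \<Rightarrow> real \<Rightarrow> real \<Rightarrow> (complex ^ 'n \<Rightarrow> complex) \<Rightarrow> complex ^ 'n \<Rightarrow> ennreal" where
  "A_functional \<alpha> k q s f \<zeta> =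
     ennpowr (if \<alpha> = 1 then radial_integral k q s f \<zeta> else area_integral \<alpha> k q s f \<zeta>) (1 / q)"

definition HF_norm ::
    "real \<Rightarrow> real \<Rightarrow> real \<Rightarrow> (complex ^ 'n \<Rightarrow> real) \<Rightarrow> (complex ^ 'n \<Rightarrow> complex) \<Rightarrow> ennreal" where
  "HF_norm p q s w f =
     ennpowr (\<integral>\<^sup>+\<zeta>. ennpowr (radial_integral (nat \<lfloor>s\<rfloor> + 1) q s f \<zeta>) (p / q) * ennreal (w \<zeta>)
                \<partial>sphere_measure) (1 / p)"

definition HF_space ::
    "real \<Rightarrow> real \<Rightarrow> real \<Rightarrow> (complex ^ 'n \<Rightarrow> real) \<Rightarrow> (complex ^ 'n \<Rightarrow> complex) set" where
  "HF_space p q s w = {f. holomorphic_on_ball f \<and> HF_norm p q s w f < \<infinity>}"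

end

theory Submission
  imports Defs "HOL-Complex_Analysis.Complex_Analysis"
begin

text \<open>
  All conditions say that an integral of the power \<open>P = p / q\<close> of some function on the sphere is
  finite with respect to \<open>w d\<sigma>\<close>: the function is a radial integral \<open>R\<^sub>k\<close> (for \<open>\<alpha> = 1\<close>, and for the norm
  of the space with \<open>k = [s]\<^sup>+\<close>) or an area integral \<open>A\<^sub>\<alpha>\<^sub>,\<^sub>k\<close> (for \<open>\<alpha> > 1\<close>) of \<open>g\<^sub>k = (I + R)\<^sup>k f\<close>. So it
  suffices to show, for all \<open>k > s\<close> and \<open>\<alpha> > 1\<close>, that finiteness for \<open>R\<^sub>k\<close> is equivalent to finiteness for
  \<open>R\<^sub>k\<^sub>+\<^sub>1\<close> and to finiteness for \<open>A\<^sub>\<alpha>\<^sub>,\<^sub>k\<close>.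

  Two of the four implications hold pointwise, up to additive and multiplicative constants. On a
  complex line the derivative of \<open>c g\<^sub>k(c z)\<close> in \<open>c\<close> is \<open>g\<^sub>k\<^sub>+\<^sub>1(c z)\<close> (\<open>IR_power_derivative\<close>), so Hardy's
  inequality along a radius bounds \<open>R\<^sub>k\<close> by \<open>R\<^sub>k\<^sub>+\<^sub>1\<close> (\<open>radial_part_le_derivative\<close>). The mean value
  inequality for \<open>|g\<^sub>k|\<^sup>q\<close> on small nonisotropic boxes around the points of the radius, which lie in the
  admissible region, bounds \<open>R\<^sub>k\<close> by \<open>A\<^sub>\<alpha>\<^sub>,\<^sub>k\<close> (\<open>radial_part_le_area\<close>).

  The other two implications need averages, because an area integral, or a derivative, at a point over
  \<open>\<zeta>\<close> involves values of \<open>g\<^sub>k\<close> on other radii. Let \<open>S\<^sub>j(\<eta>)\<close> be the part of the radial integral over the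
  radii with \<open>1 - r\<close> comparable to \<open>2\<^sup>-\<^sup>j\<close>. The mean value inequality for a small power of \<open>|g\<^sub>k|\<close>,
  Hoelder's inequality and the \<open>A\<^sub>p\<close> condition bound \<open>|g\<^sub>k|\<^sup>q\<close> at height \<open>2\<^sup>-\<^sup>j\<close> over \<open>\<zeta>\<close> by \<open>2\<^sup>a\<^sup>j\<close>, with
  \<open>a = (k - s) q\<close>, times the dyadic average \<open>(avg S\<^sub>j\<^sup>1\<^sup>/\<^sup>N)\<^sup>N\<close>, where the average is taken over a
  nonisotropic ball of radius comparable to \<open>2\<^sup>-\<^sup>j\<close> with respect to \<open>w d\<sigma>\<close>
  (\<open>pointwise_le_dyadic_average\<close>). Consequently \<open>A\<^sub>\<alpha>\<^sub>,\<^sub>k\<close>, and by Cauchy's inequality also \<open>R\<^sub>k\<^sub>+\<^sub>1\<close>, is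
  bounded by the sum of these averages over \<open>j\<close> (\<open>area_integral_le_dyadic\<close>,
  \<open>derivative_radial_part_le_dyadic\<close>).

  It remains to remove the averages inside the \<open>L\<^sup>P\<close> norm. The measure \<open>w d\<sigma>\<close> is doubling, and on every
  bounded space with a doubling measure the integral of \<open>(\<Sum>\<^sub>j (avg S\<^sub>j\<^sup>1\<^sup>/\<^sup>N)\<^sup>N)\<^sup>P\<close> is at most a constant
  times that of \<open>(\<Sum>\<^sub>j S\<^sub>j)\<^sup>P\<close>, if the radii decrease with \<open>j\<close> and \<open>N\<close> is chosen suitably for \<open>P\<close>
  (\<open>avg_power_sum_bound\<close>). This takes the place of the Fefferman--Stein vector-valued maximal inequality.
  Since each radius lies in boundedly many shells, \<open>\<Sum>\<^sub>j S\<^sub>j\<close> is at most a constant times \<open>R\<^sub>k\<close>.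
\<close>

section \<open>Real powers of extended nonnegative numbers\<close>

lemma ennreal_pos_cases:
  obtains "x = 0" | "x = top" | r where "x = ennreal r" "0 < r"
  by (cases x) (auto, metis ennreal_0 less_eq_real_def)

lemma ennpowr_ennreal: "0 \<le> x \<Longrightarrow> 0 < a \<Longrightarrow> ennpowr (ennreal x) a = ennreal (x powr a)"
  by (simp add: ennpowr_def)

lemma ennpowr_ennreal_pos: "0 < x \<Longrightarrow> ennpowr (ennreal x) a = ennreal (x powr a)"
  by (simp add: ennpowr_def ennreal_eq_0_iff)

lemma ennpowr_top [simp]: "0 < a \<Longrightarrow> ennpowr top a = top"
  by (simp add: ennpowr_def)

lemma ennpowr_zero [simp]: "0 < a \<Longrightarrow> ennpowr 0 a = 0"
  by (simp add: ennpowr_def)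

lemma ennpowr_one_left [simp]: "ennpowr 1 a = 1"
  by (simp add: ennpowr_def)

lemma ennpowr_one [simp]: "ennpowr x 1 = x"
  by (cases x) (auto simp: ennpowr_def)

lemma ennpowr_mono: "0 < a \<Longrightarrow> x \<le> y \<Longrightarrow> ennpowr x a \<le> ennpowr y a"
  by (cases x; cases y) (auto simp: ennpowr_ennreal top_unique intro!: ennreal_leI powr_mono2)

lemma ennpowr_mult:
  assumes a: "0 < a" shows "ennpowr (x * y) a = ennpowr x a * ennpowr y a"
proof (cases rule: ennreal_pos_cases[of x])
  case (3 r)
  then show ?thesis using a
    by (cases rule: ennreal_pos_cases[of y])
       (auto simp: ennpowr_ennreal_pos ennreal_mult_top ennreal_mult[symmetric] powr_mult ennreal_eq_0_iff)
next
  case 2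
  then show ?thesis using a
    by (cases rule: ennreal_pos_cases[of y])
       (auto simp: ennpowr_ennreal_pos ennreal_top_mult ennreal_eq_0_iff)
qed (use a in auto)

lemma ennpowr_add: "0 < a \<Longrightarrow> 0 < b \<Longrightarrow> ennpowr x (a + b) = ennpowr x a * ennpowr x b"
  by (cases rule: ennreal_pos_cases[of x])
     (auto simp: ennpowr_ennreal_pos ennreal_mult[symmetric] powr_add)

lemma ennpowr_ennpowr: "0 < a \<Longrightarrow> 0 < b \<Longrightarrow> ennpowr (ennpowr x a) b = ennpowr x (a * b)"
  by (cases rule: ennreal_pos_cases[of x]) (auto simp: ennpowr_ennreal_pos powr_powr)

lemma ennpowr_eq_0_iff: "0 < a \<Longrightarrow> ennpowr x a = 0 \<longleftrightarrow> x = 0"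
  by (cases rule: ennreal_pos_cases[of x]) (auto simp: ennpowr_ennreal_pos ennreal_eq_0_iff)

lemma ennpowr_eq_top_iff: "0 < a \<Longrightarrow> ennpowr x a = top \<longleftrightarrow> x = top"
  by (cases rule: ennreal_pos_cases[of x]) (auto simp: ennpowr_ennreal_pos)

lemma ennpowr_less_top_iff: "0 < a \<Longrightarrow> ennpowr x a < top \<longleftrightarrow> x < top"
  using ennpowr_eq_top_iff[of a x] by (auto simp: less_top[symmetric])

lemma ennpowr_inverse: "0 < a \<Longrightarrow> ennpowr (ennpowr x a) (1 / a) = x"
  "0 < a \<Longrightarrow> ennpowr (ennpowr x (1 / a)) a = x"
  by (simp_all add: ennpowr_ennpowr)

lemma measurable_ennpowr [measurable (raw)]:
  "g \<in> borel_measurable M \<Longrightarrow> (\<lambda>x. ennpowr (g x) a) \<in> borel_measurable M"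
proof -
  assume [measurable]: "g \<in> borel_measurable M"
  have "(\<lambda>x. ennpowr (g x) a) = (\<lambda>x. if (a < 0 \<and> g x = 0) \<or> (0 < a \<and> g x = top) then top else ennreal (enn2real (g x) powr a))"
    by (auto simp: ennpowr_def fun_eq_iff)
  moreover have "(\<lambda>x. enn2real (g x) powr a) \<in> borel_measurable M"
    by measurable
  ultimately show ?thesis by (cases "0 < a"; cases "a < 0") (simp_all, measurable)
qed

lemma ennpowr_SUP:
  assumes a: "0 < a"
  shows "ennpowr (SUP i\<in>I. X i) a = (SUP i\<in>I. ennpowr (X i) a)"
proof (rule antisym)
  have "X i \<le> ennpowr (SUP i\<in>I. ennpowr (X i) a) (1 / a)" if "i \<in> I" for i
  proof -
    have "ennpowr (X i) a \<le> (SUP i\<in>I. ennpowr (X i) a)" using that by (rule SUP_upper)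
    from ennpowr_mono[OF _ this, of "1/a"] show ?thesis using a by (simp add: ennpowr_inverse)
  qed
  then have "(SUP i\<in>I. X i) \<le> ennpowr (SUP i\<in>I. ennpowr (X i) a) (1 / a)" by (rule SUP_least)
  from ennpowr_mono[OF a this] show "ennpowr (SUP i\<in>I. X i) a \<le> (SUP i\<in>I. ennpowr (X i) a)"
    using a by (simp add: ennpowr_inverse)
  show "(SUP i\<in>I. ennpowr (X i) a) \<le> ennpowr (SUP i\<in>I. X i) a"
    by (intro SUP_least ennpowr_mono a SUP_upper)
qed

lemma ennpowr_add_le:
  assumes a: "0 < a"
  shows "ennpowr (x + y) a \<le> ennreal (2 powr a) * (ennpowr x a + ennpowr y a)"
proof -
  have "x + y \<le> 2 * max x y" by (simp add: mult_2 add_mono)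
  then have "ennpowr (x + y) a \<le> ennpowr (ennreal 2 * max x y) a" by (intro ennpowr_mono a) simp
  also have "\<dots> = ennreal (2 powr a) * ennpowr (max x y) a"
    using a by (simp only: ennpowr_mult ennpowr_ennreal)
  also have "ennpowr (max x y) a \<le> ennpowr x a + ennpowr y a" by (simp add: max_def)
  finally show ?thesis by (simp add: mult_left_mono)
qed

text \<open>
  Young's inequality, after normalizing both factors; the degenerate cases are those in which a factor has
  integral \<open>0\<close> or \<open>\<infinity>\<close>.
\<close>
lemma Holder_nn_integral:
  assumes pq: "1 < p" "1 < p'" "1 / p + 1 / p' = 1"
    and [measurable]: "F \<in> borel_measurable M" "G \<in> borel_measurable M"
  shows "(\<integral>\<^sup>+x. F x * G x \<partial>M)
    \<le> ennpowr (\<integral>\<^sup>+x. ennpowr (F x) p \<partial>M) (1 / p) * ennpowr (\<integral>\<^sup>+x. ennpowr (G x) p' \<partial>M) (1 / p')"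
proof -
  define A where "A = (\<integral>\<^sup>+x. ennpowr (F x) p \<partial>M)"
  define B where "B = (\<integral>\<^sup>+x. ennpowr (G x) p' \<partial>M)"
  have p0: "0 < p" "0 < p'" "0 < 1/p" "0 < 1/p'" using pq by auto
  show ?thesis
  proof (cases "A = 0 \<or> B = 0")
    case True
    have "AE x in M. F x * G x = 0"
    proof (cases "A = 0")
      case True
      then have "AE x in M. ennpowr (F x) p = 0" unfolding A_def by (subst (asm) nn_integral_0_iff_AE) auto
      then show ?thesis by eventually_elim (simp add: ennpowr_eq_0_iff p0)
    next
      case False
      then have "B = 0" using True by simp
      then have "AE x in M. ennpowr (G x) p' = 0" unfolding B_def by (subst (asm) nn_integral_0_iff_AE) auto
      then show ?thesis by eventually_elim (simp add: ennpowr_eq_0_iff p0)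
    qed
    then have "(\<integral>\<^sup>+x. F x * G x \<partial>M) = 0" by (simp add: nn_integral_0_iff_AE)
    then show ?thesis by simp
  next
    case False
    show ?thesis
    proof (cases "A = top \<or> B = top")
      case True
      then have "ennpowr A (1/p) * ennpowr B (1/p') = top"
        using False p0 by (auto simp: ennreal_top_mult ennreal_mult_top ennpowr_eq_0_iff)
      then show ?thesis by (simp add: A_def B_def)
    next
      case fin: False
      then obtain a b where ab: "A = ennreal a" "0 < a" "B = ennreal b" "0 < b"
        using False by (metis ennreal_pos_cases)
      define s where "s = a powr (1/p)"
      define t where "t = b powr (1/p')"
      have st: "0 < s" "0 < t" using ab by (auto simp: s_def t_def)
      have sp: "s powr p = a" "t powr p' = b" using ab p0 by (auto simp: s_def t_def powr_powr)
      have pt: "F x * G x \<le> ennreal (s * t) * (ennreal (1 / (p * a)) * ennpowr (F x) p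
            + ennreal (1 / (p' * b)) * ennpowr (G x) p')" for x
      proof -
        consider "F x = 0 \<or> G x = 0" | "F x \<noteq> 0" "G x \<noteq> 0" "F x = top \<or> G x = top"
          | u v where "F x = ennreal u" "G x = ennreal v" "0 < u" "0 < v"
          by (metis ennreal_pos_cases)
        then show ?thesis
        proof cases
          case 1
          then show ?thesis by auto
        next
          case 2
          have pab: "\<not> p * a \<le> 0" "\<not> p' * b \<le> 0"
            using mult_pos_pos[OF p0(1) ab(2)] mult_pos_pos[OF p0(2) ab(4)] by linarith+
          from 2 have eq: "ennreal (1 / (p * a)) * ennpowr (F x) p + ennreal (1 / (p' * b)) * ennpowr (G x) p' = top"
            using p0 ab pab by (auto simp: ennreal_mult_top ennreal_eq_0_iff)
          show ?thesis unfolding eq using st by (simp add: ennreal_mult_top)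
        next
          case 3
          have "(u / s) * (v / t) \<le> (u / s) powr p / p + (v / t) powr p' / p'"
            by (rule Youngs_inequality) (use pq 3 st in auto)
          also have "\<dots> = u powr p / (p * a) + v powr p' / (p' * b)"
            using 3 st by (simp add: powr_divide sp mult.commute)
          finally have "u * v \<le> (s * t) * (1 / (p * a) * u powr p + 1 / (p' * b) * v powr p')"
            using st by (simp add: field_simps)
          then have "ennreal (u * v) \<le> ennreal ((s * t) * (1 / (p * a) * u powr p + 1 / (p' * b) * v powr p'))"
            by (rule ennreal_leI)
          then show ?thesis using 3 st ab p0
            by (simp add: ennpowr_ennreal_pos ennreal_mult[symmetric] ennreal_plus[symmetric] del: ennreal_plus)
        qed
      qed
      have "(\<integral>\<^sup>+x. F x * G x \<partial>M) \<le> (\<integral>\<^sup>+x. ennreal (s * t) * (ennreal (1 / (p * a)) * ennpowr (F x) p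
            + ennreal (1 / (p' * b)) * ennpowr (G x) p') \<partial>M)"
        by (rule nn_integral_mono) (rule pt)
      also have "\<dots> = ennreal (s * t) * (ennreal (1 / (p * a)) * A + ennreal (1 / (p' * b)) * B)"
        by (simp add: nn_integral_cmult nn_integral_add A_def B_def)
      also have "ennreal (1 / (p * a)) * A + ennreal (1 / (p' * b)) * B = ennreal (1 / p + 1 / p')"
        using ab p0 by (simp add: ennreal_mult[symmetric] ennreal_plus[symmetric] del: ennreal_plus)
      also have "\<dots> = 1" by (simp add: pq)
      finally have "(\<integral>\<^sup>+x. F x * G x \<partial>M) \<le> ennreal s * ennreal t"
        using st by (simp add: ennreal_mult)
      also have "\<dots> = ennpowr A (1 / p) * ennpowr B (1 / p')"
        using ab p0 by (simp add: ennpowr_ennreal_pos s_def t_def)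
      finally show ?thesis by (simp add: A_def B_def)
    qed
  qed
qed

lemma Holder_sum:
  assumes pq: "1 < p" "1 < p'" "1 / p + 1 / p' = 1" and "finite I"
  shows "(\<Sum>i\<in>I. F i * G i) \<le> ennpowr (\<Sum>i\<in>I. ennpowr (F i) p) (1 / p) * ennpowr (\<Sum>i\<in>I. ennpowr (G i) p') (1 / p')"
  using Holder_nn_integral[OF pq, of F "count_space I" G] assms(4)
  by (simp add: nn_integral_count_space_finite)

text \<open>Hoelder's inequality against the indicator function of \<open>B\<close>.\<close>
lemma nn_integral_power_mean:
  assumes N: "1 \<le> N" and [measurable]: "G \<in> borel_measurable M" "B \<in> sets M"
    and fin: "emeasure M B \<noteq> top"
  shows "ennpowr ((\<integral>\<^sup>+x\<in>B. G x \<partial>M) / emeasure M B) N \<le> (\<integral>\<^sup>+x\<in>B. ennpowr (G x) N \<partial>M) / emeasure M B"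
proof (cases "emeasure M B = 0 \<or> N = 1")
  case True
  then show ?thesis
  proof
    assume "emeasure M B = 0"
    then have "AE x in M. x \<notin> B" by (intro AE_not_in) auto
    then have "(\<integral>\<^sup>+x\<in>B. G x \<partial>M) = 0" by (subst nn_integral_0_iff_AE) (auto)
    then show ?thesis using N by simp
  qed simp
next
  case False
  define m where "m = measure M B"
  have m: "emeasure M B = ennreal m" "0 < m"
    using fin False by (simp_all add: m_def emeasure_eq_ennreal_measure) (metis ennreal_0 emeasure_eq_ennreal_measure fin less_eq_real_def measure_nonneg)
  have N1: "1 < N" using N False by auto
  define N' where "N' = N / (N - 1)"
  have N': "1 < N'" "1 / N + 1 / N' = 1" using N1 by (auto simp: N'_def field_simps)
  have "(\<integral>\<^sup>+x\<in>B. G x \<partial>M) = (\<integral>\<^sup>+x. (G x * indicator B x) * indicator B x \<partial>M)"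
    by (intro nn_integral_cong) (auto simp: indicator_def)
  also have "\<dots> \<le> ennpowr (\<integral>\<^sup>+x. ennpowr (G x * indicator B x) N \<partial>M) (1/N) * ennpowr (\<integral>\<^sup>+x. ennpowr (indicator B x) N' \<partial>M) (1/N')"
    by (rule Holder_nn_integral) (use N1 N' in auto)
  also have "(\<integral>\<^sup>+x. ennpowr (indicator B x) N' \<partial>M) = (\<integral>\<^sup>+x. indicator B x \<partial>M)"
    by (intro nn_integral_cong) (use N' in \<open>auto simp: indicator_def\<close>)
  also have "\<dots> = ennreal m" using m by simp
  also have "(\<integral>\<^sup>+x. ennpowr (G x * indicator B x) N \<partial>M) = (\<integral>\<^sup>+x\<in>B. ennpowr (G x) N \<partial>M)"
    by (intro nn_integral_cong) (use N in \<open>auto simp: indicator_def\<close>)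
  finally have le: "(\<integral>\<^sup>+x\<in>B. G x \<partial>M) \<le> ennpowr (\<integral>\<^sup>+x\<in>B. ennpowr (G x) N \<partial>M) (1/N) * ennpowr (ennreal m) (1/N')" .
  have e: "(m powr (1 / N')) powr N = m powr (N - 1)" using N1 by (simp add: N'_def powr_powr)
  from le have "ennpowr (\<integral>\<^sup>+x\<in>B. G x \<partial>M) N \<le> ennpowr (ennpowr (\<integral>\<^sup>+x\<in>B. ennpowr (G x) N \<partial>M) (1/N) * ennpowr (ennreal m) (1/N')) N"
    using N1 by (intro ennpowr_mono) auto
  also have "\<dots> = (\<integral>\<^sup>+x\<in>B. ennpowr (G x) N \<partial>M) * ennreal (m powr (N - 1))"
    using N1 N' m e by (simp add: ennpowr_mult ennpowr_ennpowr ennpowr_ennreal_pos)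
  finally have 1: "ennpowr (\<integral>\<^sup>+x\<in>B. G x \<partial>M) N \<le> (\<integral>\<^sup>+x\<in>B. ennpowr (G x) N \<partial>M) * ennreal (m powr (N - 1))" .
  have "ennpowr ((\<integral>\<^sup>+x\<in>B. G x \<partial>M) / emeasure M B) N = ennpowr (\<integral>\<^sup>+x\<in>B. G x \<partial>M) N * ennreal (m powr (-N))"
    using m N1 by (simp add: divide_ennreal_def ennpowr_mult inverse_ennreal ennpowr_ennreal_pos powr_minus inverse_powr)
  also have "\<dots> \<le> (\<integral>\<^sup>+x\<in>B. ennpowr (G x) N \<partial>M) * ennreal (m powr (N - 1)) * ennreal (m powr (-N))"
    by (rule mult_right_mono[OF 1]) simp
  also have "\<dots> = (\<integral>\<^sup>+x\<in>B. ennpowr (G x) N \<partial>M) * ennreal (m powr (-1))"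
    by (simp add: mult.assoc ennreal_mult[symmetric] powr_add[symmetric])
  also have "\<dots> = (\<integral>\<^sup>+x\<in>B. ennpowr (G x) N \<partial>M) / emeasure M B"
    using m by (simp add: divide_ennreal_def inverse_ennreal powr_minus)
  finally show ?thesis .
qed

section \<open>Sums of averages with respect to a doubling measure\<close>

text \<open>The mean value theorem for \<open>t\<^sup>P\<close>, with the derivative at the larger point.\<close>
lemma powr_increment_le:
  fixes s t P :: real
  assumes "1 < P" "0 \<le> s" "s \<le> t"
  shows "t powr P \<le> s powr P + P * (t - s) * t powr (P - 1)"
proof -
  define P' where "P' = P / (P - 1)"
  have P': "1 < P'" "1 / P + 1 / P' = 1" using assms by (auto simp: P'_def field_simps)
  have "s * t powr (P - 1) \<le> s powr P / P + (t powr (P - 1)) powr P' / P'"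
    by (rule Youngs_inequality) (use assms P' in auto)
  also have "(t powr (P - 1)) powr P' = t powr P" using assms by (simp add: powr_powr P'_def)
  finally have "P * (s * t powr (P - 1)) \<le> P * (s powr P / P + t powr P / P')"
    using assms by (intro mult_left_mono) auto
  also have "\<dots> = s powr P + (P - 1) * t powr P" using assms by (simp add: P'_def field_simps)
  finally have 1: "P * (s * t powr (P - 1)) \<le> s powr P + (P - 1) * t powr P" .
  have "t powr P = t * t powr (P - 1)"
    using assms by (cases "t = 0") (auto simp: powr_diff)
  with 1 show ?thesis by (simp add: algebra_simps)
qed

lemma inverse_le_of_comparable:
  fixes a b :: ennreal
  assumes "a \<le> ennreal K * b" "0 \<le> K" "a \<noteq> 0" "b \<noteq> 0" "a \<noteq> top" "b \<noteq> top"
  shows "1 / b \<le> ennreal K / a"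
proof -
  obtain u v where uv: "a = ennreal u" "b = ennreal v" "0 < u" "0 < v"
    using assms by (metis ennreal_pos_cases)
  then have "u \<le> K * v" using assms by (simp add: ennreal_mult[symmetric])
  then have "1 / v \<le> K / u" using uv by (simp add: field_simps)
  then show ?thesis using uv assms(2)
    by (simp add: divide_ennreal ennreal_1[symmetric] del: ennreal_1)
qed

text \<open>
  The analogue for sums of \<open>d(s\<^sup>P) = P s\<^sup>P\<^sup>-\<^sup>1 ds\<close>, with
  \<open>s\<close> running through the partial sums.
\<close>
lemma ennpowr_sum_le_partial_sums:
  fixes a :: "nat \<Rightarrow> ennreal"
  assumes P: "1 < P"
  shows "ennpowr (\<Sum>j<J. a j) P \<le> ennreal P * (\<Sum>j<J. a j * ennpowr (\<Sum>i\<le>j. a i) (P - 1))"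
proof (induction J)
  case 0
  show ?case using P by simp
next
  case (Suc J)
  define s where "s = (\<Sum>j<J. a j)"
  have t: "(\<Sum>i\<le>J. a i) = s + a J" by (simp add: s_def lessThan_Suc_atMost[symmetric])
  have "ennpowr (s + a J) P \<le> ennpowr s P + ennreal P * (a J * ennpowr (s + a J) (P - 1))"
  proof (cases "s = top \<or> a J = top")
    case True
    then show ?thesis using P
      by (cases "a J = 0") (auto simp: ennreal_mult_top ennreal_top_mult ennreal_eq_0_iff)
  next
    case False
    then obtain u v where uv: "s = ennreal u" "a J = ennreal v" "0 \<le> u" "0 \<le> v"
      by (metis ennreal_cases)
    have "(u + v) powr P \<le> u powr P + P * (u + v - u) * (u + v) powr (P - 1)"
      using powr_increment_le[of P u "u + v"] P uv by simp
    then have "ennreal ((u + v) powr P) \<le> ennreal (u powr P + P * v * (u + v) powr (P - 1))"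
      by (intro ennreal_leI) simp
    then show ?thesis using uv P
      by (simp add: ennreal_plus[symmetric] ennpowr_ennreal ennreal_mult[symmetric] mult.assoc del: ennreal_plus)
  qed
  also have "\<dots> \<le> ennreal P * (\<Sum>j<J. a j * ennpowr (\<Sum>i\<le>j. a i) (P - 1)) + ennreal P * (a J * ennpowr (s + a J) (P - 1))"
    using Suc.IH by (intro add_mono) (simp_all add: s_def)
  also have "\<dots> = ennreal P * (\<Sum>j<Suc J. a j * ennpowr (\<Sum>i\<le>j. a i) (P - 1))"
    by (simp add: t distrib_left)
  finally show ?case by (simp add: s_def)
qed

text \<open>
  A space of homogeneous type. The constants in the quasi-triangle inequality and in the bound on the
  diameter are those of \<open>|1 - x\<eta>|\<close> on the sphere.
\<close>
locale doubling_space = finite_measure M for M :: "'a measure" +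
  fixes d :: "'a \<Rightarrow> 'a \<Rightarrow> real" and K :: real
  assumes d_measurable [measurable]: "(\<lambda>(x, y). d x y) \<in> borel_measurable (M \<Otimes>\<^sub>M M)"
    and d_sym: "x \<in> space M \<Longrightarrow> y \<in> space M \<Longrightarrow> d x y = d y x"
    and d_tri: "x \<in> space M \<Longrightarrow> y \<in> space M \<Longrightarrow> z \<in> space M \<Longrightarrow> d x z \<le> 2 * (d x y + d y z)"
    and d_less_4: "x \<in> space M \<Longrightarrow> y \<in> space M \<Longrightarrow> d x y < 4"
    and doubling: "x \<in> space M \<Longrightarrow> 0 < r \<Longrightarrow>
      emeasure M {y \<in> space M. d x y < 4 * r} \<le> ennreal K * emeasure M {y \<in> space M. d x y < r}"
    and ball_pos: "x \<in> space M \<Longrightarrow> 0 < r \<Longrightarrow> 0 < emeasure M {y \<in> space M. d x y < r}"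
    and K_ge_1: "1 \<le> K"
begin

definition qball :: "'a \<Rightarrow> real \<Rightarrow> 'a set" where
  "qball x r = {y \<in> space M. d x y < r}"

definition avg :: "real \<Rightarrow> ('a \<Rightarrow> ennreal) \<Rightarrow> 'a \<Rightarrow> ennreal" where
  "avg r G x = (\<integral>\<^sup>+y\<in>qball x r. G y \<partial>M) / emeasure M (qball x r)"

lemma sets_qball [measurable]: "x \<in> space M \<Longrightarrow> qball x r \<in> sets M"
  unfolding qball_def by measurable

lemma emeasure_qball_pos: "x \<in> space M \<Longrightarrow> 0 < r \<Longrightarrow> emeasure M (qball x r) \<noteq> 0"
  using ball_pos[of x r] by (auto simp: qball_def)

lemma emeasure_qball_measurable [measurable]: "(\<lambda>x. emeasure M (qball x r)) \<in> borel_measurable M"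
proof -
  have "(\<lambda>x. emeasure M (Pair x -` {p \<in> space (M \<Otimes>\<^sub>M M). d (fst p) (snd p) < r})) \<in> borel_measurable M"
    by (rule measurable_emeasure_Pair) measurable
  moreover have "x \<in> space M \<Longrightarrow> Pair x -` {p \<in> space (M \<Otimes>\<^sub>M M). d (fst p) (snd p) < r} = qball x r" for x
    by (auto simp: qball_def space_pair_measure)
  ultimately show ?thesis by (simp cong: measurable_cong)
qed

lemma integral_qball_measurable [measurable]:
  assumes [measurable]: "case_prod G \<in> borel_measurable (M \<Otimes>\<^sub>M M)"
  shows "(\<lambda>x. \<integral>\<^sup>+y\<in>qball x r. G x y \<partial>M) \<in> borel_measurable M"
proof -
  have "(\<lambda>x. \<integral>\<^sup>+y. G x y * indicator {p \<in> space (M \<Otimes>\<^sub>M M). d (fst p) (snd p) < r} (x, y) \<partial>M) \<in> borel_measurable M"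
    by measurable
  moreover have "x \<in> space M \<Longrightarrow> (\<integral>\<^sup>+y. G x y * indicator {p \<in> space (M \<Otimes>\<^sub>M M). d (fst p) (snd p) < r} (x, y) \<partial>M)
      = (\<integral>\<^sup>+y\<in>qball x r. G x y \<partial>M)" for x
    by (intro nn_integral_cong) (auto simp: qball_def space_pair_measure indicator_def)
  ultimately show ?thesis by (simp cong: measurable_cong)
qed

lemma avg_measurable [measurable]:
  assumes [measurable]: "G \<in> borel_measurable M"
  shows "avg r G \<in> borel_measurable M"
  unfolding avg_def by measurable

lemma avg_mono: "(\<And>y. y \<in> qball x r \<Longrightarrow> G y \<le> H y) \<Longrightarrow> avg r G x \<le> avg r H x"
  unfolding avg_def by (intro divide_right_mono_ennreal nn_integral_mono) (auto simp: indicator_def)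

lemma avg_const: "x \<in> space M \<Longrightarrow> 0 < r \<Longrightarrow> avg r (\<lambda>_. c) x = c"
  using emeasure_qball_pos[of x r]
  by (simp add: avg_def nn_integral_cmult_indicator ennreal_mult_divide_eq)

lemma avg_power_mean:
  "1 \<le> N \<Longrightarrow> x \<in> space M \<Longrightarrow> G \<in> borel_measurable M \<Longrightarrow>
    ennpowr (avg r G x) N \<le> avg r (\<lambda>y. ennpowr (G y) N) x"
  unfolding avg_def by (rule nn_integral_power_mean) auto

lemma qball_mono_center:
  assumes "x \<in> space M" "y \<in> space M" "d x y < r" "r \<le> t"
  shows "qball x t \<subseteq> qball y (4 * t)"
  using d_tri[of y x] d_sym[of x y] assms by (fastforce simp: qball_def)

lemma emeasure_qball_comparable:
  assumes "x \<in> space M" "y \<in> space M" "d x y < r"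
  shows "emeasure M (qball x r) \<le> ennreal K * emeasure M (qball y r)"
proof -
  have "0 < r \<or> qball x r = {}"
  proof (cases "0 < r")
    case False
    have "0 \<le> d x z" if "z \<in> space M" for z
    proof -
      have "d x x \<le> 2 * (d x x + d x x)" using d_tri assms by blast
      moreover have "d x x \<le> 2 * (d x z + d z x)" using d_tri[of x z x] that assms by blast
      ultimately show ?thesis using d_sym[of x z] that assms by simp
    qed
    then show ?thesis using False by (fastforce simp: qball_def)
  qed simp
  moreover have "emeasure M (qball x r) \<le> emeasure M (qball y (4 * r))"
    using assms by (intro emeasure_mono qball_mono_center) auto
  ultimately show ?thesis
    using doubling[of y r] assms by (auto simp: qball_def[symmetric] intro: order_trans)
qed

text \<open>
  By Fubini's theorem the adjoint of averaging has the kernel \<open>1 / |B(x, r)|\<close> on \<open>d(x,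
  y) < r\<close> in place of \<open>1 / |B(y, r)|\<close>, and doubling makes the two comparable.
\<close>
lemma avg_adjoint:
  assumes [measurable]: "G \<in> borel_measurable M" "F \<in> borel_measurable M" and r: "0 < r"
  shows "(\<integral>\<^sup>+x. avg r G x * F x \<partial>M) \<le> ennreal K * (\<integral>\<^sup>+y. G y * avg r F y \<partial>M)"
proof -
  interpret pair_sigma_finite M M ..
  define T where "T = {p \<in> space (M \<Otimes>\<^sub>M M). d (fst p) (snd p) < r}"
  have [measurable]: "T \<in> sets (M \<Otimes>\<^sub>M M)" unfolding T_def by measurable
  have T: "(indicator T (x, y) :: ennreal) = indicator (qball x r) y" "(indicator T (x, y) :: ennreal) = indicator (qball y r) x"
    if "x \<in> space M" "y \<in> space M" for x y
    using that d_sym[of x y] by (auto simp: T_def qball_def space_pair_measure indicator_def)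
  have "(\<integral>\<^sup>+x. avg r G x * F x \<partial>M) = (\<integral>\<^sup>+x. (\<integral>\<^sup>+y. G y * indicator T (x, y) * (F x / emeasure M (qball x r)) \<partial>M) \<partial>M)"
  proof (rule nn_integral_cong)
    fix x assume x: "x \<in> space M"
    have "avg r G x * F x = (\<integral>\<^sup>+y. G y * indicator T (x, y) \<partial>M) * (F x / emeasure M (qball x r))"
      unfolding avg_def
      by (subst nn_integral_cong[where v = "\<lambda>y. G y * indicator (qball x r) y"])
         (auto simp: T x divide_ennreal_def mult_ac)
    then show "avg r G x * F x = (\<integral>\<^sup>+y. G y * indicator T (x, y) * (F x / emeasure M (qball x r)) \<partial>M)"
      using x by (simp add: nn_integral_multc)
  qed
  also have "\<dots> = (\<integral>\<^sup>+y. (\<integral>\<^sup>+x. G y * indicator T (x, y) * (F x / emeasure M (qball x r)) \<partial>M) \<partial>M)"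
    by (rule Fubini'[symmetric]) measurable
  also have "\<dots> \<le> (\<integral>\<^sup>+y. ennreal K * (G y * avg r F y) \<partial>M)"
  proof (rule nn_integral_mono)
    fix y assume y: "y \<in> space M"
    have "(\<integral>\<^sup>+x. G y * indicator T (x, y) * (F x / emeasure M (qball x r)) \<partial>M)
        \<le> (\<integral>\<^sup>+x. (ennreal K * G y / emeasure M (qball y r)) * (F x * indicator (qball y r) x) \<partial>M)"
    proof (rule nn_integral_mono)
      fix x assume x: "x \<in> space M"
      show "G y * indicator T (x, y) * (F x / emeasure M (qball x r)) \<le> (ennreal K * G y / emeasure M (qball y r)) * (F x * indicator (qball y r) x)"
      proof (cases "x \<in> qball y r")
        case True
        have "emeasure M (qball y r) \<le> ennreal K * emeasure M (qball x r)"
          by (rule emeasure_qball_comparable) (use True x y in \<open>auto simp: qball_def\<close>)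
        then have "1 / emeasure M (qball x r) \<le> ennreal K / emeasure M (qball y r)"
          using emeasure_qball_pos[OF x r] emeasure_qball_pos[OF y r] K_ge_1
          by (intro inverse_le_of_comparable) auto
        then have "G y * F x * (1 / emeasure M (qball x r)) \<le> G y * F x * (ennreal K / emeasure M (qball y r))"
          by (rule mult_left_mono) simp
        then show ?thesis using True T(2)[OF x y] by (simp add: divide_ennreal_def mult_ac)
      qed (simp add: T(2)[OF x y])
    qed
    also have "\<dots> = ennreal K * (G y * avg r F y)"
      unfolding avg_def divide_ennreal_def using y by (subst nn_integral_cmult) (simp_all add: mult_ac)
    finally show "(\<integral>\<^sup>+x. G y * indicator T (x, y) * (F x / emeasure M (qball x r)) \<partial>M) \<le> ennreal K * (G y * avg r F y)" .
  qed
  also have "\<dots> = ennreal K * (\<integral>\<^sup>+y. G y * avg r F y \<partial>M)"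
    by (simp add: nn_integral_cmult)
  finally show ?thesis .
qed

text \<open>
  The ball around the old centre lies in the fourfold enlargement of the ball around the new one, and by
  doubling the two have comparable measures.
\<close>
lemma avg_change_center:
  assumes x: "x \<in> space M" and y: "y \<in> space M" and d: "d x y < r" and rt: "r \<le> t" and r: "0 < r"
  shows "avg t G x \<le> ennreal (K\<^sup>2) * avg (4 * t) G y"
proof -
  have t: "0 < t" using r rt by simp
  have sub: "qball x t \<subseteq> qball y (4 * t)" using qball_mono_center[OF x y d rt] .
  have sub2: "qball y (4 * t) \<subseteq> qball x (4 * (4 * t))"
    by (rule qball_mono_center[where r = "4 * t"]) (use x y d rt t d_sym[of x y] in auto)
  have "emeasure M (qball y (4 * t)) \<le> emeasure M (qball x (4 * (4 * t)))"
    using x by (intro emeasure_mono sub2) auto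
  also have "\<dots> \<le> ennreal K * emeasure M (qball x (4 * t))"
    using doubling[of x "4 * t"] x t by (simp add: qball_def)
  also have "\<dots> \<le> ennreal K * (ennreal K * emeasure M (qball x t))"
    using doubling[of x t] x t by (intro mult_left_mono) (simp_all add: qball_def)
  also have "\<dots> = ennreal (K\<^sup>2) * emeasure M (qball x t)"
    using K_ge_1 by (simp add: power2_eq_square ennreal_mult mult.assoc)
  finally have "1 / emeasure M (qball x t) \<le> ennreal (K\<^sup>2) / emeasure M (qball y (4 * t))"
    using emeasure_qball_pos[OF x t] emeasure_qball_pos[OF y, of "4 * t"] t
    by (intro inverse_le_of_comparable) auto
  then have "(\<integral>\<^sup>+z\<in>qball x t. G z \<partial>M) * (1 / emeasure M (qball x t))
      \<le> (\<integral>\<^sup>+z\<in>qball y (4 * t). G z \<partial>M) * (ennreal (K\<^sup>2) / emeasure M (qball y (4 * t)))"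
    using sub by (intro mult_mono nn_integral_mono) (auto simp: indicator_def)
  then show ?thesis by (simp add: avg_def divide_ennreal_def mult_ac)
qed

text \<open>
  Expanding the power by partial sums gives the products of \<open>avg G\<^sub>j\<close> with
  \<open>(\<Sum>\<^sub>i\<^sub>\<le>\<^sub>j avg G\<^sub>i)\<^sup>P\<^sup>-\<^sup>1\<close>. Moving the
  outer average onto the second factor leaves \<open>G\<^sub>j\<close> times an average of that factor over
  a ball of radius \<open>r\<^sub>j\<close>. This is the smallest radius in the partial sum, so on that
  ball the factor is at most a constant times its value at the centre with all radii multiplied by four.
  Hoelder's inequality separates the two factors.
\<close>
lemma avg_sum_step:
  fixes G :: "nat \<Rightarrow> 'a \<Rightarrow> ennreal"
  assumes P: "1 < P" and G [measurable]: "\<And>i. G i \<in> borel_measurable M"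
    and r: "\<And>i. 0 < r i" "antimono r"
  shows "(\<integral>\<^sup>+x. ennpowr (\<Sum>i<J. avg (r i) (G i) x) P \<partial>M) \<le> ennreal (P * K * (K\<^sup>2) powr (P - 1)) *
     (ennpowr (\<integral>\<^sup>+x. ennpowr (\<Sum>i<J. G i x) P \<partial>M) (1 / P) *
      ennpowr (\<integral>\<^sup>+x. ennpowr (\<Sum>i<J. avg (4 * r i) (G i) x) P \<partial>M) (1 - 1 / P))"
proof -
  define \<Phi> where "\<Phi> y = (\<Sum>i<J. avg (4 * r i) (G i) y)" for y
  define F where "F j x = ennpowr (\<Sum>i\<le>j. avg (r i) (G i) x) (P - 1)" for j x
  define L where "L = ennreal ((K\<^sup>2) powr (P - 1))"
  have [measurable]: "\<Phi> \<in> borel_measurable M" unfolding \<Phi>_def by measurable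
  have [measurable]: "F j \<in> borel_measurable M" for j unfolding F_def by measurable
  have G' [measurable]: "G i \<in> borel_measurable M" for i by (rule G)
  have step: "(\<integral>\<^sup>+x. avg (r j) (G j) x * F j x \<partial>M) \<le> ennreal K * (L * (\<integral>\<^sup>+y. G j y * ennpowr (\<Phi> y) (P - 1) \<partial>M))"
    if j: "j < J" for j
  proof -
    have "avg (r j) (F j) y \<le> L * ennpowr (\<Phi> y) (P - 1)" if y: "y \<in> space M" for y
    proof -
      have "F j x \<le> L * ennpowr (\<Phi> y) (P - 1)" if x: "x \<in> qball y (r j)" for x
      proof -
        have "x \<in> space M" and dxy: "d x y < r j" using x y d_sym[of x y] by (auto simp: qball_def)
        then have "(\<Sum>i\<le>j. avg (r i) (G i) x) \<le> (\<Sum>i\<le>j. ennreal (K\<^sup>2) * avg (4 * r i) (G i) y)"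
          using r y by (intro sum_mono avg_change_center[where r = "r j"]) (auto simp: antimono_def)
        also have "\<dots> \<le> ennreal (K\<^sup>2) * \<Phi> y"
          unfolding \<Phi>_def sum_distrib_left[symmetric] using j
          by (intro mult_left_mono sum_mono2) (auto simp: subset_eq)
        finally have "F j x \<le> ennpowr (ennreal (K\<^sup>2) * \<Phi> y) (P - 1)"
          unfolding F_def using P by (intro ennpowr_mono) auto
        then show ?thesis using P by (simp add: ennpowr_mult L_def ennpowr_ennreal)
      qed
      then have "avg (r j) (F j) y \<le> avg (r j) (\<lambda>_. L * ennpowr (\<Phi> y) (P - 1)) y" by (rule avg_mono)
      then show ?thesis using y r by (simp add: avg_const)
    qed
    then have "(\<integral>\<^sup>+y. G j y * avg (r j) (F j) y \<partial>M) \<le> (\<integral>\<^sup>+y. L * (G j y * ennpowr (\<Phi> y) (P - 1)) \<partial>M)"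
      by (intro nn_integral_mono) (metis (no_types) mult.left_commute mult_left_mono zero_le)
    also have "\<dots> = L * (\<integral>\<^sup>+y. G j y * ennpowr (\<Phi> y) (P - 1) \<partial>M)" by (simp add: nn_integral_cmult)
    finally have "ennreal K * (\<integral>\<^sup>+y. G j y * avg (r j) (F j) y \<partial>M) \<le> ennreal K * (L * (\<integral>\<^sup>+y. G j y * ennpowr (\<Phi> y) (P - 1) \<partial>M))"
      by (rule mult_left_mono) simp
    then show ?thesis using avg_adjoint[of "G j" "F j" "r j"] r by (auto intro: order_trans)
  qed
  have "(\<integral>\<^sup>+x. ennpowr (\<Sum>i<J. avg (r i) (G i) x) P \<partial>M) \<le> (\<integral>\<^sup>+x. ennreal P * (\<Sum>j<J. avg (r j) (G j) x * F j x) \<partial>M)"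
    unfolding F_def by (intro nn_integral_mono ennpowr_sum_le_partial_sums P)
  also have "\<dots> = ennreal P * (\<Sum>j<J. (\<integral>\<^sup>+x. avg (r j) (G j) x * F j x \<partial>M))"
    by (simp add: nn_integral_cmult nn_integral_sum)
  also have "\<dots> \<le> ennreal P * (\<Sum>j<J. ennreal K * (L * (\<integral>\<^sup>+y. G j y * ennpowr (\<Phi> y) (P - 1) \<partial>M)))"
    using step by (intro mult_left_mono sum_mono) auto
  also have "\<dots> = ennreal P * ennreal K * L * (\<integral>\<^sup>+y. (\<Sum>j<J. G j y) * ennpowr (\<Phi> y) (P - 1) \<partial>M)"
    by (simp add: sum_distrib_left[symmetric] sum_distrib_right nn_integral_sum mult.assoc)
  also have "ennreal P * ennreal K * L = ennreal (P * K * (K\<^sup>2) powr (P - 1))"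
    using P K_ge_1 by (simp add: L_def ennreal_mult)
  also have "(\<integral>\<^sup>+y. (\<Sum>j<J. G j y) * ennpowr (\<Phi> y) (P - 1) \<partial>M)
     \<le> ennpowr (\<integral>\<^sup>+x. ennpowr (\<Sum>i<J. G i x) P \<partial>M) (1 / P) *
        ennpowr (\<integral>\<^sup>+x. ennpowr (ennpowr (\<Phi> x) (P - 1)) (P / (P - 1)) \<partial>M) (1 / (P / (P - 1)))"
    by (rule Holder_nn_integral) (use P in \<open>auto simp: field_simps\<close>)
  also have "(\<lambda>x. ennpowr (ennpowr (\<Phi> x) (P - 1)) (P / (P - 1))) = (\<lambda>x. ennpowr (\<Phi> x) P)"
    using P by (simp add: ennpowr_ennpowr)
  also have "1 / (P / (P - 1)) = 1 - 1 / P" using P by (simp add: field_simps)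
  finally show ?thesis by (simp add: \<Phi>_def mult_left_mono)
qed

text \<open>
  The step bounds the sum with radii \<open>r\<close> by the one with radii \<open>4 r\<close>. After
  finitely many steps all balls are the whole space, where the power mean inequality applies. The constant
  does not grow with the number of steps: if \<open>C\<^sup>P\<close> bounds the ratio for \<open>4
  r\<close>, then \<open>C (C\<^sup>P)\<^sup>1\<^sup>-\<^sup>1\<^sup>/\<^sup>P = C\<^sup>P\<close> bounds
  it for \<open>r\<close>.
\<close>
lemma avg_sum_bound_gt1:
  fixes G :: "nat \<Rightarrow> 'a \<Rightarrow> ennreal"
  assumes P: "1 < P" and G [measurable]: "\<And>i. G i \<in> borel_measurable M"
    and r: "\<And>i. 0 < r i" "antimono r"
  shows "(\<integral>\<^sup>+x. ennpowr (\<Sum>i<J. avg (r i) (G i) x) P \<partial>M) \<le>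
    ennreal ((P * K * (K\<^sup>2) powr (P - 1)) powr P) * (\<integral>\<^sup>+x. ennpowr (\<Sum>i<J. G i x) P \<partial>M)"
proof -
  define C where "C = P * K * (K\<^sup>2) powr (P - 1)"
  have "1 * 1 * 1 \<le> C" unfolding C_def using P K_ge_1
    by (intro mult_mono ge_one_powr_ge_zero) auto
  then have C: "1 \<le> C" by simp
  define R where "R = (\<integral>\<^sup>+x. ennpowr (\<Sum>i<J. G i x) P \<partial>M)"
  have main: "(\<integral>\<^sup>+x. ennpowr (\<Sum>i<J. avg (r i) (G i) x) P \<partial>M) \<le> ennreal (C powr P) * R"
    if "\<And>i. 0 < r i" "antimono r" "\<And>i. i < J \<Longrightarrow> 4 \<le> 4 ^ m * r i" for m r
    using that
  proof (induction m arbitrary: r)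
    case 0
    have "qball x (r i) = space M" if "x \<in> space M" "i < J" for x i
      using d_less_4[OF \<open>x \<in> space M\<close>] 0(3)[OF \<open>i < J\<close>] by (fastforce simp: qball_def)
    then have "(\<Sum>i<J. avg (r i) (G i) x) = (\<integral>\<^sup>+y\<in>space M. (\<Sum>i<J. G i y) \<partial>M) / emeasure M (space M)"
      if "x \<in> space M" for x
      using that by (simp add: avg_def divide_ennreal_def sum_distrib_right[symmetric] nn_integral_sum)
    then have "(\<integral>\<^sup>+x. ennpowr (\<Sum>i<J. avg (r i) (G i) x) P \<partial>M)
       = (\<integral>\<^sup>+x. ennpowr ((\<integral>\<^sup>+y\<in>space M. (\<Sum>i<J. G i y) \<partial>M) / emeasure M (space M)) P \<partial>M)"
      by (intro nn_integral_cong) simp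
    also have "\<dots> = ennpowr ((\<integral>\<^sup>+y\<in>space M. (\<Sum>i<J. G i y) \<partial>M) / emeasure M (space M)) P * emeasure M (space M)"
      by simp
    also have "\<dots> \<le> (\<integral>\<^sup>+y\<in>space M. ennpowr (\<Sum>i<J. G i y) P \<partial>M) / emeasure M (space M) * emeasure M (space M)"
      using P by (intro mult_right_mono nn_integral_power_mean) auto
    also have "\<dots> \<le> (\<integral>\<^sup>+y\<in>space M. ennpowr (\<Sum>i<J. G i y) P \<partial>M)"
      by (cases "emeasure M (space M) = 0")
        (simp_all add: ennreal_divide_times less_top[symmetric])
    also have "\<dots> = R" unfolding R_def by (intro nn_integral_cong) simp
    also have "\<dots> \<le> ennreal (C powr P) * R"
      using mult_right_mono[of 1 "ennreal (C powr P)" R] C P by (simp add: ge_one_powr_ge_zero)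
    finally show ?case .
  next
    case (Suc m)
    have "(\<integral>\<^sup>+x. ennpowr (\<Sum>i<J. avg (4 * r i) (G i) x) P \<partial>M) \<le> ennreal (C powr P) * R"
      using Suc.prems by (intro Suc.IH) (auto simp: antimono_def algebra_simps)
    then have "(\<integral>\<^sup>+x. ennpowr (\<Sum>i<J. avg (r i) (G i) x) P \<partial>M)
        \<le> ennreal C * (ennpowr R (1 / P) * ennpowr (ennreal (C powr P) * R) (1 - 1 / P))"
    proof -
      assume 1: "(\<integral>\<^sup>+x. ennpowr (\<Sum>i<J. avg (4 * r i) (G i) x) P \<partial>M) \<le> ennreal (C powr P) * R"
      have "(\<integral>\<^sup>+x. ennpowr (\<Sum>i<J. avg (r i) (G i) x) P \<partial>M) \<le> ennreal C * (ennpowr R (1 / P) *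
          ennpowr (\<integral>\<^sup>+x. ennpowr (\<Sum>i<J. avg (4 * r i) (G i) x) P \<partial>M) (1 - 1 / P))"
        unfolding C_def R_def by (rule avg_sum_step[OF P G Suc.prems(1,2)])
      also have "\<dots> \<le> ennreal C * (ennpowr R (1 / P) * ennpowr (ennreal (C powr P) * R) (1 - 1 / P))"
        using P by (intro mult_left_mono ennpowr_mono 1) auto
      finally show ?thesis .
    qed
    also have "\<dots> = ennreal C * ennreal (C powr (P - 1)) * (ennpowr R (1 / P) * ennpowr R (1 - 1 / P))"
      using P C by (simp add: ennpowr_mult ennpowr_ennreal powr_powr right_diff_distrib mult_ac)
    also have "ennpowr R (1 / P) * ennpowr R (1 - 1 / P) = R"
      using P by (subst ennpowr_add[symmetric]) auto
    also have "ennreal C * ennreal (C powr (P - 1)) = ennreal (C powr P)"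
      using C by (simp add: ennreal_mult[symmetric] powr_diff)
    finally show ?case .
  qed
  have "\<exists>m. \<forall>i<J. 4 \<le> 4 ^ m * r i"
  proof -
    obtain m where m: "4 / r J < 4 ^ m" using real_arch_pow[of 4 "4 / r J"] by auto
    have "4 \<le> 4 ^ m * r i" if "i < J" for i
    proof -
      have "4 < 4 ^ m * r J" using m r(1)[of J] by (simp add: field_simps)
      also have "\<dots> \<le> 4 ^ m * r i" using r(2) that by (intro mult_left_mono) (auto simp: antimono_def)
      finally show ?thesis by simp
    qed
    then show ?thesis by blast
  qed
  then show ?thesis using main[OF r] by (auto simp: C_def R_def)
qed

text \<open>For \<open>P = 1\<close> the bound is self-adjointness against the constant function 1.\<close>
lemma avg_sum_bound_ge1:
  assumes P: "1 \<le> P"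
  shows "\<exists>C. \<forall>(J::nat) G r. (\<forall>i. G i \<in> borel_measurable M) \<longrightarrow> (\<forall>i. 0 < r i) \<longrightarrow> antimono r \<longrightarrow>
    (\<integral>\<^sup>+x. ennpowr (\<Sum>i<J. avg (r i) (G i) x) P \<partial>M) \<le> ennreal C * (\<integral>\<^sup>+x. ennpowr (\<Sum>i<J. G i x) P \<partial>M)"
proof (cases "P = 1")
  case True
  have "(\<integral>\<^sup>+x. (\<Sum>i<J. avg (r i) (G i) x) \<partial>M) \<le> ennreal K * (\<integral>\<^sup>+x. (\<Sum>i<J. G i x) \<partial>M)"
    if G: "\<forall>i. G i \<in> borel_measurable M" and r: "\<forall>i. 0 < r i" for J :: nat and G r
  proof -
    have [measurable]: "G i \<in> borel_measurable M" for i using G by simp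
    have "(\<integral>\<^sup>+x. avg (r i) (G i) x \<partial>M) \<le> ennreal K * (\<integral>\<^sup>+x. G i x \<partial>M)" for i
    proof -
      have "(\<integral>\<^sup>+y. G i y * avg (r i) (\<lambda>_. 1) y \<partial>M) = (\<integral>\<^sup>+x. G i x \<partial>M)"
        using r by (intro nn_integral_cong) (simp add: avg_const)
      then show ?thesis using avg_adjoint[of "G i" "\<lambda>_. 1" "r i"] r by simp
    qed
    then have "(\<Sum>i<J. \<integral>\<^sup>+x. avg (r i) (G i) x \<partial>M) \<le> (\<Sum>i<J. ennreal K * (\<integral>\<^sup>+x. G i x \<partial>M))"
      by (intro sum_mono) auto
    then show ?thesis by (simp add: nn_integral_sum sum_distrib_left)
  qed
  then show ?thesis using True by (intro exI[of _ K]) simp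
next
  case False
  then show ?thesis using P avg_sum_bound_gt1[of P] by (intro exI[of _ "(P * K * (K\<^sup>2) powr (P - 1)) powr P"]) auto
qed

text \<open>
  Let \<open>X\<close> be the left-hand integral and \<open>\<Phi>\<close> its inner sum. Then
  \<open>X\<close> is the sum of the integrals of \<open>avg H\<^sub>i\<close> times \<open>L\<^sub>i =
  (avg H\<^sub>i)\<^sup>N\<^sup>-\<^sup>1 \<Phi>\<^sup>P\<^sup>-\<^sup>1\<close>. Moving the averages onto
  \<open>L\<^sub>i\<close> and applying Hoelder's inequality, with exponents \<open>N, N'\<close> for the
  sum and \<open>3, 3/2\<close> for the integral, leaves averages of
  \<open>L\<^sub>i\<^sup>N\<^sup>'\<close> in a norm with exponent \<open>Q \<ge> 1\<close>. There the
  previous bound applies and returns \<open>X\<^sup>2\<^sup>/\<^sup>3\<close>. As \<open>X\<close> is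
  finite for bounded \<open>H\<^sub>i\<close>, this factor cancels.
\<close>
lemma avg_power_sum_bound_less1:
  assumes P: "0 < P" "P < 1"
  shows "\<exists>C. \<forall>(J::nat) H r. (\<forall>i. H i \<in> borel_measurable M) \<longrightarrow> (\<forall>i. \<exists>c::real. \<forall>x\<in>space M. H i x \<le> ennreal c) \<longrightarrow>
    (\<forall>i. 0 < r i) \<longrightarrow> antimono r \<longrightarrow>
    (\<integral>\<^sup>+x. ennpowr (\<Sum>i<J. ennpowr (avg (r i) (H i) x) (3 / P)) P \<partial>M)
      \<le> ennreal C * (\<integral>\<^sup>+x. ennpowr (\<Sum>i<J. ennpowr (H i x) (3 / P)) P \<partial>M)"
proof -
  define N where "N = 3 / P"
  define N' where "N' = N / (N - 1)"
  (* With this Q the second factor returns the integral of the power P; see QP below. *)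
  define Q where "Q = (3 - P) / 2"
  have N: "1 < N" using P by (simp add: N_def)
  have N': "1 < N'" "1 / N + 1 / N' = 1" "(N - 1) * N' = N" "N' \<noteq> 0"
    using N by (auto simp: N'_def field_simps)
  have Q: "1 \<le> Q" using P by (simp add: Q_def)
  have PN: "1 / N = P / 3" using P by (simp add: N_def)
  have QN: "1 / N' = Q * 2 / 3"
    using N'(2) unfolding PN Q_def by (simp add: field_simps)
  have QP: "Q * (1 + (P - 1) * N') = P"
  proof -
    have "Q = 3 / 2 * (1 / N')" using QN by simp
    then have "Q * (1 + (P - 1) * N') = 3 / 2 * (1 / N' + (P - 1))"
      using N'(4) by (simp add: field_simps)
    also have "\<dots> = P" using QN by (simp add: Q_def field_simps)
    finally show ?thesis .
  qed
  obtain C0 where C0: "\<forall>(J::nat) G r. (\<forall>i. G i \<in> borel_measurable M) \<longrightarrow> (\<forall>i. 0 < r i) \<longrightarrow> antimono r \<longrightarrow>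
    (\<integral>\<^sup>+x. ennpowr (\<Sum>i<J. avg (r i) (G i) x) Q \<partial>M) \<le> ennreal C0 * (\<integral>\<^sup>+x. ennpowr (\<Sum>i<J. G i x) Q \<partial>M)"
    using avg_sum_bound_ge1[OF Q] by blast
  define C1 where "C1 = max C0 1"
  have C1: "0 < C1" "1 \<le> C1" "ennreal C0 \<le> ennreal C1" by (auto simp: C1_def intro: ennreal_leI)
  have main: "(\<integral>\<^sup>+x. ennpowr (\<Sum>i<J. ennpowr (avg (r i) (H i) x) N) P \<partial>M)
      \<le> ennreal (K ^ 3 * C1\<^sup>2) * (\<integral>\<^sup>+x. ennpowr (\<Sum>i<J. ennpowr (H i x) N) P \<partial>M)"
    if H: "\<And>i. H i \<in> borel_measurable M" and bd: "\<And>i. \<exists>c::real. \<forall>x\<in>space M. H i x \<le> ennreal c"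
      and r: "\<And>i. 0 < r i" "antimono r" for J :: nat and H and r :: "nat \<Rightarrow> real"
  proof -
    note [measurable] = H
    define \<Phi> where "\<Phi> x = (\<Sum>i<J. ennpowr (avg (r i) (H i) x) N)" for x
    define L where "L i x = ennpowr (avg (r i) (H i) x) (N - 1) * ennpowr (\<Phi> x) (P - 1)" for i x
    define X where "X = (\<integral>\<^sup>+x. ennpowr (\<Phi> x) P \<partial>M)"
    define R where "R = (\<integral>\<^sup>+x. ennpowr (\<Sum>i<J. ennpowr (H i x) N) P \<partial>M)"
    have [measurable]: "\<Phi> \<in> borel_measurable M" unfolding \<Phi>_def by measurable
    have [measurable]: "L i \<in> borel_measurable M" for i unfolding L_def by measurable
    obtain c :: "nat \<Rightarrow> real" where c: "\<And>i x. x \<in> space M \<Longrightarrow> H i x \<le> ennreal (c i)" using bd by metis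
    have avg_c: "avg (r i) (H i) x \<le> ennreal (c i)" if "x \<in> space M" for i x
    proof -
      have "avg (r i) (H i) x \<le> avg (r i) (\<lambda>_. ennreal (c i)) x"
        by (rule avg_mono) (auto simp: qball_def c)
      then show ?thesis using that r by (simp add: avg_const)
    qed
    have \<Phi>_fin: "\<Phi> x \<le> (\<Sum>i<J. ennpowr (ennreal (c i)) N)" if "x \<in> space M" for x
      unfolding \<Phi>_def using N that by (intro sum_mono ennpowr_mono avg_c) auto
    have sum_fin: "(\<Sum>i<J. ennpowr (ennreal (c i)) N) < top"
      using N by (simp add: ennpowr_less_top_iff)
    have \<Phi>_top: "\<Phi> x < top" if "x \<in> space M" for x
      using \<Phi>_fin[OF that] sum_fin by (rule le_less_trans)
    have X_fin: "X < top"
    proof -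
      have "X \<le> (\<integral>\<^sup>+x. ennpowr (\<Sum>i<J. ennpowr (ennreal (c i)) N) P \<partial>M)"
        unfolding X_def using P by (intro nn_integral_mono ennpowr_mono \<Phi>_fin) auto
      also have "\<dots> = ennpowr (\<Sum>i<J. ennpowr (ennreal (c i)) N) P * emeasure M (space M)"
        by simp
      also have "\<dots> < top"
        unfolding ennreal_mult_less_top using sum_fin P
        by (auto simp: ennpowr_eq_top_iff less_top[symmetric])
      finally show ?thesis .
    qed
    have \<Phi>_cases: "\<Phi> x = 0 \<or> (\<exists>u>0. \<Phi> x = ennreal u)" if "x \<in> space M" for x
      using \<Phi>_top[OF that] by (cases rule: ennreal_pos_cases[of "\<Phi> x"]) auto
    have pt1: "ennpowr (\<Phi> x) P = (\<Sum>i<J. avg (r i) (H i) x * L i x)" if x: "x \<in> space M" for x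
    proof -
      have "avg (r i) (H i) x * L i x = ennpowr (avg (r i) (H i) x) N * ennpowr (\<Phi> x) (P - 1)" for i
        using ennpowr_add[of 1 "N - 1" "avg (r i) (H i) x"] N by (simp add: L_def mult.assoc)
      then have "(\<Sum>i<J. avg (r i) (H i) x * L i x) = \<Phi> x * ennpowr (\<Phi> x) (P - 1)"
        by (simp add: sum_distrib_right[symmetric] \<Phi>_def)
      also have "\<dots> = ennpowr (\<Phi> x) P"
        using \<Phi>_cases[OF x] P
        by (auto simp: ennpowr_ennreal_pos ennreal_mult[symmetric] powr_diff)
      finally show ?thesis by simp
    qed
    have pt2: "ennpowr (\<Sum>i<J. ennpowr (L i x) N') Q = ennpowr (\<Phi> x) P" if x: "x \<in> space M" for x
    proof -
      have "ennpowr (L i x) N' = ennpowr (avg (r i) (H i) x) N * ennpowr (ennpowr (\<Phi> x) (P - 1)) N'" for i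
        using N N' by (simp add: L_def ennpowr_mult ennpowr_ennpowr)
      then have s: "(\<Sum>i<J. ennpowr (L i x) N') = \<Phi> x * ennpowr (ennpowr (\<Phi> x) (P - 1)) N'"
        by (simp add: sum_distrib_right[symmetric] \<Phi>_def)
      show ?thesis
        using \<Phi>_cases[OF x] P Q N'
      proof (elim disjE exE conjE)
        fix u :: real assume u: "0 < u" "\<Phi> x = ennreal u"
        have "(u * (u powr (P - 1)) powr N') powr Q = (u powr (1 + (P - 1) * N')) powr Q"
          using u by (simp add: powr_powr powr_add)
        also have "\<dots> = u powr P" using QP by (simp add: powr_powr mult.commute)
        finally have "(u * (u powr (P - 1)) powr N') powr Q = u powr P" .
        then show ?thesis unfolding s using u by (simp add: ennpowr_ennreal_pos ennreal_mult[symmetric])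
      qed (use P Q in \<open>simp add: s\<close>)
    qed
    have "X = (\<integral>\<^sup>+x. (\<Sum>i<J. avg (r i) (H i) x * L i x) \<partial>M)"
      unfolding X_def by (intro nn_integral_cong pt1)
    also have "\<dots> = (\<Sum>i<J. \<integral>\<^sup>+x. avg (r i) (H i) x * L i x \<partial>M)" by (simp add: nn_integral_sum)
    also have "\<dots> \<le> (\<Sum>i<J. ennreal K * (\<integral>\<^sup>+x. H i x * avg (r i) (L i) x \<partial>M))"
      using r by (intro sum_mono avg_adjoint) auto
    also have "\<dots> = ennreal K * (\<integral>\<^sup>+x. (\<Sum>i<J. H i x * avg (r i) (L i) x) \<partial>M)"
      by (simp add: nn_integral_sum sum_distrib_left)
    also have "(\<integral>\<^sup>+x. (\<Sum>i<J. H i x * avg (r i) (L i) x) \<partial>M) \<le>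
      (\<integral>\<^sup>+x. ennpowr (\<Sum>i<J. ennpowr (H i x) N) (1 / N) * ennpowr (\<Sum>i<J. ennpowr (avg (r i) (L i) x) N') (1 / N') \<partial>M)"
      using N N' by (intro nn_integral_mono Holder_sum) auto
    also have "\<dots> \<le> ennpowr (\<integral>\<^sup>+x. ennpowr (ennpowr (\<Sum>i<J. ennpowr (H i x) N) (1 / N)) 3 \<partial>M) (1/3) *
       ennpowr (\<integral>\<^sup>+x. ennpowr (ennpowr (\<Sum>i<J. ennpowr (avg (r i) (L i) x) N') (1 / N')) (3/2) \<partial>M) (1/(3/2))"
      by (rule Holder_nn_integral) auto
    also have "(\<integral>\<^sup>+x. ennpowr (ennpowr (\<Sum>i<J. ennpowr (H i x) N) (1 / N)) 3 \<partial>M) = R"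
      using P by (simp add: R_def PN ennpowr_ennpowr)
    also have "(\<integral>\<^sup>+x. ennpowr (ennpowr (\<Sum>i<J. ennpowr (avg (r i) (L i) x) N') (1 / N')) (3/2) \<partial>M)
        = (\<integral>\<^sup>+x. ennpowr (\<Sum>i<J. ennpowr (avg (r i) (L i) x) N') Q \<partial>M)"
      using Q by (simp add: QN ennpowr_ennpowr)
    also have "\<dots> \<le> (\<integral>\<^sup>+x. ennpowr (\<Sum>i<J. avg (r i) (\<lambda>y. ennpowr (L i y) N') x) Q \<partial>M)"
      using Q N' by (intro nn_integral_mono ennpowr_mono sum_mono avg_power_mean) auto
    also have "\<dots> \<le> ennreal C0 * (\<integral>\<^sup>+x. ennpowr (\<Sum>i<J. ennpowr (L i x) N') Q \<partial>M)"
      by (rule C0[rule_format]) (use r in auto)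
    also have "(\<integral>\<^sup>+x. ennpowr (\<Sum>i<J. ennpowr (L i x) N') Q \<partial>M) = X"
      unfolding X_def by (intro nn_integral_cong pt2)
    finally have "X \<le> ennreal K * (ennpowr R (1/3) * ennpowr (ennreal C0 * X) (2/3))"
      by (simp add: mult_left_mono ennpowr_mono)
    also have "\<dots> \<le> ennreal K * (ennpowr R (1/3) * ennpowr (ennreal C1 * X) (2/3))"
      using C1 by (intro mult_left_mono ennpowr_mono mult_right_mono) auto
    finally have "ennpowr X 3 \<le> ennpowr (ennreal K * (ennpowr R (1/3) * ennpowr (ennreal C1 * X) (2/3))) 3"
      by (intro ennpowr_mono) auto
    also have "\<dots> = ennreal (K powr 3) * (R * (ennreal (C1 powr 2) * ennpowr X 2))"
      using K_ge_1 C1 powr_power[where z=C1 and n=3 and u="2/3"] by (simp add: ennpowr_mult ennpowr_ennpowr ennpowr_ennreal)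
    also have "\<dots> = ennpowr X 2 * (ennreal (K ^ 3 * C1\<^sup>2) * R)"
      using K_ge_1 C1 by (simp add: ennreal_mult mult_ac)
    also have "ennpowr X 3 = ennpowr X 2 * X"
      using ennpowr_add[of 2 1 X] by simp
    finally have le: "ennpowr X 2 * X \<le> ennpowr X 2 * (ennreal (K ^ 3 * C1\<^sup>2) * R)" .
    have "X \<le> ennreal (K ^ 3 * C1\<^sup>2) * R"
    proof (cases "X = 0")
      case False
      then have "ennpowr X 2 \<noteq> 0" "ennpowr X 2 \<noteq> top"
        using X_fin by (auto simp: ennpowr_eq_0_iff ennpowr_eq_top_iff)
      then show ?thesis using le by (simp add: ennreal_mult_le_mult_iff)
    qed simp
    then show ?thesis by (simp add: X_def R_def \<Phi>_def)
  qed
  then show ?thesis unfolding N_def[symmetric] by blast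
qed

text \<open>
  For \<open>P \<ge> 1\<close> one takes \<open>N = 1\<close>, for \<open>P < 1\<close> one takes \<open>N
  = 3 / P\<close>. Infinite sums are limits of finite ones by monotone convergence.
\<close>
theorem avg_power_sum_bound:
  assumes P: "0 < P"
  shows "\<exists>N\<ge>1. \<exists>C. \<forall>G r. (\<forall>i. G i \<in> borel_measurable M) \<longrightarrow>
    (\<forall>i. \<exists>c::real. \<forall>x\<in>space M. G i x \<le> ennreal c) \<longrightarrow> (\<forall>i. 0 < r i) \<longrightarrow> antimono r \<longrightarrow>
    (\<integral>\<^sup>+x. ennpowr (\<Sum>i. ennpowr (avg (r i) (\<lambda>y. ennpowr (G i y) (1 / N)) x) N) P \<partial>M)
      \<le> ennreal C * (\<integral>\<^sup>+x. ennpowr (\<Sum>i. G i x) P \<partial>M)"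
proof -
  have "\<exists>N\<ge>1. \<exists>C. \<forall>(J::nat) G r. (\<forall>i. G i \<in> borel_measurable M) \<longrightarrow>
    (\<forall>i. \<exists>c::real. \<forall>x\<in>space M. G i x \<le> ennreal c) \<longrightarrow> (\<forall>i. 0 < r i) \<longrightarrow> antimono r \<longrightarrow>
    (\<integral>\<^sup>+x. ennpowr (\<Sum>i<J. ennpowr (avg (r i) (\<lambda>y. ennpowr (G i y) (1 / N)) x) N) P \<partial>M)
      \<le> ennreal C * (\<integral>\<^sup>+x. ennpowr (\<Sum>i<J. G i x) P \<partial>M)"
  proof (cases "1 \<le> P")
    case True
    obtain C where C: "\<forall>(J::nat) G r. (\<forall>i. G i \<in> borel_measurable M) \<longrightarrow> (\<forall>i. 0 < r i) \<longrightarrow> antimono r \<longrightarrow>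
      (\<integral>\<^sup>+x. ennpowr (\<Sum>i<J. avg (r i) (G i) x) P \<partial>M) \<le> ennreal C * (\<integral>\<^sup>+x. ennpowr (\<Sum>i<J. G i x) P \<partial>M)"
      using avg_sum_bound_ge1[OF True] by blast
    show ?thesis
      by (rule exI[of _ 1], rule conjI, simp, rule exI[of _ C]) (simp add: C)
  next
    case False
    then obtain C where C: "\<forall>(J::nat) H r. (\<forall>i. H i \<in> borel_measurable M) \<longrightarrow> (\<forall>i. \<exists>c::real. \<forall>x\<in>space M. H i x \<le> ennreal c) \<longrightarrow>
      (\<forall>i. 0 < r i) \<longrightarrow> antimono r \<longrightarrow>
      (\<integral>\<^sup>+x. ennpowr (\<Sum>i<J. ennpowr (avg (r i) (H i) x) (3 / P)) P \<partial>M)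
        \<le> ennreal C * (\<integral>\<^sup>+x. ennpowr (\<Sum>i<J. ennpowr (H i x) (3 / P)) P \<partial>M)"
      using avg_power_sum_bound_less1[of P] P by auto
    show ?thesis
    proof (rule exI[of _ "3 / P"], rule conjI, use P False in simp, rule exI[of _ C], intro allI impI)
      fix J :: nat and G :: "nat \<Rightarrow> 'a \<Rightarrow> ennreal" and r :: "nat \<Rightarrow> real"
      assume G [rule_format]: "\<forall>i. G i \<in> borel_measurable M" and bd: "\<forall>i. \<exists>c::real. \<forall>x\<in>space M. G i x \<le> ennreal c"
        and r: "\<forall>i. 0 < r i" "antimono r"
      note [measurable] = G
      have bd': "\<exists>c::real. \<forall>x\<in>space M. ennpowr (G i x) (1 / (3 / P)) \<le> ennreal c" for i
      proof -
        obtain c :: real where c: "\<forall>x\<in>space M. G i x \<le> ennreal c" using bd by blast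
        have "ennpowr (G i x) (1 / (3 / P)) \<le> ennreal (max c 0 powr (1 / (3 / P)))" if "x \<in> space M" for x
        proof -
          have "G i x \<le> ennreal (max c 0)" using c that by (auto intro: order_trans ennreal_leI)
          then have "ennpowr (G i x) (1 / (3 / P)) \<le> ennpowr (ennreal (max c 0)) (1 / (3 / P))"
            using P by (intro ennpowr_mono) auto
          then show ?thesis using P by (simp add: ennpowr_ennreal)
        qed
        then show ?thesis by blast
      qed
      have "(\<lambda>y. ennpowr (G i y) (1 / (3 / P))) \<in> borel_measurable M" for i by measurable
      with C[rule_format, of "\<lambda>i y. ennpowr (G i y) (1 / (3 / P))" r J] bd' r
      show "(\<integral>\<^sup>+x. ennpowr (\<Sum>i<J. ennpowr (avg (r i) (\<lambda>y. ennpowr (G i y) (1 / (3 / P))) x) (3 / P)) P \<partial>M)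
        \<le> ennreal C * (\<integral>\<^sup>+x. ennpowr (\<Sum>i<J. G i x) P \<partial>M)"
        using P by (simp add: ennpowr_ennpowr)
    qed
  qed
  then obtain N C where N: "1 \<le> N" and C: "\<And>(J::nat) G r. (\<forall>i. G i \<in> borel_measurable M) \<Longrightarrow>
    (\<forall>i. \<exists>c::real. \<forall>x\<in>space M. G i x \<le> ennreal c) \<Longrightarrow> (\<forall>i. 0 < r i) \<Longrightarrow> antimono r \<Longrightarrow>
    (\<integral>\<^sup>+x. ennpowr (\<Sum>i<J. ennpowr (avg (r i) (\<lambda>y. ennpowr (G i y) (1 / N)) x) N) P \<partial>M)
      \<le> ennreal C * (\<integral>\<^sup>+x. ennpowr (\<Sum>i<J. G i x) P \<partial>M)"
    by blast
  show ?thesis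
  proof (rule exI[of _ N], rule conjI, rule N, rule exI[of _ C], intro allI impI)
    fix G :: "nat \<Rightarrow> 'a \<Rightarrow> ennreal" and r :: "nat \<Rightarrow> real"
    assume G: "\<forall>i. G i \<in> borel_measurable M" and bd: "\<forall>i. \<exists>c::real. \<forall>x\<in>space M. G i x \<le> ennreal c"
      and r: "\<forall>i. 0 < r i" "antimono r"
    have [measurable]: "G i \<in> borel_measurable M" for i using G by simp
    let ?a = "\<lambda>i x. ennpowr (avg (r i) (\<lambda>y. ennpowr (G i y) (1 / N)) x) N"
    have "(\<integral>\<^sup>+x. ennpowr (\<Sum>i. ?a i x) P \<partial>M) = (\<integral>\<^sup>+x. (SUP J. ennpowr (\<Sum>i<J. ?a i x) P) \<partial>M)"
      using P by (simp add: suminf_eq_SUP ennpowr_SUP)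
    also have "\<dots> = (SUP J. \<integral>\<^sup>+x. ennpowr (\<Sum>i<J. ?a i x) P \<partial>M)"
    proof (rule nn_integral_monotone_convergence_SUP)
      show "incseq (\<lambda>J x. ennpowr (\<Sum>i<J. ?a i x) P)"
        using P by (auto simp: incseq_def le_fun_def intro!: ennpowr_mono sum_mono2)
    qed measurable
    also have "\<dots> \<le> ennreal C * (\<integral>\<^sup>+x. ennpowr (\<Sum>i. G i x) P \<partial>M)"
    proof (rule SUP_least)
      fix J :: nat
      have "(\<integral>\<^sup>+x. ennpowr (\<Sum>i<J. G i x) P \<partial>M) \<le> (\<integral>\<^sup>+x. ennpowr (\<Sum>i. G i x) P \<partial>M)"
        using P by (intro nn_integral_mono ennpowr_mono sum_le_suminf) auto
      then have "ennreal C * (\<integral>\<^sup>+x. ennpowr (\<Sum>i<J. G i x) P \<partial>M) \<le> ennreal C * (\<integral>\<^sup>+x. ennpowr (\<Sum>i. G i x) P \<partial>M)"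
        by (rule mult_left_mono) simp
      with C[OF G bd r, of J]
      show "(\<integral>\<^sup>+x. ennpowr (\<Sum>i<J. ?a i x) P \<partial>M) \<le> ennreal C * (\<integral>\<^sup>+x. ennpowr (\<Sum>i. G i x) P \<partial>M)"
        by (rule order_trans)
    qed
    finally show "(\<integral>\<^sup>+x. ennpowr (\<Sum>i. ?a i x) P \<partial>M) \<le> ennreal C * (\<integral>\<^sup>+x. ennpowr (\<Sum>i. G i x) P \<partial>M)" .
  qed
qed

end

section \<open>Homogeneous polynomials\<close>

lemma norm_vector_smult: "norm (c *s z :: complex ^ 'n) = norm c * norm z"
  by (simp add: norm_vec_def norm_mult L2_set_right_distrib[symmetric])

lemma scaleR_eq_vector_smult: "r *\<^sub>R (z :: complex ^ 'n) = complex_of_real r *s z"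
proof (rule vec_eq_iff[THEN iffD2], rule allI)
  fix i
  have "(r *\<^sub>R z) $ i = r *\<^sub>R (z $ i)" by (rule vector_scaleR_component)
  also have "\<dots> = complex_of_real r * z $ i" by (rule scaleR_conv_of_real)
  finally show "(r *\<^sub>R z) $ i = (complex_of_real r *s z) $ i" by simp
qed

lemma norm_axis_one: "norm (axis j 1 :: complex ^ 'n) = 1"
  by (rule norm_Basis) (auto simp: Basis_vec_def)

lemma bounded_linear_vector_smult_left: "bounded_linear (\<lambda>c. c *s (z :: complex ^ 'n))"
  by (intro bounded_linear_intro[where K = "norm z"])
     (auto simp: vec_eq_iff norm_vector_smult algebra_simps)

lemma continuous_on_vector_smult [continuous_intros]:
  "continuous_on S g \<Longrightarrow> continuous_on S (\<lambda>x. g x *s (z :: complex ^ 'n))"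
  using bounded_linear.continuous_on[OF bounded_linear_vector_smult_left] .

lemma finite_multiindices: "finite {m :: 'n::finite \<Rightarrow> nat. sum m UNIV = d}"
proof (rule finite_subset)
  show "{m. sum m UNIV = d} \<subseteq> Pi\<^sub>E UNIV (\<lambda>_::'n. {..d})"
    by (auto simp: PiE_def intro: member_le_sum)
qed (intro finite_PiE, auto)

lemma homogeneous_polynomial_scale:
  assumes "homogeneous_polynomial d H"
  shows "H (c *s z) = c ^ d * H z"
proof -
  obtain a where a: "\<And>z. H z = (\<Sum>m | sum m UNIV = d. a m * (\<Prod>i\<in>UNIV. (z $ i) ^ m i))"
    using assms by (auto simp: homogeneous_polynomial_def)
  have "a m * (\<Prod>i\<in>UNIV. ((c *s z) $ i) ^ m i) = c ^ d * (a m * (\<Prod>i\<in>UNIV. (z $ i) ^ m i))"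
    if "sum m UNIV = d" for m
    using that by (simp add: power_mult_distrib prod.distrib flip: power_sum)
  then show ?thesis unfolding a sum_distrib_left by (intro sum.cong) auto
qed

lemma homogeneous_polynomial_zero: "homogeneous_polynomial d (\<lambda>_. 0)"
  unfolding homogeneous_polynomial_def by (rule exI[of _ "\<lambda>_. 0"]) simp

lemma homogeneous_polynomial_const: "homogeneous_polynomial 0 (\<lambda>_ :: complex ^ 'n. c)"
proof -
  have "{m :: 'n \<Rightarrow> nat. sum m UNIV = 0} = {\<lambda>_. 0}"
    by (auto simp: fun_eq_iff)
  then show ?thesis unfolding homogeneous_polynomial_def by (intro exI[of _ "\<lambda>_. c"]) simp
qed

lemma homogeneous_polynomial_add:
  "homogeneous_polynomial d H \<Longrightarrow> homogeneous_polynomial d G \<Longrightarrow> homogeneous_polynomial d (\<lambda>z. H z + G z)"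
  unfolding homogeneous_polynomial_def
  apply (elim exE)
  subgoal for a b by (rule exI[of _ "\<lambda>m. a m + b m"]) (simp add: sum.distrib distrib_right)
  done

lemma homogeneous_polynomial_cmult:
  "homogeneous_polynomial d H \<Longrightarrow> homogeneous_polynomial d (\<lambda>z. c * H z)"
  unfolding homogeneous_polynomial_def
  apply (elim exE)
  subgoal for a by (rule exI[of _ "\<lambda>m. c * a m"]) (simp add: sum_distrib_left mult.assoc)
  done

lemma homogeneous_polynomial_coord_mult:
  fixes j :: "'n::finite"
  assumes "homogeneous_polynomial d H"
  shows "homogeneous_polynomial (Suc d) (\<lambda>z. z $ j * H z)"
proof -
  obtain a where a: "\<And>z. H z = (\<Sum>m | sum m UNIV = d. a m * (\<Prod>i\<in>UNIV. (z $ i) ^ m i))"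
    using assms by (auto simp: homogeneous_polynomial_def)
  let ?up = "\<lambda>m :: 'n \<Rightarrow> nat. m(j := Suc (m j))"
  let ?dn = "\<lambda>m :: 'n \<Rightarrow> nat. m(j := m j - 1)"
  have sum_upd: "sum (m(j := x)) UNIV + m j = sum m UNIV + x" for m :: "'n \<Rightarrow> nat" and x
  proof -
    have "sum (m(j := x)) UNIV = x + sum m (UNIV - {j})"
      by (subst sum.remove[of _ j]) (auto intro: sum.cong)
    moreover have "sum m UNIV = m j + sum m (UNIV - {j})" by (subst sum.remove[of _ j]) auto
    ultimately show ?thesis by simp
  qed
  have prod_upd: "(\<Prod>i\<in>UNIV. (z $ i) ^ ?up m i) = z $ j * (\<Prod>i\<in>UNIV. (z $ i) ^ m i)" for m and z :: "complex ^ 'n"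
  proof -
    have "(\<Prod>i\<in>UNIV. (z $ i) ^ ?up m i) = (z $ j) ^ Suc (m j) * (\<Prod>i\<in>UNIV - {j}. (z $ i) ^ m i)"
      by (subst prod.remove[of _ j]) (auto intro: prod.cong)
    moreover have "(\<Prod>i\<in>UNIV. (z $ i) ^ m i) = (z $ j) ^ m j * (\<Prod>i\<in>UNIV - {j}. (z $ i) ^ m i)"
      by (subst prod.remove[of _ j]) auto
    ultimately show ?thesis by simp
  qed
  have "z $ j * H z = (\<Sum>m | sum m UNIV = Suc d. (if m j = 0 then 0 else a (?dn m)) * (\<Prod>i\<in>UNIV. (z $ i) ^ m i))" for z
  proof -
    have "z $ j * H z = (\<Sum>m | sum m UNIV = d. a m * (\<Prod>i\<in>UNIV. (z $ i) ^ ?up m i))"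
      unfolding a prod_upd by (simp add: sum_distrib_left mult_ac)
    also have "\<dots> = (\<Sum>m | sum m UNIV = Suc d \<and> m j \<noteq> 0. a (?dn m) * (\<Prod>i\<in>UNIV. (z $ i) ^ m i))"
    proof (rule sum.reindex_bij_witness[of _ ?dn ?up], goal_cases)
      case (4 m)
      then show ?case using sum_upd[of m "m j - 1"] by auto
    next
      case (2 m)
      then show ?case using sum_upd[of m "Suc (m j)"] by auto
    qed auto
    also have "\<dots> = (\<Sum>m | sum m UNIV = Suc d. (if m j = 0 then 0 else a (?dn m)) * (\<Prod>i\<in>UNIV. (z $ i) ^ m i))"
      by (rule sum.mono_neutral_cong_left) (auto simp: finite_multiindices)
    finally show ?thesis .
  qed
  then show ?thesis unfolding homogeneous_polynomial_def
    by (intro exI[of _ "\<lambda>m. if m j = 0 then 0 else a (?dn m)"] allI)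
qed

lemma continuous_on_homogeneous_polynomial:
  "homogeneous_polynomial d H \<Longrightarrow> continuous_on S H"
  unfolding homogeneous_polynomial_def
  by (erule exE, simp, intro continuous_intros)

lemma homogeneous_polynomial_line_holomorphic:
  "homogeneous_polynomial d H \<Longrightarrow> (\<lambda>c. H (a + c *s b)) holomorphic_on S"
  unfolding homogeneous_polynomial_def
  by (erule exE, simp, intro holomorphic_intros)

text \<open>The grading is part of the definition, so that homogeneous components can be extracted.\<close>
definition polynomial_function :: "(complex ^ 'n \<Rightarrow> complex) \<Rightarrow> bool" where
  "polynomial_function Q \<longleftrightarrow>
     (\<exists>D H. (\<forall>e. homogeneous_polynomial e (H e)) \<and> (\<forall>z. Q z = (\<Sum>e\<le>D. H e z)))"

lemma polynomial_function_const: "polynomial_function (\<lambda>_. c)"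
  unfolding polynomial_function_def
  by (rule exI[of _ 0], rule exI[of _ "\<lambda>e _. if e = 0 then c else 0"])
     (auto simp: homogeneous_polynomial_const homogeneous_polynomial_zero)

lemma polynomial_function_add:
  assumes "polynomial_function P" "polynomial_function Q"
  shows "polynomial_function (\<lambda>z. P z + Q z)"
proof -
  obtain D H where H: "\<And>e. homogeneous_polynomial e (H e)" "\<And>z. P z = (\<Sum>e\<le>D. H e z)"
    using assms(1) by (auto simp: polynomial_function_def)
  obtain E G where G: "\<And>e. homogeneous_polynomial e (G e)" "\<And>z. Q z = (\<Sum>e\<le>E. G e z)"
    using assms(2) by (auto simp: polynomial_function_def)
  let ?H = "\<lambda>e z. if e \<le> D then H e z else 0" and ?G = "\<lambda>e z. if e \<le> E then G e z else 0"
  have "homogeneous_polynomial e (?H e)" "homogeneous_polynomial e (?G e)" for e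
    using H G by (cases "e \<le> D"; cases "e \<le> E"; simp add: homogeneous_polynomial_zero)+
  moreover have "P z = (\<Sum>e\<le>max D E. ?H e z)" "Q z = (\<Sum>e\<le>max D E. ?G e z)" for z
    unfolding H G by (intro sum.mono_neutral_cong_left; auto)+
  ultimately show ?thesis unfolding polynomial_function_def
    by (intro exI[of _ "max D E"] exI[of _ "\<lambda>e z. ?H e z + ?G e z"])
       (auto simp only: sum.distrib intro: homogeneous_polynomial_add)
qed

lemma polynomial_function_cmult:
  assumes "polynomial_function P" shows "polynomial_function (\<lambda>z. c * P z)"
proof -
  obtain D H where H: "\<And>e. homogeneous_polynomial e (H e)" "\<And>z. P z = (\<Sum>e\<le>D. H e z)"
    using assms(1) by (auto simp: polynomial_function_def)
  then show ?thesis unfolding polynomial_function_def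
    by (intro exI[of _ D] exI[of _ "\<lambda>e z. c * H e z"])
       (auto simp: sum_distrib_left intro: homogeneous_polynomial_cmult)
qed

lemma polynomial_function_coord_mult:
  assumes "polynomial_function P" shows "polynomial_function (\<lambda>z. z $ j * P z)"
proof -
  obtain D H where H: "\<And>e. homogeneous_polynomial e (H e)" "\<And>z. P z = (\<Sum>e\<le>D. H e z)"
    using assms(1) by (auto simp: polynomial_function_def)
  let ?H = "\<lambda>e z. case e of 0 \<Rightarrow> 0 | Suc e' \<Rightarrow> z $ j * H e' z"
  have "homogeneous_polynomial e (?H e)" for e
    using H by (cases e) (auto simp: homogeneous_polynomial_zero homogeneous_polynomial_coord_mult)
  moreover have "z $ j * P z = (\<Sum>e\<le>Suc D. ?H e z)" for z
    unfolding H sum.atMost_Suc_shift by (simp add: sum_distrib_left)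
  ultimately show ?thesis unfolding polynomial_function_def
    by (intro exI[of _ "Suc D"] exI[of _ ?H] conjI allI)
qed

lemma polynomial_function_poly_coord_mult:
  assumes "polynomial_function P" shows "polynomial_function (\<lambda>z. poly p (z $ j) * P z)"
proof (induction p)
  case 0
  show ?case using polynomial_function_const[of 0] by simp
next
  case (pCons a p)
  have "polynomial_function (\<lambda>z. a * P z + z $ j * (poly p (z $ j) * P z))"
    by (intro polynomial_function_add polynomial_function_cmult polynomial_function_coord_mult assms pCons.IH)
  then show ?case by (simp add: algebra_simps)
qed

lemma polynomial_function_sum:
  "(\<And>k. k \<in> A \<Longrightarrow> polynomial_function (P k)) \<Longrightarrow> polynomial_function (\<lambda>z. \<Sum>k\<in>A. P k z)"
  by (induction A rule: infinite_finite_induct)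
     (simp_all add: polynomial_function_const polynomial_function_add)

text \<open>
  Restricted to the complex line through \<open>z\<close>, the scaling law is an identity between
  polynomials in the parameter, so all components of degree other than \<open>d\<close> vanish at
  \<open>z\<close>.
\<close>
lemma homogeneous_polynomial_if_scale:
  assumes P: "polynomial_function P" and scale: "\<And>c z. P (c *s z) = c ^ d * P z"
  shows "homogeneous_polynomial d P"
proof -
  obtain D H where H: "\<And>e. homogeneous_polynomial e (H e)" "\<And>z. P z = (\<Sum>e\<le>D. H e z)"
    using P by (auto simp: polynomial_function_def)
  let ?H = "\<lambda>e z. if e \<le> D then H e z else 0"
  have h: "homogeneous_polynomial e (?H e)" for e
    using H by (cases "e \<le> D") (simp_all add: homogeneous_polynomial_zero)
  have s: "P z = (\<Sum>e\<le>max D d. ?H e z)" for z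
    unfolding H by (intro sum.mono_neutral_cong_left) auto
  have "P z = ?H d z" for z
  proof -
    have "\<forall>c. (\<Sum>e\<le>max D d. ?H e z * c ^ e) = (\<Sum>e\<le>max D d. (if e = d then P z else 0) * c ^ e)"
    proof
      fix c
      have "(\<Sum>e\<le>max D d. ?H e z * c ^ e) = (\<Sum>e\<le>max D d. ?H e (c *s z))"
        by (intro sum.cong refl) (auto simp: homogeneous_polynomial_scale[OF H(1)])
      also have "\<dots> = c ^ d * P z" by (simp add: s[symmetric] scale)
      also have "\<dots> = (\<Sum>e\<le>max D d. (if e = d then P z else 0) * c ^ e)"
        by (simp add: if_distrib[of "\<lambda>x. x * _"] cong: if_cong)
      finally show "(\<Sum>e\<le>max D d. ?H e z * c ^ e) = (\<Sum>e\<le>max D d. (if e = d then P z else 0) * c ^ e)" .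
    qed
    then have "\<forall>e\<le>max D d. ?H e z = (if e = d then P z else 0)" by (simp only: polyfun_eq_coeffs)
    then show ?thesis by simp
  qed
  then have "P = ?H d" by auto
  then show ?thesis using h[of d] by metis
qed

definition lagrange_poly :: "nat \<Rightarrow> nat \<Rightarrow> complex poly" where
  "lagrange_poly d l = (\<Prod>j\<in>{..d} - {l}. smult (1 / (of_nat l - of_nat j)) [:- of_nat j, 1:])"

lemma poly_lagrange_node:
  assumes "k \<le> d" "l \<le> d"
  shows "poly (lagrange_poly d l) (of_nat k) = (if k = l then 1 else 0)"
  using assms by (auto simp: lagrange_poly_def poly_prod prod_zero_iff diff_divide_distrib[symmetric] intro!: prod.neutral)

lemma degree_lagrange_poly: "l \<le> d \<Longrightarrow> degree (lagrange_poly d l) \<le> d"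
proof -
  assume l: "l \<le> d"
  have "degree (lagrange_poly d l) \<le> (\<Sum>j\<in>{..d} - {l}. degree (smult (1 / (of_nat l - of_nat j)) [:- of_nat j, 1 :: complex:]))"
    unfolding lagrange_poly_def
    using degree_prod_sum_le[of "{..d} - {l}" "\<lambda>j. smult (1 / (of_nat l - of_nat j)) [:- of_nat j, 1 :: complex:]"]
    by (simp only: o_def finite_Diff finite_atMost)
  also have "\<dots> \<le> (\<Sum>j\<in>{..d} - {l}. 1)" by (intro sum_mono) (simp add: degree_smult_eq)
  also have "\<dots> = d" using l by simp
  finally show ?thesis .
qed

lemma lagrange_interpolation:
  fixes p :: "complex poly"
  assumes "degree p \<le> d"
  shows "poly p c = (\<Sum>l\<le>d. poly p (of_nat l) * poly (lagrange_poly d l) c)"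
proof -
  let ?q = "\<Sum>l\<le>d. smult (poly p (of_nat l)) (lagrange_poly d l)"
  have "p = ?q"
  proof (rule poly_eqI_degree[of "of_nat ` {..d}"])
    have card: "card ((of_nat :: nat \<Rightarrow> complex) ` {..d}) = Suc d" by (simp add: card_image inj_on_def)
    have "degree ?q \<le> d"
      by (intro degree_sum_le) (auto intro: order_trans[OF degree_smult_le] degree_lagrange_poly)
    then show "degree p < card ((of_nat :: nat \<Rightarrow> complex) ` {..d})" "degree ?q < card ((of_nat :: nat \<Rightarrow> complex) ` {..d})"
      using assms unfolding card by auto
    fix x :: complex assume "x \<in> of_nat ` {..d}"
    then obtain k where k: "k \<le> d" "x = of_nat k" by auto
    then show "poly p x = poly ?q x"
      by (simp add: poly_sum poly_lagrange_node if_distrib[of "\<lambda>x. _ * x"] cong: if_cong)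
  qed
  then have "poly p c = poly ?q c" by simp
  then show ?thesis by (simp add: poly_sum)
qed

text \<open>
  By Liouville's theorem \<open>h\<close> is a polynomial of degree at most \<open>d\<close>, hence equal
  to its interpolation polynomial at the nodes \<open>0, \<dots>, d\<close>.
\<close>
lemma entire_growth_lagrange:
  assumes h: "h holomorphic_on UNIV" and bd: "\<And>c. norm (h c) \<le> B * (A + norm c) ^ d" and A: "0 \<le> A" and B: "0 \<le> B"
  shows "h c = (\<Sum>l\<le>d. h (of_nat l) * poly (lagrange_poly d l) c)"
proof -
  define p where "p = (\<Sum>k\<le>d. monom ((deriv ^^ k) h 0 / fact k) k)"
  have p: "h c = poly p c" for c
  proof -
    have "h c = (\<Sum>k\<le>d. (deriv ^^ k) h 0 / fact k * c ^ k)"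
    proof (rule Liouville_polynomial[OF h, where A = A and B = "B * 2 ^ d"])
      fix z :: complex assume z: "A \<le> norm z"
      have "norm (h z) \<le> B * (A + norm z) ^ d" by (rule bd)
      also have "\<dots> \<le> B * (2 * norm z) ^ d" using z A B by (intro mult_left_mono power_mono) auto
      finally show "norm (h z) \<le> B * 2 ^ d * norm z ^ d" by (simp add: power_mult_distrib mult.assoc)
    qed
    then show ?thesis by (simp add: p_def poly_sum poly_monom)
  qed
  have "degree p \<le> d" unfolding p_def
    by (intro degree_sum_le) (auto intro: order_trans[OF degree_monom_le])
  from lagrange_interpolation[OF this, of c] show ?thesis by (simp add: p)
qed

text \<open>
  Interpolating in one coordinate after the other writes \<open>G\<close> as a finite combination of
  products of one-variable polynomials, whose coefficients are the values of \<open>G\<close> at points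
  with integer coordinates.
\<close>
lemma polynomial_function_if_separately:
  fixes G :: "complex ^ 'n \<Rightarrow> complex"
  assumes hol: "\<And>a i. (\<lambda>c. G (a + c *s axis i 1)) holomorphic_on UNIV"
    and bd: "\<And>z. norm (G z) \<le> B * norm z ^ d" and B: "0 \<le> B"
  shows "polynomial_function G"
proof -
  have "\<exists>(S :: nat set) Y Q. (\<forall>k\<in>S. polynomial_function (Q k)) \<and>
     (\<forall>z. G z = (\<Sum>k\<in>S. Q k z * G (\<chi> i. if i \<in> I then Y k $ i else z $ i)))" if "finite I" for I :: "'n set"
    using that
  proof (induction I)
    case empty
    show ?case
      by (rule exI[of _ "{0}"], rule exI, rule exI[of _ "\<lambda>_ _. 1"]) (simp add: polynomial_function_const)
  next
    case (insert j I)
    then obtain S :: "nat set" and Y :: "nat \<Rightarrow> complex ^ 'n" and Q where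
      Q: "\<And>k. k \<in> S \<Longrightarrow> polynomial_function (Q k)"
      and G: "\<And>z. G z = (\<Sum>k\<in>S. Q k z * G (\<chi> i. if i \<in> I then Y k $ i else z $ i))"
      by blast
    have step: "G (\<chi> i. if i \<in> I then y $ i else z $ i)
        = (\<Sum>l\<le>d. poly (lagrange_poly d l) (z $ j) * G (\<chi> i. if i \<in> insert j I then (if i = j then of_nat l else y $ i) else z $ i))" for y z
    proof -
      define a where "a = (\<chi> i. if i \<in> I then y $ i else if i = j then 0 else z $ i)"
      have a: "a + c *s axis j 1 = (\<chi> i. if i \<in> insert j I then (if i = j then c else y $ i) else z $ i)" for c
        using insert.hyps by (auto simp: a_def vec_eq_iff axis_def)
      have "(\<chi> i. if i \<in> I then y $ i else z $ i) = a + (z $ j) *s axis j 1"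
        using insert.hyps by (auto simp: a_def vec_eq_iff axis_def)
      then have "G (\<chi> i. if i \<in> I then y $ i else z $ i) = G (a + (z $ j) *s axis j 1)" by (rule arg_cong)
      also have "\<dots> = (\<Sum>l\<le>d. G (a + of_nat l *s axis j 1) * poly (lagrange_poly d l) (z $ j))"
      proof -
      have "G (a + c *s axis j 1) = (\<Sum>l\<le>d. G (a + of_nat l *s axis j 1) * poly (lagrange_poly d l) c)" for c
      proof (rule entire_growth_lagrange[OF hol, where B = B and A = "norm a"])
        fix c
        have "norm (G (a + c *s axis j 1)) \<le> B * norm (a + c *s axis j 1) ^ d" by (rule bd)
        also have "\<dots> \<le> B * (norm a + norm c) ^ d"
          using norm_triangle_ineq[of a "c *s axis j 1"] B
          by (intro mult_left_mono power_mono) (auto simp: norm_vector_smult norm_axis_one)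
        finally show "norm (G (a + c *s axis j 1)) \<le> B * (norm a + norm c) ^ d" .
      qed (use B in auto)
      then show ?thesis .
      qed
      also have "\<dots> = (\<Sum>l\<le>d. poly (lagrange_poly d l) (z $ j) * G (\<chi> i. if i \<in> insert j I then (if i = j then of_nat l else y $ i) else z $ i))"
        unfolding a by (intro sum.cong refl mult.commute)
      finally show ?thesis .
    qed
    (* Pairs of an old index and a node are renumbered, as the index type is fixed in the induction. *)
    have bij: "\<exists>(T :: nat set) (u :: nat \<Rightarrow> nat \<times> nat). bij_betw u T (S \<times> {..d})"
    proof -
      have "inj_on prod_encode (S \<times> {..d})" by (simp add: inj_prod_encode inj_on_subset[of _ UNIV])
      then have "bij_betw prod_encode (S \<times> {..d}) (prod_encode ` (S \<times> {..d}))" by (rule inj_on_imp_bij_betw)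
      from bij_betw_inv_into[OF this] show ?thesis by blast
    qed
    then obtain T :: "nat set" and u :: "nat \<Rightarrow> nat \<times> nat" where u: "bij_betw u T (S \<times> {..d})" by blast
    show ?case
    proof (intro exI conjI ballI allI)
      fix k assume "k \<in> T"
      then have "u k \<in> S \<times> {..d}" using u by (rule bij_betw_apply[rotated])
      then have "fst (u k) \<in> S" by auto
      then show "polynomial_function (\<lambda>z. poly (lagrange_poly d (snd (u k))) (z $ j) * Q (fst (u k)) z)"
        by (intro polynomial_function_poly_coord_mult Q)
    next
      fix z
      have "G z = (\<Sum>k\<in>S. \<Sum>l\<le>d. Q k z * (poly (lagrange_poly d l) (z $ j) * G (\<chi> i. if i \<in> insert j I then (if i = j then of_nat l else Y k $ i) else z $ i)))"
        by (subst G) (simp only: step sum_distrib_left)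
      also have "\<dots> = (\<Sum>(k, l)\<in>S \<times> {..d}. Q k z * (poly (lagrange_poly d l) (z $ j) * G (\<chi> i. if i \<in> insert j I then (if i = j then of_nat l else Y k $ i) else z $ i)))"
        by (rule sum.cartesian_product)
      also have "\<dots> = (\<Sum>k\<in>T. poly (lagrange_poly d (snd (u k))) (z $ j) * Q (fst (u k)) z *
          G (\<chi> i. if i \<in> insert j I then (\<chi> i. if i = j then of_nat (snd (u k)) else Y (fst (u k)) $ i) $ i else z $ i))"
        unfolding sum.reindex_bij_betw[OF u, symmetric]
        by (intro sum.cong refl) (simp add: case_prod_beta mult_ac cong: if_cong)
      finally show "G z = (\<Sum>k\<in>T. poly (lagrange_poly d (snd (u k))) (z $ j) * Q (fst (u k)) z *
          G (\<chi> i. if i \<in> insert j I then (\<chi> i. if i = j then of_nat (snd (u k)) else Y (fst (u k)) $ i) $ i else z $ i))" .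
    qed
  qed
  from this[of UNIV] obtain S :: "nat set" and Y :: "nat \<Rightarrow> complex ^ 'n" and Q where
    Q: "\<And>k. k \<in> S \<Longrightarrow> polynomial_function (Q k)" and G: "\<And>z. G z = (\<Sum>k\<in>S. Q k z * G (\<chi> i. Y k $ i))"
    by auto
  define L where "L = (\<lambda>z. \<Sum>k\<in>S. G (\<chi> i. Y k $ i) * Q k z)"
  have "polynomial_function L"
    unfolding L_def by (intro polynomial_function_sum polynomial_function_cmult Q)
  moreover have "G = L"
  proof
    fix z
    show "G z = L z" unfolding L_def by (rule trans[OF G], rule sum.cong[OF refl], rule mult.commute)
  qed
  ultimately show ?thesis by simp
qed

section \<open>Homogeneous expansions and the operators \<open>(I + R)\<^sup>k\<close>\<close>

text \<open>
  This form of holomorphy concerns functions of one variable only and passes to locally uniform limits,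
  which is how it is inherited by \<open>(I + R)\<^sup>k f\<close>.
\<close>
definition line_holomorphic :: "(complex ^ 'n \<Rightarrow> complex) \<Rightarrow> bool" where
  "line_holomorphic g \<longleftrightarrow> continuous_on (ball 0 1) g \<and>
     (\<forall>a b. (\<lambda>c. g (a + c *s b)) holomorphic_on {c. a + c *s b \<in> ball 0 1})"

lemma holomorphic_on_ball_imp_line_holomorphic:
  assumes "holomorphic_on_ball f" shows "line_holomorphic f"
proof -
  have der: "\<exists>f'. (f has_derivative f') (at z) \<and> (\<forall>c v. f' (c *s v) = c * f' v)" if "z \<in> ball 0 1" for z
    using assms that by (auto simp: holomorphic_on_ball_def)
  have "continuous_on (ball 0 1) f"
    using der by (meson continuous_at_imp_continuous_on has_derivative_continuous)
  moreover have "(\<lambda>c. f (a + c *s b)) holomorphic_on {c. a + c *s b \<in> ball 0 1}" for a b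
  proof (rule holomorphic_onI)
    fix c assume c: "c \<in> {c. a + c *s b \<in> ball 0 1}"
    obtain f' where f': "(f has_derivative f') (at (a + c *s b))" "\<And>c v. f' (c *s v) = c * f' v"
      using der[of "a + c *s b"] c by auto
    have lin: "((\<lambda>c. a + c *s b) has_derivative (\<lambda>h. h *s b)) (at c)"
    proof -
      have "((\<lambda>c. c *s b) has_derivative (\<lambda>h. h *s b)) (at c)"
        by (rule bounded_linear.has_derivative[OF bounded_linear_vector_smult_left has_derivative_ident])
      from has_derivative_add[OF has_derivative_const this, of a] show ?thesis by simp
    qed
    have "((\<lambda>c. f (a + c *s b)) has_derivative (\<lambda>h. f' (h *s b))) (at c)"
      by (rule has_derivative_compose[OF lin f'(1)])
    then have "((\<lambda>c. f (a + c *s b)) has_field_derivative f' b) (at c)"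
      unfolding has_field_derivative_def f'(2) by (simp only: mult_commute_abs)
    then show "(\<lambda>c. f (a + c *s b)) field_differentiable at c within {c. a + c *s b \<in> ball 0 1}"
      using field_differentiable_def field_differentiable_at_within by blast
  qed
  ultimately show ?thesis by (simp add: line_holomorphic_def)
qed

lemma line_holomorphicD:
  assumes "line_holomorphic g" "\<And>c. c \<in> S \<Longrightarrow> norm (a + c *s b) < 1"
  shows "(\<lambda>c. g (a + c *s b)) holomorphic_on S"
proof (rule holomorphic_on_subset)
  show "(\<lambda>c. g (a + c *s b)) holomorphic_on {c. a + c *s b \<in> ball 0 1}"
    using assms(1) by (simp add: line_holomorphic_def)
  show "S \<subseteq> {c. a + c *s b \<in> ball 0 1}" using assms(2) by auto
qed

lemma line_holomorphic_slice:
  assumes "line_holomorphic g" "\<And>c. c \<in> S \<Longrightarrow> norm c * norm b < 1"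
  shows "(\<lambda>c. g (c *s b)) holomorphic_on S"
  using line_holomorphicD[OF assms(1), of S 0 b] assms(2) by (simp add: norm_vector_smult)

text \<open>
  The coefficient of degree \<open>d\<close> of the slice of \<open>f\<close> on the complex line through
  \<open>z\<close>. These are the homogeneous parts of \<open>f\<close>, but this is not obvious, as each
  slice could have unrelated coefficients.
\<close>
definition taylor_part :: "(complex ^ 'n \<Rightarrow> complex) \<Rightarrow> nat \<Rightarrow> complex ^ 'n \<Rightarrow> complex" where
  "taylor_part f d z = (deriv ^^ d) (\<lambda>c. f (c *s z)) 0 / fact d"

lemma slice_radius:
  fixes z :: "complex ^ 'n"
  assumes "c \<in> ball (0::complex) (1 / (norm z + e))" "0 < e" shows "norm c * norm z < 1"
proof -
  have pos: "0 < norm z + e" using assms(2) norm_ge_zero[of z] by linarith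
  have "norm c * norm z \<le> norm c * (norm z + e)" using assms(2) by (intro mult_left_mono) auto
  also have "\<dots> < 1" using assms(1) pos by (simp add: pos_less_divide_eq)
  finally show ?thesis .
qed

lemma taylor_part_scale:
  assumes "line_holomorphic f"
  shows "taylor_part f d (c *s z) = c ^ d * taylor_part f d z"
proof -
  let ?T = "ball (0::complex) (1 / (norm z + 1))"
  let ?S = "ball (0::complex) (1 / ((norm c + 1) * (norm z + 1)))"
  have pos: "0 < norm z + 1" "0 < norm c + 1" by (auto simp: add_nonneg_pos)
  have hol: "(\<lambda>c. f (c *s z)) holomorphic_on ?T"
    by (rule line_holomorphic_slice[OF assms]) (rule slice_radius, auto)
  have "(deriv ^^ d) (\<lambda>w. f ((c * w) *s z)) 0 = c ^ d * (deriv ^^ d) (\<lambda>w. f (w *s z)) (c * 0)"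
  proof (rule higher_deriv_compose_linear[OF hol, of ?S])
    fix w assume w: "w \<in> ?S"
    have "norm (c * w) \<le> (norm c + 1) * norm w" by (simp add: norm_mult distrib_right)
    also have "\<dots> < (norm c + 1) * (1 / ((norm c + 1) * (norm z + 1)))"
      using w pos by (intro mult_strict_left_mono) auto
    also have "\<dots> = 1 / (norm z + 1)" using pos by simp
    finally show "c * w \<in> ?T" by simp
  qed (use pos in auto)
  then show ?thesis by (simp add: taylor_part_def mult.commute)
qed

lemma taylor_part_sums:
  assumes "line_holomorphic f" "norm z < 1"
  shows "(\<lambda>d. taylor_part f d z) sums f z"
proof -
  define e where "e = (1 - norm z) / 2"
  have e: "0 < e" using assms by (simp add: e_def)
  let ?T = "ball (0::complex) (1 / (norm z + e))"
  have pos: "0 < norm z + e" using e norm_ge_zero[of z] by linarith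
  have hol: "(\<lambda>c. f (c *s z)) holomorphic_on ?T"
    by (rule line_holomorphic_slice[OF assms(1)]) (rule slice_radius[OF _ e])
  have "1 \<in> ?T" using pos assms by (simp add: e_def field_simps)
  from holomorphic_power_series[OF hol this] show ?thesis by (simp add: taylor_part_def)
qed

lemma taylor_part_bound:
  assumes f: "line_holomorphic f" and \<rho>: "0 < \<rho>" "\<rho> < 1" and M: "\<And>z. norm z \<le> \<rho> \<Longrightarrow> norm (f z) \<le> M"
  shows "norm (taylor_part f d z) \<le> M * (norm z / \<rho>) ^ d"
proof (cases "z = 0")
  case True
  have "0 \<le> M" using order_trans[OF norm_ge_zero M[of 0]] \<rho> by simp
  have "taylor_part f d z = 0 ^ d * taylor_part f d 0"
    using taylor_part_scale[OF f, of d 0 0] True by simp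
  moreover have "taylor_part f 0 0 = f 0" by (simp add: taylor_part_def)
  ultimately show ?thesis using M[of 0] \<rho> \<open>0 \<le> M\<close> True by (cases d) auto
next
  case False
  let ?r = "\<rho> / norm z"
  have bnd: "norm c * norm z \<le> \<rho>" if "norm c \<le> ?r" for c :: complex
    using that False by (simp add: field_simps)
  have "norm ((deriv ^^ d) (\<lambda>c. f (c *s z)) 0) \<le> fact d * M / ?r ^ d"
  proof (rule Cauchy_inequality)
    have hol: "(\<lambda>c. f (c *s z)) holomorphic_on cball 0 ?r"
      by (rule line_holomorphic_slice[OF f]) (use bnd \<rho> in \<open>force intro: le_less_trans\<close>)
    then show "(\<lambda>c. f (c *s z)) holomorphic_on ball 0 ?r" by (rule holomorphic_on_subset) auto
    show "continuous_on (cball 0 ?r) (\<lambda>c. f (c *s z))" using hol by (rule holomorphic_on_imp_continuous_on)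
    show "norm (f (c *s z)) \<le> M" if "norm (0 - c) = ?r" for c
      using bnd[of c] that by (intro M) (simp add: norm_vector_smult)
  qed (use False \<rho> in auto)
  then have "norm (taylor_part f d z) \<le> M / ?r ^ d"
    by (simp add: taylor_part_def norm_divide field_simps)
  also have "\<dots> = M * (norm z / \<rho>) ^ d" by (simp add: power_divide)
  finally show ?thesis .
qed

lemma line_holomorphic_bounded:
  assumes "line_holomorphic f" "\<rho> < 1"
  obtains M where "0 \<le> M" "\<And>z. norm z \<le> \<rho> \<Longrightarrow> norm (f z) \<le> M"
proof -
  have "compact (f ` cball 0 \<rho>)"
    using assms by (intro compact_continuous_image)
      (auto simp: line_holomorphic_def intro: continuous_on_subset)
  then obtain M where "\<And>w. w \<in> f ` cball 0 \<rho> \<Longrightarrow> norm w \<le> M" by (meson bounded_iff compact_imp_bounded)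
  then show ?thesis by (intro that[of "max M 0"]) (auto simp: max.coboundedI1)
qed

text \<open>
  Cauchy's estimates for the slice bound the remainder by a geometric series of ratio at most
  \<open>1/2\<close>.
\<close>
lemma taylor_part_remainder:
  assumes f: "line_holomorphic f" and \<rho>: "0 < \<rho>" "\<rho> < 1" and M: "\<And>z. norm z \<le> \<rho> \<Longrightarrow> norm (f z) \<le> M"
    and t: "0 < t" "t * norm z \<le> \<rho> / 2"
  shows "norm ((f (of_real t *s z) - (\<Sum>l<d. of_real t ^ l * taylor_part f l z)) / of_real t ^ d - taylor_part f d z)
      \<le> 2 * M * (norm z / \<rho>) ^ Suc d * t"
proof -
  have M0: "0 \<le> M" using order_trans[OF norm_ge_zero M[of 0]] \<rho> by simp
  define x where "x = t * norm z / \<rho>"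
  have x: "0 \<le> x" "x \<le> 1/2" using t \<rho> by (auto simp: x_def field_simps)
  have nz: "norm (of_real t *s z) < 1" using t \<rho> by (simp add: norm_vector_smult)
  let ?a = "\<lambda>l. of_real t ^ l * taylor_part f l z"
  have sums: "?a sums f (of_real t *s z)"
    using taylor_part_sums[OF f nz] by (simp add: taylor_part_scale[OF f])
  have bd: "norm (?a l) \<le> M * x ^ l" for l
  proof -
    have "norm (?a l) = t ^ l * norm (taylor_part f l z)" using t by (simp add: norm_mult norm_power)
    also have "\<dots> \<le> t ^ l * (M * (norm z / \<rho>) ^ l)"
      using t by (intro mult_left_mono taylor_part_bound[OF f \<rho> M]) auto
    also have "\<dots> = M * x ^ l" by (simp add: x_def power_mult_distrib power_divide)
    finally show ?thesis .
  qed
  have geo: "summable (\<lambda>l. M * x ^ (l + Suc d))"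
    using x by (auto simp: power_add intro!: summable_mult summable_mult2 summable_geometric)
  have "f (of_real t *s z) = (\<Sum>l. ?a (l + Suc d)) + (\<Sum>l<Suc d. ?a l)"
    using suminf_split_initial_segment[OF sums_summable[OF sums], of "Suc d"] sums_unique[OF sums] by simp
  then have "f (of_real t *s z) - (\<Sum>l<d. ?a l) - ?a d = (\<Sum>l. ?a (l + Suc d))" by simp
  also have "norm \<dots> \<le> (\<Sum>l. M * x ^ (l + Suc d))" by (rule norm_suminf_le[OF bd geo])
  also have "\<dots> = M * x ^ Suc d * (\<Sum>l. x ^ l)"
  proof -
    have "summable (\<lambda>l. x ^ l)" using x by (intro summable_geometric) simp
    from suminf_mult[OF this, of "M * x ^ Suc d"] show ?thesis by (simp add: power_add mult_ac)
  qed
  also have "(\<Sum>l. x ^ l) \<le> 2" using x by (simp add: suminf_geometric field_simps)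
  finally have "norm (f (of_real t *s z) - (\<Sum>l<d. ?a l) - ?a d) \<le> M * x ^ Suc d * 2"
    using M0 x by (simp add: mult_left_mono)
  moreover have "(f (of_real t *s z) - (\<Sum>l<d. ?a l)) / of_real t ^ d - taylor_part f d z
      = (f (of_real t *s z) - (\<Sum>l<d. ?a l) - ?a d) / of_real t ^ d"
    using t by (simp add: field_simps)
  ultimately have "norm ((f (of_real t *s z) - (\<Sum>l<d. ?a l)) / of_real t ^ d - taylor_part f d z)
      \<le> M * x ^ Suc d * 2 / t ^ d"
    using t by (simp add: norm_divide norm_power divide_right_mono)
  also have "\<dots> = 2 * M * (norm z / \<rho>) ^ Suc d * t"
    using t by (simp add: x_def power_mult_distrib power_divide)
  finally show ?thesis .
qed

text \<open>
  By induction on \<open>d\<close>: the difference quotients in the remainder estimate are holomorphic on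
  any given line, and converge uniformly on bounded parts of it as \<open>t\<close> tends to 0.
\<close>
lemma taylor_part_entire:
  fixes f :: "complex ^ 'n \<Rightarrow> complex"
  assumes f: "line_holomorphic f"
  shows "(\<lambda>c. taylor_part f d (a + c *s b)) holomorphic_on UNIV"
proof (induction d rule: less_induct)
  case (less d)
  obtain M where M: "0 \<le> M" "\<And>z. norm z \<le> 1/2 \<Longrightarrow> norm (f z) \<le> M"
    using line_holomorphic_bounded[OF f, of "1/2"] by auto
  have "(\<lambda>c. taylor_part f d (a + c *s b)) holomorphic_on ball 0 R" if R: "0 < R" for R
  proof -
    define A where "A = norm a + R * norm b + 1"
    have A: "1 \<le> A" using R by (simp add: A_def)
    have nA: "norm (a + c *s b) \<le> A" if "c \<in> ball 0 R" for c
    proof -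
      have "norm (a + c *s b) \<le> norm a + norm c * norm b"
        using norm_triangle_ineq[of a "c *s b"] by (simp add: norm_vector_smult)
      also have "norm c * norm b \<le> R * norm b" using that by (intro mult_right_mono) auto
      finally show ?thesis by (simp add: A_def)
    qed
    define t where "t n = 1 / (4 * A * real (Suc n))" for n
    have t: "0 < t n" "t n * A \<le> 1/4" for n
    proof -
      show "0 < t n" using A by (simp add: t_def)
      have "t n * A = 1 / (4 * real (Suc n))" using A by (simp add: t_def)
      also have "\<dots> \<le> 1 / 4" by (simp add: divide_le_eq)
      finally show "t n * A \<le> 1 / 4" .
    qed
    have t0: "t \<longlonglongrightarrow> 0"
    proof -
      have "t = (\<lambda>n. (1 / (4 * A)) * inverse (real (Suc n)))" by (auto simp: t_def fun_eq_iff field_simps)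
      then show ?thesis by (simp only:) (rule tendsto_mult_right_zero[OF LIMSEQ_inverse_real_of_nat])
    qed
    let ?q = "\<lambda>n c. (f (of_real (t n) *s (a + c *s b)) - (\<Sum>l<d. of_real (t n) ^ l * taylor_part f l (a + c *s b))) / of_real (t n) ^ d"
    show ?thesis
    proof (rule holomorphic_uniform_sequence)
      fix n
      have "(\<lambda>c. f (of_real (t n) *s a + c *s (of_real (t n) *s b))) holomorphic_on ball 0 R"
      proof (rule line_holomorphicD[OF f])
        fix c :: complex assume c: "c \<in> ball 0 R"
        have "of_real (t n) *s a + c *s (of_real (t n) *s b) = of_real (t n) *s (a + c *s b)"
          by (simp add: vec_eq_iff algebra_simps)
        then have "norm (of_real (t n) *s a + c *s (of_real (t n) *s b)) = t n * norm (a + c *s b)"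
          using t(1)[of n] by (simp only: norm_vector_smult) simp
        also have "\<dots> \<le> t n * A" using nA[OF c] t(1)[of n] by (intro mult_left_mono) auto
        finally show "norm (of_real (t n) *s a + c *s (of_real (t n) *s b)) < 1" using t(2)[of n] by linarith
      qed
      moreover have "of_real (t n) *s a + c *s (of_real (t n) *s b) = of_real (t n) *s (a + c *s b)" for c
        by (simp add: vec_eq_iff algebra_simps)
      ultimately have "(\<lambda>c. f (of_real (t n) *s (a + c *s b))) holomorphic_on ball 0 R" by (simp only:)
      then show "?q n holomorphic_on ball 0 R"
        using t(1)[of n] less.IH by (intro holomorphic_intros) (auto intro: holomorphic_on_subset)
    next
      fix x :: complex assume x: "x \<in> ball 0 R"
      obtain e where e: "0 < e" "cball x e \<subseteq> ball 0 R" using x open_ball open_contains_cball by blast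
      have "uniform_limit (ball 0 R) ?q (\<lambda>c. taylor_part f d (a + c *s b)) sequentially"
      proof (rule uniform_limitI)
        fix \<epsilon> :: real assume \<epsilon>: "0 < \<epsilon>"
        have "(\<lambda>n. 2 * M * (A / (1/2)) ^ Suc d * t n) \<longlonglongrightarrow> 0" by (rule tendsto_mult_right_zero[OF t0])
        from order_tendstoD(2)[OF this \<epsilon>]
        show "\<forall>\<^sub>F n in sequentially. \<forall>c\<in>ball 0 R. dist (?q n c) (taylor_part f d (a + c *s b)) < \<epsilon>"
        proof eventually_elim
          case (elim n)
          show ?case
          proof
            fix c :: complex assume c: "c \<in> ball 0 R"
            have "t n * norm (a + c *s b) \<le> t n * A" using nA[OF c] t(1)[of n] by (intro mult_left_mono) auto
            also have "\<dots> \<le> 1/2 / 2" using t(2)[of n] by simp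
            finally have "dist (?q n c) (taylor_part f d (a + c *s b)) \<le> 2 * M * (norm (a + c *s b) / (1/2)) ^ Suc d * t n"
              unfolding dist_norm using t(1)[of n]
              by (intro taylor_part_remainder[OF f _ _ M(2)]) auto
            also have "\<dots> \<le> 2 * M * (A / (1/2)) ^ Suc d * t n"
              using nA[OF c] t(1)[of n] M(1) by (intro mult_right_mono mult_left_mono power_mono divide_right_mono) auto
            finally show "dist (?q n c) (taylor_part f d (a + c *s b)) < \<epsilon>" using elim by linarith
          qed
        qed
      qed
      then have "uniform_limit (cball x e) ?q (\<lambda>c. taylor_part f d (a + c *s b)) sequentially"
        using e(2) by (rule uniform_limit_on_subset)
      then show "\<exists>e>0. cball x e \<subseteq> ball 0 R \<and> uniform_limit (cball x e) ?q (\<lambda>c. taylor_part f d (a + c *s b)) sequentially"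
        using e by blast
    qed simp
  qed
  then have "(\<lambda>c. taylor_part f d (a + c *s b)) field_differentiable (at x)" for x
    by (rule holomorphic_on_imp_differentiable_at[of _ "ball 0 (norm x + 1)"]) (auto simp: add_nonneg_pos)
  then show ?case by (simp add: holomorphic_on_def)
qed

text \<open>
  The Taylor part is separately entire and bounded by a multiple of \<open>|z|\<^sup>d\<close>, hence a
  polynomial function, and it scales with degree \<open>d\<close>.
\<close>
lemma homogeneous_polynomial_taylor_part:
  assumes f: "line_holomorphic f"
  shows "homogeneous_polynomial d (taylor_part f d)"
proof (rule homogeneous_polynomial_if_scale)
  obtain M where M: "0 \<le> M" "\<And>z. norm z \<le> 1/2 \<Longrightarrow> norm (f z) \<le> M"
    using line_holomorphic_bounded[OF f, of "1/2"] by auto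
  show "polynomial_function (taylor_part f d)"
  proof (rule polynomial_function_if_separately)
    show "norm (taylor_part f d z) \<le> (M * 2 ^ d) * norm z ^ d" for z
      using taylor_part_bound[OF f _ _ M(2), where \<rho> = "1/2" and d = d and z = z] by (simp add: power_mult_distrib mult_ac)
  qed (use M taylor_part_entire[OF f] in auto)
qed (rule taylor_part_scale[OF f])

text \<open>On the slice through \<open>z\<close> both expansions are power series with the same sum.\<close>
lemma homogeneous_expansion_unique:
  fixes f :: "complex ^ 'n \<Rightarrow> complex"
  assumes F: "homogeneous_expansion f F" and G: "homogeneous_expansion f G"
  shows "F = G"
proof (intro ext)
  fix d and z :: "complex ^ 'n"
  define u where "u = 1 / (2 * (norm z + 1))"
  define t where "t = complex_of_real u"
  have pos: "0 < norm z + 1" by (simp add: add_nonneg_pos)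
  have t: "t \<noteq> 0" "norm (t *s z) < 1" 
  proof -
    have "0 < u" "u * norm z < 1" using pos by (auto simp: u_def field_simps)
    then show "t \<noteq> 0" "norm (t *s z) < 1" by (auto simp: t_def norm_vector_smult)
  qed
  have scale: "F d (c *s z) = c ^ d * F d z" "G d (c *s z) = c ^ d * G d z" for c d z
    using F G by (auto simp: homogeneous_expansion_def intro!: homogeneous_polynomial_scale)
  define a where "a n = F n (t *s z) - G n (t *s z)" for n
  have sums0: "(\<lambda>n. a n * x ^ n) sums 0" if "norm x < 1" for x
  proof -
    have "norm x * norm (t *s z) \<le> 1 * norm (t *s z)" using that by (intro mult_right_mono) auto
    then have "x *s (t *s z) \<in> ball 0 1" using t(2) by (simp add: norm_vector_smult norm_mult)
    then have "(\<lambda>n. F n (x *s (t *s z)) - G n (x *s (t *s z))) sums (f (x *s (t *s z)) - f (x *s (t *s z)))"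
      using F G by (intro sums_diff) (auto simp: homogeneous_expansion_def)
    then show ?thesis by (simp add: scale a_def algebra_simps)
  qed
  have "a m = 0" for m
  proof (rule ccontr)
    assume m: "a m \<noteq> 0"
    show False
    proof (cases "m = 0")
      case True
      have "(\<lambda>n. a n * 0 ^ n) sums a 0" by (rule powser_sums_zero)
      then show False using sums0[of 0] m True sums_unique2 by auto
    next
      case False
      show False
      proof (rule powser_0_nonzero[of 1 0 a "\<lambda>_. 0" m])
        fix s :: real assume "0 < s" and s: "\<And>x :: complex. x \<in> cball 0 s - {0} \<Longrightarrow> (0 :: complex) \<noteq> 0"
        then show False using s[of "of_real s"] by auto
      qed (use sums0 m False in auto)
    qed
  qed
  then have "t ^ d * F d z = t ^ d * G d z" by (simp add: a_def scale)
  then show "F d z = G d z" using t(1) by simp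
qed

lemma homogeneous_part_eq_taylor_part:
  assumes f: "line_holomorphic f"
  shows "homogeneous_part f = taylor_part f"
proof -
  have "homogeneous_expansion f (taylor_part f)"
    using homogeneous_polynomial_taylor_part[OF f] taylor_part_sums[OF f]
    by (auto simp: homogeneous_expansion_def)
  then show ?thesis unfolding homogeneous_part_def
    by (intro the_equality) (auto intro: homogeneous_expansion_unique)
qed

lemma summable_power_weight:
  fixes x :: "'a :: {real_normed_field, banach}"
  assumes c: "\<And>x :: 'a. norm x < K \<Longrightarrow> summable (\<lambda>d. c d * x ^ d)" and x: "norm x < K"
  shows "summable (\<lambda>d. of_nat (Suc d) ^ k * c d * x ^ d)"
  using x
proof (induction k arbitrary: x)
  case 0
  then show ?case using c by simp
next
  case (Suc k)
  let ?b = "\<lambda>n. case n of 0 \<Rightarrow> 0 | Suc d \<Rightarrow> of_nat (Suc d) ^ k * c d"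
  have "summable (\<lambda>n. ?b n * y ^ n)" if "norm y < K" for y
  proof -
    have "summable (\<lambda>d. (of_nat (Suc d) ^ k * c d * y ^ d) * y)"
      using Suc.IH[OF that] by (rule summable_mult2)
    then have "summable (\<lambda>n. ?b (Suc n) * y ^ Suc n)" by (simp add: mult_ac)
    then show ?thesis by (subst (asm) summable_Suc_iff)
  qed
  from termdiff_converges[OF Suc.prems this] show ?case by (simp add: diffs_def mult_ac)
qed

lemma IR_power_eq:
  assumes f: "line_holomorphic f"
  shows "IR_power (real k) f z = (\<Sum>d. of_nat (Suc d) ^ k * taylor_part f d z)"
proof -
  have "complex_of_real ((1 + real d) powr real k) = of_nat (Suc d) ^ k" for d
    by (simp add: powr_realpow add_pos_nonneg)
  then show ?thesis by (simp add: IR_power_def homogeneous_part_eq_taylor_part[OF f])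
qed

lemma IR_power_slice:
  assumes f: "line_holomorphic f"
  shows "IR_power (real k) f (c *s z) = (\<Sum>d. of_nat (Suc d) ^ k * taylor_part f d z * c ^ d)"
  by (simp add: IR_power_eq[OF f] taylor_part_scale[OF f] mult_ac)

text \<open>
  The function \<open>c g\<^sub>k(c z)\<close> is the sum of \<open>(d + 1)\<^sup>k f\<^sub>d(z)
  c\<^sup>d\<^sup>+\<^sup>1\<close>, and differentiation multiplies each term by \<open>d + 1\<close>.
\<close>
lemma IR_power_derivative:
  fixes f :: "complex ^ 'n \<Rightarrow> complex"
  assumes f: "line_holomorphic f" and z: "norm z \<le> 1" and c: "norm c < 1"
  shows "((\<lambda>c. c * IR_power (real k) f (c *s z)) has_field_derivative IR_power (real (Suc k)) f (c *s z)) (at c)"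
proof -
  let ?b = "\<lambda>n. case n of 0 \<Rightarrow> 0 | Suc d \<Rightarrow> of_nat (Suc d) ^ k * taylor_part f d z"
  have sm: "summable (\<lambda>d. of_nat (Suc d) ^ k * taylor_part f d z * y ^ d)" if "norm y < 1" for y
  proof (rule summable_power_weight[OF _ that])
    fix x :: complex assume "norm x < 1"
    then have "norm (x *s z) < 1"
      using z mult_left_le[of "norm z" "norm x"] by (simp add: norm_vector_smult)
    from sums_summable[OF taylor_part_sums[OF f this]]
    show "summable (\<lambda>d. taylor_part f d z * x ^ d)" by (simp add: taylor_part_scale[OF f] mult.commute)
  qed
  have sb: "summable (\<lambda>n. ?b n * y ^ n)" "(\<Sum>n. ?b n * y ^ n) = y * IR_power (real k) f (y *s z)" if "norm y < 1" for y
  proof -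
    have "summable (\<lambda>d. (of_nat (Suc d) ^ k * taylor_part f d z * y ^ d) * y)"
      using sm[OF that] by (rule summable_mult2)
    then have s: "summable (\<lambda>n. ?b (Suc n) * y ^ Suc n)" by (simp add: mult_ac)
    then show s': "summable (\<lambda>n. ?b n * y ^ n)" by (subst (asm) summable_Suc_iff)
    have "(\<Sum>n. ?b n * y ^ n) = (\<Sum>d. y * (of_nat (Suc d) ^ k * taylor_part f d z * y ^ d))"
      using suminf_split_head[OF s'] by (simp add: mult_ac)
    also have "\<dots> = y * (\<Sum>d. of_nat (Suc d) ^ k * taylor_part f d z * y ^ d)"
      by (rule suminf_mult[OF sm[OF that]])
    finally show "(\<Sum>n. ?b n * y ^ n) = y * IR_power (real k) f (y *s z)"
      by (simp add: IR_power_slice[OF f])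
  qed
  have "((\<lambda>y. \<Sum>n. ?b n * y ^ n) has_field_derivative (\<Sum>n. diffs ?b n * c ^ n)) (at c)"
    by (rule termdiffs_strong'[of 1]) (use sb c in auto)
  moreover have "(\<Sum>n. diffs ?b n * c ^ n) = IR_power (real (Suc k)) f (c *s z)"
    unfolding IR_power_slice[OF f] by (simp add: diffs_def mult_ac)
  ultimately have "((\<lambda>y. \<Sum>n. ?b n * y ^ n) has_field_derivative IR_power (real (Suc k)) f (c *s z)) (at c)" by simp
  then show ?thesis
    by (rule has_field_derivative_transform_within_open[of _ _ _ "ball 0 1"]) (use sb c in auto)
qed

lemma IR_power_uniform:
  fixes f :: "complex ^ 'n \<Rightarrow> complex"
  assumes f: "line_holomorphic f" and r: "r < 1"
  shows "uniform_limit (cball 0 r) (\<lambda>n z. \<Sum>d<n. of_nat (Suc d) ^ k * taylor_part f d z) (IR_power (real k) f) sequentially"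
proof -
  define \<rho> where "\<rho> = (1 + max r 0) / 2"
  have \<rho>: "0 < \<rho>" "\<rho> < 1" "max r 0 < \<rho>" using r by (auto simp: \<rho>_def)
  obtain M where M: "0 \<le> M" "\<And>z. norm z \<le> \<rho> \<Longrightarrow> norm (f z) \<le> M"
    using line_holomorphic_bounded[OF f \<rho>(2)] by auto
  have "uniform_limit (cball 0 r) (\<lambda>n z. \<Sum>d<n. of_nat (Suc d) ^ k * taylor_part f d z)
      (\<lambda>z. \<Sum>d. of_nat (Suc d) ^ k * taylor_part f d z) sequentially"
  proof (rule Weierstrass_m_test)
    fix d and z :: "complex ^ 'n" assume z: "z \<in> cball 0 r"
    have "norm (taylor_part f d z) \<le> M * (norm z / \<rho>) ^ d" by (rule taylor_part_bound[OF f \<rho>(1,2) M(2)])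
    also have "\<dots> \<le> M * (max r 0 / \<rho>) ^ d"
      using z M(1) \<rho> by (intro mult_left_mono power_mono divide_right_mono) auto
    finally have "real (Suc d) ^ k * norm (taylor_part f d z) \<le> real (Suc d) ^ k * (M * (max r 0 / \<rho>) ^ d)"
      by (rule mult_left_mono) simp
    then show "norm (of_nat (Suc d) ^ k * taylor_part f d z) \<le> real (Suc d) ^ k * M * (max r 0 / \<rho>) ^ d"
      by (simp add: norm_mult norm_power mult.assoc del: of_nat_Suc)
  next
    show "summable (\<lambda>d. real (Suc d) ^ k * M * (max r 0 / \<rho>) ^ d)"
      by (rule summable_power_weight[of 1]) (use \<rho> in \<open>auto intro!: summable_mult summable_geometric\<close>)
  qed
  then show ?thesis unfolding IR_power_eq[OF f] .
qed

text \<open>The partial sums are polynomials and converge locally uniformly.\<close>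
lemma IR_power_line_holomorphic:
  fixes f :: "complex ^ 'n \<Rightarrow> complex"
  assumes f: "line_holomorphic f"
  shows "line_holomorphic (IR_power (real k) f)"
  unfolding line_holomorphic_def
proof (intro conjI allI)
  let ?S = "\<lambda>n z. \<Sum>d<n. of_nat (Suc d) ^ k * taylor_part f d z"
  have cont: "continuous_on (cball 0 r) (IR_power (real k) f)" if "r < 1" for r
  proof (rule uniform_limit_theorem[OF _ IR_power_uniform[OF f that]])
    show "\<forall>\<^sub>F n in sequentially. continuous_on (cball 0 r) (?S n)"
      by (intro always_eventually allI continuous_intros
          continuous_on_homogeneous_polynomial[OF homogeneous_polynomial_taylor_part[OF f]])
  qed simp
  show "continuous_on (ball 0 1) (IR_power (real k) f)"
  proof (rule continuous_at_imp_continuous_on, rule ballI)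
    fix z :: "complex ^ 'n" assume z: "z \<in> ball 0 1"
    define r where "r = (norm z + 1) / 2"
    have "r < 1" "z \<in> interior (cball 0 r)" using z by (auto simp: r_def)
    then show "isCont (IR_power (real k) f) z" using cont continuous_on_interior by blast
  qed
  fix a b :: "complex ^ 'n"
  let ?T = "{c. a + c *s b \<in> ball 0 1}"
  have contl: "continuous_on UNIV (\<lambda>c. a + c *s b)" by (intro continuous_intros)
  show "(\<lambda>c. IR_power (real k) f (a + c *s b)) holomorphic_on ?T"
  proof (rule holomorphic_uniform_sequence)
    have "open ((\<lambda>c. a + c *s b) -` ball 0 1)" using contl by (intro open_vimage) auto
    then show "open ?T" by (simp add: vimage_def)
    show "(\<lambda>c. ?S n (a + c *s b)) holomorphic_on ?T" for n
      by (intro holomorphic_intros homogeneous_polynomial_line_holomorphic[OF homogeneous_polynomial_taylor_part[OF f]])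
    fix x assume x: "x \<in> ?T"
    define r where "r = (norm (a + x *s b) + 1) / 2"
    have r: "r < 1" "norm (a + x *s b) < r" using x by (auto simp: r_def)
    have "open ((\<lambda>c. a + c *s b) -` ball 0 r)" using contl by (intro open_vimage) auto
    moreover have "x \<in> (\<lambda>c. a + c *s b) -` ball 0 r" using r by simp
    ultimately obtain e where e: "0 < e" "cball x e \<subseteq> (\<lambda>c. a + c *s b) -` ball 0 r"
      using open_contains_cball by blast
    have "uniform_limit ((\<lambda>c. a + c *s b) ` cball x e) ?S (IR_power (real k) f) sequentially"
      by (rule uniform_limit_on_subset[OF IR_power_uniform[OF f r(1)]]) (use e in fastforce)
    then have "uniform_limit (cball x e) (\<lambda>n c. ?S n (a + c *s b)) (\<lambda>c. IR_power (real k) f (a + c *s b)) sequentially"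
      by (auto simp: uniform_limit_iff elim!: eventually_mono)
    then show "\<exists>e>0. cball x e \<subseteq> ?T \<and> uniform_limit (cball x e) (\<lambda>n c. ?S n (a + c *s b)) (\<lambda>c. IR_power (real k) f (a + c *s b)) sequentially"
      using e r by (intro exI[of _ e]) (auto simp: subset_eq)
  qed
qed

section \<open>Hermitian geometry of the ball\<close>

lemma hermitian_cnj: "hermitian w z = cnj (hermitian z w)"
  by (simp add: hermitian_def mult.commute)

lemma hermitian_add_left: "hermitian (x + y) z = hermitian x z + hermitian y z"
  by (simp add: hermitian_def sum.distrib algebra_simps)

lemma hermitian_diff_left: "hermitian (x - y) z = hermitian x z - hermitian y z"
  by (simp add: hermitian_def sum_subtractf algebra_simps)

lemma hermitian_smult_left: "hermitian (c *s x) z = c * hermitian x z"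
  by (simp add: hermitian_def sum_distrib_left mult.assoc)

lemma hermitian_smult_right: "hermitian x (c *s z) = cnj c * hermitian x z"
  by (simp add: hermitian_def sum_distrib_left mult_ac)

lemma hermitian_diff_right: "hermitian x (y - z) = hermitian x y - hermitian x z"
  by (simp add: hermitian_def sum_subtractf algebra_simps)

lemma hermitian_scaleR_left: "hermitian (r *\<^sub>R x) z = of_real r * hermitian x z"
  by (simp add: scaleR_eq_vector_smult hermitian_smult_left)

lemma norm_square_vec: "(norm (z :: complex ^ 'n))\<^sup>2 = (\<Sum>i\<in>UNIV. (norm (z $ i))\<^sup>2)"
  by (simp add: norm_vec_def L2_set_def sum_nonneg)

lemma hermitian_self: "hermitian z z = of_real ((norm z)\<^sup>2)"
  unfolding norm_square_vec hermitian_def by (simp only: of_real_sum complex_norm_square)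

lemma hermitian_Cauchy_Schwarz: "norm (hermitian a b) \<le> norm a * norm b"
proof -
  have "norm (hermitian a b) \<le> (\<Sum>i\<in>UNIV. \<bar>norm (a $ i)\<bar> * \<bar>norm (b $ i)\<bar>)"
    unfolding hermitian_def by (rule order_trans[OF norm_sum]) (simp add: norm_mult)
  also have "\<dots> \<le> norm a * norm b" unfolding norm_vec_def by (rule L2_set_mult_ineq)
  finally show ?thesis .
qed

lemma continuous_on_hermitian [continuous_intros]:
  "continuous_on S f \<Longrightarrow> continuous_on S g \<Longrightarrow> continuous_on S (\<lambda>x. hermitian (f x) (g x))"
  unfolding hermitian_def by (intro continuous_intros)

lemma borel_measurable_hermitian [measurable (raw)]:
  assumes "f \<in> borel_measurable M" "g \<in> borel_measurable M"
  shows "(\<lambda>x. hermitian (f x) (g x)) \<in> borel_measurable M"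
proof -
  have "(\<lambda>p. hermitian (fst p) (snd p)) \<in> borel_measurable borel"
    by (intro borel_measurable_continuous_onI continuous_intros)
  from measurable_compose[OF borel_measurable_Pair[OF assms] this] show ?thesis by simp
qed

text \<open>The component orthogonal to the complex line of the unit vector \<open>\<zeta>\<close>.\<close>
definition orth_part :: "complex ^ 'n \<Rightarrow> complex ^ 'n \<Rightarrow> complex ^ 'n" where
  "orth_part \<zeta> z = z - hermitian z \<zeta> *s \<zeta>"

lemma orth_part_hermitian: "norm \<zeta> = 1 \<Longrightarrow> hermitian (orth_part \<zeta> z) \<zeta> = 0"
  by (simp add: orth_part_def hermitian_diff_left hermitian_smult_left hermitian_self)

lemma orth_part_pythagoras:
  assumes "norm \<zeta> = 1"
  shows "(norm z)\<^sup>2 = (norm (hermitian z \<zeta>))\<^sup>2 + (norm (orth_part \<zeta> z))\<^sup>2"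
proof -
  let ?h = "hermitian z \<zeta>"
  have "hermitian (orth_part \<zeta> z) (orth_part \<zeta> z) = hermitian (orth_part \<zeta> z) z"
    using orth_part_hermitian[OF assms, of z]
    by (subst (2) orth_part_def) (simp add: hermitian_diff_right hermitian_smult_right)
  also have "\<dots> = hermitian z z - ?h * cnj ?h"
    by (simp add: orth_part_def hermitian_diff_left hermitian_smult_left hermitian_cnj[of \<zeta> z])
  finally have "complex_of_real ((norm (orth_part \<zeta> z))\<^sup>2) = of_real ((norm z)\<^sup>2 - (norm ?h)\<^sup>2)"
    by (simp only: hermitian_self complex_norm_square[symmetric] of_real_diff of_real_power)
  then have "(norm (orth_part \<zeta> z))\<^sup>2 = (norm z)\<^sup>2 - (norm ?h)\<^sup>2" by (simp only: of_real_eq_iff)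
  then show ?thesis by simp
qed

lemma hermitian_split:
  assumes "norm \<zeta> = 1"
  shows "hermitian a b = hermitian a \<zeta> * hermitian \<zeta> b + hermitian (orth_part \<zeta> a) (orth_part \<zeta> b)"
proof -
  have "hermitian (orth_part \<zeta> a) (orth_part \<zeta> b) = hermitian (orth_part \<zeta> a) b"
    using orth_part_hermitian[OF assms, of a]
    by (subst (2) orth_part_def) (simp add: hermitian_diff_right hermitian_smult_right)
  also have "\<dots> = hermitian a b - hermitian a \<zeta> * hermitian \<zeta> b"
    by (simp add: orth_part_def hermitian_diff_left hermitian_smult_left)
  finally show ?thesis by simp
qed

lemma orth_part_small:
  assumes "norm \<zeta> = 1" "norm z \<le> 1"
  shows "(norm (orth_part \<zeta> z))\<^sup>2 \<le> 2 * norm (1 - hermitian z \<zeta>)"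
proof -
  let ?x = "norm (hermitian z \<zeta>)"
  have x1: "?x \<le> 1" using hermitian_Cauchy_Schwarz[of z \<zeta>] assms by simp
  have "(norm z)\<^sup>2 \<le> 1" using assms by (simp add: power_le_one)
  then have "(norm (orth_part \<zeta> z))\<^sup>2 \<le> 1 - ?x\<^sup>2" using orth_part_pythagoras[OF assms(1), of z] by linarith
  also have "\<dots> = (1 + ?x) * (1 - ?x)" by (simp add: power2_eq_square algebra_simps)
  also have "\<dots> \<le> 2 * (1 - ?x)" using x1 by (intro mult_right_mono) auto
  also have "1 - ?x \<le> norm (1 - hermitian z \<zeta>)" using norm_triangle_ineq2[of 1 "hermitian z \<zeta>"] by simp
  finally show ?thesis by simp
qed

text \<open>
  Splitting off the components along \<open>c\<close> gives \<open>1 - ab = (1 - ac) + ac (1 - cb) -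
  a'b'\<close>, with products hermitian and \<open>a', b'\<close> orthogonal to \<open>c\<close>. The
  squares of \<open>|a'|\<close> and \<open>|b'|\<close> are at most \<open>2 |1 - ac|\<close> and \<open>2
  |1 - cb|\<close>.
\<close>
lemma nonisotropic_triangle:
  assumes "norm a \<le> 1" "norm b \<le> 1" "norm c = 1"
  shows "norm (1 - hermitian a b) \<le> 2 * (norm (1 - hermitian a c) + norm (1 - hermitian c b))"
proof -
  let ?x = "norm (1 - hermitian a c)" and ?y = "norm (1 - hermitian c b)"
  have y: "norm (1 - hermitian b c) = ?y"
  proof -
    have "1 - hermitian b c = cnj (1 - hermitian c b)" by (simp add: hermitian_cnj[of b c])
    then show ?thesis by (simp only: complex_mod_cnj)
  qed
  have ac: "norm (hermitian a c) \<le> 1" using hermitian_Cauchy_Schwarz[of a c] assms by simp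
  have "1 - hermitian a b = (1 - hermitian a c) + hermitian a c * (1 - hermitian c b) - hermitian (orth_part c a) (orth_part c b)"
    using hermitian_split[OF assms(3), of a b] by (simp add: algebra_simps)
  then have "norm (1 - hermitian a b) \<le> norm ((1 - hermitian a c) + hermitian a c * (1 - hermitian c b))
     + norm (hermitian (orth_part c a) (orth_part c b))"
    by (simp only: norm_triangle_ineq4)
  also have "norm ((1 - hermitian a c) + hermitian a c * (1 - hermitian c b)) \<le> ?x + norm (hermitian a c) * ?y"
    by (rule order_trans[OF norm_triangle_ineq]) (simp add: norm_mult)
  also have "norm (hermitian a c) * ?y \<le> ?y" using mult_right_mono[OF ac, of ?y] by simp
  also have "norm (hermitian (orth_part c a) (orth_part c b)) \<le> norm (orth_part c a) * norm (orth_part c b)"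
    by (rule hermitian_Cauchy_Schwarz)
  also have "\<dots> \<le> ((norm (orth_part c a))\<^sup>2 + (norm (orth_part c b))\<^sup>2) / 2"
    using sum_squares_bound[of "norm (orth_part c a)" "norm (orth_part c b)"] by simp
  also have "\<dots> \<le> ?x + ?y"
    using orth_part_small[OF assms(3,1)] orth_part_small[OF assms(3,2)] y by simp
  finally show ?thesis by simp
qed

section \<open>Linear maps and Lebesgue measure\<close>

lemma nn_integral_lborel_translate:
  fixes F :: "'a::euclidean_space \<Rightarrow> ennreal"
  assumes [measurable]: "F \<in> borel_measurable borel"
  shows "(\<integral>\<^sup>+x. F (t + x) \<partial>lborel) = (\<integral>\<^sup>+x. F x \<partial>lborel)"
proof -
  have "(\<integral>\<^sup>+x. F x \<partial>lborel) = (\<integral>\<^sup>+x. F x \<partial>distr lborel borel ((+) t))" by (simp add: lborel_distr_plus)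
  also have "\<dots> = (\<integral>\<^sup>+x. F (t + x) \<partial>lborel)" by (rule nn_integral_distr) auto
  finally show ?thesis by simp
qed

lemma nn_integral_lborel_scale:
  fixes F :: "'a::euclidean_space \<Rightarrow> ennreal"
  assumes [measurable]: "F \<in> borel_measurable borel" and c: "c \<noteq> 0"
  shows "(\<integral>\<^sup>+x. F x \<partial>lborel) = ennreal (\<bar>c\<bar> ^ DIM('a)) * (\<integral>\<^sup>+x. F (c *\<^sub>R x) \<partial>lborel)"
  by (subst lborel_affine[OF c, of 0]) (simp add: nn_integral_density nn_integral_distr nn_integral_cmult)

lemma nn_integral_lborel_reflect:
  fixes F :: "'a::euclidean_space \<Rightarrow> ennreal"
  assumes [measurable]: "F \<in> borel_measurable borel"
  shows "(\<integral>\<^sup>+x. F (t - x) \<partial>lborel) = (\<integral>\<^sup>+x. F x \<partial>lborel)"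
proof -
  have "(\<integral>\<^sup>+x. F (t - x) \<partial>lborel) = (\<integral>\<^sup>+x. F (t + - x) \<partial>lborel)" by simp
  also have "\<dots> = (\<integral>\<^sup>+x. F (t + x) \<partial>lborel)"
    using nn_integral_lborel_scale[of "\<lambda>x. F (t + x)" "-1"] by simp
  also have "\<dots> = (\<integral>\<^sup>+x. F x \<partial>lborel)" by (rule nn_integral_lborel_translate) simp
  finally show ?thesis .
qed

text \<open>
  The uniqueness argument for Haar measure, for the image of Lebesgue measure under a linear bijection:
  shear the product of \<open>A\<close> and the preimage of \<open>B\<close> by translations, and exchange
  the order of integration.
\<close>
lemma lborel_linear_image_ratio:
  fixes T S :: "'a::euclidean_space \<Rightarrow> 'a"
  assumes T: "linear T" and S: "linear S" and TS: "\<And>x. T (S x) = x"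
    and A: "A \<in> sets borel" and B: "B \<in> sets borel"
  shows "emeasure lborel A * emeasure lborel (T -` B) = emeasure lborel (T -` A) * emeasure lborel B"
proof -
  have [measurable]: "T \<in> borel_measurable borel" "S \<in> borel_measurable borel"
    using T S by (auto intro!: borel_measurable_continuous_onI linear_continuous_on linear_conv_bounded_linear[THEN iffD1])
  note [measurable] = A B
  have Tadd: "T (x + y) = T x + T y" for x y using T by (simp add: linear_add)
  have em: "emeasure lborel (T -` C) = (\<integral>\<^sup>+y. indicator C (T y) \<partial>lborel)" if "C \<in> sets borel" for C
  proof -
    have "T -` C \<in> sets borel" using that measurable_sets[of T borel borel C] by simp
    moreover have "(\<integral>\<^sup>+y. indicator C (T y) \<partial>lborel) = (\<integral>\<^sup>+y. indicator (T -` C) y \<partial>lborel)"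
      by (intro nn_integral_cong) (auto simp: indicator_def)
    ultimately show ?thesis by simp
  qed
  have "emeasure lborel A * emeasure lborel (T -` B) = (\<integral>\<^sup>+x. indicator A x \<partial>lborel) * (\<integral>\<^sup>+y. indicator B (T y) \<partial>lborel)"
    by (simp add: em)
  also have "\<dots> = (\<integral>\<^sup>+y. (\<integral>\<^sup>+x. indicator A x \<partial>lborel) * indicator B (T y) \<partial>lborel)"
    by (simp add: nn_integral_cmult)
  also have "\<dots> = (\<integral>\<^sup>+y. (\<integral>\<^sup>+x. indicator A (T y + x) * indicator B (T y) \<partial>lborel) \<partial>lborel)"
    by (simp add: nn_integral_multc nn_integral_lborel_translate[of "indicator A"])
  also have "\<dots> = (\<integral>\<^sup>+x. (\<integral>\<^sup>+y. indicator A (T y + x) * indicator B (T y) \<partial>lborel) \<partial>lborel)"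
    by (rule lborel_pair.Fubini'[symmetric]) measurable
  also have "\<dots> = (\<integral>\<^sup>+x. (\<integral>\<^sup>+y. indicator A (T y) * indicator B (T y - x) \<partial>lborel) \<partial>lborel)"
  proof (rule nn_integral_cong)
    fix x
    have "(\<integral>\<^sup>+y. indicator A (T y + x) * indicator B (T y) \<partial>lborel)
        = (\<integral>\<^sup>+y. (\<lambda>y. indicator A (T y) * indicator B (T y - x) :: ennreal) (S x + y) \<partial>lborel)"
      by (simp add: Tadd TS add.commute)
    also have "\<dots> = (\<integral>\<^sup>+y. indicator A (T y) * indicator B (T y - x) \<partial>lborel)"
      by (rule nn_integral_lborel_translate) measurable
    finally show "(\<integral>\<^sup>+y. indicator A (T y + x) * indicator B (T y) \<partial>lborel) = (\<integral>\<^sup>+y. indicator A (T y) * indicator B (T y - x) \<partial>lborel)" .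
  qed
  also have "\<dots> = (\<integral>\<^sup>+y. (\<integral>\<^sup>+x. indicator A (T y) * indicator B (T y - x) \<partial>lborel) \<partial>lborel)"
    by (rule lborel_pair.Fubini') measurable
  also have "\<dots> = (\<integral>\<^sup>+y. indicator A (T y) * (\<integral>\<^sup>+x. indicator B x \<partial>lborel) \<partial>lborel)"
    by (simp add: nn_integral_cmult nn_integral_lborel_reflect[of "indicator B"])
  also have "\<dots> = emeasure lborel (T -` A) * emeasure lborel B"
    by (simp add: nn_integral_multc em)
  finally show ?thesis .
qed

lemma emeasure_lborel_ball_pos_fin:
  fixes x :: "'a::euclidean_space"
  assumes "0 < r" shows "emeasure lborel (ball x r) \<noteq> 0" "emeasure lborel (ball x r) \<noteq> top"
proof -
  show "emeasure lborel (ball x r) \<noteq> top"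
    using emeasure_bounded_finite[of "ball x r"] by simp
  have "0 < measure lebesgue (ball x r)" using assms by (simp add: content_ball_pos)
  then show "emeasure lborel (ball x r) \<noteq> 0" by (auto simp: measure_def)
qed

text \<open>
  The ratio of the two measures is a constant, which is 1 because a linear isometry preserves the unit
  ball.
\<close>
lemma distr_lborel_isometry:
  fixes T S :: "'a::euclidean_space \<Rightarrow> 'a"
  assumes T: "linear T" and S: "linear S" and TS: "\<And>x. T (S x) = x" and iso: "\<And>x. norm (T x) = norm x"
  shows "distr lborel borel T = lborel"
proof (rule measure_eqI)
  fix A assume A: "A \<in> sets (distr lborel borel T)"
  have [measurable]: "T \<in> borel_measurable borel"
    using T by (auto intro!: borel_measurable_continuous_onI linear_continuous_on linear_conv_bounded_linear[THEN iffD1])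
  have "T -` ball 0 1 = ball 0 1" using iso by auto
  then have "emeasure lborel A * emeasure lborel (ball (0::'a) 1) = emeasure lborel (T -` A) * emeasure lborel (ball (0::'a) 1)"
    using lborel_linear_image_ratio[OF T S TS, of A "ball 0 1"] A by simp
  then have "emeasure lborel (ball (0::'a) 1) * emeasure lborel (T -` A) = emeasure lborel (ball (0::'a) 1) * emeasure lborel A"
    by (simp add: mult.commute)
  then have "emeasure lborel (T -` A) = emeasure lborel A"
    by (intro antisym; subst ennreal_mult_le_mult_iff[symmetric, of "emeasure lborel (ball (0::'a) 1)"])
       (simp_all add: emeasure_lborel_ball_pos_fin)
  then show "emeasure (distr lborel borel T) A = emeasure lborel A" using A by (simp add: emeasure_distr)
qed simp

lemma linear_vector_smult: "linear (\<lambda>x. c *s (x :: complex ^ 'n))"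
  by (rule linearI) (simp_all add: vec_eq_iff algebra_simps scaleR_conv_of_real)

lemma nn_integral_lborel_rotate:
  fixes F :: "complex ^ 'n \<Rightarrow> ennreal"
  assumes [measurable]: "F \<in> borel_measurable borel" and c: "norm c = 1"
  shows "(\<integral>\<^sup>+x. F (c *s x) \<partial>lborel) = (\<integral>\<^sup>+x. F x \<partial>lborel)"
proof -
  have c0: "c \<noteq> 0" using c by auto
  have [measurable]: "(\<lambda>x. c *s (x :: complex ^ 'n)) \<in> borel_measurable borel"
    by (intro borel_measurable_continuous_onI linear_continuous_on linear_conv_bounded_linear[THEN iffD1] linear_vector_smult)
  have "distr lborel borel (\<lambda>x. c *s (x :: complex ^ 'n)) = lborel"
    by (rule distr_lborel_isometry[OF linear_vector_smult linear_vector_smult[of "inverse c"]])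
       (use c c0 in \<open>auto simp: norm_vector_smult\<close>)
  then have "(\<integral>\<^sup>+x. F x \<partial>lborel) = (\<integral>\<^sup>+x. F x \<partial>distr lborel borel (\<lambda>x. c *s x))" by simp
  also have "\<dots> = (\<integral>\<^sup>+x. F (c *s x) \<partial>lborel)" by (rule nn_integral_distr) measurable
  finally show ?thesis by simp
qed

text \<open>
  A rotation of the coordinate vector makes its product with \<open>\<zeta>\<close> real and nonnegative;
  the Householder reflection in the difference then exchanges the two vectors.
\<close>
lemma unitary_to_axis:
  fixes \<zeta> :: "complex ^ 'n"
  assumes \<zeta>: "norm \<zeta> = 1"
  obtains U V :: "complex ^ 'n \<Rightarrow> complex ^ 'n" where
    "\<And>x y. U (x + y) = U x + U y" "\<And>c x. U (c *s x) = c *s U x" "linear V"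
    "\<And>x. U (V x) = x" "\<And>x. norm (U x) = norm x"
    "\<And>x y. hermitian (U x) (U y) = hermitian x y" "U (axis j 1) = \<zeta>"
proof -
  define e where "e = (axis j 1 :: complex ^ 'n)"
  define \<rho> where "\<rho> = norm (\<zeta> $ j)"
  define c where "c = (if \<zeta> $ j = 0 then 1 else \<zeta> $ j / of_real \<rho>)"
  have c: "norm c = 1" by (simp add: c_def \<rho>_def norm_divide)
  have c\<rho>: "\<zeta> $ j = c * of_real \<rho>" by (simp add: c_def \<rho>_def)
  have ne: "norm e = 1" by (simp add: e_def norm_axis_one)
  have cc: "c * cnj c = 1" using c by (simp add: complex_norm_square[symmetric])
  have cc': "c * (cnj c * x) = x" "cnj c * (c * x) = x" for x
    using cc by (simp_all add: mult.assoc[symmetric] mult.commute[of "cnj c" c])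
  have nce: "norm (c *s e) = 1" by (simp add: norm_vector_smult c ne)
  have he: "hermitian e x = cnj (x $ j)" for x
    unfolding hermitian_def e_def by (subst sum.remove[of _ j]) (auto simp: axis_def intro: sum.neutral)
  define v where "v = \<zeta> - c *s e"
  have hcv: "hermitian (c *s e) v = of_real \<rho> - 1"
    by (simp add: cc' nce v_def hermitian_diff_right hermitian_smult_left hermitian_smult_right hermitian_self he[of \<zeta>] c\<rho>)
  have hz: "hermitian \<zeta> (c *s e) = of_real \<rho>"
    by (simp add: cc' hermitian_smult_right hermitian_cnj[of \<zeta> e] he c\<rho>)
  have nv: "of_real ((norm v)\<^sup>2) = (2 - 2 * of_real \<rho> :: complex)"
  proof -
    have "hermitian v v = hermitian \<zeta> v - hermitian (c *s e) v" by (subst v_def) (rule hermitian_diff_left)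
    also have "hermitian \<zeta> v = 1 - of_real \<rho>" by (simp add: v_def hermitian_diff_right hermitian_self \<zeta> hz)
    finally show ?thesis by (simp add: hermitian_self hcv)
  qed
  define H where "H z = z - (2 * hermitian z v / of_real ((norm v)\<^sup>2)) *s v" for z
  have H_add: "H (x + y) = H x + H y" for x y
    by (simp add: H_def hermitian_add_left vec_eq_iff algebra_simps add_divide_distrib)
  have H_smult: "H (a *s x) = a *s H x" for a x
    by (simp add: H_def hermitian_smult_left vec_eq_iff algebra_simps)
  have HH: "H (H x) = x" for x
  proof (cases "v = 0")
    case False
    then have "hermitian (H x) v = - hermitian x v"
      by (simp add: H_def hermitian_diff_left hermitian_smult_left hermitian_self)
    then show ?thesis by (subst H_def) (simp add: H_def vec_eq_iff)
  qed (simp add: H_def)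
  have H_self_adj: "hermitian (H x) y = hermitian x (H y)" for x y
    by (simp add: H_def hermitian_diff_left hermitian_diff_right hermitian_smult_left hermitian_smult_right hermitian_cnj[of v y])
  have H_norm: "norm (H x) = norm x" for x
  proof -
    have "complex_of_real ((norm (H x))\<^sup>2) = of_real ((norm x)\<^sup>2)"
      unfolding hermitian_self[symmetric] by (simp add: H_self_adj HH)
    then have "(norm (H x))\<^sup>2 = (norm x)\<^sup>2" by (simp only: of_real_eq_iff)
    then show ?thesis by simp
  qed
  have H_ce: "H (c *s e) = \<zeta>"
  proof (cases "v = 0")
    case True
    then show ?thesis by (simp add: H_def) (simp add: v_def)
  next
    case False
    then have "of_real ((norm v)\<^sup>2) \<noteq> (0::complex)" by simp
    then have "2 * hermitian (c *s e) v / of_real ((norm v)\<^sup>2) = -1"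
      unfolding nv hcv by (simp add: field_simps)
    then have "H (c *s e) = c *s e + v" by (simp only: H_def) simp
    then show ?thesis by (simp add: v_def)
  qed
  show ?thesis
  proof (rule that[of "\<lambda>x. H (c *s x)" "\<lambda>x. cnj c *s H x"])
    show "linear (\<lambda>x. cnj c *s H x)"
      by (rule linearI)
         (simp_all add: H_add scaleR_eq_vector_smult H_smult vec_eq_iff algebra_simps)
    show "H (c *s (cnj c *s H x)) = x" for x using cc by (simp add: HH)
    show "norm (H (c *s x)) = norm x" for x by (simp add: H_norm norm_vector_smult c)
    show "H (c *s (a *s x)) = a *s H (c *s x)" for a x by (simp add: H_smult[symmetric] mult.commute)
    show "hermitian (H (c *s x)) (H (c *s y)) = hermitian x y" for x y
      by (simp add: H_self_adj HH hermitian_smult_left hermitian_smult_right cc')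
  qed (use H_ce in \<open>auto simp: H_add vector_add_ldistrib e_def\<close>)
qed

text \<open>
  The linear map with dilation \<open>\<delta>\<close> along the complex line of \<open>\<zeta>\<close> and
  \<open>\<tau>\<close> orthogonally to it, after moving the coordinate vector to \<open>\<zeta>\<close> by
  a unitary map.
\<close>
lemma ellipsoid_map:
  fixes \<zeta> :: "complex ^ 'n"
  assumes \<zeta>: "norm \<zeta> = 1" and pos: "0 < \<delta>" "0 < \<tau>"
  obtains L :: "complex ^ 'n \<Rightarrow> complex ^ 'n" where
    "\<And>x y. L (x + y) = L x + L y" "\<And>c x. L (c *s x) = c *s L x"
    "\<And>x. hermitian (L x) \<zeta> = of_real \<delta> * x $ j"
    "\<And>x. norm (orth_part \<zeta> (L x)) = \<tau> * norm (x - (x $ j) *s axis j 1)"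
    "\<And>F. F \<in> borel_measurable borel \<Longrightarrow> (\<integral>\<^sup>+x. F x \<partial>lborel)
       = ennreal (\<delta>\<^sup>2 * \<tau> ^ (2 * CARD('n) - 2)) * (\<integral>\<^sup>+x. F (L x) \<partial>lborel)"
proof -
  obtain U V :: "complex ^ 'n \<Rightarrow> complex ^ 'n" where
    U: "\<And>x y. U (x + y) = U x + U y" "\<And>c x. U (c *s x) = c *s U x" and V: "linear V"
    and UV: "\<And>x. U (V x) = x" and iso: "\<And>x. norm (U x) = norm x"
    and Uh: "\<And>x y. hermitian (U x) (U y) = hermitian x y" and Ue: "U (axis j 1) = \<zeta>"
    by (rule unitary_to_axis[OF \<zeta>, of j]) (rule that)
  have linU: "linear U" by (rule linearI) (simp_all add: U scaleR_eq_vector_smult)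
  let ?e = "axis j 1 :: complex ^ 'n"
  define D where "D x = of_real \<tau> *s x + (of_real (\<delta> - \<tau>) * x $ j) *s ?e" for x
  define k where "k b = (if b \<in> {axis j 1, axis j \<i>} then \<delta> else \<tau>)" for b :: "complex ^ 'n"
  have D_add: "D (x + y) = D x + D y" for x y by (simp add: D_def vec_eq_iff algebra_simps)
  have D_smult: "D (c *s x) = c *s D x" for c x by (simp add: D_def vec_eq_iff algebra_simps)
  have D_eq: "D x = 0 + (\<Sum>b\<in>Basis. (k b * (x \<bullet> b)) *\<^sub>R b)" for x
  proof (rule euclidean_eqI)
    fix b :: "complex ^ 'n" assume b: "b \<in> Basis"
    then obtain i u where iu: "b = axis i u" "u \<in> {1, \<i>}" by (auto simp: Basis_vec_def Basis_complex_def)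
    have kb: "k b = (if i = j then \<delta> else \<tau>)" using iu by (auto simp: k_def axis_eq_axis)
    have "D x $ i = of_real (k b) * x $ i" by (simp add: kb D_def axis_def algebra_simps)
    then have "D x $ i = k b *\<^sub>R (x $ i)" by (simp only: scaleR_conv_of_real)
    then have "D x \<bullet> b = k b * (x \<bullet> b)" unfolding iu(1) by (simp add: inner_axis)
    then show "D x \<bullet> b = (0 + (\<Sum>b\<in>Basis. (k b * (x \<bullet> b)) *\<^sub>R b)) \<bullet> b"
      using b by (simp add: inner_sum_left_Basis)
  qed
  have k0: "k b \<noteq> 0" for b using pos by (auto simp: k_def)
  have prodk: "(\<Prod>b\<in>Basis. \<bar>k b\<bar>) = \<delta>\<^sup>2 * \<tau> ^ (2 * CARD('n) - 2)"
  proof -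
    let ?A = "{axis j 1, axis j \<i>} :: (complex ^ 'n) set"
    have A: "?A \<subseteq> Basis" by (auto simp: Basis_vec_def Basis_complex_def)
    have cA: "card ?A = 2" by (simp add: axis_eq_axis complex_eq_iff)
    have "(\<Prod>b\<in>Basis. \<bar>k b\<bar>) = (\<Prod>b\<in>?A. \<bar>k b\<bar>) * (\<Prod>b\<in>Basis - ?A. \<bar>k b\<bar>)"
      using A by (subst prod.subset_diff[of ?A]) (auto simp: mult.commute)
    also have "(\<Prod>b\<in>?A. \<bar>k b\<bar>) = (\<Prod>b\<in>?A. \<delta>)" using pos by (intro prod.cong) (auto simp: k_def)
    also have "(\<Prod>b\<in>Basis - ?A. \<bar>k b\<bar>) = (\<Prod>b\<in>Basis - ?A. \<tau>)" using pos by (intro prod.cong) (auto simp: k_def)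
    finally have eq: "(\<Prod>b\<in>Basis. \<bar>k b\<bar>) = (\<Prod>b\<in>?A. \<delta>) * (\<Prod>b\<in>Basis - ?A. \<tau>)" .
    have "card (Basis - ?A :: (complex ^ 'n) set) = 2 * CARD('n) - 2"
      using A cA by (subst card_Diff_subset) auto
    then show ?thesis unfolding eq prod_constant cA by simp
  qed
  have [measurable]: "U \<in> borel_measurable borel"
    by (intro borel_measurable_continuous_onI linear_continuous_on linear_conv_bounded_linear[THEN iffD1] linU)
  have linD: "linear D" by (rule linearI) (simp_all add: D_add D_smult scaleR_eq_vector_smult)
  have [measurable]: "D \<in> borel_measurable borel"
    by (intro borel_measurable_continuous_onI linear_continuous_on linear_conv_bounded_linear[THEN iffD1] linD)
  have hU: "hermitian (U x) \<zeta> = x $ j" for x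
  proof -
    have "hermitian x ?e = x $ j"
      unfolding hermitian_def by (subst sum.remove[of _ j]) (auto simp: axis_def intro: sum.neutral)
    then show ?thesis using Uh[of x ?e] by (simp add: Ue)
  qed
  show ?thesis
  proof (rule that[of "\<lambda>x. U (D x)"])
    show "hermitian (U (D x)) \<zeta> = of_real \<delta> * x $ j" for x
      by (simp add: hU D_def algebra_simps)
    show "norm (orth_part \<zeta> (U (D x))) = \<tau> * norm (x - (x $ j) *s axis j 1)" for x
    proof -
      have "orth_part \<zeta> (U (D x)) = U (D x) - (D x $ j) *s U ?e" by (simp add: orth_part_def hU Ue)
      also have "\<dots> = U (D x - (D x $ j) *s ?e)"
        using linU by (simp add: linear_diff U(2)[symmetric])
      also have "D x - (D x $ j) *s ?e = of_real \<tau> *s (x - (x $ j) *s ?e)"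
        by (simp add: D_def vec_eq_iff algebra_simps)
      finally show ?thesis using pos by (simp only: iso norm_vector_smult) simp
    qed
    fix F :: "complex ^ 'n \<Rightarrow> ennreal" assume [measurable]: "F \<in> borel_measurable borel"
    have "(\<integral>\<^sup>+x. F x \<partial>lborel) = (\<integral>\<^sup>+x. F x \<partial>distr lborel borel U)"
      by (simp add: distr_lborel_isometry[OF linU V UV iso])
    also have "\<dots> = (\<integral>\<^sup>+x. F (U x) \<partial>lborel)" by (rule nn_integral_distr) measurable
    also have "\<dots> = (\<integral>\<^sup>+x. F (U x) \<partial>density (distr lborel borel D) (\<lambda>_. \<Prod>b\<in>Basis. \<bar>k b\<bar>))"
    proof (rule arg_cong[where f = "\<lambda>M. \<integral>\<^sup>+x. F (U x) \<partial>M"])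
      have "(\<lambda>x. 0 + (\<Sum>b\<in>Basis. (k b * (x \<bullet> b)) *\<^sub>R b)) = D" using D_eq by auto
      with lborel_affine_euclidean[of k 0] k0
      show "lborel = density (distr lborel borel D) (\<lambda>_. \<Prod>b\<in>Basis. \<bar>k b\<bar>)" by (simp only: not_False_eq_True simp_thms)
    qed
    also have "\<dots> = ennreal (\<Prod>b\<in>Basis. \<bar>k b\<bar>) * (\<integral>\<^sup>+x. F (U (D x)) \<partial>lborel)"
      by (simp add: nn_integral_density nn_integral_distr nn_integral_cmult)
    finally show "(\<integral>\<^sup>+x. F x \<partial>lborel) = ennreal (\<delta>\<^sup>2 * \<tau> ^ (2 * CARD('n) - 2)) * (\<integral>\<^sup>+x. F (U (D x)) \<partial>lborel)"
      unfolding prodk .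
  qed (simp_all add: U D_add D_smult)
qed

section \<open>Surface measure and nonisotropic balls\<close>

definition dir :: "complex ^ 'n \<Rightarrow> complex ^ 'n" where "dir z = z /\<^sub>R norm z"

lemma borel_measurable_dir [measurable]: "dir \<in> borel_measurable borel"
  unfolding dir_def by measurable

lemma norm_dir: "z \<noteq> 0 \<Longrightarrow> norm (dir z) = 1"
  by (simp add: dir_def)

lemma dir_zero [simp]: "dir 0 = 0"
  by (simp add: dir_def)

lemma scaleR_dir: "norm z *\<^sub>R dir z = z"
  by (cases "z = 0") (simp_all add: dir_def)

lemma dir_scaleR: "0 < r \<Longrightarrow> dir (r *\<^sub>R z) = dir z"
  by (simp add: dir_def)

text \<open>
  The surface measure before restriction to the sphere: it lives on the whole space and gives full mass to
  the sphere, up to the origin, which is a null set.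
\<close>
definition dir_measure :: "(complex ^ 'n) measure" where
  "dir_measure = distr (uniform_measure lborel (ball 0 1)) borel dir"

definition borel_sphere :: "(complex ^ 'n) measure" where
  "borel_sphere = restrict_space dir_measure (sphere 0 1)"

lemma sphere_measure_eq: "sphere_measure = completion borel_sphere"
  by (simp add: sphere_measure_def borel_sphere_def dir_measure_def dir_def[abs_def])

lemma sets_dir_measure [measurable_cong]: "sets dir_measure = sets borel"
  by (simp add: dir_measure_def)

lemma space_borel_sphere: "space borel_sphere = sphere 0 1"
  by (simp add: borel_sphere_def space_restrict_space dir_measure_def)

lemma sets_borel_sphere: "sets borel_sphere = sets (restrict_space borel (sphere 0 1))"
  by (simp add: borel_sphere_def sets_restrict_space sets_dir_measure)

lemma measurable_borel_sphereI:
  "g \<in> borel_measurable borel \<Longrightarrow> g \<in> borel_measurable borel_sphere"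
  unfolding borel_sphere_def dir_measure_def by (intro measurable_restrict_space1) simp

definition unit_vol :: "'n::finite itself \<Rightarrow> real" where
  "unit_vol _ = measure lborel (ball (0 :: complex ^ 'n) 1)"

lemma emeasure_unit_ball: "emeasure lborel (ball (0 :: complex ^ 'n) 1) = ennreal (unit_vol TYPE('n))"
  using emeasure_lborel_ball_pos_fin[of 1 "0 :: complex ^ 'n"] by (simp add: unit_vol_def emeasure_eq_ennreal_measure)

lemma unit_vol_pos: "0 < unit_vol TYPE('n::finite)"
  using emeasure_lborel_ball_pos_fin(1)[of 1 "0 :: complex ^ 'n"] unfolding emeasure_unit_ball
  by (simp add: ennreal_eq_0_iff)

lemma emeasure_dir_measure:
  fixes B :: "(complex ^ 'n) set"
  assumes [measurable]: "B \<in> sets borel"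
  shows "ennreal (unit_vol TYPE('n)) * emeasure dir_measure B = emeasure lborel {z \<in> ball 0 1. dir z \<in> B}"
proof -
  have "emeasure dir_measure B = emeasure (uniform_measure lborel (ball 0 1)) (dir -` B)"
    unfolding dir_measure_def by (subst emeasure_distr) auto
  also have "\<dots> = emeasure lborel (ball 0 1 \<inter> dir -` B) / emeasure lborel (ball (0 :: complex ^ 'n) 1)"
    by (rule emeasure_uniform_measure) (use measurable_sets[OF borel_measurable_dir assms] in auto)
  also have "ball 0 1 \<inter> dir -` B = {z \<in> ball 0 1. dir z \<in> B}" by auto
  finally show ?thesis
    using unit_vol_pos[where 'n = 'n] unfolding emeasure_unit_ball
    by (simp add: ennreal_times_divide mult.commute[of "ennreal _" "emeasure _ _"] ennreal_mult_divide_eq ennreal_eq_0_iff)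
qed

lemma emeasure_dir_measure_UNIV: "emeasure (dir_measure :: (complex ^ 'n) measure) UNIV = 1"
proof -
  have "{z \<in> ball (0 :: complex ^ 'n) 1. dir z \<in> UNIV} = ball 0 1" by auto
  then have "ennreal (unit_vol TYPE('n)) * emeasure (dir_measure :: (complex ^ 'n) measure) UNIV = ennreal (unit_vol TYPE('n)) * 1"
    using emeasure_dir_measure[of "UNIV :: (complex ^ 'n) set"] emeasure_unit_ball[where 'n = 'n] by simp
  then have "emeasure (dir_measure :: (complex ^ 'n) measure) UNIV \<le> 1" "1 \<le> emeasure (dir_measure :: (complex ^ 'n) measure) UNIV"
    using unit_vol_pos[where 'n = 'n]
    by (subst ennreal_mult_le_mult_iff[symmetric, of "ennreal (unit_vol TYPE('n))"]; simp add: ennreal_eq_0_iff)+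
  then show ?thesis by simp
qed

lemma finite_measure_dir_measure: "finite_measure (dir_measure :: (complex ^ 'n) measure)"
  by (rule finite_measureI) (simp add: emeasure_dir_measure_UNIV dir_measure_def[THEN arg_cong[where f = space]])

lemma emeasure_borel_sphere:
  assumes "B \<in> sets borel" "B \<subseteq> sphere 0 1"
  shows "emeasure borel_sphere B = emeasure dir_measure B"
  unfolding borel_sphere_def using assms
  by (intro emeasure_restrict_space) (auto simp: sets_dir_measure)

lemma nn_integral_borel_sphere:
  assumes [measurable]: "F \<in> borel_measurable borel"
  shows "(\<integral>\<^sup>+\<eta>. F \<eta> \<partial>borel_sphere) = (\<integral>\<^sup>+\<eta>. F \<eta> * indicator (sphere 0 1) \<eta> \<partial>dir_measure)"
  unfolding borel_sphere_def
  by (rule nn_integral_restrict_space) (simp add: sets_dir_measure)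

text \<open>The dilation by \<open>\<rho>\<close> of real dimension \<open>2n\<close>.\<close>
lemma cone_scale:
  fixes B :: "(complex ^ 'n) set"
  assumes [measurable]: "B \<in> sets borel" and \<rho>: "0 < \<rho>"
  shows "emeasure lborel {z. norm z < \<rho> \<and> dir z \<in> B}
    = ennreal (\<rho> ^ (2 * CARD('n))) * emeasure lborel {z. norm z < 1 \<and> dir z \<in> B}"
proof -
  have [measurable]: "{z. norm z < r \<and> dir z \<in> B} \<in> sets borel" for r
  proof -
    have "{z. norm z < r \<and> dir z \<in> B} = {z \<in> space borel. norm z < r \<and> dir z \<in> B}" by simp
    also have "\<dots> \<in> sets borel" by measurable
    finally show ?thesis .
  qed
  have "emeasure lborel {z. norm z < \<rho> \<and> dir z \<in> B} = (\<integral>\<^sup>+z. indicator {z. norm z < \<rho> \<and> dir z \<in> B} z \<partial>lborel)"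
    by simp
  also have "\<dots> = ennreal (\<bar>\<rho>\<bar> ^ DIM(complex ^ 'n)) * (\<integral>\<^sup>+z. indicator {z. norm z < \<rho> \<and> dir z \<in> B} (\<rho> *\<^sub>R z) \<partial>lborel)"
    by (rule nn_integral_lborel_scale) (use \<rho> in auto)
  also have "(\<lambda>z. indicator {z. norm z < \<rho> \<and> dir z \<in> B} (\<rho> *\<^sub>R z) :: ennreal) = indicator {z. norm z < 1 \<and> dir z \<in> B}"
    using \<rho> by (auto simp: fun_eq_iff indicator_def dir_scaleR)
  finally show ?thesis using \<rho> by (simp add: mult.commute[of "CARD('n)" 2])
qed

lemma emeasure_sphere_zero: "0 < r \<Longrightarrow> emeasure lborel (sphere (0 :: 'a::euclidean_space) r) = 0"
proof -
  assume r: "0 < r"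
  have "sphere (0 :: 'a) r = cball 0 r - ball 0 r" by auto
  then have "emeasure lborel (sphere (0 :: 'a) r) = emeasure lborel (cball (0 :: 'a) r) - emeasure lborel (ball (0 :: 'a) r)"
    using emeasure_lborel_ball_pos_fin[OF r, of "0 :: 'a"] by (simp add: emeasure_Diff)
  then show ?thesis using r by (simp add: emeasure_cball emeasure_ball)
qed

lemma shell_cone:
  fixes B :: "(complex ^ 'n) set"
  assumes [measurable]: "B \<in> sets borel" and \<rho>: "0 < \<rho>" "\<rho> < 1"
  shows "emeasure lborel {z. \<rho> < norm z \<and> norm z < 1 \<and> dir z \<in> B}
    = ennreal ((1 - \<rho> ^ (2 * CARD('n))) * unit_vol TYPE('n)) * emeasure dir_measure B"
proof -
  interpret D: finite_measure "dir_measure :: (complex ^ 'n) measure" by (rule finite_measure_dir_measure)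
  have m1: "{z. P z \<and> dir z \<in> B} \<in> sets borel" if "{z :: complex ^ 'n. P z} \<in> sets borel" for P
  proof -
    have "{z. P z \<and> dir z \<in> B} = {z. P z} \<inter> (dir -` B \<inter> space borel)" by auto
    then show ?thesis using that measurable_sets[OF borel_measurable_dir, of B] by auto
  qed
  have ob: "{z :: complex ^ 'n. norm z < r} = ball 0 r" "{z :: complex ^ 'n. norm z \<le> r} = cball 0 r" for r by auto
  have mlt [measurable]: "{z. norm z < r \<and> dir z \<in> B} \<in> sets borel" for r
    by (rule m1) (simp add: ob)
  define V where "V = unit_vol TYPE('n)"
  define b where "b = measure dir_measure B"
  have V: "0 < V" unfolding V_def by (rule unit_vol_pos)
  have b: "emeasure dir_measure B = ennreal b" "0 \<le> b" by (auto simp: b_def D.emeasure_eq_measure)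
  have one: "emeasure lborel {z. norm z < 1 \<and> dir z \<in> B} = ennreal (V * b)"
    using emeasure_dir_measure[of B] V b by (simp add: V_def b_def ennreal_mult D.emeasure_eq_measure)
  have rho: "emeasure lborel {z. norm z < \<rho> \<and> dir z \<in> B} = ennreal (\<rho> ^ (2 * CARD('n)) * (V * b))"
    unfolding cone_scale[OF assms(1) \<rho>(1)] one using \<rho> V b by (simp add: ennreal_mult)
  have p1: "\<rho> ^ (2 * CARD('n)) \<le> 1" using \<rho> by (simp add: power_le_one)
  have "{z. norm z < 1 \<and> dir z \<in> B} - {z. norm z < \<rho> \<and> dir z \<in> B} = {z. \<rho> \<le> norm z \<and> norm z < 1 \<and> dir z \<in> B}"
    using \<rho> by auto
  moreover have "{z. norm z < \<rho> \<and> dir z \<in> B} \<subseteq> {z. norm z < 1 \<and> dir z \<in> B}" using \<rho> by auto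
  ultimately have "emeasure lborel {z. \<rho> \<le> norm z \<and> norm z < 1 \<and> dir z \<in> B} = ennreal (V * b) - ennreal (\<rho> ^ (2 * CARD('n)) * (V * b))"
    using emeasure_Diff[of lborel "{z. norm z < \<rho> \<and> dir z \<in> B}" "{z. norm z < 1 \<and> dir z \<in> B}"]
    by (simp add: one rho)
  also have "\<dots> = ennreal (V * b - \<rho> ^ (2 * CARD('n)) * (V * b))"
    using V b \<rho> by (intro ennreal_minus) auto
  finally have le: "emeasure lborel {z. \<rho> \<le> norm z \<and> norm z < 1 \<and> dir z \<in> B} = ennreal ((1 - \<rho> ^ (2 * CARD('n))) * V) * emeasure dir_measure B"
    using V b p1 by (simp add: b(1) ennreal_mult[symmetric] algebra_simps)
  have mle: "{z. \<rho> \<le> norm z \<and> norm z < 1 \<and> dir z \<in> B} \<in> sets borel"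
  proof -
    have "{z. \<rho> \<le> norm z \<and> norm z < 1 \<and> dir z \<in> B} = {z. norm z < 1 \<and> dir z \<in> B} - {z. norm z < \<rho> \<and> dir z \<in> B}"
      using \<rho> by auto
    then show ?thesis by (simp add: mlt sets.Diff)
  qed
  have "emeasure lborel {z. \<rho> < norm z \<and> norm z < 1 \<and> dir z \<in> B} = emeasure lborel ({z. \<rho> \<le> norm z \<and> norm z < 1 \<and> dir z \<in> B} - sphere 0 \<rho>)"
    by (rule arg_cong[where f = "emeasure lborel"]) auto
  also have "\<dots> = emeasure lborel {z. \<rho> \<le> norm z \<and> norm z < 1 \<and> dir z \<in> B}"
    using mle emeasure_sphere_zero[OF \<rho>(1), where 'a = "complex ^ 'n"]
    by (intro emeasure_Diff_null_set) (auto simp: null_sets_def)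
  finally show ?thesis unfolding le V_def .
qed

lemma nn_integral_radial_power:
  assumes "0 \<le> x" "x < (1::real)" "0 < m"
  shows "(\<integral>\<^sup>+r. ennreal (real m * r ^ (m - 1)) * indicator {x<..<1} r \<partial>lborel) = ennreal (1 - x ^ m)"
proof -
  have "(\<integral>\<^sup>+r. ennreal (real m * r ^ (m - 1)) * indicator {x..1} r \<partial>lborel) = ennreal (1 ^ m - x ^ m)"
  proof (rule nn_integral_FTC_Icc)
    show "DERIV (\<lambda>r. r ^ m) r :> real m * r ^ (m - 1)" if "r \<in> {x..1}" for r
      using DERIV_pow[of m r] by simp
    show "0 \<le> real m * r ^ (m - 1)" if "r \<in> {x..1}" for r using that assms by simp
  qed (use assms in auto)
  moreover have "(\<integral>\<^sup>+r. ennreal (real m * r ^ (m - 1)) * indicator {x<..<1} r \<partial>lborel)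
      = (\<integral>\<^sup>+r. ennreal (real m * r ^ (m - 1)) * indicator {x..1} r \<partial>lborel)"
  proof (rule nn_integral_cong_AE)
    have "AE r in lborel. r \<noteq> x \<and> r \<noteq> (1 :: real)" using AE_lborel_singleton[of x] AE_lborel_singleton[of "1::real"] by auto
    then show "AE r in lborel. ennreal (real m * r ^ (m - 1)) * indicator {x<..<1} r = ennreal (real m * r ^ (m - 1)) * indicator {x..1} r"
      by eventually_elim (auto simp: indicator_def)
  qed
  ultimately show ?thesis by simp
qed

text \<open>
  Both sides are measures of \<open>F\<close>. They agree on the indicator functions of truncated cones
  over spherical sets, by scaling, and these generate the Borel sets.
\<close>
theorem nn_integral_polar:
  fixes F :: "complex ^ 'n \<Rightarrow> ennreal"
  assumes [measurable]: "F \<in> borel_measurable borel"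
  shows "(\<integral>\<^sup>+z\<in>ball 0 1. F z \<partial>lborel) =
    ennreal (unit_vol TYPE('n)) * (\<integral>\<^sup>+\<eta>. (\<integral>\<^sup>+r\<in>{0<..<1}. F (r *\<^sub>R \<eta>) * ennreal (2 * CARD('n) * r ^ (2 * CARD('n) - 1)) \<partial>lborel) \<partial>borel_sphere)"
proof -
  let ?m = "2 * CARD('n)"
  let ?V = "unit_vol TYPE('n)"
  interpret D: finite_measure "dir_measure :: (complex ^ 'n) measure" by (rule finite_measure_dir_measure)
  define R where "R = density lborel (\<lambda>r. ennreal (real ?m * r ^ (?m - 1)) * indicator {0<..<1::real} r)"
  define M where "M = distr (density lborel (indicator (ball (0 :: complex ^ 'n) 1))) (borel \<Otimes>\<^sub>M borel) (\<lambda>z. (norm z, dir z))"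
  have sR [measurable_cong]: "sets R = sets borel" by (simp add: R_def)
  have R_gt: "emeasure R {x<..} = (if x < 0 then 1 else if x < 1 then ennreal (1 - x ^ ?m) else 0)" for x
  proof -
    have "emeasure R {x<..} = (\<integral>\<^sup>+r. ennreal (real ?m * r ^ (?m - 1)) * indicator {max x 0<..<1} r \<partial>lborel)"
      unfolding R_def by (subst emeasure_density) (auto simp: indicator_def intro!: nn_integral_cong)
    then show ?thesis
      using nn_integral_radial_power[of "max x 0" ?m] by (auto simp: max_def)
  qed
  have emM: "emeasure M (A \<times> B) = emeasure lborel {z. norm z < 1 \<and> norm z \<in> A \<and> dir z \<in> B}"
    if [measurable]: "A \<in> sets borel" "B \<in> sets borel" for A and B :: "(complex ^ 'n) set"
  proof -
    let ?P = "(\<lambda>z :: complex ^ 'n. (norm z, dir z)) -` (A \<times> B)"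
    have P: "?P \<in> sets borel"
      using measurable_sets[of "\<lambda>z :: complex ^ 'n. (norm z, dir z)" borel "borel \<Otimes>\<^sub>M borel" "A \<times> B"] by simp
    have "emeasure M (A \<times> B) = emeasure (density lborel (indicator (ball (0 :: complex ^ 'n) 1))) ?P"
      unfolding M_def by (subst emeasure_distr) auto
    also have "\<dots> = (\<integral>\<^sup>+z. indicator (ball 0 1) z * indicator ?P z \<partial>lborel)"
      using P by (subst emeasure_density) (auto intro!: borel_measurable_indicator)
    also have "\<dots> = (\<integral>\<^sup>+z. indicator (ball 0 1 \<inter> ?P) z \<partial>lborel)"
      by (intro nn_integral_cong) (auto simp: indicator_def)
    also have "\<dots> = emeasure lborel (ball 0 1 \<inter> ?P)" using P by simp
    also have "ball 0 1 \<inter> ?P = {z. norm z < 1 \<and> norm z \<in> A \<and> dir z \<in> B}" by auto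
    finally show ?thesis .
  qed
  have rect: "ennreal ?V * (emeasure R A * emeasure dir_measure B) = emeasure M (A \<times> B)"
    if A: "A \<in> sets borel" and [measurable]: "B \<in> sets borel" for A and B :: "(complex ^ 'n) set"
  proof -
    define N1 where "N1 = scale_measure (ennreal ?V * emeasure dir_measure B) R"
    define N2 where "N2 = distr (restrict_space M (UNIV \<times> B)) borel fst"
    have sM: "sets M = sets (borel \<Otimes>\<^sub>M borel)" by (simp add: M_def)
    have UB: "UNIV \<times> B \<in> sets M" by (simp add: sM)
    have f [measurable]: "fst \<in> restrict_space M (UNIV \<times> B) \<rightarrow>\<^sub>M borel"
      by (rule measurable_restrict_space1) (simp add: M_def)
    have N2: "emeasure N2 C = emeasure M (C \<times> B)" if "C \<in> sets borel" for C
    proof -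
      have "emeasure N2 C = emeasure (restrict_space M (UNIV \<times> B)) (fst -` C \<inter> space (restrict_space M (UNIV \<times> B)))"
        unfolding N2_def by (rule emeasure_distr[OF f that])
      also have "fst -` C \<inter> space (restrict_space M (UNIV \<times> B)) = C \<times> B"
        by (auto simp: space_restrict_space M_def space_pair_measure)
      also have "emeasure (restrict_space M (UNIV \<times> B)) (C \<times> B) = emeasure M (C \<times> B)"
        using UB by (intro emeasure_restrict_space) (auto simp: sM M_def space_pair_measure)
      finally show ?thesis .
    qed
    have "N1 = N2"
    proof (rule measure_eqI_lessThan)
      show "sets N1 = sets borel" "sets N2 = sets borel" by (simp_all add: N1_def N2_def sR)
      show "emeasure N1 {x<..} < \<infinity>" for x
        by (auto simp: N1_def R_gt ennreal_mult_less_top D.emeasure_eq_measure)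
      show "emeasure N1 {x<..} = emeasure N2 {x<..}" for x
      proof -
        have N1x: "emeasure N1 {x<..} = ennreal ?V * emeasure dir_measure B * emeasure R {x<..}" by (simp add: N1_def)
        have N2x: "emeasure N2 {x<..} = emeasure lborel {z. norm z < 1 \<and> x < norm z \<and> dir z \<in> B}"
          by (subst N2) (simp_all add: emM)
        consider "x < 0" | "x = 0" | "0 < x" "x < 1" | "1 \<le> x" by linarith
        then show ?thesis
        proof cases
          case 1
          then have "{z. norm z < 1 \<and> x < norm z \<and> dir z \<in> B} = {z \<in> ball 0 1. dir z \<in> B}"
            by (auto intro: less_le_trans)
          then show ?thesis using 1 unfolding N1x N2x R_gt by (simp add: emeasure_dir_measure)
        next
          case 2
          have "{z. norm z < 1 \<and> 0 < norm z \<and> dir z \<in> B} = {z \<in> ball 0 1. dir z \<in> B} - {0}" by auto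
          moreover have "emeasure lborel ({z \<in> ball 0 1. dir z \<in> B} - {0}) = emeasure lborel {z \<in> ball 0 1. dir z \<in> B}"
          proof (rule emeasure_Diff_null_set)
            have "{z \<in> ball 0 1. dir z \<in> B} = ball 0 1 \<inter> (dir -` B \<inter> space borel)" by auto
            then show "{z \<in> ball 0 1. dir z \<in> B} \<in> sets lborel"
              using measurable_sets[OF borel_measurable_dir, of B] by auto
          qed (simp add: null_sets_def)
          ultimately show ?thesis using 2 unfolding N1x N2x R_gt by (simp add: emeasure_dir_measure power_0_left)
        next
          case 3
          have "{z. norm z < 1 \<and> x < norm z \<and> dir z \<in> B} = {z. x < norm z \<and> norm z < 1 \<and> dir z \<in> B}" by auto
          moreover have "x ^ ?m \<le> 1" using 3 by (simp add: power_le_one)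
          ultimately show ?thesis using 3 unit_vol_pos[where 'n = 'n] unfolding N1x N2x R_gt
            by (simp add: shell_cone ennreal_mult mult_ac)
        next
          case 4
          then have e: "{z. norm z < 1 \<and> x < norm z \<and> dir z \<in> B} = {}" by auto
          show ?thesis unfolding N1x N2x R_gt e using 4 by simp
        qed
      qed
    qed
    then have "emeasure N1 A = emeasure N2 A" by simp
    then show ?thesis using A by (simp add: N1_def N2 mult_ac)
  qed
  have R1: "finite_measure R"
  proof
    have "emeasure R UNIV \<le> emeasure R {-1<..}"
    proof -
      have "emeasure R UNIV = (\<integral>\<^sup>+r. ennreal (real ?m * r ^ (?m - 1)) * indicator {0<..<1} r \<partial>lborel)"
        unfolding R_def by (subst emeasure_density) auto
      also have "\<dots> = 1" using nn_integral_radial_power[of 0 ?m] by simp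
      finally show ?thesis by (simp add: R_gt)
    qed
    moreover have "space R = UNIV" by (simp add: R_def)
    ultimately show "emeasure R (space R) \<noteq> \<infinity>" by (auto simp: R_gt top_unique)
  qed
  interpret R: finite_measure R by (rule R1)
  have fin: "finite_measure (scale_measure (ennreal ?V) R)"
    by (rule finite_measureI) (simp add: ennreal_mult_eq_top_iff space_scale_measure R.emeasure_eq_measure)
  interpret VR: finite_measure "scale_measure (ennreal ?V) R" by (rule fin)
  have eq: "scale_measure (ennreal ?V) R \<Otimes>\<^sub>M dir_measure = M"
  proof (rule pair_measure_eqI)
    show "sigma_finite_measure (scale_measure (ennreal ?V) R)"
      by unfold_locales
    show "sigma_finite_measure (dir_measure :: (complex ^ 'n) measure)" by unfold_locales
    show "sets (scale_measure (ennreal ?V) R \<Otimes>\<^sub>M dir_measure) = sets M"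
      unfolding M_def by (simp cong: sets_pair_measure_cong add: sR sets_dir_measure)
  qed (use rect in \<open>simp add: sR sets_dir_measure mult.assoc\<close>)
  have "(\<integral>\<^sup>+z\<in>ball 0 1. F z \<partial>lborel) = (\<integral>\<^sup>+z. F (norm z *\<^sub>R dir z) \<partial>density lborel (indicator (ball (0 :: complex ^ 'n) 1)))"
    by (subst nn_integral_density) (auto simp: scaleR_dir mult.commute intro!: borel_measurable_indicator)
  also have "\<dots> = (\<integral>\<^sup>+p. F (fst p *\<^sub>R snd p) \<partial>M)"
    unfolding M_def by (subst nn_integral_distr) auto
  also have "\<dots> = (\<integral>\<^sup>+p. F (fst p *\<^sub>R snd p) \<partial>(scale_measure (ennreal ?V) R \<Otimes>\<^sub>M dir_measure))"
    by (simp add: eq)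
  also have "\<dots> = ennreal ?V * (\<integral>\<^sup>+\<eta>. (\<integral>\<^sup>+r. F (r *\<^sub>R \<eta>) \<partial>R) \<partial>dir_measure)"
  proof -
    interpret P: pair_sigma_finite "scale_measure (ennreal ?V) R" "dir_measure :: (complex ^ 'n) measure" ..
    have mF [measurable]: "(\<lambda>p. F (fst p *\<^sub>R snd p)) \<in> borel_measurable (borel \<Otimes>\<^sub>M borel)" by measurable
    have "(\<lambda>p. F (fst p *\<^sub>R snd p)) \<in> borel_measurable (scale_measure (ennreal ?V) R \<Otimes>\<^sub>M dir_measure)"
      unfolding eq M_def by simp
    from P.nn_integral_snd[OF this]
    have "(\<integral>\<^sup>+p. F (fst p *\<^sub>R snd p) \<partial>(scale_measure (ennreal ?V) R \<Otimes>\<^sub>M dir_measure))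
        = (\<integral>\<^sup>+\<eta>. (\<integral>\<^sup>+r. F (r *\<^sub>R \<eta>) \<partial>scale_measure (ennreal ?V) R) \<partial>dir_measure)" by simp
    also have "\<dots> = (\<integral>\<^sup>+\<eta>. ennreal ?V * (\<integral>\<^sup>+r. F (r *\<^sub>R \<eta>) \<partial>R) \<partial>dir_measure)"
      by (intro nn_integral_cong nn_integral_scale_measure) measurable
    also have "\<dots> = ennreal ?V * (\<integral>\<^sup>+\<eta>. (\<integral>\<^sup>+r. F (r *\<^sub>R \<eta>) \<partial>R) \<partial>dir_measure)"
      by (intro nn_integral_cmult) measurable
    finally show ?thesis .
  qed
  also have "(\<integral>\<^sup>+\<eta>. (\<integral>\<^sup>+r. F (r *\<^sub>R \<eta>) \<partial>R) \<partial>dir_measure)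
      = (\<integral>\<^sup>+\<eta>. (\<integral>\<^sup>+r\<in>{0<..<1}. F (r *\<^sub>R \<eta>) * ennreal (2 * CARD('n) * r ^ (2 * CARD('n) - 1)) \<partial>lborel) \<partial>dir_measure)"
    unfolding R_def by (intro nn_integral_cong, subst nn_integral_density) (auto simp: mult_ac intro!: nn_integral_cong)
  also have "\<dots> = (\<integral>\<^sup>+\<eta>. (\<integral>\<^sup>+r\<in>{0<..<1}. F (r *\<^sub>R \<eta>) * ennreal (2 * CARD('n) * r ^ (2 * CARD('n) - 1)) \<partial>lborel) \<partial>borel_sphere)"
  proof -
    have "AE \<eta> in dir_measure. \<eta> \<in> sphere (0 :: complex ^ 'n) 1"
    proof -
      have "AE z in uniform_measure lborel (ball (0 :: complex ^ 'n) 1). dir z \<in> sphere 0 1"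
      proof (rule AE_uniform_measureI)
        show "AE z in lborel. z \<in> ball (0 :: complex ^ 'n) 1 \<longrightarrow> dir z \<in> sphere 0 1"
          using AE_lborel_singleton[of "0 :: complex ^ 'n"] by eventually_elim (simp add: norm_dir)
      qed simp
      then show ?thesis unfolding dir_measure_def by (subst AE_distr_iff) auto
    qed
    then show ?thesis
      by (subst nn_integral_borel_sphere) (auto intro!: nn_integral_cong_AE simp: indicator_def)
  qed
  finally show ?thesis .
qed

definition cyl_vol :: "'n::finite itself \<Rightarrow> 'n \<Rightarrow> real" where
  "cyl_vol _ j = measure lborel {x :: complex ^ 'n. norm (x $ j) < 1 \<and> norm (x - (x $ j) *s axis j 1) < 1}"

lemma cyl_vol:
  fixes j :: "'n::finite"
  defines "S \<equiv> {x :: complex ^ 'n. norm (x $ j) < 1 \<and> norm (x - (x $ j) *s axis j 1) < 1}"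
  shows "S \<in> sets borel" "emeasure lborel S = ennreal (cyl_vol TYPE('n) j)" "0 < cyl_vol TYPE('n) j"
proof -
  have "open S" unfolding S_def by (intro open_Collect_conj open_Collect_less continuous_intros)
  then show S: "S \<in> sets borel" by simp
  have "S \<subseteq> ball 0 2"
  proof
    fix x assume x: "x \<in> S"
    have "norm x \<le> norm (x - (x $ j) *s axis j 1) + norm ((x $ j) *s axis j (1 :: complex))"
      using norm_triangle_ineq[of "x - (x $ j) *s axis j 1" "(x $ j) *s axis j 1"] by simp
    also have "\<dots> < 2" using x by (simp add: S_def norm_vector_smult norm_axis_one)
    finally show "x \<in> ball 0 2" by simp
  qed
  then have "emeasure lborel S \<le> emeasure lborel (ball (0 :: complex ^ 'n) 2)" by (intro emeasure_mono) auto
  then have "emeasure lborel S \<noteq> top" using emeasure_lborel_ball_pos_fin(2)[of 2 "0 :: complex ^ 'n"] by (auto simp: top_unique)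
  then show 1: "emeasure lborel S = ennreal (cyl_vol TYPE('n) j)"
    by (simp add: cyl_vol_def S_def emeasure_eq_ennreal_measure)
  have "ball 0 (1/2) \<subseteq> S"
  proof
    fix x :: "complex ^ 'n" assume x: "x \<in> ball 0 (1/2)"
    have c: "norm (x $ j) \<le> norm x" by (rule Finite_Cartesian_Product.norm_nth_le)
    have "norm (x - (x $ j) *s axis j 1) \<le> norm x + norm ((x $ j) *s axis j (1 :: complex))" by (rule norm_triangle_ineq4)
    also have "\<dots> < 1" using x c by (simp add: norm_vector_smult norm_axis_one)
    finally show "x \<in> S" using x c by (simp add: S_def)
  qed
  then have "emeasure lborel (ball (0 :: complex ^ 'n) (1/2)) \<le> emeasure lborel S" using S by (intro emeasure_mono) auto
  then have "emeasure lborel S \<noteq> 0" using emeasure_lborel_ball_pos_fin(1)[of "1/2" "0 :: complex ^ 'n"] by auto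
  then show "0 < cyl_vol TYPE('n) j" unfolding 1 by (simp add: ennreal_eq_0_iff)
qed

text \<open>A translation by \<open>c \<zeta>\<close> and the ellipsoid map reduce this to the unit cylinder.\<close>
lemma emeasure_cylinder:
  fixes \<zeta> :: "complex ^ 'n"
  assumes \<zeta>: "norm \<zeta> = 1" and pos: "0 < \<delta>" "0 < \<tau>"
  shows "emeasure lborel {z. norm (hermitian z \<zeta> - c) < \<delta> \<and> norm (orth_part \<zeta> z) < \<tau>}
    = ennreal (\<delta>\<^sup>2 * \<tau> ^ (2 * CARD('n) - 2) * cyl_vol TYPE('n) j)"
proof -
  obtain L :: "complex ^ 'n \<Rightarrow> complex ^ 'n" where
    L: "\<And>x y. L (x + y) = L x + L y" "\<And>c x. L (c *s x) = c *s L x"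
    "\<And>x. hermitian (L x) \<zeta> = of_real \<delta> * x $ j"
    "\<And>x. norm (orth_part \<zeta> (L x)) = \<tau> * norm (x - (x $ j) *s axis j 1)"
    "\<And>F. F \<in> borel_measurable borel \<Longrightarrow> (\<integral>\<^sup>+x. F x \<partial>lborel)
       = ennreal (\<delta>\<^sup>2 * \<tau> ^ (2 * CARD('n) - 2)) * (\<integral>\<^sup>+x. F (L x) \<partial>lborel)"
    by (rule ellipsoid_map[OF \<zeta> pos, of j]) (rule that)
  let ?A = "{z. norm (hermitian z \<zeta> - c) < \<delta> \<and> norm (orth_part \<zeta> z) < \<tau>}"
  let ?S = "{x :: complex ^ 'n. norm (x $ j) < 1 \<and> norm (x - (x $ j) *s axis j 1) < 1}"
  have "open ?A" unfolding orth_part_def by (intro open_Collect_conj open_Collect_less continuous_intros)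
  then have mA [measurable]: "?A \<in> sets borel" by simp
  have t: "indicator ?A (c *s \<zeta> + L x) = (indicator ?S x :: ennreal)" for x
  proof -
    have "hermitian (c *s \<zeta> + L x) \<zeta> - c = of_real \<delta> * x $ j"
      by (simp add: hermitian_add_left hermitian_smult_left hermitian_self \<zeta> L)
    moreover have "orth_part \<zeta> (c *s \<zeta> + L x) = orth_part \<zeta> (L x)"
      by (simp add: orth_part_def hermitian_add_left hermitian_smult_left hermitian_self \<zeta> vec_eq_iff algebra_simps)
    ultimately have "c *s \<zeta> + L x \<in> ?A \<longleftrightarrow> x \<in> ?S" using pos by (simp add: L norm_mult)
    then show ?thesis by (simp add: indicator_def)
  qed
  have "emeasure lborel ?A = (\<integral>\<^sup>+z. indicator ?A z \<partial>lborel)" using mA by simp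
  also have "\<dots> = (\<integral>\<^sup>+z. indicator ?A (c *s \<zeta> + z) \<partial>lborel)"
    by (rule nn_integral_lborel_translate[symmetric]) measurable
  also have "\<dots> = ennreal (\<delta>\<^sup>2 * \<tau> ^ (2 * CARD('n) - 2)) * (\<integral>\<^sup>+x. indicator ?A (c *s \<zeta> + L x) \<partial>lborel)"
    by (rule L(5)) measurable
  also have "(\<integral>\<^sup>+x. indicator ?A (c *s \<zeta> + L x) \<partial>lborel) = emeasure lborel ?S"
    unfolding t using cyl_vol(1)[of j] by simp
  finally show ?thesis using pos cyl_vol(3)[of j] by (simp add: cyl_vol(2) ennreal_mult)
qed

lemma nonisotropic_ball_borel: "nonisotropic_ball \<zeta> r \<in> sets borel"
proof -
  have "open {\<eta>. norm (1 - hermitian \<zeta> \<eta>) < r}" by (intro open_Collect_less continuous_intros)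
  then have "sphere 0 1 \<inter> {\<eta>. norm (1 - hermitian \<zeta> \<eta>) < r} \<in> sets borel" by auto
  moreover have "sphere 0 1 \<inter> {\<eta>. norm (1 - hermitian \<zeta> \<eta>) < r} = nonisotropic_ball \<zeta> r"
    by (auto simp: nonisotropic_ball_def)
  ultimately show ?thesis by simp
qed

lemma norm_one_minus_hermitian_commute: "norm (1 - hermitian x y) = norm (1 - hermitian y x)"
proof -
  have "1 - hermitian x y = cnj (1 - hermitian y x)" by (simp add: hermitian_cnj[of x y])
  then show ?thesis by (simp only: complex_mod_cnj)
qed

lemma norm_one_minus_hermitian_le_2:
  assumes "norm x = 1" "norm y = 1" shows "norm (1 - hermitian x y) \<le> 2"
  using norm_triangle_ineq4[of 1 "hermitian x y"] hermitian_Cauchy_Schwarz[of x y] assms by simp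

text \<open>Moving along a radius changes the product by at most the distance moved.\<close>
lemma hermitian_dir:
  assumes "norm \<zeta> = 1" "norm z \<le> 1"
  shows "norm (1 - hermitian (dir z) \<zeta>) \<le> norm (1 - hermitian z \<zeta>) + (1 - norm z)"
    and "norm (1 - hermitian z \<zeta>) \<le> norm (1 - hermitian (dir z) \<zeta>) + (1 - norm z)"
proof -
  have z: "hermitian z \<zeta> = of_real (norm z) * hermitian (dir z) \<zeta>"
    by (subst scaleR_dir[of z, symmetric]) (rule hermitian_scaleR_left)
  have "norm (dir z) \<le> 1" by (cases "z = 0") (simp_all add: norm_dir)
  then have h: "norm (hermitian (dir z) \<zeta>) \<le> 1" using hermitian_Cauchy_Schwarz[of "dir z" \<zeta>] assms by simp
  have "hermitian z \<zeta> - hermitian (dir z) \<zeta> = of_real (norm z - 1) * hermitian (dir z) \<zeta>"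
    by (simp add: z algebra_simps)
  then have "norm (hermitian z \<zeta> - hermitian (dir z) \<zeta>) = (1 - norm z) * norm (hermitian (dir z) \<zeta>)"
    using assms by (simp only: norm_mult norm_of_real) simp
  also have "\<dots> \<le> (1 - norm z) * 1" using assms h by (intro mult_left_mono) auto
  finally have d: "norm (hermitian z \<zeta> - hermitian (dir z) \<zeta>) \<le> 1 - norm z" by simp
  show "norm (1 - hermitian (dir z) \<zeta>) \<le> norm (1 - hermitian z \<zeta>) + (1 - norm z)"
    using norm_triangle_ineq[of "1 - hermitian z \<zeta>" "hermitian z \<zeta> - hermitian (dir z) \<zeta>"] d by simp
  show "norm (1 - hermitian z \<zeta>) \<le> norm (1 - hermitian (dir z) \<zeta>) + (1 - norm z)"
    using norm_triangle_ineq4[of "1 - hermitian (dir z) \<zeta>" "hermitian z \<zeta> - hermitian (dir z) \<zeta>"] d by simp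
qed

lemma norm_orth_part_le_sqrt:
  assumes "norm \<zeta> = 1" "norm z \<le> 1" "norm (1 - hermitian z \<zeta>) \<le> a"
  shows "norm (orth_part \<zeta> z) \<le> sqrt (2 * a)"
  using orth_part_small[OF assms(1,2)] assms(3) by (intro real_le_rsqrt) linarith

text \<open>
  The part of the cone over the ball in which \<open>1 - r < |z| < 1\<close> has volume comparable to
  \<open>r\<close> times the measure of the ball, and it lies in a cylinder of widths proportional to
  \<open>r\<close> and \<open>\<surd>r\<close>, whose volume is proportional to
  \<open>r\<^sup>n\<^sup>+\<^sup>1\<close>.
\<close>
lemma emeasure_nonisotropic_ball_upper:
  "\<exists>C>0. \<forall>\<zeta> :: complex ^ 'n. norm \<zeta> = 1 \<longrightarrow> (\<forall>r>0. emeasure dir_measure (nonisotropic_ball \<zeta> r) \<le> ennreal (C * r ^ CARD('n)))"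
proof -
  define n where "n = CARD('n)"
  have n: "1 \<le> n" by (simp add: n_def Suc_leI)
  define V where "V = unit_vol TYPE('n)"
  define j :: 'n where "j = undefined"
  define W where "W = cyl_vol TYPE('n) j"
  have VW: "0 < V" "0 < W" using unit_vol_pos[where 'n = 'n] cyl_vol(3)[of j] by (auto simp: V_def W_def)
  define C where "C = max 1 (4 * 9 ^ (n - 1) * W / V)"
  have "emeasure dir_measure (nonisotropic_ball \<zeta> r) \<le> ennreal (C * r ^ n)" if \<zeta>: "norm \<zeta> = 1" and r: "0 < r" for \<zeta> :: "complex ^ 'n" and r
  proof (cases "r < 1")
    case False
    have "emeasure dir_measure (nonisotropic_ball \<zeta> r) \<le> emeasure (dir_measure :: (complex ^ 'n) measure) UNIV"
      by (rule emeasure_mono) (auto simp: sets_dir_measure)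
    also have "\<dots> \<le> ennreal (C * r ^ n)"
      using False mult_mono[of 1 C 1 "r ^ n"] by (simp add: emeasure_dir_measure_UNIV C_def)
    finally show ?thesis .
  next
    case True
    interpret D: finite_measure "dir_measure :: (complex ^ 'n) measure" by (rule finite_measure_dir_measure)
    let ?B = "nonisotropic_ball \<zeta> r"
    define b where "b = measure dir_measure ?B"
    have b: "emeasure dir_measure ?B = ennreal b" "0 \<le> b" by (auto simp: b_def D.emeasure_eq_measure)
    let ?A = "{z. norm (hermitian z \<zeta> - 1) < 2 * r \<and> norm (orth_part \<zeta> z) < 3 * sqrt r}"
    have "{z. 1 - r < norm z \<and> norm z < 1 \<and> dir z \<in> ?B} \<subseteq> ?A"
    proof
      fix z assume z: "z \<in> {z. 1 - r < norm z \<and> norm z < 1 \<and> dir z \<in> ?B}"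
      have "norm (1 - hermitian (dir z) \<zeta>) < r"
        using z by (simp add: nonisotropic_ball_def norm_one_minus_hermitian_commute[of "dir z"])
      then have h: "norm (1 - hermitian z \<zeta>) < 2 * r" using hermitian_dir(2)[OF \<zeta>, of z] z by simp
      have "norm (orth_part \<zeta> z) \<le> sqrt (2 * (2 * r))"
        by (rule norm_orth_part_le_sqrt[OF \<zeta>]) (use z h in auto)
      also have "\<dots> = 2 * sqrt r" using real_sqrt_mult[of 4 r] by simp
      also have "\<dots> < 3 * sqrt r" using r by simp
      finally show "z \<in> ?A" using h by (simp add: norm_minus_commute)
    qed
    moreover have "?A \<in> sets lborel"
    proof -
      have "open ?A" unfolding orth_part_def by (intro open_Collect_conj open_Collect_less continuous_intros)
      then show ?thesis by simp
    qed
    ultimately have "emeasure lborel {z. 1 - r < norm z \<and> norm z < 1 \<and> dir z \<in> ?B} \<le> emeasure lborel ?A"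
      by (rule emeasure_mono)
    then have le1: "ennreal ((1 - (1 - r) ^ (2 * n)) * V) * ennreal b \<le> ennreal ((2 * r)\<^sup>2 * (3 * sqrt r) ^ (2 * n - 2) * W)"
      using r True shell_cone[OF nonisotropic_ball_borel, of "1 - r" \<zeta> r]
        emeasure_cylinder[OF \<zeta>, of "2 * r" "3 * sqrt r" 1 j]
      by (simp add: b n_def V_def W_def)
    have le2: "(3 * sqrt r) ^ (2 * n - 2) = 9 ^ (n - 1) * r ^ (n - 1)"
    proof -
      have "2 * n - 2 = 2 * (n - 1)" by simp
      then show ?thesis using r by (simp add: power_mult power_mult_distrib)
    qed
    have "r \<le> 1 - (1 - r) ^ (2 * n)"
    proof -
      have "(1 - r) ^ (2 * n) \<le> (1 - r) ^ 1" using r True n by (intro power_decreasing) auto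
      then show ?thesis by simp
    qed
    then have "r * V * b \<le> (1 - (1 - r) ^ (2 * n)) * V * b"
      using VW b by (intro mult_right_mono) auto
    then have "ennreal (r * V * b) \<le> ennreal ((1 - (1 - r) ^ (2 * n)) * V * b)" by (rule ennreal_leI)
    also have "ennreal ((1 - (1 - r) ^ (2 * n)) * V * b) = ennreal ((1 - (1 - r) ^ (2 * n)) * V) * ennreal b"
      using b(2) by (rule ennreal_mult'')
    also note le1
    finally have "ennreal (r * V * b) \<le> ennreal ((2 * r)\<^sup>2 * (9 ^ (n - 1) * r ^ (n - 1)) * W)"
      unfolding le2 .
    then have "r * V * b \<le> (2 * r)\<^sup>2 * (9 ^ (n - 1) * r ^ (n - 1)) * W"
      using VW r by (subst (asm) ennreal_le_iff) auto
    also have "\<dots> = r * (4 * 9 ^ (n - 1) * W * (r * r ^ (n - 1)))" by (simp add: power2_eq_square)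
    also have "r * r ^ (n - 1) = r ^ n" using n by (cases n) auto
    finally have "V * b \<le> 4 * 9 ^ (n - 1) * W * r ^ n" using r by simp
    then have "b \<le> (4 * 9 ^ (n - 1) * W / V) * r ^ n" using VW by (simp add: field_simps)
    also have "\<dots> \<le> C * r ^ n" using r by (intro mult_right_mono) (auto simp: C_def)
    finally show ?thesis unfolding b by (rule ennreal_leI)
  qed
  moreover have "0 < C" by (simp add: C_def)
  ultimately show ?thesis unfolding n_def by blast
qed

text \<open>
  Conversely, a cylinder of widths proportional to \<open>r\<close> and \<open>\<surd>r\<close> lies in
  such a truncated cone.
\<close>
lemma emeasure_nonisotropic_ball_lower:
  "\<exists>c>0. \<forall>\<zeta> :: complex ^ 'n. norm \<zeta> = 1 \<longrightarrow> (\<forall>r>0. ennreal (c * min r 1 ^ CARD('n)) \<le> emeasure dir_measure (nonisotropic_ball \<zeta> r))"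
proof -
  define n where "n = CARD('n)"
  have n: "1 \<le> n" by (simp add: n_def Suc_leI)
  define V where "V = unit_vol TYPE('n)"
  define j :: 'n where "j = undefined"
  define W where "W = cyl_vol TYPE('n) j"
  have VW: "0 < V" "0 < W" using unit_vol_pos[where 'n = 'n] cyl_vol(3)[of j] by (auto simp: V_def W_def)
  define c where "c = W / (64 * 16 ^ (n - 1) * (2 * n * V))"
  have c: "0 < c" using VW n by (simp add: c_def)
  have main: "ennreal (c * r ^ n) \<le> emeasure dir_measure (nonisotropic_ball \<zeta> r)" if \<zeta>: "norm \<zeta> = 1" and r: "0 < r" "r < 1" for \<zeta> :: "complex ^ 'n" and r
  proof -
    interpret D: finite_measure "dir_measure :: (complex ^ 'n) measure" by (rule finite_measure_dir_measure)
    let ?B = "nonisotropic_ball \<zeta> r"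
    define b where "b = measure dir_measure ?B"
    have b: "emeasure dir_measure ?B = ennreal b" "0 \<le> b" by (auto simp: b_def D.emeasure_eq_measure)
    let ?A = "{z. norm (hermitian z \<zeta> - of_real (1 - r / 4)) < r / 8 \<and> norm (orth_part \<zeta> z) < sqrt r / 4}"
    let ?S = "{z. 1 - r < norm z \<and> norm z < 1 \<and> dir z \<in> ?B}"
    have "?A \<subseteq> ?S"
    proof
      fix z assume z: "z \<in> ?A"
      let ?h = "hermitian z \<zeta>"
      have nr: "norm (complex_of_real (1 - r / 4)) = 1 - r / 4" by (subst norm_of_real) (use r in simp)
      have h1: "norm ?h < 1 - r / 8" using norm_triangle_ineq2[of ?h "of_real (1 - r / 4)"] z nr by simp
      have h2: "1 - 3 * r / 8 < norm ?h"
        using norm_triangle_ineq2[of "of_real (1 - r / 4)" ?h] z nr by (simp add: norm_minus_commute)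
      have "norm (of_real (1 - r/4) - ?h) < r / 8" using z by (simp add: norm_minus_commute)
      moreover have "norm (1 - complex_of_real (1 - r / 4)) = r / 4"
      proof -
        have "1 - complex_of_real (1 - r / 4) = of_real (r / 4)" by simp
        then show ?thesis by (simp only: norm_of_real) (use r in simp)
      qed
      ultimately have h3: "norm (1 - ?h) < 3 * r / 8"
        using norm_triangle_ineq[of "1 - complex_of_real (1 - r / 4)" "of_real (1 - r / 4) - ?h"] by simp
      have "(norm ?h)\<^sup>2 \<le> (1 - r / 8)\<^sup>2" using h1 by (intro power_mono) auto
      moreover have "(norm (orth_part \<zeta> z))\<^sup>2 \<le> (sqrt r / 4)\<^sup>2" using z by (intro power_mono) auto
      moreover have "(sqrt r / 4)\<^sup>2 = r / 16" using r by (simp add: power_divide)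
      moreover have "(1 - r / 8)\<^sup>2 = 1 - r / 4 + r * r / 64" by (simp add: power2_eq_square field_simps)
      moreover have "r * r < r * 1" using r by (intro mult_strict_left_mono) auto
      ultimately have "(norm z)\<^sup>2 < 1" using orth_part_pythagoras[OF \<zeta>, of z] r by linarith
      then have z1: "norm z < 1" by (simp add: power2_less_1_iff abs_square_less_1)
      have z2: "1 - 3 * r / 8 < norm z" using h2 hermitian_Cauchy_Schwarz[of z \<zeta>] \<zeta> by simp
      then have "z \<noteq> 0" using r by auto
      moreover have "norm (1 - hermitian (dir z) \<zeta>) < r"
        using hermitian_dir(1)[OF \<zeta>, of z] h3 z1 z2 r by simp
      ultimately show "z \<in> ?S"
        using z1 z2 r by (simp add: nonisotropic_ball_def norm_dir norm_one_minus_hermitian_commute[of \<zeta>])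
    qed
    moreover have "?S \<in> sets lborel"
    proof -
      have "?S = (ball 0 1 - cball 0 (1 - r)) \<inter> (dir -` ?B \<inter> space borel)" by auto
      then show ?thesis using measurable_sets[OF borel_measurable_dir nonisotropic_ball_borel[of \<zeta> r]] by auto
    qed
    ultimately have "emeasure lborel ?A \<le> emeasure lborel ?S" by (rule emeasure_mono)
    then have "ennreal ((r / 8)\<^sup>2 * (sqrt r / 4) ^ (2 * n - 2) * W) \<le> ennreal ((1 - (1 - r) ^ (2 * n)) * V) * ennreal b"
      using r shell_cone[OF nonisotropic_ball_borel, of "1 - r" \<zeta> r]
        emeasure_cylinder[OF \<zeta>, of "r / 8" "sqrt r / 4" "of_real (1 - r / 4)" j]
      by (simp add: b n_def V_def W_def)
    moreover have "(1 - r) ^ (2 * n) \<le> 1" using r by (simp add: power_le_one)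
    ultimately have "(r / 8)\<^sup>2 * (sqrt r / 4) ^ (2 * n - 2) * W \<le> (1 - (1 - r) ^ (2 * n)) * V * b"
      using VW b by (simp add: ennreal_mult[symmetric])
    also have "\<dots> \<le> (2 * n * r) * V * b"
    proof -
      have "1 + real (2 * n) * (- r) \<le> (1 + (- r)) ^ (2 * n)" using r by (intro Bernoulli_inequality) auto
      then show ?thesis using VW b by (intro mult_right_mono) auto
    qed
    also have "(sqrt r / 4) ^ (2 * n - 2) = r ^ (n - 1) / 16 ^ (n - 1)"
    proof -
      have "2 * n - 2 = 2 * (n - 1)" by simp
      then show ?thesis using r by (simp add: power_mult power_divide)
    qed
    finally have le: "(r / 8)\<^sup>2 * (r ^ (n - 1) / 16 ^ (n - 1)) * W \<le> (2 * n * r) * V * b" .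
    have "r ^ n = r * r ^ (n - 1)" using n by (cases n) auto
    then have "c * r ^ n = (r / 8)\<^sup>2 * (r ^ (n - 1) / 16 ^ (n - 1)) * W / ((2 * n * r) * V)"
      using r VW n by (simp add: c_def power2_eq_square field_simps)
    also have "\<dots> \<le> b" using le r VW n by (simp add: divide_le_eq mult_ac)
    finally show ?thesis unfolding b by (rule ennreal_leI)
  qed
  have "ennreal ((c / 2 ^ n) * min r 1 ^ n) \<le> emeasure dir_measure (nonisotropic_ball \<zeta> r)" if \<zeta>: "norm \<zeta> = 1" and r: "0 < r" for \<zeta> :: "complex ^ 'n" and r
  proof -
    have "(c / 2 ^ n) * min r 1 ^ n = c * (min r 1 / 2) ^ n" by (simp add: power_divide)
    also have "ennreal \<dots> \<le> emeasure dir_measure (nonisotropic_ball \<zeta> (min r 1 / 2))"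
      by (rule main[OF \<zeta>]) (use r in auto)
    also have "\<dots> \<le> emeasure dir_measure (nonisotropic_ball \<zeta> r)"
      by (rule emeasure_mono)
         (use r in \<open>auto simp: nonisotropic_ball_def sets_dir_measure nonisotropic_ball_borel[unfolded nonisotropic_ball_def]\<close>)
    finally show ?thesis .
  qed
  moreover have "0 < c / 2 ^ n" using c by simp
  ultimately show ?thesis unfolding n_def by blast
qed

section \<open>Mean value inequalities\<close>

lemma pred_ball [measurable (raw)]:
  fixes f :: "'a \<Rightarrow> 'b::euclidean_space"
  assumes [measurable]: "f \<in> borel_measurable M"
  shows "Measurable.pred M (\<lambda>x. f x \<in> ball a d)"
  unfolding mem_ball by measurable

lemma line_holomorphic_borel:
  fixes g :: "complex ^ 'n \<Rightarrow> complex"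
  assumes "line_holomorphic g"
  shows "(\<lambda>x. if x \<in> ball 0 1 then g x else 0) \<in> borel_measurable borel"
  using assms by (intro borel_measurable_continuous_on_if) (auto simp: line_holomorphic_def)

lemma norm_integral_le_nn_integral:
  fixes F :: "real \<Rightarrow> complex"
  assumes cont: "continuous_on {u..v} F"
  shows "ennreal (norm (integral {u..v} F)) \<le> (\<integral>\<^sup>+t\<in>{u..v}. ennreal (norm (F t)) \<partial>lborel)"
proof -
  have le: "norm (integral {u..v} F) \<le> integral {u..v} (\<lambda>t. norm (F t))"
    by (rule integral_norm_bound_integral) (auto intro!: integrable_continuous_interval continuous_on_norm cont)
  have "set_integrable lborel {u..v} (\<lambda>t. norm (F t))"
    unfolding set_integrable_def by (intro borel_integrable_compact continuous_on_norm cont) auto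
  then have "integral {u..v} (\<lambda>t. norm (F t)) = (\<integral>t. indicator {u..v} t *\<^sub>R norm (F t) \<partial>lborel)"
    and int: "integrable lborel (\<lambda>t. indicator {u..v} t *\<^sub>R norm (F t))"
    using set_borel_integral_eq_integral(2)[of "{u..v}" "\<lambda>t. norm (F t)"]
    by (auto simp: set_lebesgue_integral_def set_integrable_def)
  then have "ennreal (norm (integral {u..v} F)) \<le> ennreal (\<integral>t. indicator {u..v} t *\<^sub>R norm (F t) \<partial>lborel)"
    using le by (simp add: ennreal_leI)
  also have "\<dots> = (\<integral>\<^sup>+t. ennreal (indicator {u..v} t *\<^sub>R norm (F t)) \<partial>lborel)"
    by (rule nn_integral_eq_integral[OF int, symmetric]) auto
  also have "\<dots> = (\<integral>\<^sup>+t\<in>{u..v}. ennreal (norm (F t)) \<partial>lborel)"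
    by (intro nn_integral_cong) (auto simp: indicator_def)
  finally show ?thesis .
qed

lemma circle_mean_le:
  assumes "\<phi> holomorphic_on ball 0 R" "1 < R"
  shows "ennreal (norm (\<phi> 0)) \<le> (\<integral>\<^sup>+t\<in>{0..1}. ennreal (norm (\<phi> (exp (2 * of_real pi * \<i> * of_real t)))) \<partial>lborel)"
proof -
  let ?e = "\<lambda>t. exp (2 * of_real pi * \<i> * of_real t) :: complex"
  have ne: "norm (?e t) = 1" for t by simp
  have cont: "continuous_on {0..1} (\<lambda>t. \<phi> (?e t))"
  proof -
    have "continuous_on (?e ` {0..1}) \<phi>"
      using assms by (intro continuous_on_subset[OF holomorphic_on_imp_continuous_on[OF assms(1)]]) auto
    moreover have "continuous_on {0..1} ?e" by (intro continuous_intros)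
    ultimately have "continuous_on {0..1} (\<phi> \<circ> ?e)" by (intro continuous_on_compose)
    then show ?thesis by (simp add: o_def)
  qed
  have "((\<lambda>u. \<phi> u / (u - 0)) has_contour_integral (2 * of_real pi * \<i>) * \<phi> 0) (circlepath 0 1)"
  proof (rule Cauchy_integral_circlepath)
    show "continuous_on (cball 0 1) \<phi>"
      using assms by (intro continuous_on_subset[OF holomorphic_on_imp_continuous_on[OF assms(1)]]) auto
    show "\<phi> holomorphic_on ball 0 1" using assms by (intro holomorphic_on_subset[OF assms(1)]) auto
  qed simp
  then have "((\<lambda>t. \<phi> (circlepath 0 1 t) / circlepath 0 1 t * vector_derivative (circlepath 0 1) (at t within {0..1})) has_integral (2 * of_real pi * \<i>) * \<phi> 0) {0..1}"
    by (simp add: has_contour_integral_def)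
  then have "((\<lambda>t. 2 * of_real pi * \<i> * \<phi> (?e t)) has_integral (2 * of_real pi * \<i>) * \<phi> 0) {0..1}"
  proof (rule has_integral_eq[rotated])
    fix t :: real assume t: "t \<in> {0..1}"
    show "\<phi> (circlepath 0 1 t) / circlepath 0 1 t * vector_derivative (circlepath 0 1) (at t within {0..1}) = 2 * of_real pi * \<i> * \<phi> (?e t)"
    proof -
      have vd: "vector_derivative (circlepath 0 1) (at t within {0..1}) = 2 * of_real pi * \<i> * ?e t"
        using t by (simp add: vector_derivative_circlepath01)
      show ?thesis unfolding vd by (simp add: circlepath mult_ac)
    qed
  qed
  from has_integral_mult_right[OF this, of "1 / (2 * of_real pi * \<i>)"]
  have "((\<lambda>t. \<phi> (?e t)) has_integral \<phi> 0) {0..1}" by simp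
  then have "integral {0..1} (\<lambda>t. \<phi> (?e t)) = \<phi> 0" by (rule integral_unique)
  then show ?thesis using norm_integral_le_nn_integral[OF cont] by simp
qed

text \<open>
  The mean value property on the circles \<open>x + e\<^sup>i\<^sup>\<theta> v\<close> for each
  \<open>v\<close>, integrated over \<open>v\<close> in the ball, which is invariant under these rotations.
\<close>
lemma ball_mean_le:
  fixes h :: "complex ^ 'n \<Rightarrow> complex"
  assumes h: "line_holomorphic h" and d: "0 < d" and sub: "norm x + d \<le> 1"
  shows "ennreal (norm (h x)) * emeasure lborel (ball (0 :: complex ^ 'n) d) \<le> (\<integral>\<^sup>+y\<in>ball x d. ennreal (norm (h y)) \<partial>lborel)"
proof -
  let ?e = "\<lambda>t. exp (2 * of_real pi * \<i> * of_real t) :: complex"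
  define k where "k y = (if y \<in> ball 0 1 then h y else 0)" for y
  have [measurable]: "k \<in> borel_measurable borel" unfolding k_def[abs_def] by (rule line_holomorphic_borel[OF h])
  have k: "k y = h y" if "norm (y - x) < d" for y
    using norm_triangle_ineq[of x "y - x"] that sub by (auto simp: k_def)
  have [measurable]: "(\<lambda>p. x + ?e (snd p) *s fst p) \<in> borel_measurable (borel \<Otimes>\<^sub>M borel)"
  proof -
    have "(\<lambda>p :: (complex ^ 'n) \<times> real. x + ?e (snd p) *s fst p) \<in> borel_measurable borel"
    proof (intro borel_measurable_continuous_onI continuous_on_add continuous_on_const)
      show "continuous_on UNIV (\<lambda>p :: (complex ^ 'n) \<times> real. ?e (snd p) *s fst p)"
        unfolding vector_scalar_mult_def by (intro continuous_intros)
    qed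
    then show ?thesis by (simp add: borel_prod)
  qed
  have [measurable]: "(\<lambda>p. x + ?e (fst p) *s snd p) \<in> borel_measurable (borel \<Otimes>\<^sub>M borel)"
  proof -
    have "(\<lambda>p :: real \<times> (complex ^ 'n). x + ?e (fst p) *s snd p) \<in> borel_measurable borel"
    proof (intro borel_measurable_continuous_onI continuous_on_add continuous_on_const)
      show "continuous_on UNIV (\<lambda>p :: real \<times> (complex ^ 'n). ?e (fst p) *s snd p)"
        unfolding vector_scalar_mult_def by (intro continuous_intros)
    qed
    then show ?thesis by (simp add: borel_prod)
  qed
  have pt: "ennreal (norm (h x)) \<le> (\<integral>\<^sup>+t\<in>{0..1}. ennreal (norm (k (x + ?e t *s v))) \<partial>lborel)" if v: "v \<in> ball 0 d" for v
  proof -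
    define R where "R = (if v = 0 then 2 else d / norm v)"
    have R: "1 < R" using v d by (simp add: R_def)
    have "(\<lambda>c. h (x + c *s v)) holomorphic_on ball 0 R"
    proof (rule line_holomorphicD[OF h])
      fix c :: complex assume c: "c \<in> ball 0 R"
      have "norm (c *s v) < d" using c v d by (cases "v = 0") (simp_all add: norm_vector_smult R_def field_simps)
      then show "norm (x + c *s v) < 1" using norm_triangle_ineq[of x "c *s v"] sub by simp
    qed
    from circle_mean_le[OF this R]
    have "ennreal (norm (h x)) \<le> (\<integral>\<^sup>+t\<in>{0..1}. ennreal (norm (h (x + ?e t *s v))) \<partial>lborel)" by simp
    also have "\<dots> = (\<integral>\<^sup>+t\<in>{0..1}. ennreal (norm (k (x + ?e t *s v))) \<partial>lborel)"
      using v by (intro nn_integral_cong) (simp add: k norm_vector_smult)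
    finally show ?thesis .
  qed
  have "ennreal (norm (h x)) * emeasure lborel (ball (0 :: complex ^ 'n) d) = (\<integral>\<^sup>+v. ennreal (norm (h x)) * indicator (ball (0 :: complex ^ 'n) d) v \<partial>lborel)"
    by (rule nn_integral_cmult_indicator[symmetric]) simp
  also have "\<dots> \<le> (\<integral>\<^sup>+v. (\<integral>\<^sup>+t. ennreal (norm (k (x + ?e t *s v))) * indicator {0..1} t * indicator (ball 0 d) v \<partial>lborel) \<partial>lborel)"
    using pt by (intro nn_integral_mono) (auto simp: indicator_def)
  also have "\<dots> = (\<integral>\<^sup>+t. (\<integral>\<^sup>+v. ennreal (norm (k (x + ?e t *s v))) * indicator {0..1} t * indicator (ball 0 d) v \<partial>lborel) \<partial>lborel)"
    by (rule lborel_pair.Fubini', subst measurable_cong_sets[OF sets_pair_measure_cong[OF sets_lborel sets_lborel] refl]) measurable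
  also have "\<dots> = (\<integral>\<^sup>+t. (\<integral>\<^sup>+v\<in>ball 0 d. ennreal (norm (k (x + v))) \<partial>lborel) * indicator {0..1} (t :: real) \<partial>lborel)"
  proof (intro nn_integral_cong)
    fix t :: real
    have m: "(\<lambda>v. ennreal (norm (k (x + v))) * indicator (ball 0 d) v) \<in> borel_measurable borel" by measurable
    have "(\<integral>\<^sup>+v. ennreal (norm (k (x + ?e t *s v))) * indicator {0..1} t * indicator (ball 0 d) v \<partial>lborel)
       = (\<integral>\<^sup>+v. (\<lambda>v. ennreal (norm (k (x + v))) * indicator (ball 0 d) v) (?e t *s v) \<partial>lborel) * indicator {0..1} t"
      by (cases "t \<in> {0..1}") (auto intro!: nn_integral_cong simp: indicator_def norm_vector_smult)
    also have "(\<integral>\<^sup>+v. (\<lambda>v. ennreal (norm (k (x + v))) * indicator (ball 0 d) v) (?e t *s v) \<partial>lborel)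
        = (\<integral>\<^sup>+v\<in>ball 0 d. ennreal (norm (k (x + v))) \<partial>lborel)"
      by (rule nn_integral_lborel_rotate[OF m]) simp
    finally show "(\<integral>\<^sup>+v. ennreal (norm (k (x + ?e t *s v))) * indicator {0..1} t * indicator (ball 0 d) v \<partial>lborel)
        = (\<integral>\<^sup>+v\<in>ball 0 d. ennreal (norm (k (x + v))) \<partial>lborel) * indicator {0..1} t" .
  qed
  also have "\<dots> = (\<integral>\<^sup>+v\<in>ball 0 d. ennreal (norm (k (x + v))) \<partial>lborel)"
    by (simp add: nn_integral_cmult)
  also have "\<dots> = (\<integral>\<^sup>+v. (\<lambda>y. ennreal (norm (k y)) * indicator (ball x d) y) (x + v) \<partial>lborel)"
    by (intro nn_integral_cong) (auto simp: indicator_def dist_norm)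
  also have "\<dots> = (\<integral>\<^sup>+y. ennreal (norm (k y)) * indicator (ball x d) y \<partial>lborel)"
    by (rule nn_integral_lborel_translate) measurable
  also have "\<dots> = (\<integral>\<^sup>+y\<in>ball x d. ennreal (norm (h y)) \<partial>lborel)"
    by (intro nn_integral_cong) (auto simp: indicator_def k dist_norm norm_minus_commute)
  finally show ?thesis .
qed

lemma emeasure_ball_scale:
  assumes "0 < d"
  shows "emeasure lborel (ball (0 :: complex ^ 'n) d) = ennreal (unit_vol TYPE('n) * d ^ (2 * CARD('n)))"
proof -
  have "emeasure lborel {z :: complex ^ 'n. norm z < d \<and> dir z \<in> UNIV} = ennreal (d ^ (2 * CARD('n))) * emeasure lborel {z :: complex ^ 'n. norm z < 1 \<and> dir z \<in> UNIV}"
    by (rule cone_scale[OF _ assms]) simp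
  moreover have "{z :: complex ^ 'n. norm z < r \<and> dir z \<in> UNIV} = ball 0 r" for r by auto
  ultimately show ?thesis
    using assms unit_vol_pos[where 'n = 'n] by (simp add: emeasure_unit_ball ennreal_mult[symmetric] mult.commute)
qed

text \<open>
  Hardy and Littlewood's device. For \<open>\<epsilon> \<ge> 1\<close> the values of \<open>|h|\<close>
  below half of \<open>|h(0)|\<close> are absorbed, and on the others \<open>|h|\<close> is at most a
  multiple of its power. For \<open>\<epsilon> < 1\<close> the ordinary mean value inequality is applied at
  a point where \<open>|h(y)| (1 - |y|)\<^sup>D\<^sup>/\<^sup>\<epsilon>\<close> is maximal, with
  \<open>D\<close> the real dimension: around it \<open>|h|\<close> is at most a multiple of its value
  there, so that \<open>|h|\<close> can be replaced by \<open>|h|\<^sup>\<epsilon>\<close>.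
\<close>
lemma power_mean_le:
  assumes \<epsilon>: "0 < \<epsilon>"
  shows "\<exists>C>0. \<forall>h :: complex ^ 'n \<Rightarrow> complex. line_holomorphic h \<longrightarrow> continuous_on (cball 0 1) h \<longrightarrow>
     ennreal (norm (h 0) powr \<epsilon>) \<le> ennreal C * (\<integral>\<^sup>+v\<in>ball 0 1. ennreal (norm (h v) powr \<epsilon>) \<partial>lborel)"
proof -
  define V where "V = unit_vol TYPE('n)"
  have V: "0 < V" unfolding V_def by (rule unit_vol_pos)
  define D where "D = 2 * CARD('n)"
  have D: "0 < D" by (simp add: D_def)
  have key: "ennreal a \<le> ennreal C * X" if "0 < b" "ennreal (b * a) \<le> X" "1 \<le> C * b" "0 \<le> a" "0 \<le> C" for a b C X
  proof -
    have "ennreal a \<le> ennreal ((C * b) * a)" using mult_right_mono[OF that(3,4)] by (intro ennreal_leI) simp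
    also have "\<dots> = ennreal C * ennreal (b * a)" using that by (simp add: ennreal_mult[symmetric] mult.assoc)
    also have "\<dots> \<le> ennreal C * X" using that by (intro mult_left_mono) auto
    finally show ?thesis .
  qed
  show ?thesis
  proof (cases "1 \<le> \<epsilon>")
    case True
    have "ennreal (norm (h 0) powr \<epsilon>) \<le> ennreal (2 powr \<epsilon> / V) * (\<integral>\<^sup>+v\<in>ball 0 1. ennreal (norm (h v) powr \<epsilon>) \<partial>lborel)"
      if h: "line_holomorphic h" for h :: "complex ^ 'n \<Rightarrow> complex"
    proof (cases "h 0 = 0")
      case False
      define k where "k y = (if y \<in> ball 0 1 then h y else 0)" for y
      have [measurable]: "k \<in> borel_measurable borel" unfolding k_def[abs_def] by (rule line_holomorphic_borel[OF h])
      define lam where "lam = norm (h 0) / 2"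
      have l: "0 < lam" using False by (simp add: lam_def)
      have h0: "norm (h 0) = 2 * lam" by (simp add: lam_def)
      have pt: "norm (h v) \<le> lam + lam powr (1 - \<epsilon>) * norm (h v) powr \<epsilon>" for v
      proof (cases "norm (h v) \<le> lam")
        case False
        have "norm (h v) = norm (h v) powr (1 - \<epsilon>) * norm (h v) powr \<epsilon>"
          using False l by (simp add: powr_add[symmetric])
        also have "norm (h v) powr (1 - \<epsilon>) \<le> lam powr (1 - \<epsilon>)"
          using False l True by (intro powr_mono2') auto
        finally show ?thesis using l by (simp add: mult_right_mono)
      qed (use l in \<open>simp add: add_increasing2\<close>)
      let ?X = "\<integral>\<^sup>+v\<in>ball 0 1. ennreal (norm (h v) powr \<epsilon>) \<partial>lborel"
      have "ennreal (norm (h 0)) * emeasure lborel (ball (0 :: complex ^ 'n) 1) \<le> (\<integral>\<^sup>+y\<in>ball 0 1. ennreal (norm (h y)) \<partial>lborel)"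
        by (rule ball_mean_le[OF h]) auto
      also have "\<dots> \<le> (\<integral>\<^sup>+y. ennreal lam * indicator (ball 0 1) y + ennreal (lam powr (1 - \<epsilon>)) * (ennreal (norm (k y) powr \<epsilon>) * indicator (ball 0 1) y) \<partial>lborel)"
      proof (rule nn_integral_mono)
        fix y :: "complex ^ 'n"
        have "ennreal (norm (h y)) \<le> ennreal lam + ennreal (lam powr (1 - \<epsilon>)) * ennreal (norm (h y) powr \<epsilon>)"
          using ennreal_leI[OF pt[of y]] l by (simp add: ennreal_mult)
        then show "ennreal (norm (h y)) * indicator (ball 0 1) y \<le> ennreal lam * indicator (ball 0 1) y + ennreal (lam powr (1 - \<epsilon>)) * (ennreal (norm (k y) powr \<epsilon>) * indicator (ball 0 1) y)"
          by (auto simp: indicator_def k_def)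
      qed
      also have "\<dots> = ennreal lam * emeasure lborel (ball (0 :: complex ^ 'n) 1) + ennreal (lam powr (1 - \<epsilon>)) * (\<integral>\<^sup>+y\<in>ball 0 1. ennreal (norm (k y) powr \<epsilon>) \<partial>lborel)"
        by (simp add: nn_integral_add nn_integral_cmult nn_integral_cmult_indicator)
      also have "(\<integral>\<^sup>+y\<in>ball 0 1. ennreal (norm (k y) powr \<epsilon>) \<partial>lborel) = ?X"
        by (intro nn_integral_cong) (auto simp: indicator_def k_def)
      finally have "ennreal (2 * lam * V) \<le> ennreal (lam * V) + ennreal (lam powr (1 - \<epsilon>)) * ?X"
        using l V h0 by (simp add: emeasure_unit_ball V_def[symmetric] ennreal_mult)
      moreover have "ennreal (2 * lam * V) = ennreal (lam * V) + ennreal (lam * V)"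
        using l V by (simp add: ennreal_plus[symmetric] del: ennreal_plus)
      ultimately have le: "ennreal (lam * V) \<le> ennreal (lam powr (1 - \<epsilon>)) * ?X"
        by (simp add: ennreal_add_left_cancel_le)
      have "ennreal (lam powr (\<epsilon> - 1)) * ennreal (lam * V) \<le> ennreal (lam powr (\<epsilon> - 1)) * (ennreal (lam powr (1 - \<epsilon>)) * ?X)"
        by (rule mult_left_mono[OF le]) simp
      also have "\<dots> = ?X" using l by (simp add: mult.assoc[symmetric] ennreal_mult[symmetric] powr_add[symmetric])
      also have "ennreal (lam powr (\<epsilon> - 1)) * ennreal (lam * V) = ennreal (V * lam powr \<epsilon>)"
        using l V by (simp add: ennreal_mult[symmetric] powr_diff)
      finally have "ennreal (V / 2 powr \<epsilon> * norm (h 0) powr \<epsilon>) \<le> ?X"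
        by (simp add: lam_def powr_divide)
      then show ?thesis by (rule key[rotated]) (use V in auto)
    qed (use \<epsilon> in simp)
    then show ?thesis using V by (intro exI[of _ "2 powr \<epsilon> / V"]) auto
  next
    case False
    define C where "C = 2 ^ D * 2 powr (D / \<epsilon> * (1 - \<epsilon>)) / V"
    have C: "0 < C" using V by (simp add: C_def)
    have "ennreal (norm (h 0) powr \<epsilon>) \<le> ennreal C * (\<integral>\<^sup>+v\<in>ball 0 1. ennreal (norm (h v) powr \<epsilon>) \<partial>lborel)"
      if h: "line_holomorphic h" and cont: "continuous_on (cball 0 1) h" for h :: "complex ^ 'n \<Rightarrow> complex"
    proof (cases "h 0 = 0")
      case h0: False
      define k where "k y = (if y \<in> ball 0 1 then h y else 0)" for y
      have [measurable]: "k \<in> borel_measurable borel" unfolding k_def[abs_def] by (rule line_holomorphic_borel[OF h])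
      let ?X = "\<integral>\<^sup>+v\<in>ball 0 1. ennreal (norm (h v) powr \<epsilon>) \<partial>lborel"
      have "\<exists>z1\<in>cball 0 1. \<forall>y\<in>cball 0 1. norm (h y) * (1 - norm y) powr (D / \<epsilon>) \<le> norm (h z1) * (1 - norm z1) powr (D / \<epsilon>)"
      proof (rule continuous_attains_sup)
        show "continuous_on (cball 0 1) (\<lambda>y. norm (h y) * (1 - norm y) powr (D / \<epsilon>))"
          by (rule continuous_on_mult[OF continuous_on_norm[OF cont]], rule continuous_on_powr')
             (use \<epsilon> D in \<open>auto intro!: continuous_intros\<close>)
      qed auto
      then obtain z1 where z1: "norm z1 \<le> 1" and max: "\<And>y. norm y \<le> 1 \<Longrightarrow> norm (h y) * (1 - norm y) powr (D / \<epsilon>) \<le> norm (h z1) * (1 - norm z1) powr (D / \<epsilon>)"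
        by auto
      have m0: "norm (h 0) \<le> norm (h z1) * (1 - norm z1) powr (D / \<epsilon>)" using max[of 0] by simp
      then have z1': "norm z1 < 1" "h z1 \<noteq> 0" using h0 z1 by (auto simp: order_le_less)
      define d where "d = (1 - norm z1) / 2"
      have d: "0 < d" "norm z1 + d \<le> 1" "1 - norm z1 = 2 * d" using z1' by (auto simp: d_def field_simps)
      have pt: "norm (h y) \<le> (2 powr (D / \<epsilon>) * norm (h z1)) powr (1 - \<epsilon>) * norm (h y) powr \<epsilon>" if y: "y \<in> ball z1 d" for y
      proof (cases "h y = 0")
        case False
        have "norm y \<le> norm z1 + d" using norm_triangle_ineq2[of y z1] y by (simp add: dist_norm norm_minus_commute)
        then have dy: "d \<le> 1 - norm y" using d by simp
        have "norm (h y) * d powr (D / \<epsilon>) \<le> norm (h y) * (1 - norm y) powr (D / \<epsilon>)"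
          using dy d \<epsilon> by (intro mult_left_mono powr_mono2) auto
        also have "\<dots> \<le> norm (h z1) * (2 * d) powr (D / \<epsilon>)" using max[of y] dy d by simp
        also have "\<dots> = 2 powr (D / \<epsilon>) * norm (h z1) * d powr (D / \<epsilon>)" using d by (simp add: powr_mult)
        finally have "norm (h y) \<le> 2 powr (D / \<epsilon>) * norm (h z1)" using d by simp
        then have "norm (h y) powr (1 - \<epsilon>) \<le> (2 powr (D / \<epsilon>) * norm (h z1)) powr (1 - \<epsilon>)"
          using \<open>\<not> 1 \<le> \<epsilon>\<close> by (intro powr_mono2) auto
        then have "norm (h y) powr (1 - \<epsilon>) * norm (h y) powr \<epsilon> \<le> (2 powr (D / \<epsilon>) * norm (h z1)) powr (1 - \<epsilon>) * norm (h y) powr \<epsilon>"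
          by (rule mult_right_mono) simp
        then show ?thesis using False by (simp add: powr_add[symmetric])
      qed simp
      let ?K = "(2 powr (D / \<epsilon>) * norm (h z1)) powr (1 - \<epsilon>)"
      have sub: "ball z1 d \<subseteq> ball 0 1"
      proof
        fix y assume "y \<in> ball z1 d"
        then show "y \<in> ball 0 1" using norm_triangle_ineq2[of y z1] d by (simp add: dist_norm norm_minus_commute)
      qed
      have "ennreal (norm (h z1)) * ennreal (V * d ^ D) \<le> (\<integral>\<^sup>+y\<in>ball z1 d. ennreal (norm (h y)) \<partial>lborel)"
        using ball_mean_le[OF h d(1,2)] d(1) by (simp add: emeasure_ball_scale V_def D_def)
      also have "\<dots> \<le> (\<integral>\<^sup>+y. ennreal ?K * (ennreal (norm (k y) powr \<epsilon>) * indicator (ball 0 1) y) \<partial>lborel)"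
      proof (rule nn_integral_mono)
        fix y :: "complex ^ 'n"
        show "ennreal (norm (h y)) * indicator (ball z1 d) y \<le> ennreal ?K * (ennreal (norm (k y) powr \<epsilon>) * indicator (ball 0 1) y)"
        proof (cases "y \<in> ball z1 d")
          case True
          then have y: "y \<in> ball 0 1" using sub by blast
          have "ennreal (norm (h y)) \<le> ennreal ?K * ennreal (norm (h y) powr \<epsilon>)"
            using ennreal_leI[OF pt[OF True]] by (simp add: ennreal_mult)
          then show ?thesis using y True by (simp add: k_def)
        qed simp
      qed
      also have "\<dots> = ennreal ?K * (\<integral>\<^sup>+y\<in>ball 0 1. ennreal (norm (k y) powr \<epsilon>) \<partial>lborel)"
        by (rule nn_integral_cmult) measurable
      also have "(\<integral>\<^sup>+y\<in>ball 0 1. ennreal (norm (k y) powr \<epsilon>) \<partial>lborel) = ?X"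
        by (intro nn_integral_cong) (auto simp: indicator_def k_def)
      finally have le: "ennreal (norm (h z1)) * ennreal (V * d ^ D) \<le> ennreal ?K * ?X" .
      define u where "u = norm (h z1)"
      have u: "0 < u" using z1' by (simp add: u_def)
      define K1 where "K1 = 2 powr (D / \<epsilon> * (1 - \<epsilon>))"
      have K1: "0 < K1" by (simp add: K1_def)
      have K: "?K = K1 * u powr (1 - \<epsilon>)" using u by (simp add: powr_mult powr_powr K1_def u_def)
      have "ennreal (u powr (\<epsilon> - 1)) * (ennreal u * ennreal (V * d ^ D)) \<le> ennreal (u powr (\<epsilon> - 1)) * (ennreal ?K * ?X)"
        using le by (intro mult_left_mono) (auto simp: u_def)
      also have "ennreal (u powr (\<epsilon> - 1)) * (ennreal u * ennreal (V * d ^ D)) = ennreal (V * d ^ D * u powr \<epsilon>)"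
        using u V d by (simp add: ennreal_mult[symmetric] powr_diff)
      also have "ennreal (u powr (\<epsilon> - 1)) * (ennreal ?K * ?X) = ennreal K1 * ?X"
      proof -
        have "u powr (\<epsilon> - 1) * u powr (1 - \<epsilon>) = 1" using u by (simp add: powr_add[symmetric])
        then have "u powr (\<epsilon> - 1) * (K1 * u powr (1 - \<epsilon>)) = K1" by (simp add: mult.left_commute[of _ K1])
        then show ?thesis unfolding K using K1 by (simp only: mult.assoc[symmetric] ennreal_mult[symmetric] powr_ge_zero mult_nonneg_nonneg less_imp_le)
      qed
      finally have "ennreal (V * d ^ D * u powr \<epsilon>) \<le> ennreal K1 * ?X" .
      then have "ennreal (1 / K1) * ennreal (V * d ^ D * u powr \<epsilon>) \<le> ennreal (1 / K1) * (ennreal K1 * ?X)"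
        by (intro mult_left_mono) auto
      also have "\<dots> = ?X" using K1 by (simp add: mult.assoc[symmetric] ennreal_mult[symmetric])
      also have "ennreal (1 / K1) * ennreal (V * d ^ D * u powr \<epsilon>) = ennreal (V / K1 * (d ^ D * u powr \<epsilon>))"
        using K1 V d by (simp add: ennreal_mult[symmetric])
      finally have le2: "ennreal (V / K1 * (d ^ D * u powr \<epsilon>)) \<le> ?X" .
      have "norm (h 0) powr \<epsilon> \<le> (u * (2 * d) powr (D / \<epsilon>)) powr \<epsilon>"
        using m0 d \<epsilon> by (intro powr_mono2) (auto simp: u_def)
      also have "\<dots> = u powr \<epsilon> * (2 * d) powr D" using u d \<epsilon> by (simp add: powr_mult powr_powr)
      also have "\<dots> = 2 ^ D * (d ^ D * u powr \<epsilon>)" using d by (simp add: powr_realpow power_mult_distrib)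
      finally have "V / K1 / 2 ^ D * norm (h 0) powr \<epsilon> \<le> V / K1 / 2 ^ D * (2 ^ D * (d ^ D * u powr \<epsilon>))"
        using V K1 by (intro mult_left_mono) auto
      also have "\<dots> = V / K1 * (d ^ D * u powr \<epsilon>)" by simp
      finally have "ennreal (V / K1 / 2 ^ D * norm (h 0) powr \<epsilon>) \<le> ?X"
        using le2 by (auto intro: order_trans ennreal_leI)
      then show ?thesis by (rule key[rotated]) (use V K1 in \<open>auto simp: C_def K1_def\<close>)
    qed (use \<epsilon> in simp)
    then show ?thesis using C by blast
  qed
qed

text \<open>
  A nonisotropic neighbourhood of \<open>z\<close>: its size is comparable to \<open>1 - |z|\<close> along
  the complex line of \<open>z\<close>, and to the square root of \<open>1 - |z|\<close> in the other
  directions.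
\<close>
definition ellipsoid_box :: "real \<Rightarrow> complex ^ 'n \<Rightarrow> (complex ^ 'n) set" where
  "ellipsoid_box \<delta> z = {x. (1 - 2 * \<delta>) * (1 - norm z) \<le> 1 - norm x \<and> 1 - norm x \<le> (1 + \<delta>) * (1 - norm z)
     \<and> norm (1 - hermitian x (dir z)) \<le> (1 + \<delta>) * (1 - norm z)}"

text \<open>
  The box contains the image of the unit ball under an affine map with dilations \<open>\<delta> (1 -
  |z|)\<close> along the complex line of \<open>z\<close> and \<open>\<delta> \<surd>(1 - |z|)\<close>
  orthogonally to it. Its Jacobian is proportional to \<open>(1 - |z|)\<^sup>n\<^sup>+\<^sup>1\<close>.
\<close>
lemma ellipsoid_mean_le:
  assumes \<epsilon>: "0 < \<epsilon>" and \<delta>: "0 < \<delta>" "\<delta> \<le> 1/4"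
  shows "\<exists>C>0. \<forall>(g :: complex ^ 'n \<Rightarrow> complex) z. line_holomorphic g \<longrightarrow> 1/2 \<le> norm z \<longrightarrow> norm z < 1 \<longrightarrow>
     ennreal (norm (g z) powr \<epsilon>) \<le> ennreal (C / (1 - norm z) ^ (CARD('n) + 1)) * (\<integral>\<^sup>+x\<in>ellipsoid_box \<delta> z. ennreal (norm (g x) powr \<epsilon>) \<partial>lborel)"
proof -
  obtain C where C: "0 < C" and mean: "\<And>h :: complex ^ 'n \<Rightarrow> complex. line_holomorphic h \<Longrightarrow> continuous_on (cball 0 1) h \<Longrightarrow>
     ennreal (norm (h 0) powr \<epsilon>) \<le> ennreal C * (\<integral>\<^sup>+v\<in>ball 0 1. ennreal (norm (h v) powr \<epsilon>) \<partial>lborel)"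
    using power_mean_le[OF \<epsilon>] by blast
  define n where "n = CARD('n)"
  have n: "1 \<le> n" by (simp add: n_def Suc_leI)
  define j :: 'n where "j = undefined"
  have "ennreal (norm (g z) powr \<epsilon>) \<le> ennreal (C / \<delta> ^ (2 * n) / (1 - norm z) ^ (n + 1)) * (\<integral>\<^sup>+x\<in>ellipsoid_box \<delta> z. ennreal (norm (g x) powr \<epsilon>) \<partial>lborel)"
    if g: "line_holomorphic g" and z: "1/2 \<le> norm z" "norm z < 1" for g :: "complex ^ 'n \<Rightarrow> complex" and z
  proof -
    define r where "r = norm z"
    define t where "t = 1 - r"
    define \<eta> where "\<eta> = dir z"
    have r: "1/2 \<le> r" "r < 1" "0 < t" "t \<le> 1/2" "r = 1 - t" using z by (auto simp: r_def t_def)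
    have \<eta>: "norm \<eta> = 1" using z by (auto simp: \<eta>_def intro: norm_dir)
    have z\<eta>: "z = of_real r *s \<eta>" using scaleR_dir[of z] by (simp add: \<eta>_def r_def scaleR_eq_vector_smult)
    have st: "0 < \<delta> * t" "0 < \<delta> * sqrt t" using \<delta> r by auto
    obtain L :: "complex ^ 'n \<Rightarrow> complex ^ 'n" where
      L: "\<And>x y. L (x + y) = L x + L y" "\<And>c x. L (c *s x) = c *s L x"
      "\<And>x. hermitian (L x) \<eta> = of_real (\<delta> * t) * x $ j"
      "\<And>x. norm (orth_part \<eta> (L x)) = (\<delta> * sqrt t) * norm (x - (x $ j) *s axis j 1)"
      "\<And>F. F \<in> borel_measurable borel \<Longrightarrow> (\<integral>\<^sup>+x. F x \<partial>lborel)
         = ennreal ((\<delta> * t)\<^sup>2 * (\<delta> * sqrt t) ^ (2 * CARD('n) - 2)) * (\<integral>\<^sup>+x. F (L x) \<partial>lborel)"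
      by (rule ellipsoid_map[OF \<eta> st, of j]) (rule that)
    have scale: "(\<delta> * t)\<^sup>2 * (\<delta> * sqrt t) ^ (2 * n - 2) = \<delta> ^ (2 * n) * t ^ (n + 1)"
    proof -
      have e: "2 * n - 2 = 2 * (n - 1)" by simp
      have "(\<delta> * t)\<^sup>2 * (\<delta> * sqrt t) ^ (2 * n - 2) = (\<delta>\<^sup>2 * (\<delta>\<^sup>2) ^ (n - 1)) * (t\<^sup>2 * t ^ (n - 1))"
        unfolding e using r by (simp add: power_mult power_mult_distrib)
      also have "\<delta>\<^sup>2 * (\<delta>\<^sup>2) ^ (n - 1) = (\<delta>\<^sup>2) ^ n" using n by (cases n) auto
      also have "t\<^sup>2 * t ^ (n - 1) = t ^ (n + 1)" using n by (cases n) (auto simp: power2_eq_square)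
      finally show ?thesis by (simp add: power_mult)
    qed
    have box: "z + L a \<in> ellipsoid_box \<delta> z \<and> norm (z + L a) < 1" if a: "norm a \<le> 1" for a
    proof -
      let ?x = "z + L a"
      have hx: "hermitian ?x \<eta> = of_real r + of_real (\<delta> * t) * a $ j"
        by (simp add: hermitian_add_left L(3)) (simp add: z\<eta> hermitian_smult_left hermitian_self \<eta>)
      have ox: "orth_part \<eta> ?x = orth_part \<eta> (L a)"
        by (simp add: orth_part_def hermitian_add_left z\<eta> hermitian_smult_left hermitian_self \<eta> vec_eq_iff algebra_simps)
      have py: "(norm a)\<^sup>2 = (norm (a $ j))\<^sup>2 + (norm (a - (a $ j) *s axis j 1))\<^sup>2"
      proof -
        have "hermitian a (axis j 1) = a $ j"
          unfolding hermitian_def by (subst sum.remove[of _ j]) (auto simp: axis_def intro: sum.neutral)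
        then show ?thesis using orth_part_pythagoras[of "axis j 1" a] by (simp add: norm_axis_one orth_part_def)
      qed
      have "(norm a)\<^sup>2 \<le> 1" using a by (simp add: power_le_one)
      then have "(norm (a - (a $ j) *s axis j 1))\<^sup>2 \<le> 1" using py zero_le_power2[of "norm (a $ j)"] by linarith
      then have a': "norm (a - (a $ j) *s axis j 1) \<le> 1" by (simp add: abs_square_le_1)
      have aj: "norm (a $ j) \<le> 1" using Finite_Cartesian_Product.norm_nth_le[of a j] a by simp
      have hj: "norm (of_real (\<delta> * t) * a $ j) \<le> \<delta> * t"
        using aj st by (simp only: norm_mult norm_of_real) (simp add: mult_left_le)
      have nr: "norm (complex_of_real r) = r" unfolding norm_of_real using r(1) by simp
      have up: "norm (hermitian ?x \<eta>) \<le> r + \<delta> * t"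
        unfolding hx using norm_triangle_ineq[of "of_real r" "of_real (\<delta> * t) * a $ j"] hj nr by simp
      have lo: "r - \<delta> * t \<le> norm ?x"
      proof -
        have "r - \<delta> * t \<le> norm (hermitian ?x \<eta>)"
          unfolding hx using norm_diff_ineq[of "of_real r" "of_real (\<delta> * t) * a $ j"] hj nr by simp
        then show ?thesis using hermitian_Cauchy_Schwarz[of ?x \<eta>] \<eta> by simp
      qed
      have hi: "norm ?x \<le> r + 2 * (\<delta> * t)"
      proof -
        have "(norm ?x)\<^sup>2 = (norm (hermitian ?x \<eta>))\<^sup>2 + (norm (orth_part \<eta> ?x))\<^sup>2" by (rule orth_part_pythagoras[OF \<eta>])
        also have "(norm (hermitian ?x \<eta>))\<^sup>2 \<le> (r + \<delta> * t)\<^sup>2" using up by (intro power_mono) auto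
        also have "norm (orth_part \<eta> ?x) \<le> \<delta> * sqrt t" unfolding ox L(4) using a' st by (simp add: mult_left_le)
        then have "(norm (orth_part \<eta> ?x))\<^sup>2 \<le> (\<delta> * sqrt t)\<^sup>2" by (intro power_mono) auto
        also have "(\<delta> * sqrt t)\<^sup>2 = \<delta> * (\<delta> * t)" using r by (simp add: power_mult_distrib power2_eq_square)
        also have "\<dots> \<le> 1 * (\<delta> * t)" using \<delta> st by (intro mult_right_mono) auto
        also have "(r + \<delta> * t)\<^sup>2 + 1 * (\<delta> * t) \<le> (r + 2 * (\<delta> * t))\<^sup>2"
        proof -
          have "(r + 2 * (\<delta> * t))\<^sup>2 - (r + \<delta> * t)\<^sup>2 = (\<delta> * t) * (2 * r) + 3 * (\<delta> * t)\<^sup>2"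
            by (simp add: power2_eq_square algebra_simps)
          moreover have "(\<delta> * t) * 1 \<le> (\<delta> * t) * (2 * r)" using r st by (intro mult_left_mono) auto
          ultimately show ?thesis using zero_le_power2[of "\<delta> * t"] by linarith
        qed
        finally have "(norm ?x)\<^sup>2 \<le> (r + 2 * (\<delta> * t))\<^sup>2" by simp
        then show ?thesis using r st by (simp add: power2_le_iff_abs_le)
      qed
      have "norm (1 - hermitian ?x \<eta>) \<le> t + \<delta> * t"
      proof -
        have "1 - hermitian ?x \<eta> = of_real t - of_real (\<delta> * t) * a $ j" by (simp add: hx r(5))
        then show ?thesis
          using norm_triangle_ineq4[of "of_real t" "of_real (\<delta> * t) * a $ j"] hj r by simp
      qed
      moreover have "2 * (\<delta> * t) < t" using mult_right_mono[OF \<delta>(2), of t] r by simp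
      then have "norm ?x < 1" using hi r by linarith
      ultimately show ?thesis using lo hi r unfolding ellipsoid_box_def
        by (simp add: \<eta>_def[symmetric] r_def[symmetric] t_def[symmetric] algebra_simps)
    qed
    define h where "h a = g (z + L a)" for a
    have linL: "linear L" by (rule linearI) (simp_all add: L scaleR_eq_vector_smult)
    have contL: "continuous_on S L" for S using linL by (simp add: linear_continuous_on linear_conv_bounded_linear)
    have conth: "continuous_on (cball 0 1) h"
      unfolding h_def
    proof (rule continuous_on_compose2[of "ball 0 1" g])
      show "continuous_on (ball 0 1) g" using g by (simp add: line_holomorphic_def)
      show "continuous_on (cball 0 1) (\<lambda>a. z + L a)" by (intro continuous_intros contL)
    qed (use box in auto)
    have hol: "line_holomorphic h"
      unfolding line_holomorphic_def
    proof (intro conjI allI)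
      show "continuous_on (ball 0 1) h" using conth by (rule continuous_on_subset) auto
      fix a b
      have "(\<lambda>c. g ((z + L a) + c *s L b)) holomorphic_on {c. a + c *s b \<in> ball 0 1}"
      proof (rule line_holomorphicD[OF g])
        fix c assume "c \<in> {c. a + c *s b \<in> ball 0 1}"
        then have "norm (z + L (a + c *s b)) < 1" using box[of "a + c *s b"] by simp
        then show "norm ((z + L a) + c *s L b) < 1" by (simp add: L add.assoc)
      qed
      then show "(\<lambda>c. h (a + c *s b)) holomorphic_on {c. a + c *s b \<in> ball 0 1}"
        by (simp add: h_def L add.assoc)
    qed
    define k where "k y = (if y \<in> ball 0 1 then g y else 0)" for y
    have [measurable]: "k \<in> borel_measurable borel" unfolding k_def[abs_def] by (rule line_holomorphic_borel[OF g])
    have "closed (ellipsoid_box \<delta> z)" unfolding ellipsoid_box_def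
      by (intro closed_Collect_conj closed_Collect_le continuous_intros)
    then have [measurable]: "ellipsoid_box \<delta> z \<in> sets borel" by simp
    let ?F = "\<lambda>x. ennreal (norm (k x) powr \<epsilon>) * indicator (ellipsoid_box \<delta> z) x"
    have "ennreal (norm (h 0) powr \<epsilon>) \<le> ennreal C * (\<integral>\<^sup>+v\<in>ball 0 1. ennreal (norm (h v) powr \<epsilon>) \<partial>lborel)"
      by (rule mean[OF hol conth])
    also have "(\<integral>\<^sup>+v\<in>ball 0 1. ennreal (norm (h v) powr \<epsilon>) \<partial>lborel) \<le> (\<integral>\<^sup>+a. ?F (z + L a) \<partial>lborel)"
      using box by (intro nn_integral_mono) (auto simp: indicator_def h_def k_def)
    also have "\<dots> = ennreal (1 / (\<delta> ^ (2 * n) * t ^ (n + 1))) * (ennreal (\<delta> ^ (2 * n) * t ^ (n + 1)) * (\<integral>\<^sup>+a. ?F (z + L a) \<partial>lborel))"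
      using \<delta> r by (simp add: mult.assoc[symmetric] ennreal_mult[symmetric])
    also have "ennreal (\<delta> ^ (2 * n) * t ^ (n + 1)) * (\<integral>\<^sup>+a. ?F (z + L a) \<partial>lborel) = (\<integral>\<^sup>+x. ?F (z + x) \<partial>lborel)"
      unfolding scale[symmetric] by (rule L(5)[folded n_def, symmetric]) measurable
    also have "\<dots> = (\<integral>\<^sup>+x. ?F x \<partial>lborel)" by (rule nn_integral_lborel_translate) measurable
    also have "\<dots> = (\<integral>\<^sup>+x\<in>ellipsoid_box \<delta> z. ennreal (norm (g x) powr \<epsilon>) \<partial>lborel)"
    proof (intro nn_integral_cong)
      fix x
      have "norm x < 1" if "x \<in> ellipsoid_box \<delta> z"
      proof -
        have "0 < (1 - 2 * \<delta>) * (1 - norm z)" using \<delta> z by (intro mult_pos_pos) auto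
        then show ?thesis using that by (simp add: ellipsoid_box_def)
      qed
      then show "?F x = ennreal (norm (g x) powr \<epsilon>) * indicator (ellipsoid_box \<delta> z) x"
        by (auto simp: k_def indicator_def)
    qed
    finally have "ennreal (norm (h 0) powr \<epsilon>) \<le> ennreal C * (ennreal (1 / (\<delta> ^ (2 * n) * t ^ (n + 1))) *
        (\<integral>\<^sup>+x\<in>ellipsoid_box \<delta> z. ennreal (norm (g x) powr \<epsilon>) \<partial>lborel))"
      by (simp add: mult_left_mono)
    also have "\<dots> = ennreal (C / \<delta> ^ (2 * n) / t ^ (n + 1)) * (\<integral>\<^sup>+x\<in>ellipsoid_box \<delta> z. ennreal (norm (g x) powr \<epsilon>) \<partial>lborel)"
      using C \<delta> r by (simp add: mult.assoc[symmetric] ennreal_mult[symmetric])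
    finally show ?thesis using linear_0[OF linL] by (simp add: h_def t_def r_def)
  qed
  then show ?thesis using C \<delta> by (intro exI[of _ "C / \<delta> ^ (2 * n)"]) (auto simp: n_def)
qed

section \<open>Comparisons along a radius\<close>

lemma powr_comparable:
  fixes u v :: real
  assumes "0 < u" "0 < v" "u \<le> M * v" "v \<le> M * u" "1 \<le> M"
  shows "u powr b \<le> M powr \<bar>b\<bar> * v powr b"
proof (cases "0 \<le> b")
  case True
  have "u powr b \<le> (M * v) powr b" using assms True by (intro powr_mono2) auto
  then show ?thesis using assms True by (simp add: powr_mult)
next
  case False
  have "u powr b \<le> (v / M) powr b"
    using assms False by (intro powr_mono2') (auto simp: field_simps)
  also have "\<dots> = M powr (- b) * v powr b" using assms by (simp add: powr_divide powr_minus field_simps)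
  finally show ?thesis using False by simp
qed

lemma one_minus_square_comparable:
  fixes r :: real
  assumes "0 \<le> r" "r < 1"
  shows "(1 - r\<^sup>2) powr b \<le> 2 powr \<bar>b\<bar> * (1 - r) powr b" "(1 - r) powr b \<le> 2 powr \<bar>b\<bar> * (1 - r\<^sup>2) powr b"
proof -
  have e: "1 - r\<^sup>2 = (1 + r) * (1 - r)" by (simp add: power2_eq_square algebra_simps)
  have 1: "0 < 1 - r\<^sup>2" using assms by (simp add: e)
  have 2: "1 - r\<^sup>2 \<le> 2 * (1 - r)" unfolding e using assms by (intro mult_right_mono) auto
  have "1 * (1 - r) \<le> (1 + r) * (1 - r)" using assms by (intro mult_right_mono) auto
  then have 3: "1 - r \<le> 1 - r\<^sup>2" by (simp add: e)
  have 4: "1 - r \<le> 2 * (1 - r\<^sup>2)" by (rule order_trans[OF 3]) (use 1 in simp)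
  have 5: "1 - r\<^sup>2 \<le> 2 * (1 - r)" by (rule 2)
  show "(1 - r\<^sup>2) powr b \<le> 2 powr \<bar>b\<bar> * (1 - r) powr b" using 1 4 5 assms by (intro powr_comparable) auto
  show "(1 - r) powr b \<le> 2 powr \<bar>b\<bar> * (1 - r\<^sup>2) powr b" using 1 4 5 assms by (intro powr_comparable) auto
qed

text \<open>
  The radial integral with the equivalent weight \<open>1 - r\<close>, starting at a radius
  \<open>b\<close>; here \<open>a\<close> stands for \<open>(k - s) q\<close>.
\<close>
definition radial_part :: "real \<Rightarrow> real \<Rightarrow> real \<Rightarrow> (complex ^ 'n \<Rightarrow> complex) \<Rightarrow> complex ^ 'n \<Rightarrow> ennreal" where
  "radial_part b q a g \<zeta> = (\<integral>\<^sup>+r\<in>{b<..<1}. ennreal (norm (g (r *\<^sub>R \<zeta>)) powr q * (1 - r) powr (a - 1)) \<partial>lborel)"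

lemma line_holomorphic_ray_borel:
  fixes g :: "complex ^ 'n \<Rightarrow> complex"
  assumes g: "line_holomorphic g" and \<zeta>: "norm \<zeta> = 1" and b: "0 \<le> b"
  shows "(\<lambda>r. indicator {b<..<1} r *\<^sub>R g (r *\<^sub>R \<zeta>)) \<in> borel_measurable borel"
proof -
  define k where "k y = (if y \<in> ball 0 1 then g y else 0)" for y
  have [measurable]: "k \<in> borel_measurable borel" unfolding k_def[abs_def] by (rule line_holomorphic_borel[OF g])
  have "(\<lambda>r. indicator {b<..<1} r *\<^sub>R k (r *\<^sub>R \<zeta>)) \<in> borel_measurable borel" by measurable
  moreover have "(\<lambda>r. indicator {b<..<1} r *\<^sub>R k (r *\<^sub>R \<zeta>)) = (\<lambda>r. indicator {b<..<1} r *\<^sub>R g (r *\<^sub>R \<zeta>))"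
    using b \<zeta> by (auto simp: fun_eq_iff k_def indicator_def)
  ultimately show ?thesis by simp
qed

lemma nn_integral_powr_from_zero:
  fixes c :: real
  assumes "0 < c" "0 \<le> l" "l < 1"
  shows "(\<integral>\<^sup>+r\<in>{l<..<1}. ennreal ((1 - r) powr (c - 1)) \<partial>lborel) \<le> ennreal ((1 - l) powr c / c)"
proof -
  have seg: "(\<integral>\<^sup>+r. ennreal ((1 - r) powr (c - 1)) * indicator {l..u} r \<partial>lborel) \<le> ennreal ((1 - l) powr c / c)" if u: "l \<le> u" "u < 1" for u
  proof -
    have "(\<integral>\<^sup>+r. ennreal ((1 - r) powr (c - 1)) * indicator {l..u} r \<partial>lborel) = ennreal (- ((1 - u) powr c / c) - - ((1 - l) powr c / c))"
    proof (rule nn_integral_FTC_Icc)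
      fix r assume r: "r \<in> {l..u}"
      show "DERIV (\<lambda>r. - ((1 - r) powr c / c)) r :> (1 - r) powr (c - 1)"
        using r u assms by (auto intro!: derivative_eq_intros simp: powr_diff field_simps)
    qed (use u assms in auto)
    also have "\<dots> \<le> ennreal ((1 - l) powr c / c)" using assms by (intro ennreal_leI) auto
    finally show ?thesis .
  qed
  define u where "u n = 1 - (1 - l) / (real n + 1)" for n
  have u: "l \<le> u n" "u n < 1" for n
  proof -
    have "(1 - l) / (real n + 1) \<le> (1 - l) / 1" using assms by (intro divide_left_mono) auto
    then show "l \<le> u n" by (simp add: u_def)
    show "u n < 1" using assms by (simp add: u_def)
  qed
  have inc: "incseq u" unfolding incseq_def u_def using assms by (auto intro!: divide_left_mono)
  have "(\<integral>\<^sup>+r\<in>{l<..<1}. ennreal ((1 - r) powr (c - 1)) \<partial>lborel)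
      \<le> (\<integral>\<^sup>+r. (SUP n. ennreal ((1 - r) powr (c - 1)) * indicator {l..u n} r) \<partial>lborel)"
  proof (rule nn_integral_mono)
    fix r :: real
    show "ennreal ((1 - r) powr (c - 1)) * indicator {l<..<1} r \<le> (SUP n. ennreal ((1 - r) powr (c - 1)) * indicator {l..u n} r)"
    proof (cases "r \<in> {l<..<1}")
      case True
      obtain n where n: "(1 - l) / (1 - r) < real n" using reals_Archimedean2 by blast
      then have "(1 - l) / (1 - r) \<le> real n + 1" by simp
      then have "(1 - l) / (real n + 1) \<le> 1 - r" using True by (simp add: field_simps)
      then have "r \<in> {l..u n}" using True by (simp add: u_def)
      then show ?thesis using True by (intro SUP_upper2[of n]) auto
    qed simp
  qed
  also have "\<dots> = (SUP n. \<integral>\<^sup>+r. ennreal ((1 - r) powr (c - 1)) * indicator {l..u n} r \<partial>lborel)"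
  proof (rule nn_integral_monotone_convergence_SUP)
    show "incseq (\<lambda>n r. ennreal ((1 - r) powr (c - 1)) * indicator {l..u n} r)"
      using inc by (auto simp: incseq_def le_fun_def indicator_def intro!: mult_left_mono dest: order_trans)
  qed measurable
  also have "\<dots> \<le> ennreal ((1 - l) powr c / c)" using seg[OF u] by (intro SUP_least) auto
  finally show ?thesis .
qed

lemma nn_integral_powr_neg:
  fixes c :: real
  assumes "0 < c" "0 \<le> l" "l \<le> u" "u < 1"
  shows "(\<integral>\<^sup>+r\<in>{l..u}. ennreal ((1 - r) powr (- c - 1)) \<partial>lborel) \<le> ennreal ((1 - u) powr (- c) / c)"
proof -
  have "(\<integral>\<^sup>+r. ennreal ((1 - r) powr (- c - 1)) * indicator {l..u} r \<partial>lborel) = ennreal ((1 - u) powr (- c) / c - (1 - l) powr (- c) / c)"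
  proof (rule nn_integral_FTC_Icc)
    fix r assume r: "r \<in> {l..u}"
    show "DERIV (\<lambda>r. (1 - r) powr (- c) / c) r :> (1 - r) powr (- c - 1)"
      using r assms by (auto intro!: derivative_eq_intros simp: powr_diff field_simps)
  qed (use assms in auto)
  also have "\<dots> \<le> ennreal ((1 - u) powr (- c) / c)" using assms by (intro ennreal_leI) auto
  finally show ?thesis .
qed

text \<open>
  Hoelder's inequality with the auxiliary weight \<open>(1 - t)\<^sup>e\<close> bounds the power of the
  inner integral by a weighted integral of \<open>\<psi>\<^sup>q\<close>, and Fubini's theorem exchanges
  the integrations. The choice \<open>e = q - 1 + a / 2\<close> leaves the integrable weight \<open>(1 -
  r)\<^sup>a\<^sup>/\<^sup>2\<^sup>-\<^sup>1\<close> in the outer variable.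
\<close>
lemma Hardy_inequality:
  fixes \<psi> :: "real \<Rightarrow> ennreal"
  assumes [measurable]: "\<psi> \<in> borel_measurable borel" and q: "1 < q" and a: "0 < a" and l: "0 \<le> l" "l < 1"
  shows "(\<integral>\<^sup>+r\<in>{l<..<1}. ennpowr (\<integral>\<^sup>+t\<in>{l..r}. \<psi> t \<partial>lborel) q * ennreal ((1 - r) powr (a - 1)) \<partial>lborel)
    \<le> ennreal ((2 * (q - 1) / a) powr (q - 1) * (2 / a)) * (\<integral>\<^sup>+t\<in>{l..<1}. ennpowr (\<psi> t) q * ennreal ((1 - t) powr (a + q - 1)) \<partial>lborel)"
proof -
  define c where "c = (a / 2) / (q - 1)"
  have c: "0 < c" using a q by (simp add: c_def)
  (* The dual weight then has the exponent -c - 1, whose integral up to r is (1 - r) powr (-c) / c at most. *)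
  define e where "e = (1 + c) * (q - 1)"
  have ce: "e = q - 1 + a / 2" using q by (simp add: e_def c_def field_simps)
  define q' where "q' = q / (q - 1)"
  have q': "1 < q'" "1 / q + 1 / q' = 1" using q by (auto simp: q'_def field_simps)
  define A where "A = (1 / c) powr (q - 1)"
  have A: "0 < A" using c by (simp add: A_def)
  have inner: "ennpowr (\<integral>\<^sup>+t\<in>{l..r}. \<psi> t \<partial>lborel) q \<le> ennreal (A * (1 - r) powr (- a / 2)) * (\<integral>\<^sup>+t\<in>{l..r}. ennpowr (\<psi> t) q * ennreal ((1 - t) powr e) \<partial>lborel)"
    if r: "l < r" "r < 1" for r
  proof -
    have "(\<integral>\<^sup>+t\<in>{l..r}. \<psi> t \<partial>lborel) = (\<integral>\<^sup>+t. (\<psi> t * ennreal ((1 - t) powr (e / q)) * indicator {l..r} t) * (ennreal ((1 - t) powr (- e / q)) * indicator {l..r} t) \<partial>lborel)"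
    proof (rule nn_integral_cong)
      fix t
      show "\<psi> t * indicator {l..r} t = (\<psi> t * ennreal ((1 - t) powr (e / q)) * indicator {l..r} t) * (ennreal ((1 - t) powr (- e / q)) * indicator {l..r} t)"
        using r by (auto simp: indicator_def mult.assoc ennreal_mult[symmetric] powr_add[symmetric])
    qed
    also have "\<dots> \<le> ennpowr (\<integral>\<^sup>+t. ennpowr (\<psi> t * ennreal ((1 - t) powr (e / q)) * indicator {l..r} t) q \<partial>lborel) (1 / q)
        * ennpowr (\<integral>\<^sup>+t. ennpowr (ennreal ((1 - t) powr (- e / q)) * indicator {l..r} t) q' \<partial>lborel) (1 / q')"
      by (rule Holder_nn_integral[OF q q']) measurable
    also have "(\<integral>\<^sup>+t. ennpowr (\<psi> t * ennreal ((1 - t) powr (e / q)) * indicator {l..r} t) q \<partial>lborel) = (\<integral>\<^sup>+t\<in>{l..r}. ennpowr (\<psi> t) q * ennreal ((1 - t) powr e) \<partial>lborel)"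
      using q r by (intro nn_integral_cong) (auto simp: indicator_def ennpowr_mult ennpowr_ennreal powr_powr)
    also have "(\<integral>\<^sup>+t. ennpowr (ennreal ((1 - t) powr (- e / q)) * indicator {l..r} t) q' \<partial>lborel) = (\<integral>\<^sup>+t\<in>{l..r}. ennreal ((1 - t) powr (- c - 1)) \<partial>lborel)"
    proof (rule nn_integral_cong)
      fix t
      have "- (e / q * q') = - c - 1" using q by (simp add: e_def q'_def)
      then show "ennpowr (ennreal ((1 - t) powr (- e / q)) * indicator {l..r} t) q' = ennreal ((1 - t) powr (- c - 1)) * indicator {l..r} t"
        using q' by (auto simp: indicator_def ennpowr_ennreal powr_powr)
    qed
    also have "\<dots> \<le> ennreal ((1 - r) powr (- c) / c)" by (rule nn_integral_powr_neg) (use c l r in auto)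
    finally have "(\<integral>\<^sup>+t\<in>{l..r}. \<psi> t \<partial>lborel) \<le> ennpowr (\<integral>\<^sup>+t\<in>{l..r}. ennpowr (\<psi> t) q * ennreal ((1 - t) powr e) \<partial>lborel) (1 / q) * ennpowr (ennreal ((1 - r) powr (- c) / c)) (1 / q')"
      using q' by (simp add: mult_left_mono ennpowr_mono)
    then have "ennpowr (\<integral>\<^sup>+t\<in>{l..r}. \<psi> t \<partial>lborel) q \<le> ennpowr (ennpowr (\<integral>\<^sup>+t\<in>{l..r}. ennpowr (\<psi> t) q * ennreal ((1 - t) powr e) \<partial>lborel) (1 / q) * ennpowr (ennreal ((1 - r) powr (- c) / c)) (1 / q')) q"
      using q by (intro ennpowr_mono) auto
    also have "\<dots> = (\<integral>\<^sup>+t\<in>{l..r}. ennpowr (\<psi> t) q * ennreal ((1 - t) powr e) \<partial>lborel) * ennpowr (ennreal ((1 - r) powr (- c) / c)) (q - 1)"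
    proof -
      have "1 / q' * q = q - 1" using q by (simp add: q'_def)
      then show ?thesis using q q' by (simp only: ennpowr_mult ennpowr_ennpowr) (simp add: ennpowr_mult ennpowr_ennpowr)
    qed
    also have "ennpowr (ennreal ((1 - r) powr (- c) / c)) (q - 1) = ennreal (A * (1 - r) powr (- a / 2))"
    proof -
      have q1: "q - 1 \<noteq> 0" using q by simp
      have "((1 - r) powr (- c) / c) powr (q - 1) = A * (1 - r) powr (- c * (q - 1))"
        using c r by (simp add: A_def powr_divide powr_powr)
      also have "- c * (q - 1) = - a / 2" using q1 by (simp add: c_def del: divide_divide_eq_left)
      finally show ?thesis using c q by (simp add: ennpowr_ennreal)
    qed
    finally show ?thesis by (simp add: mult.commute)
  qed
  have mT [measurable]: "Measurable.pred (borel \<Otimes>\<^sub>M borel) (\<lambda>p :: real \<times> real. snd p \<in> {l..fst p})"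
    unfolding atLeastAtMost_iff by measurable
  let ?\<Psi> = "\<lambda>t. ennpowr (\<psi> t) q * ennreal ((1 - t) powr e)"
  have "(\<integral>\<^sup>+r\<in>{l<..<1}. ennpowr (\<integral>\<^sup>+t\<in>{l..r}. \<psi> t \<partial>lborel) q * ennreal ((1 - r) powr (a - 1)) \<partial>lborel)
     \<le> (\<integral>\<^sup>+r. (\<integral>\<^sup>+t. ?\<Psi> t * indicator {l..<1} t * (ennreal (A * (1 - r) powr (a / 2 - 1)) * indicator {t<..<1} r) + 0 \<partial>lborel) \<partial>lborel)"
  proof (rule nn_integral_mono)
    fix r :: real
    show "ennpowr (\<integral>\<^sup>+t\<in>{l..r}. \<psi> t \<partial>lborel) q * ennreal ((1 - r) powr (a - 1)) * indicator {l<..<1} r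
      \<le> (\<integral>\<^sup>+t. ?\<Psi> t * indicator {l..<1} t * (ennreal (A * (1 - r) powr (a / 2 - 1)) * indicator {t<..<1} r) + 0 \<partial>lborel)"
    proof (cases "r \<in> {l<..<1}")
      case True
      have "(1 - r) powr (- a / 2) * (1 - r) powr (a - 1) = (1 - r) powr (a / 2 - 1)"
        by (simp add: powr_add[symmetric])
      then have pe: "A * (1 - r) powr (- a / 2) * (1 - r) powr (a - 1) = A * (1 - r) powr (a / 2 - 1)" by (simp only: mult.assoc)
      have "ennpowr (\<integral>\<^sup>+t\<in>{l..r}. \<psi> t \<partial>lborel) q * ennreal ((1 - r) powr (a - 1))
        \<le> ennreal (A * (1 - r) powr (- a / 2)) * (\<integral>\<^sup>+t\<in>{l..r}. ?\<Psi> t \<partial>lborel) * ennreal ((1 - r) powr (a - 1))"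
        using True by (intro mult_right_mono inner) auto
      also have "\<dots> = ennreal (A * (1 - r) powr (a / 2 - 1)) * (\<integral>\<^sup>+t\<in>{l..r}. ?\<Psi> t \<partial>lborel)"
        using A by (simp add: pe[symmetric] ennreal_mult mult_ac)
      also have "(\<integral>\<^sup>+t\<in>{l..r}. ?\<Psi> t \<partial>lborel) = (\<integral>\<^sup>+t. ?\<Psi> t * indicator {l..<1} t * indicator {t<..<1} r \<partial>lborel)"
      proof (rule nn_integral_cong_AE)
        have "AE t in lborel. t \<noteq> r" by (rule AE_lborel_singleton)
        then show "AE t in lborel. ?\<Psi> t * indicator {l..r} t = ?\<Psi> t * indicator {l..<1} t * indicator {t<..<1} r"
          by eventually_elim (use True in \<open>auto simp: indicator_def\<close>)
      qed
      also have "ennreal (A * (1 - r) powr (a / 2 - 1)) * \<dots> = (\<integral>\<^sup>+t. ennreal (A * (1 - r) powr (a / 2 - 1)) * (?\<Psi> t * indicator {l..<1} t * indicator {t<..<1} r) \<partial>lborel)"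
      proof (rule nn_integral_cmult[symmetric])
        have "Measurable.pred borel (\<lambda>t. r \<in> {t<..<1})" unfolding greaterThanLessThan_iff by measurable
        then show "(\<lambda>t. ?\<Psi> t * indicator {l..<1} t * indicator {t<..<1} r) \<in> borel_measurable lborel"
          by (simp add: indicator_def of_bool_def) measurable
      qed
      finally show ?thesis using True by (simp add: mult_ac)
    qed simp
  qed
  also have "\<dots> = (\<integral>\<^sup>+r. (\<integral>\<^sup>+t. ?\<Psi> t * indicator {l..<1} t * (ennreal (A * (1 - r) powr (a / 2 - 1)) * indicator {t<..<1} r) \<partial>lborel) \<partial>lborel)"
    by simp
  also have "\<dots> = (\<integral>\<^sup>+t. (\<integral>\<^sup>+r. ?\<Psi> t * indicator {l..<1} t * (ennreal (A * (1 - r) powr (a / 2 - 1)) * indicator {t<..<1} r) \<partial>lborel) \<partial>lborel)"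
  proof (rule lborel_pair.Fubini')
    have [measurable]: "Measurable.pred (borel \<Otimes>\<^sub>M borel) (\<lambda>p :: real \<times> real. snd p \<in> {fst p<..<1})"
      unfolding greaterThanLessThan_iff by measurable
    have "(\<lambda>p. ?\<Psi> (fst p) * indicator {l..<1} (fst p) * (ennreal (A * (1 - snd p) powr (a / 2 - 1)) * (if snd p \<in> {fst p<..<1} then 1 else 0))) \<in> borel_measurable (borel \<Otimes>\<^sub>M borel)"
      by measurable
    then show "(\<lambda>(t, r). ?\<Psi> t * indicator {l..<1} t * (ennreal (A * (1 - r) powr (a / 2 - 1)) * indicator {t<..<1} r)) \<in> borel_measurable (lborel \<Otimes>\<^sub>M lborel)"
      by (subst measurable_cong_sets[OF sets_pair_measure_cong[OF sets_lborel sets_lborel] refl])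
         (simp add: split_beta' indicator_def of_bool_def)
  qed
  also have "\<dots> \<le> (\<integral>\<^sup>+t. ennreal (A * (2 / a)) * (ennpowr (\<psi> t) q * ennreal ((1 - t) powr (a + q - 1)) * indicator {l..<1} t) \<partial>lborel)"
  proof (rule nn_integral_mono)
    fix t :: real
    show "(\<integral>\<^sup>+r. ?\<Psi> t * indicator {l..<1} t * (ennreal (A * (1 - r) powr (a / 2 - 1)) * indicator {t<..<1} r) \<partial>lborel)
      \<le> ennreal (A * (2 / a)) * (ennpowr (\<psi> t) q * ennreal ((1 - t) powr (a + q - 1)) * indicator {l..<1} t)"
    proof (cases "t \<in> {l..<1}")
      case True
      have "(\<integral>\<^sup>+r. ennreal A * (ennreal ((1 - r) powr (a / 2 - 1)) * indicator {t<..<1} r) \<partial>lborel) \<le> ennreal A * ennreal ((1 - t) powr (a / 2) / (a / 2))"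
      proof -
        have "(\<integral>\<^sup>+r\<in>{t<..<1}. ennreal ((1 - r) powr (a / 2 - 1)) \<partial>lborel) \<le> ennreal ((1 - t) powr (a / 2) / (a / 2))"
          by (rule nn_integral_powr_from_zero) (use True l a in auto)
        then have "ennreal A * (\<integral>\<^sup>+r\<in>{t<..<1}. ennreal ((1 - r) powr (a / 2 - 1)) \<partial>lborel) \<le> ennreal A * ennreal ((1 - t) powr (a / 2) / (a / 2))"
          by (rule mult_left_mono) simp
        then show ?thesis by (subst nn_integral_cmult) measurable
      qed
      then have "?\<Psi> t * (\<integral>\<^sup>+r. ennreal A * (ennreal ((1 - r) powr (a / 2 - 1)) * indicator {t<..<1} r) \<partial>lborel) \<le> ?\<Psi> t * (ennreal A * ennreal ((1 - t) powr (a / 2) / (a / 2)))"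
        by (rule mult_left_mono) simp
      moreover have "?\<Psi> t * (ennreal A * ennreal ((1 - t) powr (a / 2) / (a / 2))) = ennreal (A * (2 / a)) * (ennpowr (\<psi> t) q * ennreal ((1 - t) powr (a + q - 1)))"
      proof -
        have ea: "e + a / 2 = a + q - 1" by (simp add: ce)
        have z: "(1 - t) powr e * (1 - t) powr (a / 2) = (1 - t) powr (a + q - 1)"
          by (simp only: powr_add[symmetric] ea)
        have em: "ennreal E * (ennreal A * ennreal y) = ennreal (E * (A * y))" if "0 \<le> E" "0 \<le> y" for E y
          using A that by (simp add: ennreal_mult)
        have "ennreal ((1 - t) powr e) * (ennreal A * ennreal ((1 - t) powr (a / 2) / (a / 2))) = ennreal ((1 - t) powr e * (A * ((1 - t) powr (a / 2) / (a / 2))))"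
          using a by (intro em) auto
        also have "(1 - t) powr e * (A * ((1 - t) powr (a / 2) / (a / 2))) = A * (2 / a) * (1 - t) powr (a + q - 1)"
          unfolding z[symmetric] by simp
        also have "ennreal \<dots> = ennreal (A * (2 / a)) * ennreal ((1 - t) powr (a + q - 1))"
          using A a by (intro ennreal_mult) auto
        finally show ?thesis by (simp add: mult.assoc mult.left_commute[of "ennpowr (\<psi> t) q"])
      qed
      moreover have "(\<integral>\<^sup>+r. ?\<Psi> t * indicator {l..<1} t * (ennreal (A * (1 - r) powr (a / 2 - 1)) * indicator {t<..<1} r) \<partial>lborel)
          = ?\<Psi> t * (\<integral>\<^sup>+r. ennreal A * (ennreal ((1 - r) powr (a / 2 - 1)) * indicator {t<..<1} r) \<partial>lborel)"
        using True A by (subst nn_integral_cmult[symmetric]) (auto simp: ennreal_mult mult.assoc)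
      ultimately show ?thesis using True by simp
    qed simp
  qed
  also have "\<dots> = ennreal (A * (2 / a)) * (\<integral>\<^sup>+t\<in>{l..<1}. ennpowr (\<psi> t) q * ennreal ((1 - t) powr (a + q - 1)) \<partial>lborel)"
    by (rule nn_integral_cmult) measurable
  also have "A = (2 * (q - 1) / a) powr (q - 1)"
    by (simp only: A_def c_def divide_divide_eq_right divide_divide_eq_left mult_1)
  finally show ?thesis .
qed

lemma line_holomorphic_radial_continuous:
  assumes g: "line_holomorphic g" and \<zeta>: "norm \<zeta> = 1" and b: "0 \<le> u" "v < 1"
  shows "continuous_on {u..v} (\<lambda>r. g (r *\<^sub>R \<zeta>))"
proof (rule continuous_on_compose2[of "ball 0 1" g])
  show "continuous_on (ball 0 1) g" using g by (simp add: line_holomorphic_def)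
  show "continuous_on {u..v} (\<lambda>r. r *\<^sub>R \<zeta>)" by (intro continuous_intros)
  show "(\<lambda>r. r *\<^sub>R \<zeta>) ` {u..v} \<subseteq> ball 0 1" using \<zeta> b by auto
qed

text \<open>
  The function \<open>r g\<^sub>k(r \<zeta>)\<close> is its value at \<open>1/2\<close> plus the integral
  of \<open>g\<^sub>k\<^sub>+\<^sub>1(t \<zeta>)\<close>, to which Hardy's inequality applies.
\<close>
lemma radial_part_le_derivative:
  fixes f :: "complex ^ 'n \<Rightarrow> complex"
  assumes f: "line_holomorphic f" and q: "1 < q" and a: "0 < a"
  shows "\<exists>C0 C. \<forall>\<zeta>. norm \<zeta> = 1 \<longrightarrow> radial_part (1/2) q a (IR_power (real k) f) \<zeta>
    \<le> ennreal C0 + ennreal C * radial_part 0 q (a + q) (IR_power (real (Suc k)) f) \<zeta>"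
proof -
  define g where "g = IR_power (real k) f"
  define g' where "g' = IR_power (real (Suc k)) f"
  have g: "line_holomorphic g" "line_holomorphic g'"
    unfolding g_def g'_def by (rule IR_power_line_holomorphic[OF f]) (rule IR_power_line_holomorphic[OF f])
  obtain M where M: "0 \<le> M" "\<And>z. norm z \<le> 1/2 \<Longrightarrow> norm (g z) \<le> M"
    using line_holomorphic_bounded[OF g(1), of "1/2"] by auto
  define A where "A = 4 powr q"
  define H where "H = (2 * (q - 1) / a) powr (q - 1) * (2 / a)"
  define W where "W = (1 - (1/2::real)) powr a / a"
  have "radial_part (1/2) q a g \<zeta> \<le> ennreal (A * (M powr q * W)) + ennreal (A * H) * radial_part 0 q (a + q) g' \<zeta>" if \<zeta>: "norm \<zeta> = 1" for \<zeta>
  proof -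
    define \<psi> where "\<psi> t = ennreal (norm (indicator {0<..<1} t *\<^sub>R g' (t *\<^sub>R \<zeta>)))" for t
    have [measurable]: "\<psi> \<in> borel_measurable borel"
      unfolding \<psi>_def
      by (rule measurable_compose[OF line_holomorphic_ray_borel[OF g(2) \<zeta> order_refl], of "\<lambda>z. ennreal (norm z)"]) measurable
    define I where "I r = (\<integral>\<^sup>+t\<in>{1/2..r}. \<psi> t \<partial>lborel)" for r
    have pt: "ennreal (norm (g (r *\<^sub>R \<zeta>)) powr q) \<le> ennreal A * (ennreal (M powr q) + ennpowr (I r) q)" if r: "1/2 < r" "r < 1" for r
    proof -
      have cont: "continuous_on {1/2..r} (\<lambda>t. g' (t *\<^sub>R \<zeta>))"
        by (rule line_holomorphic_radial_continuous[OF g(2) \<zeta>]) (use r in auto)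
      have "((\<lambda>t. g' (t *\<^sub>R \<zeta>)) has_integral (of_real r * g (r *\<^sub>R \<zeta>) - of_real (1/2) * g ((1/2) *\<^sub>R \<zeta>))) {1/2..r}"
      proof (rule fundamental_theorem_of_calculus)
        fix t assume t: "t \<in> {1/2..r}"
        have "((\<lambda>c. c * g (c *s \<zeta>)) has_field_derivative g' (of_real t *s \<zeta>)) (at (of_real t))"
          unfolding g_def g'_def by (rule IR_power_derivative[OF f]) (use \<zeta> t r in auto)
        from has_vector_derivative_real_field[OF this]
        show "((\<lambda>t. of_real t * g (t *\<^sub>R \<zeta>)) has_vector_derivative g' (t *\<^sub>R \<zeta>)) (at t within {1/2..r})"
          by (simp add: scaleR_eq_vector_smult)
      qed (use r in auto)
      then have "integral {1/2..r} (\<lambda>t. g' (t *\<^sub>R \<zeta>)) = of_real r * g (r *\<^sub>R \<zeta>) - of_real (1/2) * g ((1/2) *\<^sub>R \<zeta>)" by (rule integral_unique)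
      then have "ennreal (norm (of_real r * g (r *\<^sub>R \<zeta>) - of_real (1/2) * g ((1/2) *\<^sub>R \<zeta>))) \<le> (\<integral>\<^sup>+t\<in>{1/2..r}. ennreal (norm (g' (t *\<^sub>R \<zeta>))) \<partial>lborel)"
        using norm_integral_le_nn_integral[OF cont] by simp
      also have "\<dots> = I r" unfolding I_def \<psi>_def using r by (intro nn_integral_cong) (auto simp: indicator_def)
      finally have Ir: "ennreal (norm (of_real r * g (r *\<^sub>R \<zeta>) - of_real (1/2) * g ((1/2) *\<^sub>R \<zeta>))) \<le> I r" .
      have nr: "norm (complex_of_real r) = r" "norm (complex_of_real (1/2)) = 1/2" unfolding norm_of_real using r by auto
      define Y where "Y = norm (of_real r * g (r *\<^sub>R \<zeta>) - of_real (1/2) * g ((1/2) *\<^sub>R \<zeta>))"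
      have "norm (of_real r * g (r *\<^sub>R \<zeta>)) \<le> norm (of_real (1/2) * g ((1/2) *\<^sub>R \<zeta>)) + Y"
        unfolding Y_def by (rule norm_triangle_sub)
      then have "r * norm (g (r *\<^sub>R \<zeta>)) \<le> (1/2) * norm (g ((1/2) *\<^sub>R \<zeta>)) + Y" unfolding norm_mult nr .
      moreover have "(1/2) * norm (g (r *\<^sub>R \<zeta>)) \<le> r * norm (g (r *\<^sub>R \<zeta>))" using r by (intro mult_right_mono) auto
      ultimately have "(1/2) * norm (g (r *\<^sub>R \<zeta>)) \<le> (1/2) * norm (g ((1/2) *\<^sub>R \<zeta>)) + Y" by (rule order_trans[rotated])
      moreover have "norm (g ((1/2) *\<^sub>R \<zeta>)) \<le> M" using \<zeta> by (intro M(2)) simp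
      ultimately have "norm (g (r *\<^sub>R \<zeta>)) \<le> 2 * (M + Y)" using M(1) by argo
      then have "norm (g (r *\<^sub>R \<zeta>)) \<le> 2 * (M + norm (of_real r * g (r *\<^sub>R \<zeta>) - of_real (1/2) * g ((1/2) *\<^sub>R \<zeta>)))"
        unfolding Y_def .
      then have "ennreal (norm (g (r *\<^sub>R \<zeta>))) \<le> ennreal 2 * (ennreal M + ennreal (norm (of_real r * g (r *\<^sub>R \<zeta>) - of_real (1/2) * g ((1/2) *\<^sub>R \<zeta>))))"
        using M(1) by (simp add: ennreal_mult[symmetric] ennreal_plus[symmetric] ennreal_leI del: ennreal_plus ennreal_numeral)
      also have "\<dots> \<le> ennreal 2 * (ennreal M + I r)" using Ir by (intro mult_left_mono add_left_mono) auto
      finally have "ennpowr (ennreal (norm (g (r *\<^sub>R \<zeta>)))) q \<le> ennpowr (ennreal 2 * (ennreal M + I r)) q" using q by (intro ennpowr_mono) auto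
      also have "\<dots> = ennreal (2 powr q) * ennpowr (ennreal M + I r) q" using q by (simp add: ennpowr_mult ennpowr_ennreal del: ennreal_numeral)
      also have "\<dots> \<le> ennreal (2 powr q) * (ennreal (2 powr q) * (ennpowr (ennreal M) q + ennpowr (I r) q))"
        using q by (intro mult_left_mono ennpowr_add_le) auto
      also have "\<dots> = ennreal A * (ennreal (M powr q) + ennpowr (I r) q)"
      proof -
        have "2 powr q * 2 powr q = A" using powr_mult[of 2 2 q] by (simp add: A_def)
        then show ?thesis using q M(1) by (simp add: ennpowr_ennreal mult.assoc[symmetric] ennreal_mult[symmetric])
      qed
      finally show ?thesis using q by (simp add: ennpowr_ennreal)
    qed
    have [measurable]: "I \<in> borel_measurable borel"
    proof -
      have m: "Measurable.pred (borel \<Otimes>\<^sub>M borel) (\<lambda>p :: real \<times> real. snd p \<in> {1/2..fst p})"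
        unfolding atLeastAtMost_iff by measurable
      have "(\<lambda>p. \<psi> (snd p) * (if snd p \<in> {1/2..fst p} then 1 else 0)) \<in> borel_measurable (borel \<Otimes>\<^sub>M borel)" using m by measurable
      then have "(\<lambda>(r, t). \<psi> t * indicator {1/2..r} t) \<in> borel_measurable (borel \<Otimes>\<^sub>M lborel)"
        by (subst measurable_cong_sets[OF sets_pair_measure_cong[OF refl sets_lborel] refl]) (simp add: split_beta' indicator_def of_bool_def)
      then show ?thesis unfolding I_def by (rule lborel.borel_measurable_nn_integral)
    qed
    have "radial_part (1/2) q a g \<zeta> \<le> (\<integral>\<^sup>+r. ennreal A * (ennreal (M powr q) * (ennreal ((1 - r) powr (a - 1)) * indicator {1/2<..<1} r) + ennpowr (I r) q * ennreal ((1 - r) powr (a - 1)) * indicator {1/2<..<1} r) \<partial>lborel)"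
      unfolding radial_part_def
    proof (rule nn_integral_mono)
      fix r :: real
      show "ennreal (norm (g (r *\<^sub>R \<zeta>)) powr q * (1 - r) powr (a - 1)) * indicator {1/2<..<1} r
        \<le> ennreal A * (ennreal (M powr q) * (ennreal ((1 - r) powr (a - 1)) * indicator {1/2<..<1} r) + ennpowr (I r) q * ennreal ((1 - r) powr (a - 1)) * indicator {1/2<..<1} r)"
      proof (cases "r \<in> {1/2<..<1}")
        case True
        have "ennreal (norm (g (r *\<^sub>R \<zeta>)) powr q) * ennreal ((1 - r) powr (a - 1)) \<le> ennreal A * (ennreal (M powr q) + ennpowr (I r) q) * ennreal ((1 - r) powr (a - 1))"
          using True by (intro mult_right_mono pt) auto
        then show ?thesis using True by (simp add: ennreal_mult distrib_left distrib_right mult.assoc)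
      qed simp
    qed
    also have "\<dots> = ennreal A * (ennreal (M powr q) * (\<integral>\<^sup>+r\<in>{1/2<..<1}. ennreal ((1 - r) powr (a - 1)) \<partial>lborel) + (\<integral>\<^sup>+r\<in>{1/2<..<1}. ennpowr (I r) q * ennreal ((1 - r) powr (a - 1)) \<partial>lborel))"
      by (simp add: nn_integral_cmult nn_integral_add)
    also have "\<dots> \<le> ennreal A * (ennreal (M powr q) * ennreal W + ennreal H * (\<integral>\<^sup>+t\<in>{1/2..<1}. ennpowr (\<psi> t) q * ennreal ((1 - t) powr (a + q - 1)) \<partial>lborel))"
      unfolding I_def W_def H_def using q a
      by (intro mult_left_mono add_mono Hardy_inequality nn_integral_powr_from_zero) auto
    also have "(\<integral>\<^sup>+t\<in>{1/2..<1}. ennpowr (\<psi> t) q * ennreal ((1 - t) powr (a + q - 1)) \<partial>lborel) \<le> radial_part 0 q (a + q) g' \<zeta>"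
      unfolding radial_part_def using q
      by (intro nn_integral_mono) (auto simp: indicator_def \<psi>_def ennpowr_ennreal ennreal_mult)
    finally have "radial_part (1/2) q a g \<zeta> \<le> ennreal A * (ennreal (M powr q) * ennreal W + ennreal H * radial_part 0 q (a + q) g' \<zeta>)"
      by (simp add: mult_left_mono add_left_mono)
    moreover have "0 \<le> A" "0 \<le> H" "0 \<le> W" using a q by (auto simp: A_def H_def W_def)
    ultimately show ?thesis by (simp add: distrib_left ennreal_mult mult.assoc)
  qed
  then show ?thesis unfolding g_def g'_def by blast
qed

text \<open>
  The weights \<open>1 - r\<^sup>2\<close> and \<open>1 - r\<close> are comparable, and
  \<open>g\<^sub>k\<close> is bounded on the ball of radius \<open>b\<close>.
\<close>
lemma radial_integral_compare:
  fixes f :: "complex ^ 'n \<Rightarrow> complex"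
  assumes f: "line_holomorphic f" and q: "1 < q" and a: "0 < (real k - s) * q" and b: "0 \<le> b" "b < 1"
  shows "\<exists>C0 C. \<forall>\<zeta>. norm \<zeta> = 1 \<longrightarrow> radial_integral k q s f \<zeta> \<le> ennreal C0 + ennreal C * radial_part b q ((real k - s) * q) (IR_power (real k) f) \<zeta>"
    and "\<exists>C. \<forall>\<zeta>. norm \<zeta> = 1 \<longrightarrow> radial_part 0 q ((real k - s) * q) (IR_power (real k) f) \<zeta> \<le> ennreal C * radial_integral k q s f \<zeta>"
proof -
  define g where "g = IR_power (real k) f"
  define a where "a = (real k - s) * q"
  have g: "line_holomorphic g" unfolding g_def by (rule IR_power_line_holomorphic[OF f])
  obtain M where M: "0 \<le> M" "\<And>z. norm z \<le> b \<Longrightarrow> norm (g z) \<le> M"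
    using line_holomorphic_bounded[OF g b(2)] by auto
  define C where "C = 2 powr \<bar>a - 1\<bar>"
  have C: "0 < C" by (simp add: C_def)
  have a0: "0 < a" using assms(3) by (simp add: a_def)
  have 1: "radial_integral k q s f \<zeta> \<le> ennreal (M powr q * C / a) + ennreal C * radial_part b q a g \<zeta>" if \<zeta>: "norm \<zeta> = 1" for \<zeta>
  proof -
    define u where "u r = indicator {b<..<1} r *\<^sub>R g (r *\<^sub>R \<zeta>)" for r
    have [measurable]: "u \<in> borel_measurable borel" unfolding u_def[abs_def] by (rule line_holomorphic_ray_borel[OF g \<zeta> b(1)])
    have "radial_integral k q s f \<zeta> \<le> (\<integral>\<^sup>+r. ennreal (M powr q * C) * (ennreal ((1 - r) powr (a - 1)) * indicator {0<..<1} r)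
        + ennreal C * (ennreal (norm (u r) powr q * (1 - r) powr (a - 1)) * indicator {b<..<1} r) \<partial>lborel)"
      unfolding radial_integral_def g_def[symmetric] a_def[symmetric]
    proof (rule nn_integral_mono)
      fix r :: real
      show "ennreal (norm (g (r *\<^sub>R \<zeta>)) powr q * (1 - r\<^sup>2) powr (a - 1)) * indicator {0<..<1} r
        \<le> ennreal (M powr q * C) * (ennreal ((1 - r) powr (a - 1)) * indicator {0<..<1} r)
        + ennreal C * (ennreal (norm (u r) powr q * (1 - r) powr (a - 1)) * indicator {b<..<1} r)"
      proof (cases "r \<in> {0<..<1}")
        case True
        have w: "(1 - r\<^sup>2) powr (a - 1) \<le> C * (1 - r) powr (a - 1)"
          unfolding C_def using True by (intro one_minus_square_comparable) auto
        have main: "norm (g (r *\<^sub>R \<zeta>)) powr q * (1 - r\<^sup>2) powr (a - 1) \<le> C * (norm (g (r *\<^sub>R \<zeta>)) powr q * (1 - r) powr (a - 1))"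
          using mult_left_mono[OF w, of "norm (g (r *\<^sub>R \<zeta>)) powr q"] by (simp add: mult_ac)
        show ?thesis
        proof (cases "b < r")
          case br: True
          have "ennreal (norm (g (r *\<^sub>R \<zeta>)) powr q * (1 - r\<^sup>2) powr (a - 1)) \<le> ennreal C * ennreal (norm (g (r *\<^sub>R \<zeta>)) powr q * (1 - r) powr (a - 1))"
            using ennreal_leI[OF main] C by (simp add: ennreal_mult)
          then show ?thesis using True br by (simp add: u_def add_increasing)
        next
          case False
          have "norm (g (r *\<^sub>R \<zeta>)) powr q \<le> M powr q" using False True \<zeta> q by (intro powr_mono2 M(2)) auto
          then have "C * (norm (g (r *\<^sub>R \<zeta>)) powr q * (1 - r) powr (a - 1)) \<le> C * (M powr q * (1 - r) powr (a - 1))"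
            using C by (intro mult_left_mono mult_right_mono) auto
          then have "norm (g (r *\<^sub>R \<zeta>)) powr q * (1 - r\<^sup>2) powr (a - 1) \<le> (M powr q * C) * (1 - r) powr (a - 1)" using main by (simp add: mult_ac)
          then have "ennreal (norm (g (r *\<^sub>R \<zeta>)) powr q * (1 - r\<^sup>2) powr (a - 1)) \<le> ennreal (M powr q * C) * ennreal ((1 - r) powr (a - 1))"
            using C by (simp add: ennreal_mult[symmetric] ennreal_leI)
          then show ?thesis using True False by simp
        qed
      qed simp
    qed
    also have "\<dots> = ennreal (M powr q * C) * (\<integral>\<^sup>+r\<in>{0<..<1}. ennreal ((1 - r) powr (a - 1)) \<partial>lborel)
        + ennreal C * (\<integral>\<^sup>+r\<in>{b<..<1}. ennreal (norm (u r) powr q * (1 - r) powr (a - 1)) \<partial>lborel)"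
      by (simp add: nn_integral_add nn_integral_cmult)
    also have "(\<integral>\<^sup>+r\<in>{b<..<1}. ennreal (norm (u r) powr q * (1 - r) powr (a - 1)) \<partial>lborel) = radial_part b q a g \<zeta>"
      unfolding radial_part_def by (intro nn_integral_cong) (auto simp: indicator_def u_def)
    also have "(\<integral>\<^sup>+r\<in>{0<..<1}. ennreal ((1 - r) powr (a - 1)) \<partial>lborel) \<le> ennreal (1 / a)"
      using nn_integral_powr_from_zero[OF a0, of 0] by simp
    finally have "radial_integral k q s f \<zeta> \<le> ennreal (M powr q * C) * ennreal (1 / a) + ennreal C * radial_part b q a g \<zeta>"
      by (simp add: mult_left_mono add_right_mono)
    then show ?thesis using C a0 by (simp add: ennreal_mult[symmetric])
  qed
  have 2: "radial_part 0 q a g \<zeta> \<le> ennreal C * radial_integral k q s f \<zeta>" if \<zeta>: "norm \<zeta> = 1" for \<zeta>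
  proof -
    define u where "u r = indicator {0<..<1} r *\<^sub>R g (r *\<^sub>R \<zeta>)" for r
    have [measurable]: "u \<in> borel_measurable borel" unfolding u_def[abs_def] by (rule line_holomorphic_ray_borel[OF g \<zeta> order_refl])
    have "radial_part 0 q a g \<zeta> \<le> (\<integral>\<^sup>+r. ennreal C * (ennreal (norm (u r) powr q * (1 - r\<^sup>2) powr (a - 1)) * indicator {0<..<1} r) \<partial>lborel)"
      unfolding radial_part_def
    proof (rule nn_integral_mono)
      fix r :: real
      show "ennreal (norm (g (r *\<^sub>R \<zeta>)) powr q * (1 - r) powr (a - 1)) * indicator {0<..<1} r
        \<le> ennreal C * (ennreal (norm (u r) powr q * (1 - r\<^sup>2) powr (a - 1)) * indicator {0<..<1} r)"
      proof (cases "r \<in> {0<..<1}")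
        case True
        have "(1 - r) powr (a - 1) \<le> C * (1 - r\<^sup>2) powr (a - 1)"
          unfolding C_def using True by (intro one_minus_square_comparable) auto
        from mult_left_mono[OF this, of "norm (g (r *\<^sub>R \<zeta>)) powr q"]
        have "norm (g (r *\<^sub>R \<zeta>)) powr q * (1 - r) powr (a - 1) \<le> C * (norm (g (r *\<^sub>R \<zeta>)) powr q * (1 - r\<^sup>2) powr (a - 1))" by (simp add: mult_ac)
        from ennreal_leI[OF this] show ?thesis using True C by (simp add: u_def ennreal_mult)
      qed simp
    qed
    also have "\<dots> = ennreal C * (\<integral>\<^sup>+r\<in>{0<..<1}. ennreal (norm (u r) powr q * (1 - r\<^sup>2) powr (a - 1)) \<partial>lborel)"
      by (intro nn_integral_cmult) measurable
    also have "(\<integral>\<^sup>+r\<in>{0<..<1}. ennreal (norm (u r) powr q * (1 - r\<^sup>2) powr (a - 1)) \<partial>lborel) = radial_integral k q s f \<zeta>"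
      unfolding radial_integral_def g_def[symmetric] a_def[symmetric] by (intro nn_integral_cong) (auto simp: indicator_def u_def)
    finally show ?thesis .
  qed
  show "\<exists>C0 C. \<forall>\<zeta>. norm \<zeta> = 1 \<longrightarrow> radial_integral k q s f \<zeta> \<le> ennreal C0 + ennreal C * radial_part b q ((real k - s) * q) (IR_power (real k) f) \<zeta>"
    using 1 unfolding g_def a_def by blast
  show "\<exists>C. \<forall>\<zeta>. norm \<zeta> = 1 \<longrightarrow> radial_part 0 q ((real k - s) * q) (IR_power (real k) f) \<zeta> \<le> ennreal C * radial_integral k q s f \<zeta>"
    using 2 unfolding g_def a_def by blast
qed

text \<open>
  The mean value inequality is applied on small boxes around the points of the radius, which stay in the
  admissible region because \<open>\<alpha> > 1\<close>. By Fubini's theorem each point of the region is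
  counted on a segment of radii of length comparable to \<open>1 - |z|\<close>, which accounts for the
  exponent \<open>n + 1\<close> in the area integral.
\<close>
lemma radial_part_le_area:
  fixes f :: "complex ^ 'n \<Rightarrow> complex"
  assumes f: "line_holomorphic f" and q: "1 < q" and \<alpha>: "1 < \<alpha>"
  shows "\<exists>C. \<forall>\<zeta>. norm \<zeta> = 1 \<longrightarrow> radial_part (1/2) q ((real k - s) * q) (IR_power (real k) f) \<zeta> \<le> ennreal C * area_integral \<alpha> k q s f \<zeta>"
proof -
  define n where "n = CARD('n)"
  define g where "g = IR_power (real k) f"
  define a where "a = (real k - s) * q"
  have g: "line_holomorphic g" unfolding g_def by (rule IR_power_line_holomorphic[OF f])
  (* A box of this size stays in the region by d1 below, also after 1 - r is replaced by 1 - |x|. *)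
  define \<delta> where "\<delta> = min (1/4) ((\<alpha> - 1) / (4 * \<alpha>))"
  have \<delta>: "0 < \<delta>" "\<delta> \<le> 1/4" using \<alpha> by (auto simp: \<delta>_def)
  have d1: "1 + \<delta> < \<alpha> * (1 - 2 * \<delta>)"
  proof -
    define ad where "ad = \<alpha> * \<delta>"
    have "\<delta> \<le> (\<alpha> - 1) / (4 * \<alpha>)" by (simp add: \<delta>_def)
    then have "4 * ad \<le> \<alpha> - 1" using \<alpha> by (simp add: ad_def field_simps)
    moreover have "1 * \<delta> < ad" unfolding ad_def using \<alpha> \<delta> by (intro mult_strict_right_mono) auto
    ultimately have "1 + \<delta> < \<alpha> - 2 * ad" using \<delta> by linarith
    then show ?thesis by (simp add: ad_def algebra_simps)
  qed
  obtain C where C: "0 < C" and mean: "\<And>(g :: complex ^ 'n \<Rightarrow> complex) z. line_holomorphic g \<Longrightarrow> 1/2 \<le> norm z \<Longrightarrow> norm z < 1 \<Longrightarrow>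
     ennreal (norm (g z) powr q) \<le> ennreal (C / (1 - norm z) ^ (CARD('n) + 1)) * (\<integral>\<^sup>+x\<in>ellipsoid_box \<delta> z. ennreal (norm (g x) powr q) \<partial>lborel)"
    using ellipsoid_mean_le[of q \<delta>, where 'n = 'n] q \<delta> by fastforce
  define B where "B = 2 powr \<bar>a - real n - 2\<bar> * 2 powr \<bar>a - real n - 1\<bar> * 2"
  have B: "0 < B" by (simp add: B_def)
  define kx where "kx y = (if y \<in> ball 0 1 then g y else 0)" for y
  have [measurable]: "kx \<in> borel_measurable borel" unfolding kx_def[abs_def] by (rule line_holomorphic_borel[OF g])
  have "radial_part (1/2) q a g \<zeta> \<le> ennreal (C * B) * area_integral \<alpha> k q s f \<zeta>" if \<zeta>: "norm \<zeta> = 1" for \<zeta>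
  proof -
    define E where "E = {p :: real \<times> (complex ^ 'n). 1/2 < fst p \<and> fst p < 1 \<and> (1 - 2 * \<delta>) * (1 - fst p) \<le> 1 - norm (snd p)
       \<and> 1 - norm (snd p) \<le> (1 + \<delta>) * (1 - fst p) \<and> norm (1 - hermitian (snd p) \<zeta>) \<le> (1 + \<delta>) * (1 - fst p)}"
    have E [measurable]: "Measurable.pred (borel \<Otimes>\<^sub>M borel) (\<lambda>p. p \<in> E)" unfolding E_def mem_Collect_eq by measurable
    let ?F = "\<lambda>r x. ennreal (norm (kx x) powr q) * (ennreal (C * (1 - r) powr (a - real n - 2)) * (if (r, x) \<in> E then 1 else 0))"
    have "radial_part (1/2) q a g \<zeta> \<le> (\<integral>\<^sup>+r. (\<integral>\<^sup>+x. ?F r x \<partial>lborel) \<partial>lborel)"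
      unfolding radial_part_def
    proof (rule nn_integral_mono)
      fix r :: real
      show "ennreal (norm (g (r *\<^sub>R \<zeta>)) powr q * (1 - r) powr (a - 1)) * indicator {1/2<..<1} r \<le> (\<integral>\<^sup>+x. ?F r x \<partial>lborel)"
      proof (cases "r \<in> {1/2<..<1}")
        case True
        have nr: "norm (r *\<^sub>R \<zeta>) = r" using True \<zeta> by simp
        have dr: "dir (r *\<^sub>R \<zeta>) = \<zeta>" using True \<zeta> by (simp add: dir_scaleR) (simp add: dir_def)
        have "ennreal (norm (g (r *\<^sub>R \<zeta>)) powr q) * ennreal ((1 - r) powr (a - 1))
           \<le> ennreal (C / (1 - r) ^ (n + 1)) * (\<integral>\<^sup>+x\<in>ellipsoid_box \<delta> (r *\<^sub>R \<zeta>). ennreal (norm (g x) powr q) \<partial>lborel) * ennreal ((1 - r) powr (a - 1))"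
          using mean[OF g, of "r *\<^sub>R \<zeta>"] nr True unfolding n_def by (intro mult_right_mono) auto
        also have "\<dots> = ennreal (C * (1 - r) powr (a - real n - 2)) * (\<integral>\<^sup>+x\<in>ellipsoid_box \<delta> (r *\<^sub>R \<zeta>). ennreal (norm (g x) powr q) \<partial>lborel)"
        proof -
          have "C / (1 - r) ^ (n + 1) * (1 - r) powr (a - 1) = C * (1 - r) powr (a - real n - 2)"
          proof -
            have "(1 - r) ^ (n + 1) = (1 - r) powr (real n + 1)" using True powr_realpow[of "1 - r" "n + 1"] by (simp add: add.commute)
            moreover have "a - real n - 2 = (a - 1) - (real n + 1)" by simp
            ultimately show ?thesis by (simp only: powr_diff) simp
          qed
          moreover have "ennreal (C / (1 - r) ^ (n + 1)) * ennreal ((1 - r) powr (a - 1)) = ennreal (C / (1 - r) ^ (n + 1) * (1 - r) powr (a - 1))"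
            using C True by (intro ennreal_mult[symmetric]) auto
          ultimately have e: "ennreal (C / (1 - r) ^ (n + 1)) * ennreal ((1 - r) powr (a - 1)) = ennreal (C * (1 - r) powr (a - real n - 2))" by (simp only:)
          show ?thesis unfolding e[symmetric] by (simp only: ac_simps)
        qed
        also have "(\<integral>\<^sup>+x\<in>ellipsoid_box \<delta> (r *\<^sub>R \<zeta>). ennreal (norm (g x) powr q) \<partial>lborel) = (\<integral>\<^sup>+x. ennreal (norm (kx x) powr q) * (if (r, x) \<in> E then 1 else 0) \<partial>lborel)"
        proof (rule nn_integral_cong)
          fix x
          have "x \<in> ellipsoid_box \<delta> (r *\<^sub>R \<zeta>) \<longleftrightarrow> (r, x) \<in> E" using True by (simp add: ellipsoid_box_def E_def nr dr del: norm_scaleR)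
          moreover have "norm x < 1" if "(r, x) \<in> E"
          proof -
            have "0 < (1 - 2 * \<delta>) * (1 - r)" using \<delta> True by (intro mult_pos_pos) auto
            then show ?thesis using that by (simp add: E_def)
          qed
          ultimately show "ennreal (norm (g x) powr q) * indicator (ellipsoid_box \<delta> (r *\<^sub>R \<zeta>)) x = ennreal (norm (kx x) powr q) * (if (r, x) \<in> E then 1 else 0)"
            by (auto simp: kx_def indicator_def)
        qed
        also have "ennreal (C * (1 - r) powr (a - real n - 2)) * \<dots> = (\<integral>\<^sup>+x. ennreal (C * (1 - r) powr (a - real n - 2)) * (ennreal (norm (kx x) powr q) * (if (r, x) \<in> E then 1 else 0)) \<partial>lborel)"
          by (rule nn_integral_cmult[symmetric]) measurable
        finally show ?thesis using True by (simp add: ennreal_mult mult_ac)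
      qed simp
    qed
    also have "\<dots> = (\<integral>\<^sup>+x. (\<integral>\<^sup>+r. ?F r x \<partial>lborel) \<partial>lborel)"
      by (rule lborel_pair.Fubini'[symmetric], subst measurable_cong_sets[OF sets_pair_measure_cong[OF sets_lborel sets_lborel] refl]) measurable
    also have "\<dots> \<le> (\<integral>\<^sup>+x. ennreal (C * B) * (ennreal (norm (kx x) powr q * (1 - (norm x)\<^sup>2) powr (a - real n - 1)) * (if norm x < 1 \<and> norm (1 - hermitian x \<zeta>) < \<alpha> * (1 - norm x) then 1 else 0)) \<partial>lborel)"
    proof (rule nn_integral_mono)
      fix x :: "complex ^ 'n"
      define \<tau> where "\<tau> = 1 - norm x"
      have inE: "0 < \<tau> \<and> norm (1 - hermitian x \<zeta>) < \<alpha> * \<tau> \<and> 1 - r \<le> 2 * \<tau> \<and> \<tau> \<le> 2 * (1 - r) \<and> 1/2 < r \<and> r < 1" if e: "(r, x) \<in> E" for r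
      proof -
        have r: "1/2 < r" "r < 1" and lo: "(1 - 2 * \<delta>) * (1 - r) \<le> \<tau>" and hi: "\<tau> \<le> (1 + \<delta>) * (1 - r)" and h: "norm (1 - hermitian x \<zeta>) \<le> (1 + \<delta>) * (1 - r)"
          using e by (auto simp: E_def \<tau>_def)
        have "(1/2) * (1 - r) \<le> (1 - 2 * \<delta>) * (1 - r)" using \<delta> r by (intro mult_right_mono) auto
        then have 1: "1 - r \<le> 2 * \<tau>" using lo by simp
        have "(1 + \<delta>) * (1 - r) \<le> 2 * (1 - r)" using \<delta> r by (intro mult_right_mono) auto
        then have 2: "\<tau> \<le> 2 * (1 - r)" using hi by simp
        have "(1 + \<delta>) * (1 - r) < \<alpha> * (1 - 2 * \<delta>) * (1 - r)" using d1 r by (intro mult_strict_right_mono) auto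
        also have "\<dots> \<le> \<alpha> * \<tau>" using lo \<alpha> by (simp add: mult.assoc)
        finally have lt: "(1 + \<delta>) * (1 - r) < \<alpha> * \<tau>" .
        have "norm (1 - hermitian x \<zeta>) < \<alpha> * \<tau>" by (rule le_less_trans[OF h lt])
        moreover have "0 < \<tau>" using 1 r by linarith
        ultimately show ?thesis using 1 2 r by blast
      qed
      show "(\<integral>\<^sup>+r. ?F r x \<partial>lborel) \<le> ennreal (C * B) * (ennreal (norm (kx x) powr q * (1 - (norm x)\<^sup>2) powr (a - real n - 1)) * (if norm x < 1 \<and> norm (1 - hermitian x \<zeta>) < \<alpha> * (1 - norm x) then 1 else 0))"
      proof (cases "\<exists>r. (r, x) \<in> E")
        case False
        then show ?thesis by simp
      next
        case True
        then have \<tau>: "0 < \<tau>" "norm (1 - hermitian x \<zeta>) < \<alpha> * \<tau>" using inE by blast+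
        have "(\<integral>\<^sup>+r. ?F r x \<partial>lborel) \<le> (\<integral>\<^sup>+r. ennreal (norm (kx x) powr q) * ennreal (C * (2 powr \<bar>a - real n - 2\<bar> * \<tau> powr (a - real n - 2))) * indicator {1 - 2 * \<tau>..1} r \<partial>lborel)"
        proof (rule nn_integral_mono)
          fix r :: real
          show "?F r x \<le> ennreal (norm (kx x) powr q) * ennreal (C * (2 powr \<bar>a - real n - 2\<bar> * \<tau> powr (a - real n - 2))) * indicator {1 - 2 * \<tau>..1} r"
          proof (cases "(r, x) \<in> E")
            case True
            have "(1 - r) powr (a - real n - 2) \<le> 2 powr \<bar>a - real n - 2\<bar> * \<tau> powr (a - real n - 2)"
              using inE[OF True] by (intro powr_comparable) auto
            then have "ennreal (C * (1 - r) powr (a - real n - 2)) \<le> ennreal (C * (2 powr \<bar>a - real n - 2\<bar> * \<tau> powr (a - real n - 2)))"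
              using C by (intro ennreal_leI mult_left_mono) auto
            then show ?thesis using True inE[OF True] by (auto intro: mult_left_mono)
          qed simp
        qed
        also have "\<dots> = ennreal (norm (kx x) powr q) * ennreal (C * (2 powr \<bar>a - real n - 2\<bar> * \<tau> powr (a - real n - 2))) * ennreal (2 * \<tau>)"
          using \<tau> by (subst nn_integral_cmult_indicator) auto
        also have "\<dots> = ennreal (norm (kx x) powr q * (C * (2 powr \<bar>a - real n - 2\<bar> * (\<tau> powr (a - real n - 2) * \<tau>) * 2)))"
          using C \<tau> by (simp add: ennreal_mult[symmetric] mult_ac)
        also have "\<tau> powr (a - real n - 2) * \<tau> = \<tau> powr (a - real n - 1)"
        proof -
          have "a - real n - 1 = (a - real n - 2) + 1" by simp
          then show ?thesis using \<tau> by (simp only: powr_add) simp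
        qed
        also have "ennreal (norm (kx x) powr q * (C * (2 powr \<bar>a - real n - 2\<bar> * \<tau> powr (a - real n - 1) * 2))) \<le> ennreal (C * B * (norm (kx x) powr q * (1 - (norm x)\<^sup>2) powr (a - real n - 1)))"
        proof (rule ennreal_leI)
          have "\<tau> powr (a - real n - 1) \<le> 2 powr \<bar>a - real n - 1\<bar> * (1 - (norm x)\<^sup>2) powr (a - real n - 1)"
            unfolding \<tau>_def using \<tau> by (intro one_minus_square_comparable) (auto simp: \<tau>_def)
          from mult_left_mono[OF this, of "norm (kx x) powr q * C * 2 powr \<bar>a - real n - 2\<bar> * 2"]
          show "norm (kx x) powr q * (C * (2 powr \<bar>a - real n - 2\<bar> * \<tau> powr (a - real n - 1) * 2)) \<le> C * B * (norm (kx x) powr q * (1 - (norm x)\<^sup>2) powr (a - real n - 1))"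
            using C by (simp add: B_def mult_ac)
        qed
        finally show ?thesis using \<tau> C B by (simp add: \<tau>_def ennreal_mult[symmetric])
      qed
    qed
    also have "\<dots> = ennreal (C * B) * (\<integral>\<^sup>+x. ennreal (norm (kx x) powr q * (1 - (norm x)\<^sup>2) powr (a - real n - 1)) * (if norm x < 1 \<and> norm (1 - hermitian x \<zeta>) < \<alpha> * (1 - norm x) then 1 else 0) \<partial>lborel)"
      by (rule nn_integral_cmult) measurable
    also have "(\<integral>\<^sup>+x. ennreal (norm (kx x) powr q * (1 - (norm x)\<^sup>2) powr (a - real n - 1)) * (if norm x < 1 \<and> norm (1 - hermitian x \<zeta>) < \<alpha> * (1 - norm x) then 1 else 0) \<partial>lborel) = area_integral \<alpha> k q s f \<zeta>"
      unfolding area_integral_def by (intro nn_integral_cong) (auto simp: admissible_region_def indicator_def kx_def g_def a_def n_def)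
    finally show ?thesis .
  qed
  then show ?thesis unfolding g_def a_def by blast
qed

lemma radial_integral_measurable:
  fixes f :: "complex ^ 'n \<Rightarrow> complex"
  assumes f: "line_holomorphic f"
  shows "radial_integral k q s f \<in> borel_measurable borel_sphere"
proof -
  define g where "g = IR_power (real k) f"
  have g: "line_holomorphic g" unfolding g_def by (rule IR_power_line_holomorphic[OF f])
  define kx where "kx y = (if y \<in> ball 0 1 then g y else 0)" for y
  have [measurable]: "kx \<in> borel_measurable borel" unfolding kx_def[abs_def] by (rule line_holomorphic_borel[OF g])
  let ?F = "\<lambda>\<zeta> r. ennreal (norm (kx (r *\<^sub>R \<zeta>)) powr q * (1 - r\<^sup>2) powr ((real k - s) * q - 1)) * indicator {0<..<1} r"
  have "case_prod ?F \<in> borel_measurable (borel \<Otimes>\<^sub>M lborel)"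
    by (subst measurable_cong_sets[OF sets_pair_measure_cong[OF refl sets_lborel] refl]) measurable
  then have "(\<lambda>\<zeta>. \<integral>\<^sup>+r. ?F \<zeta> r \<partial>lborel) \<in> borel_measurable borel" by (rule lborel.borel_measurable_nn_integral)
  then have "(\<lambda>\<zeta>. \<integral>\<^sup>+r. ?F \<zeta> r \<partial>lborel) \<in> borel_measurable borel_sphere" by (rule measurable_borel_sphereI)
  moreover have "radial_integral k q s f \<zeta> = (\<integral>\<^sup>+r. ?F \<zeta> r \<partial>lborel)" if "\<zeta> \<in> space borel_sphere" for \<zeta>
    unfolding radial_integral_def using that
    by (intro nn_integral_cong) (auto simp: kx_def g_def indicator_def space_borel_sphere)
  ultimately show ?thesis by (simp cong: measurable_cong)
qed

lemma area_integral_measurable: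
  fixes f :: "complex ^ 'n \<Rightarrow> complex"
  assumes f: "line_holomorphic f"
  shows "area_integral \<alpha> k q s f \<in> borel_measurable borel_sphere"
proof -
  define g where "g = IR_power (real k) f"
  have g: "line_holomorphic g" unfolding g_def by (rule IR_power_line_holomorphic[OF f])
  define kx where "kx y = (if y \<in> ball 0 1 then g y else 0)" for y
  have [measurable]: "kx \<in> borel_measurable borel" unfolding kx_def[abs_def] by (rule line_holomorphic_borel[OF g])
  let ?F = "\<lambda>\<zeta> z. ennreal (norm (kx z) powr q * (1 - (norm z)\<^sup>2) powr ((real k - s) * q - real CARD('n) - 1)) * (if norm z < 1 \<and> norm (1 - hermitian z \<zeta>) < \<alpha> * (1 - norm z) then 1 else 0)"
  have "case_prod ?F \<in> borel_measurable (borel \<Otimes>\<^sub>M lborel)"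
    by (subst measurable_cong_sets[OF sets_pair_measure_cong[OF refl sets_lborel] refl]) measurable
  then have "(\<lambda>\<zeta>. \<integral>\<^sup>+z. ?F \<zeta> z \<partial>lborel) \<in> borel_measurable borel" by (rule lborel.borel_measurable_nn_integral)
  then have "(\<lambda>\<zeta>. \<integral>\<^sup>+z. ?F \<zeta> z \<partial>lborel) \<in> borel_measurable borel_sphere" by (rule measurable_borel_sphereI)
  moreover have e: "area_integral \<alpha> k q s f = (\<lambda>\<zeta>. \<integral>\<^sup>+z. ?F \<zeta> z \<partial>lborel)"
    unfolding area_integral_def by (intro ext nn_integral_cong) (auto simp: admissible_region_def indicator_def kx_def g_def)
  ultimately show ?thesis unfolding e by (simp only:)
qed

section \<open>Muckenhoupt weights are doubling\<close>

definition ndist :: "complex ^ 'n \<Rightarrow> complex ^ 'n \<Rightarrow> real" where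
  "ndist x y = norm (1 - hermitian x y)"

lemma sets_nonisotropic_ball: "nonisotropic_ball \<zeta> r \<in> sets borel_sphere"
proof -
  have "sphere (0 :: complex ^ 'n) 1 \<in> sets borel" by simp
  then show ?thesis
    unfolding sets_borel_sphere using nonisotropic_ball_borel
    by (subst sets_restrict_space_iff) (auto simp: nonisotropic_ball_def)
qed

lemma emeasure_borel_sphere_ball: "emeasure borel_sphere (nonisotropic_ball \<zeta> r) = emeasure dir_measure (nonisotropic_ball \<zeta> r)"
  by (rule emeasure_borel_sphere[OF nonisotropic_ball_borel]) (auto simp: nonisotropic_ball_def)

lemma emeasure_borel_sphere_ball_fin: "emeasure borel_sphere (nonisotropic_ball \<zeta> r) \<noteq> top"
  unfolding emeasure_borel_sphere_ball
  by (simp add: finite_measure.emeasure_finite[OF finite_measure_dir_measure])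

lemma emeasure_borel_sphere_ball_pos:
  fixes \<zeta> :: "complex ^ 'n"
  assumes "norm \<zeta> = 1" "0 < r" shows "emeasure borel_sphere (nonisotropic_ball \<zeta> r) \<noteq> 0"
proof -
  obtain c where c: "0 < c" "ennreal (c * min r 1 ^ CARD('n)) \<le> emeasure dir_measure (nonisotropic_ball \<zeta> r)"
    using emeasure_nonisotropic_ball_lower[where 'n = 'n] assms by blast
  moreover have "0 < ennreal (c * min r 1 ^ CARD('n))" using c(1) assms by simp
  ultimately show ?thesis unfolding emeasure_borel_sphere_ball by (metis less_le_trans less_irrefl)
qed

text \<open>The radius 3 exceeds the diameter.\<close>
lemma nonisotropic_ball_eq_sphere: "norm \<zeta> = 1 \<Longrightarrow> nonisotropic_ball \<zeta> 3 = sphere 0 1"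
  using norm_one_minus_hermitian_le_2[of \<zeta>] by (fastforce simp: nonisotropic_ball_def)

text \<open>
  A Borel representative of an \<open>A\<^sub>p\<close> weight. The zero weight, which satisfies the
  condition because \<open>0 * \<infinity> = 0\<close>, is excluded.
\<close>
locale muckenhoupt =
  fixes p :: real and W :: "complex ^ 'n \<Rightarrow> ennreal" and A :: real
  assumes p: "1 < p" and W_measurable [measurable]: "W \<in> borel_measurable borel_sphere"
    and W_fin: "\<And>x. W x < top" and A: "0 < A"
    and Ap: "\<And>\<zeta> r. norm \<zeta> = 1 \<Longrightarrow> 0 < r \<Longrightarrow>
      (\<integral>\<^sup>+\<eta>\<in>nonisotropic_ball \<zeta> r. W \<eta> \<partial>borel_sphere) / emeasure borel_sphere (nonisotropic_ball \<zeta> r) *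
      ennpowr ((\<integral>\<^sup>+\<eta>\<in>nonisotropic_ball \<zeta> r. ennpowr (W \<eta>) (- 1 / (p - 1)) \<partial>borel_sphere) /
         emeasure borel_sphere (nonisotropic_ball \<zeta> r)) (p - 1) \<le> ennreal A"
    and W_nontrivial: "(\<integral>\<^sup>+\<eta>. W \<eta> \<partial>borel_sphere) \<noteq> 0"
begin

definition mu :: "(complex ^ 'n) measure" where "mu = density borel_sphere W"

lemma sets_mu [measurable_cong]: "sets mu = sets borel_sphere"
  by (simp add: mu_def)

lemma space_mu: "space mu = sphere 0 1"
  by (simp add: mu_def space_borel_sphere)

lemma emeasure_mu_ball: "emeasure mu (nonisotropic_ball \<zeta> r) = (\<integral>\<^sup>+\<eta>\<in>nonisotropic_ball \<zeta> r. W \<eta> \<partial>borel_sphere)"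
  unfolding mu_def by (rule emeasure_density) (auto simp: sets_nonisotropic_ball)

lemma integral_sphere: "norm \<zeta> = 1 \<Longrightarrow> (\<integral>\<^sup>+\<eta>\<in>nonisotropic_ball \<zeta> 3. F \<eta> \<partial>borel_sphere) = (\<integral>\<^sup>+\<eta>. F \<eta> \<partial>borel_sphere)"
  by (intro nn_integral_cong) (simp add: nonisotropic_ball_eq_sphere space_borel_sphere)

text \<open>
  The product of the two averages over the whole sphere is finite. As the first is not 0, the second is not
  \<open>\<infinity>\<close>, so \<open>W\<close> vanishes only on a null set; then the second is not 0, so
  the first is not \<open>\<infinity>\<close>.
\<close>
lemma W_pos: "AE \<eta> in borel_sphere. W \<eta> \<noteq> 0"
  and mu_fin: "(\<integral>\<^sup>+\<eta>. W \<eta> \<partial>borel_sphere) \<noteq> top"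
proof -
  define e where "e = (axis undefined 1 :: complex ^ 'n)"
  have e: "norm e = 1" by (simp add: e_def norm_axis_one)
  let ?b = "emeasure borel_sphere (nonisotropic_ball e 3)"
  let ?Y = "\<integral>\<^sup>+\<eta>. ennpowr (W \<eta>) (- 1 / (p - 1)) \<partial>borel_sphere"
  let ?X = "\<integral>\<^sup>+\<eta>. W \<eta> \<partial>borel_sphere"
  have b: "?b \<noteq> 0" "?b \<noteq> top" using emeasure_borel_sphere_ball_pos[OF e, of 3] emeasure_borel_sphere_ball_fin[of e 3] by auto
  have main: "?X / ?b * ennpowr (?Y / ?b) (p - 1) \<le> ennreal A"
    using Ap[OF e, of 3] unfolding integral_sphere[OF e] by simp
  have X0: "?X / ?b \<noteq> 0" using W_nontrivial b by (simp add: ennreal_divide_eq_0_iff)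
  have "?Y \<noteq> top"
  proof
    assume Y: "?Y = top"
    then have "?Y / ?b = top" using b by (simp add: ennreal_top_divide)
    then have "?X / ?b * ennpowr (?Y / ?b) (p - 1) = top" using X0 p by (simp add: ennreal_mult_top)
    then show False using main by (simp add: top_unique)
  qed
  then have "AE \<eta> in borel_sphere. ennpowr (W \<eta>) (- 1 / (p - 1)) \<noteq> \<infinity>"
    by (intro nn_integral_PInf_AE) auto
  then show "AE \<eta> in borel_sphere. W \<eta> \<noteq> 0"
    by eventually_elim (use p in \<open>auto simp: ennpowr_def\<close>)
  then have "AE \<eta> in borel_sphere. ennpowr (W \<eta>) (- 1 / (p - 1)) \<noteq> 0"
  proof eventually_elim
    case (elim \<eta>)
    obtain v where v: "W \<eta> = ennreal v" "0 < v" using elim W_fin[of \<eta>] by (cases rule: ennreal_pos_cases[of "W \<eta>"]) auto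
    then show ?case by (simp add: ennpowr_ennreal_pos ennreal_eq_0_iff)
  qed
  moreover have "?Y \<noteq> 0"
  proof
    assume "?Y = 0"
    then have "AE \<eta> in borel_sphere. ennpowr (W \<eta>) (- 1 / (p - 1)) = 0" by (subst (asm) nn_integral_0_iff_AE) auto
    with calculation have "AE \<eta> in borel_sphere. \<eta> \<notin> nonisotropic_ball e 3"
      by eventually_elim simp
    then have "emeasure borel_sphere (nonisotropic_ball e 3) = 0"
      using AE_iff_measurable[OF sets_nonisotropic_ball[of e 3], of "\<lambda>\<eta>. \<eta> \<notin> nonisotropic_ball e 3"]
      by (auto simp: nonisotropic_ball_def space_borel_sphere)
    then show False using b(1) by simp
  qed
  then have Y0: "ennpowr (?Y / ?b) (p - 1) \<noteq> 0" using p b by (simp add: ennpowr_eq_0_iff ennreal_divide_eq_0_iff)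
  show "?X \<noteq> top"
  proof
    assume "?X = top"
    then have "?X / ?b = top" using b by (simp add: ennreal_top_divide)
    then have "?X / ?b * ennpowr (?Y / ?b) (p - 1) = top" using Y0 by (simp add: ennreal_top_mult)
    then show False using main by (simp add: top_unique)
  qed
qed

lemma finite_measure_mu: "finite_measure mu"
proof (rule finite_measureI)
  have "emeasure mu (space mu) = (\<integral>\<^sup>+\<eta>. W \<eta> * indicator (space borel_sphere) \<eta> \<partial>borel_sphere)"
    unfolding mu_def by (subst emeasure_density) auto
  also have "\<dots> = (\<integral>\<^sup>+\<eta>. W \<eta> \<partial>borel_sphere)" by (intro nn_integral_cong) simp
  finally show "emeasure mu (space mu) \<noteq> \<infinity>" using mu_fin by simp
qed

lemma emeasure_mu_ball_pos:
  assumes "norm \<zeta> = 1" "0 < r" shows "emeasure mu (nonisotropic_ball \<zeta> r) \<noteq> 0"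
proof
  assume "emeasure mu (nonisotropic_ball \<zeta> r) = 0"
  then have "AE \<eta> in borel_sphere. W \<eta> * indicator (nonisotropic_ball \<zeta> r) \<eta> = 0"
    unfolding emeasure_mu_ball using sets_nonisotropic_ball[of \<zeta> r, measurable]
    by (subst (asm) nn_integral_0_iff_AE) measurable
  with W_pos have "AE \<eta> in borel_sphere. \<eta> \<notin> nonisotropic_ball \<zeta> r"
    by eventually_elim (auto simp: indicator_def split: if_splits)
  then have "emeasure borel_sphere (nonisotropic_ball \<zeta> r) = 0"
    using AE_iff_measurable[OF sets_nonisotropic_ball[of \<zeta> r], of "\<lambda>\<eta>. \<eta> \<notin> nonisotropic_ball \<zeta> r"]
    by (auto simp: nonisotropic_ball_def space_borel_sphere)
  then show False using emeasure_borel_sphere_ball_pos[OF assms] by simp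
qed

text \<open>
  Write \<open>H\<^sup>1\<^sup>/\<^sup>p = (H W)\<^sup>1\<^sup>/\<^sup>p
  W\<^sup>-\<^sup>1\<^sup>/\<^sup>p\<close>, apply Hoelder's inequality, and estimate the factor with the
  negative power of \<open>W\<close> by the \<open>A\<^sub>p\<close> condition.
\<close>
lemma sphere_average_le:
  assumes [measurable]: "H \<in> borel_measurable borel_sphere" and \<zeta>: "norm \<zeta> = 1" and r: "0 < r"
  shows "(\<integral>\<^sup>+\<eta>\<in>nonisotropic_ball \<zeta> r. ennpowr (H \<eta>) (1 / p) \<partial>borel_sphere)
    \<le> ennreal (A powr (1 / p)) * emeasure borel_sphere (nonisotropic_ball \<zeta> r) *
       ennpowr ((\<integral>\<^sup>+\<eta>\<in>nonisotropic_ball \<zeta> r. H \<eta> \<partial>mu) / emeasure mu (nonisotropic_ball \<zeta> r)) (1 / p)"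
proof -
  let ?B = "nonisotropic_ball \<zeta> r"
  note [measurable] = sets_nonisotropic_ball[of \<zeta> r]
  interpret mu: finite_measure mu by (rule finite_measure_mu)
  define p' where "p' = p / (p - 1)"
  have p': "1 < p'" "1 / p + 1 / p' = 1" "1 / p' = (p - 1) / p" using p by (auto simp: p'_def field_simps)
  define V where "V \<eta> = ennpowr (W \<eta>) (- 1 / (p - 1))" for \<eta>
  have [measurable]: "V \<in> borel_measurable borel_sphere" unfolding V_def by measurable
  have e1: "(p - 1) / p * p' = 1" using p by (simp add: p'_def)
  have pp: "0 < (p - 1) / p" "0 < 1 / p" using p by auto
  have "(\<integral>\<^sup>+\<eta>\<in>?B. ennpowr (H \<eta>) (1 / p) \<partial>borel_sphere)
      = (\<integral>\<^sup>+\<eta>. (ennpowr (H \<eta> * W \<eta>) (1 / p) * indicator ?B \<eta>) * (ennpowr (V \<eta>) ((p - 1) / p) * indicator ?B \<eta>) \<partial>borel_sphere)"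
  proof (rule nn_integral_cong_AE)
    show "AE \<eta> in borel_sphere. ennpowr (H \<eta>) (1 / p) * indicator ?B \<eta> = (ennpowr (H \<eta> * W \<eta>) (1 / p) * indicator ?B \<eta>) * (ennpowr (V \<eta>) ((p - 1) / p) * indicator ?B \<eta>)"
      using W_pos
    proof eventually_elim
      case (elim \<eta>)
      obtain v where v: "W \<eta> = ennreal v" "0 < v" using elim W_fin[of \<eta>] by (cases rule: ennreal_pos_cases[of "W \<eta>"]) auto
      have "(v powr (- 1 / (p - 1))) powr ((p - 1) / p) = v powr (- 1 / p)" using p by (simp add: powr_powr)
      then have "ennpowr (V \<eta>) ((p - 1) / p) = ennreal (v powr (- 1 / p))" using v pp by (simp add: V_def ennpowr_ennreal_pos)
      moreover have "ennpowr (H \<eta> * W \<eta>) (1 / p) = ennpowr (H \<eta>) (1 / p) * ennreal (v powr (1 / p))"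
        using v pp by (simp add: ennpowr_mult ennpowr_ennreal_pos)
      moreover have "ennreal (v powr (1 / p)) * ennreal (v powr (- 1 / p)) = 1"
        using v by (simp add: ennreal_mult[symmetric] powr_add[symmetric])
      ultimately have "ennpowr (H \<eta> * W \<eta>) (1 / p) * ennpowr (V \<eta>) ((p - 1) / p) = ennpowr (H \<eta>) (1 / p)"
        by (simp add: mult.assoc)
      then show ?case by (simp add: indicator_def)
    qed
  qed
  also have "\<dots> \<le> ennpowr (\<integral>\<^sup>+\<eta>. ennpowr (ennpowr (H \<eta> * W \<eta>) (1 / p) * indicator ?B \<eta>) p \<partial>borel_sphere) (1 / p)
      * ennpowr (\<integral>\<^sup>+\<eta>. ennpowr (ennpowr (V \<eta>) ((p - 1) / p) * indicator ?B \<eta>) p' \<partial>borel_sphere) (1 / p')"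
    by (rule Holder_nn_integral[OF p p'(1,2)]) measurable
  also have "(\<integral>\<^sup>+\<eta>. ennpowr (ennpowr (H \<eta> * W \<eta>) (1 / p) * indicator ?B \<eta>) p \<partial>borel_sphere) = (\<integral>\<^sup>+\<eta>\<in>?B. H \<eta> \<partial>mu)"
  proof -
    have "(\<integral>\<^sup>+\<eta>\<in>?B. H \<eta> \<partial>mu) = (\<integral>\<^sup>+\<eta>. W \<eta> * (H \<eta> * indicator ?B \<eta>) \<partial>borel_sphere)"
      unfolding mu_def by (rule nn_integral_density) measurable
    moreover have "ennpowr (ennpowr (H \<eta> * W \<eta>) (1 / p) * indicator ?B \<eta>) p = W \<eta> * (H \<eta> * indicator ?B \<eta>)" for \<eta>
      using p by (simp add: indicator_def ennpowr_inverse mult.commute)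
    ultimately show ?thesis by simp
  qed
  also have "(\<integral>\<^sup>+\<eta>. ennpowr (ennpowr (V \<eta>) ((p - 1) / p) * indicator ?B \<eta>) p' \<partial>borel_sphere) = (\<integral>\<^sup>+\<eta>\<in>?B. V \<eta> \<partial>borel_sphere)"
    using p' pp e1 by (intro nn_integral_cong) (auto simp: indicator_def ennpowr_ennpowr)
  finally have le: "(\<integral>\<^sup>+\<eta>\<in>?B. ennpowr (H \<eta>) (1 / p) \<partial>borel_sphere) \<le> ennpowr (\<integral>\<^sup>+\<eta>\<in>?B. H \<eta> \<partial>mu) (1 / p) * ennpowr (\<integral>\<^sup>+\<eta>\<in>?B. V \<eta> \<partial>borel_sphere) ((p - 1) / p)"
    unfolding p'(3) .
  obtain b where b: "emeasure borel_sphere ?B = ennreal b" "0 < b"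
    using emeasure_borel_sphere_ball_pos[OF \<zeta> r] emeasure_borel_sphere_ball_fin[of \<zeta> r] by (metis ennreal_pos_cases)
  obtain m where m: "emeasure mu ?B = ennreal m" "0 < m"
    using emeasure_mu_ball_pos[OF \<zeta> r] mu.emeasure_finite[of ?B] by (metis ennreal_pos_cases)
  have ap: "ennreal m / ennreal b * ennpowr ((\<integral>\<^sup>+\<eta>\<in>?B. V \<eta> \<partial>borel_sphere) / ennreal b) (p - 1) \<le> ennreal A"
    using Ap[OF \<zeta> r] unfolding emeasure_mu_ball[symmetric] b(1) m(1) V_def .
  obtain y where y: "(\<integral>\<^sup>+\<eta>\<in>?B. V \<eta> \<partial>borel_sphere) = ennreal y" "0 \<le> y"
  proof (cases "\<integral>\<^sup>+\<eta>\<in>?B. V \<eta> \<partial>borel_sphere")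
    case top
    have "ennreal m / ennreal b * ennpowr (top / ennreal b) (p - 1) = top"
      using b(2) m(2) p by (simp add: ennreal_top_divide divide_ennreal ennreal_mult_top)
    then show ?thesis using ap top by (simp add: top_unique)
  qed (use that in blast)
  have ypow: "y powr ((p - 1) / p) \<le> A powr (1 / p) * b * m powr (- 1 / p)"
  proof -
    have "m / b * (y / b) powr (p - 1) \<le> A"
      using ap b(2) m(2) y p A by (simp add: y(1) divide_ennreal ennpowr_ennreal ennreal_mult[symmetric])
    then have "(y / b) powr (p - 1) \<le> A * b / m" using b(2) m(2) by (simp add: field_simps)
    then have "((y / b) powr (p - 1)) powr (1 / p) \<le> (A * b / m) powr (1 / p)" using p by (intro powr_mono2) auto
    then have "(y / b) powr ((p - 1) / p) \<le> (A * b / m) powr (1 / p)" by (simp add: powr_powr)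
    then have "b powr ((p - 1) / p) * (y / b) powr ((p - 1) / p) \<le> b powr ((p - 1) / p) * (A * b / m) powr (1 / p)" by (intro mult_left_mono) auto
    also have "b powr ((p - 1) / p) * (y / b) powr ((p - 1) / p) = y powr ((p - 1) / p)"
      using b(2) y(2) by (simp add: powr_mult[symmetric])
    also have "b powr ((p - 1) / p) * (A * b / m) powr (1 / p) = A powr (1 / p) * (b powr ((p - 1) / p) * b powr (1 / p)) * m powr (- 1 / p)"
      using b(2) m(2) A by (simp add: powr_mult powr_divide powr_minus field_simps)
    also have "b powr ((p - 1) / p) * b powr (1 / p) = b"
    proof -
      have "(p - 1) / p + 1 / p = 1" using p by (simp add: field_simps)
      then show ?thesis using b(2) by (simp add: powr_add[symmetric])
    qed
    finally show ?thesis .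
  qed
  have "(\<integral>\<^sup>+\<eta>\<in>?B. ennpowr (H \<eta>) (1 / p) \<partial>borel_sphere) \<le> ennpowr (\<integral>\<^sup>+\<eta>\<in>?B. H \<eta> \<partial>mu) (1 / p) * ennreal (A powr (1 / p) * b * m powr (- 1 / p))"
  proof (rule order_trans[OF le])
    have "ennpowr (\<integral>\<^sup>+\<eta>\<in>?B. V \<eta> \<partial>borel_sphere) ((p - 1) / p) = ennreal (y powr ((p - 1) / p))"
      unfolding y(1) using y(2) pp(1) by (rule ennpowr_ennreal)
    then show "ennpowr (\<integral>\<^sup>+\<eta>\<in>?B. H \<eta> \<partial>mu) (1 / p) * ennpowr (\<integral>\<^sup>+\<eta>\<in>?B. V \<eta> \<partial>borel_sphere) ((p - 1) / p)
      \<le> ennpowr (\<integral>\<^sup>+\<eta>\<in>?B. H \<eta> \<partial>mu) (1 / p) * ennreal (A powr (1 / p) * b * m powr (- 1 / p))"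
      using ennreal_leI[OF ypow] by (simp only: mult_left_mono zero_le)
  qed
  also have "\<dots> = ennreal (A powr (1 / p)) * ennreal b * (ennpowr (\<integral>\<^sup>+\<eta>\<in>?B. H \<eta> \<partial>mu) (1 / p) * ennreal (m powr (- 1 / p)))"
    using b(2) by (simp add: ennreal_mult mult_ac)
  also have "ennpowr (\<integral>\<^sup>+\<eta>\<in>?B. H \<eta> \<partial>mu) (1 / p) * ennreal (m powr (- 1 / p)) = ennpowr ((\<integral>\<^sup>+\<eta>\<in>?B. H \<eta> \<partial>mu) / ennreal m) (1 / p)"
    using m(2) pp by (simp add: divide_ennreal_def ennpowr_mult inverse_ennreal ennpowr_ennreal_pos powr_minus inverse_powr)
  finally show ?thesis unfolding b(1) m(1) .
qed

text \<open>
  For the indicator function of the smaller ball, the preceding inequality compares the ratio of the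
  weighted measures of the two balls with that of their surface measures, which is bounded.
\<close>
lemma mu_doubling: "\<exists>K\<ge>1. \<forall>\<zeta> r. norm \<zeta> = 1 \<longrightarrow> 0 < r \<longrightarrow>
   emeasure mu (nonisotropic_ball \<zeta> (4 * r)) \<le> ennreal K * emeasure mu (nonisotropic_ball \<zeta> r)"
proof -
  interpret mu: finite_measure mu by (rule finite_measure_mu)
  define n where "n = CARD('n)"
  obtain C where C: "0 < C" "\<And>(\<zeta> :: complex ^ 'n) r. norm \<zeta> = 1 \<Longrightarrow> 0 < r \<Longrightarrow> emeasure dir_measure (nonisotropic_ball \<zeta> r) \<le> ennreal (C * r ^ n)"
    using emeasure_nonisotropic_ball_upper[where 'n = 'n] unfolding n_def by blast
  obtain c where c: "0 < c" "\<And>(\<zeta> :: complex ^ 'n) r. norm \<zeta> = 1 \<Longrightarrow> 0 < r \<Longrightarrow> ennreal (c * min r 1 ^ n) \<le> emeasure dir_measure (nonisotropic_ball \<zeta> r)"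
    using emeasure_nonisotropic_ball_lower[where 'n = 'n] unfolding n_def by blast
  (* The ratio of the surface measures, for radii at most 1 and for larger ones. *)
  define K0 where "K0 = max (C * 4 ^ n / c) (1 / c)"
  have K0: "0 < K0" using c by (simp add: K0_def less_max_iff_disj)
  have "emeasure mu (nonisotropic_ball \<zeta> (4 * r)) \<le> ennreal (max 1 (A * K0 powr p)) * emeasure mu (nonisotropic_ball \<zeta> r)"
    if \<zeta>: "norm \<zeta> = 1" and r: "0 < r" for \<zeta> :: "complex ^ 'n" and r
  proof -
    let ?B = "nonisotropic_ball \<zeta> (4 * r)" and ?S = "nonisotropic_ball \<zeta> r"
    have sub: "?S \<subseteq> ?B" using r by (auto simp: nonisotropic_ball_def)
    note [measurable] = sets_nonisotropic_ball[of \<zeta> r] sets_nonisotropic_ball[of \<zeta> "4 * r"]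
    have r4: "0 < 4 * r" using r by simp
    obtain b where b: "emeasure borel_sphere ?B = ennreal b" "0 < b"
      using emeasure_borel_sphere_ball_pos[OF \<zeta> r4] emeasure_borel_sphere_ball_fin[of \<zeta> "4 * r"] by (metis ennreal_pos_cases)
    obtain b' where b': "emeasure borel_sphere ?S = ennreal b'" "0 < b'"
      using emeasure_borel_sphere_ball_pos[OF \<zeta> r] emeasure_borel_sphere_ball_fin[of \<zeta> r] by (metis ennreal_pos_cases)
    obtain m where m: "emeasure mu ?B = ennreal m" "0 < m"
      using emeasure_mu_ball_pos[OF \<zeta> r4] mu.emeasure_finite[of ?B] by (metis ennreal_pos_cases)
    obtain m' where m': "emeasure mu ?S = ennreal m'" "0 < m'"
      using emeasure_mu_ball_pos[OF \<zeta> r] mu.emeasure_finite[of ?S] by (metis ennreal_pos_cases)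
    have bK: "b \<le> K0 * b'"
    proof (cases "r \<le> 1")
      case True
      have "b \<le> C * (4 * r) ^ n" using C(2)[OF \<zeta> r4] C(1) r unfolding emeasure_borel_sphere_ball[symmetric] b(1)
        by (subst (asm) ennreal_le_iff) auto
      moreover have "c * r ^ n \<le> b'" using c(2)[OF \<zeta> r] True b'(2) unfolding emeasure_borel_sphere_ball[symmetric] b'(1)
        by (simp add: min_def)
      then have "(C * 4 ^ n / c) * (c * r ^ n) \<le> (C * 4 ^ n / c) * b'" using C c by (intro mult_left_mono) auto
      then have "C * (4 * r) ^ n \<le> (C * 4 ^ n / c) * b'" using c by (simp add: power_mult_distrib)
      moreover have "(C * 4 ^ n / c) * b' \<le> K0 * b'" using b'(2) by (intro mult_right_mono) (auto simp: K0_def)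
      ultimately show ?thesis by linarith
    next
      case False
      have "emeasure dir_measure ?B \<le> emeasure (dir_measure :: (complex ^ 'n) measure) UNIV"
        by (intro emeasure_mono) (auto simp: sets_dir_measure)
      then have "b \<le> 1" unfolding emeasure_borel_sphere_ball[symmetric] b(1) emeasure_dir_measure_UNIV by (simp add: ennreal_le_1)
      moreover have "c \<le> b'" using c(2)[OF \<zeta> r] False b'(2) unfolding emeasure_borel_sphere_ball[symmetric] b'(1) by (simp add: min_def)
      then have "1 \<le> (1 / c) * b'" using c by (simp add: field_simps)
      moreover have "(1 / c) * b' \<le> K0 * b'" using b'(2) by (intro mult_right_mono) (auto simp: K0_def)
      ultimately show ?thesis by linarith
    qed
    have "(\<integral>\<^sup>+\<eta>\<in>?B. ennpowr (indicator ?S \<eta>) (1 / p) \<partial>borel_sphere) = (\<integral>\<^sup>+\<eta>. indicator ?S \<eta> \<partial>borel_sphere)"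
      using sub p by (intro nn_integral_cong) (auto simp: indicator_def)
    moreover have "(\<integral>\<^sup>+\<eta>\<in>?B. indicator ?S \<eta> \<partial>mu) = (\<integral>\<^sup>+\<eta>. indicator ?S \<eta> \<partial>mu)"
      using sub by (intro nn_integral_cong) (auto simp: indicator_def)
    moreover have "(\<integral>\<^sup>+\<eta>. indicator ?S \<eta> \<partial>borel_sphere) = ennreal b'" "(\<integral>\<^sup>+\<eta>. indicator ?S \<eta> \<partial>mu) = ennreal m'"
      using b'(1) m'(1) by (simp_all add: sets_mu)
    ultimately have "ennreal b' \<le> ennreal (A powr (1 / p)) * ennreal b * ennpowr (ennreal m' / ennreal m) (1 / p)"
      using sphere_average_le[OF _ \<zeta> r4, of "indicator ?S"] by (simp add: b(1) m(1))
    also have "\<dots> = ennreal (A powr (1 / p) * b * (m' / m) powr (1 / p))"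
      using m(2) m'(2) b(2) p by (simp add: divide_ennreal ennpowr_ennreal ennreal_mult[symmetric])
    finally have "b' \<le> A powr (1 / p) * b * (m' / m) powr (1 / p)" using b(2) by (subst (asm) ennreal_le_iff) auto
    then have "b' powr p \<le> (A powr (1 / p) * b * (m' / m) powr (1 / p)) powr p" using b'(2) p by (intro powr_mono2) auto
    also have "\<dots> = A * b powr p * (m' / m)" using A b(2) m(2) m'(2) p by (simp add: powr_mult powr_powr)
    finally have "m * b' powr p \<le> A * b powr p * m'" using m(2) by (simp add: field_simps)
    also have "\<dots> \<le> A * (K0 * b') powr p * m'"
      using bK A b(2) m'(2) p by (intro mult_right_mono mult_left_mono powr_mono2) auto
    also have "(K0 * b') powr p = K0 powr p * b' powr p" using K0 b'(2) by (simp add: powr_mult)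
    finally have "m * b' powr p \<le> (A * K0 powr p * m') * b' powr p" by (simp add: mult_ac)
    then have "m \<le> A * K0 powr p * m'" using b'(2) by simp
    also have "\<dots> \<le> max 1 (A * K0 powr p) * m'" using m'(2) by (intro mult_right_mono) auto
    finally show ?thesis unfolding m(1) m'(1) using m'(2) by (simp add: ennreal_mult[symmetric] ennreal_leI)
  qed
  then show ?thesis by (intro exI[of _ "max 1 (A * K0 powr p)"]) auto
qed

definition K :: real where
  "K = (SOME K. 1 \<le> K \<and> (\<forall>\<zeta> r. norm \<zeta> = 1 \<longrightarrow> 0 < r \<longrightarrow>
     emeasure mu (nonisotropic_ball \<zeta> (4 * r)) \<le> ennreal K * emeasure mu (nonisotropic_ball \<zeta> r)))"

lemma K: "1 \<le> K" "norm \<zeta> = 1 \<Longrightarrow> 0 < r \<Longrightarrow>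
     emeasure mu (nonisotropic_ball \<zeta> (4 * r)) \<le> ennreal K * emeasure mu (nonisotropic_ball \<zeta> r)"
  using someI_ex[OF mu_doubling] unfolding K_def[symmetric] by auto

lemma ndist_ball: "norm x = 1 \<Longrightarrow> {y \<in> space mu. ndist x y < r} = nonisotropic_ball x r"
  by (auto simp: space_mu nonisotropic_ball_def ndist_def)

sublocale doubling_space mu ndist K
proof -
  have id: "(\<lambda>x. x) \<in> mu \<rightarrow>\<^sub>M borel"
    using measurable_borel_sphereI[of "\<lambda>x. x"] by (simp cong: measurable_cong_sets add: sets_mu)
  have f: "(\<lambda>p. fst p) \<in> mu \<Otimes>\<^sub>M mu \<rightarrow>\<^sub>M borel" by (rule measurable_compose[OF measurable_fst id])
  have s: "(\<lambda>p. snd p) \<in> mu \<Otimes>\<^sub>M mu \<rightarrow>\<^sub>M borel" by (rule measurable_compose[OF measurable_snd id])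
  interpret mu: finite_measure mu by (rule finite_measure_mu)
  show "doubling_space mu ndist K"
  proof
    have "(\<lambda>p. norm (1 - hermitian (fst p) (snd p))) \<in> borel_measurable (mu \<Otimes>\<^sub>M mu)"
      using f s by measurable
    then show "(\<lambda>(x, y). ndist x y) \<in> borel_measurable (mu \<Otimes>\<^sub>M mu)" by (simp add: ndist_def split_beta')
    show "ndist x y = ndist y x" for x y :: "complex ^ 'n"
      unfolding ndist_def by (rule norm_one_minus_hermitian_commute)
    show "ndist x z \<le> 2 * (ndist x y + ndist y z)" if "x \<in> space mu" "y \<in> space mu" "z \<in> space mu" for x y z
      unfolding ndist_def using that by (intro nonisotropic_triangle) (auto simp: space_mu)
    show "ndist x y < 4" if "x \<in> space mu" "y \<in> space mu" for x y
      unfolding ndist_def using norm_one_minus_hermitian_le_2[of x y] that by (simp add: space_mu)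
    show "emeasure mu {y \<in> space mu. ndist x y < 4 * r} \<le> ennreal K * emeasure mu {y \<in> space mu. ndist x y < r}"
      if "x \<in> space mu" "0 < r" for x r
    proof -
      have nx: "norm x = 1" using that by (simp add: space_mu)
      show ?thesis unfolding ndist_ball[OF nx] by (rule K(2)[OF nx that(2)])
    qed
    show "0 < emeasure mu {y \<in> space mu. ndist x y < r}" if "x \<in> space mu" "0 < r" for x r
    proof -
      have nx: "norm x = 1" using that by (simp add: space_mu)
      show ?thesis unfolding ndist_ball[OF nx] using emeasure_mu_ball_pos[OF nx that(2)] by (simp add: zero_less_iff_neq_zero)
    qed
    show "1 \<le> K" by (rule K(1))
  qed
qed

lemma qball_eq: "norm x = 1 \<Longrightarrow> qball x r = nonisotropic_ball x r"
  by (simp add: qball_def ndist_ball)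

lemma sphere_average_le_avg:
  assumes "H \<in> borel_measurable borel_sphere" "norm \<zeta> = 1" "0 < r"
  shows "(\<integral>\<^sup>+\<eta>\<in>nonisotropic_ball \<zeta> r. ennpowr (H \<eta>) (1 / p) \<partial>borel_sphere)
    \<le> ennreal (A powr (1 / p)) * emeasure borel_sphere (nonisotropic_ball \<zeta> r) * ennpowr (avg r H \<zeta>) (1 / p)"
  using sphere_average_le[OF assms] assms(2) by (simp add: avg_def qball_eq)

end

section \<open>Pointwise bounds by dyadic averages\<close>

text \<open>
  The radii at distance comparable to \<open>2\<^sup>-\<^sup>j\<close> from 1. The factors
  \<open>1/8\<close> and \<open>4\<close> leave room for the moduli of the points of a box around
  \<open>z\<close> if \<open>1 - |z|\<close> is between \<open>1/4\<close> and \<open>2\<close> times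
  \<open>2\<^sup>-\<^sup>j\<close>.
\<close>
definition shell :: "nat \<Rightarrow> real set" where
  "shell j = {r. 0 < r \<and> r < 1 \<and> (1/2) ^ j / 8 \<le> 1 - r \<and> 1 - r \<le> 4 * (1/2) ^ j}"

definition shell_integral :: "real \<Rightarrow> real \<Rightarrow> (complex ^ 'n \<Rightarrow> complex) \<Rightarrow> nat \<Rightarrow> complex ^ 'n \<Rightarrow> ennreal" where
  "shell_integral q a g j \<eta> = (\<integral>\<^sup>+r\<in>shell j. ennreal (norm (g (r *\<^sub>R \<eta>)) powr q * (1 - r) powr (a - 1)) \<partial>lborel)"

lemma pred_shell [measurable]: "Measurable.pred borel (\<lambda>r. r \<in> shell j)"
  unfolding shell_def mem_Collect_eq by measurable

lemma sets_shell [measurable]: "shell j \<in> sets borel"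
  using pred_shell[of j] by (simp add: pred_def)

lemma shell_powr_comparable:
  assumes "r \<in> shell j"
  shows "((1/2) ^ j) powr b \<le> 8 powr \<bar>b\<bar> * (1 - r) powr b" "(1 - r) powr b \<le> 8 powr \<bar>b\<bar> * ((1/2) ^ j) powr b"
proof -
  have t: "0 < (1/2 :: real) ^ j" by simp
  have "(1/2) ^ j / 8 \<le> 1 - r" "1 - r \<le> 4 * (1/2) ^ j" using assms by (auto simp: shell_def)
  then have h: "(1/2) ^ j \<le> 8 * (1 - r)" "1 - r \<le> 8 * (1/2) ^ j" using t by auto
  have r: "0 < 1 - r" using assms by (simp add: shell_def)
  show "((1/2) ^ j) powr b \<le> 8 powr \<bar>b\<bar> * (1 - r) powr b" by (rule powr_comparable[OF t r h]) simp
  show "(1 - r) powr b \<le> 8 powr \<bar>b\<bar> * ((1/2) ^ j) powr b" by (rule powr_comparable[OF r t h(2,1)]) simp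
qed

lemma emeasure_shell: "emeasure lborel (shell j) \<le> ennreal (4 * (1/2) ^ j)"
proof -
  have "shell j \<subseteq> {1 - 4 * (1/2) ^ j..1}" by (auto simp: shell_def)
  then have "emeasure lborel (shell j) \<le> emeasure lborel {1 - 4 * (1/2) ^ j..1 :: real}" by (intro emeasure_mono) auto
  then show ?thesis by simp
qed

text \<open>Two shells which are six or more apart are disjoint.\<close>
lemma shell_overlap: "(\<Sum>j. indicator (shell j) r :: ennreal) \<le> 6 * indicator {0<..<1} r"
proof (cases "\<exists>j. r \<in> shell j")
  case False
  then show ?thesis by simp
next
  case True
  define i where "i = (LEAST j. r \<in> shell j)"
  have i: "r \<in> shell i" unfolding i_def using True by (rule LeastI_ex)
  have out: "indicator (shell j) r = (0 :: ennreal)" if j: "j \<notin> {i..<i + 6}" for j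
  proof (rule ccontr)
    assume "indicator (shell j) r \<noteq> (0 :: ennreal)"
    then have rj: "r \<in> shell j" by (simp add: indicator_def split: if_splits)
    then have "i \<le> j" unfolding i_def by (rule Least_le)
    then have "i + 6 \<le> j" using j by simp
    have "(1/2) ^ i / 8 \<le> 4 * (1/2 :: real) ^ j" using i rj by (simp add: shell_def)
    also have "\<dots> \<le> 4 * (1/2) ^ (i + 6)" using \<open>i + 6 \<le> j\<close> by (intro mult_left_mono power_decreasing) auto
    finally show False by (simp add: power_add power_divide field_simps)
  qed
  have "(\<Sum>j. indicator (shell j) r :: ennreal) = (\<Sum>j\<in>{i..<i + 6}. indicator (shell j) r)"
    using out by (intro suminf_finite) auto
  also have "\<dots> \<le> (\<Sum>j\<in>{i..<i + 6}. 1)" by (intro sum_mono) (simp add: indicator_def)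
  also have "\<dots> = 6" by simp
  finally show ?thesis using i by (simp add: shell_def)
qed

lemma suminf_shell_integral_le:
  assumes g: "line_holomorphic g" and \<zeta>: "norm \<zeta> = 1"
  shows "(\<Sum>j. shell_integral q a g j \<zeta>) \<le> 6 * radial_part 0 q a g \<zeta>"
proof -
  define u where "u r = indicator {0<..<1} r *\<^sub>R g (r *\<^sub>R \<zeta>)" for r
  have [measurable]: "u \<in> borel_measurable borel" unfolding u_def[abs_def] by (rule line_holomorphic_ray_borel[OF g \<zeta> order_refl])
  let ?F = "\<lambda>r. ennreal (norm (u r) powr q * (1 - r) powr (a - 1))"
  have "(\<Sum>j. shell_integral q a g j \<zeta>) = (\<Sum>j. \<integral>\<^sup>+r\<in>shell j. ?F r \<partial>lborel)"
    unfolding shell_integral_def by (intro suminf_cong nn_integral_cong) (auto simp: indicator_def u_def shell_def)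
  also have "\<dots> = (\<integral>\<^sup>+r. (\<Sum>j. ?F r * indicator (shell j) r) \<partial>lborel)"
    by (rule nn_integral_suminf[symmetric]) measurable
  also have "\<dots> \<le> (\<integral>\<^sup>+r. 6 * (?F r * indicator {0<..<1} r) \<partial>lborel)"
  proof (rule nn_integral_mono)
    fix r :: real
    have "(\<Sum>j. ?F r * indicator (shell j) r) = ?F r * (\<Sum>j. indicator (shell j) r)" by (rule ennreal_suminf_cmult)
    also have "\<dots> \<le> ?F r * (6 * indicator {0<..<1} r)" by (intro mult_left_mono shell_overlap) simp
    finally show "(\<Sum>j. ?F r * indicator (shell j) r) \<le> 6 * (?F r * indicator {0<..<1} r)" by (simp add: mult_ac)
  qed
  also have "\<dots> = 6 * (\<integral>\<^sup>+r\<in>{0<..<1}. ?F r \<partial>lborel)" by (rule nn_integral_cmult) measurable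
  also have "(\<integral>\<^sup>+r\<in>{0<..<1}. ?F r \<partial>lborel) = radial_part 0 q a g \<zeta>"
    unfolding radial_part_def by (intro nn_integral_cong) (auto simp: indicator_def u_def)
  finally show ?thesis .
qed

lemma shell_integral_bounded:
  fixes g :: "complex ^ 'n \<Rightarrow> complex"
  assumes g: "line_holomorphic g" and q: "0 < q"
  shows "\<exists>c. \<forall>\<eta>. norm \<eta> = 1 \<longrightarrow> shell_integral q a g j \<eta> \<le> ennreal c"
proof -
  define t where "t = (1/2 :: real) ^ j"
  have t: "0 < t" by (simp add: t_def)
  obtain M where M: "0 \<le> M" "\<And>z. norm z \<le> 1 - t / 8 \<Longrightarrow> norm (g z) \<le> M"
    using line_holomorphic_bounded[OF g, of "1 - t / 8"] t by auto
  define c where "c = M powr q * (8 powr \<bar>a - 1\<bar> * t powr (a - 1))"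
  have "shell_integral q a g j \<eta> \<le> ennreal (c * (4 * t))" if \<eta>: "norm \<eta> = 1" for \<eta>
  proof -
    have "shell_integral q a g j \<eta> \<le> (\<integral>\<^sup>+r. ennreal c * indicator (shell j) r \<partial>lborel)"
      unfolding shell_integral_def
    proof (rule nn_integral_mono)
      fix r :: real
      show "ennreal (norm (g (r *\<^sub>R \<eta>)) powr q * (1 - r) powr (a - 1)) * indicator (shell j) r \<le> ennreal c * indicator (shell j) r"
      proof (cases "r \<in> shell j")
        case True
        have "norm (g (r *\<^sub>R \<eta>)) powr q \<le> M powr q"
          using True \<eta> q by (intro powr_mono2 M(2)) (auto simp: shell_def t_def)
        moreover have "(1 - r) powr (a - 1) \<le> 8 powr \<bar>a - 1\<bar> * t powr (a - 1)"
          using shell_powr_comparable(2)[OF True] by (simp add: t_def)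
        ultimately have "norm (g (r *\<^sub>R \<eta>)) powr q * (1 - r) powr (a - 1) \<le> c" unfolding c_def by (intro mult_mono) auto
        then show ?thesis using True by (simp add: ennreal_leI)
      qed simp
    qed
    also have "\<dots> = ennreal c * emeasure lborel (shell j)" by (intro nn_integral_cmult_indicator) simp
    also have "\<dots> \<le> ennreal c * ennreal (4 * t)" unfolding t_def by (intro mult_left_mono emeasure_shell) simp
    also have "\<dots> = ennreal (c * (4 * t))" using t by (simp add: c_def ennreal_mult)
    finally show ?thesis .
  qed
  then show ?thesis by blast
qed

lemma shell_integral_measurable:
  fixes g :: "complex ^ 'n \<Rightarrow> complex"
  assumes g: "line_holomorphic g"
  shows "shell_integral q a g j \<in> borel_measurable borel_sphere"
proof -
  define kx where "kx y = (if y \<in> ball 0 1 then g y else 0)" for y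
  have [measurable]: "kx \<in> borel_measurable borel" unfolding kx_def[abs_def] by (rule line_holomorphic_borel[OF g])
  let ?F = "\<lambda>\<zeta> r. ennreal (norm (kx (r *\<^sub>R \<zeta>)) powr q * (1 - r) powr (a - 1)) * indicator (shell j) r"
  have "case_prod ?F \<in> borel_measurable (borel \<Otimes>\<^sub>M lborel)"
    by (subst measurable_cong_sets[OF sets_pair_measure_cong[OF refl sets_lborel] refl]) measurable
  then have "(\<lambda>\<zeta>. \<integral>\<^sup>+r. ?F \<zeta> r \<partial>lborel) \<in> borel_measurable borel" by (rule lborel.borel_measurable_nn_integral)
  then have "(\<lambda>\<zeta>. \<integral>\<^sup>+r. ?F \<zeta> r \<partial>lborel) \<in> borel_measurable borel_sphere" by (rule measurable_borel_sphereI)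
  moreover have "shell_integral q a g j \<zeta> = (\<integral>\<^sup>+r. ?F \<zeta> r \<partial>lborel)" if "\<zeta> \<in> space borel_sphere" for \<zeta>
    unfolding shell_integral_def using that
    by (intro nn_integral_cong) (auto simp: kx_def indicator_def space_borel_sphere shell_def)
  ultimately show ?thesis by (simp cong: measurable_cong)
qed

lemma dyadic_scale:
  fixes \<tau> :: real
  assumes "0 < \<tau>" "\<tau> \<le> 1"
  obtains j where "(1/2) ^ j / 2 < \<tau>" "\<tau> \<le> (1/2) ^ j"
proof -
  obtain m where m: "(1/2 :: real) ^ m < \<tau>" using real_arch_pow_inv[of \<tau> "1/2"] assms by auto
  define i where "i = (LEAST m. (1/2 :: real) ^ m < \<tau>)"
  have i: "(1/2 :: real) ^ i < \<tau>" unfolding i_def using m by (rule LeastI)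
  have "i \<noteq> 0" using i assms by (cases i) auto
  then obtain j where j: "i = Suc j" by (cases i) auto
  have "\<not> (1/2 :: real) ^ j < \<tau>" using not_less_Least[of j "\<lambda>m. (1/2 :: real) ^ m < \<tau>"] j by (simp add: i_def)
  then show ?thesis using i j by (intro that[of j]) auto
qed

context muckenhoupt begin

text \<open>
  The parameter \<open>\<rho>\<close> is the factor by which the radius exceeds
  \<open>2\<^sup>-\<^sup>j\<close>.
\<close>
definition dyadic_average :: "real \<Rightarrow> real \<Rightarrow> real \<Rightarrow> real \<Rightarrow> (complex ^ 'n \<Rightarrow> complex) \<Rightarrow> nat \<Rightarrow> complex ^ 'n \<Rightarrow> ennreal" where
  "dyadic_average \<rho> N q a g j \<zeta> = ennpowr (avg (\<rho> * (1/2) ^ j) (\<lambda>\<eta>. ennpowr (shell_integral q a g j \<eta>) (1 / N)) \<zeta>) N"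

text \<open>
  The mean value inequality is applied to the power \<open>\<epsilon> = q / (p N)\<close> on a box whose
  points project to the ball of radius \<open>\<rho> 2\<^sup>-\<^sup>j\<close> around
  \<open>\<zeta>\<close>, with moduli in the shell. In polar coordinates, Hoelder's inequality with
  exponent \<open>Q = p N\<close> on each radius bounds the inner integral by
  \<open>S\<^sub>j(\<eta>)\<^sup>1\<^sup>/\<^sup>(\<^sup>p\<^sup>N\<^sup>)\<close>, and the
  \<open>A\<^sub>p\<close> condition bounds the surface average of
  \<open>(S\<^sub>j\<^sup>1\<^sup>/\<^sup>N)\<^sup>1\<^sup>/\<^sup>p\<close> by the weighted average of
  \<open>S\<^sub>j\<^sup>1\<^sup>/\<^sup>N\<close>. Raising to the power \<open>Q\<close> gives the claim.
\<close>
lemma pointwise_le_dyadic_average: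
  assumes q: "1 < q" and N: "1 \<le> N" and \<kappa>: "0 < \<kappa>"
  shows "\<exists>C>0. \<forall>(g :: complex ^ 'n \<Rightarrow> complex) j \<zeta> z. line_holomorphic g \<longrightarrow> norm \<zeta> = 1 \<longrightarrow> 1/2 \<le> norm z \<longrightarrow> norm z < 1 \<longrightarrow>
     (1/2) ^ j / 4 \<le> 1 - norm z \<longrightarrow> 1 - norm z \<le> 2 * (1/2) ^ j \<longrightarrow> norm (1 - hermitian z \<zeta>) \<le> \<kappa> * (1/2) ^ j \<longrightarrow>
     ennreal (norm (g z) powr q) \<le> ennreal (C * ((1/2) ^ j) powr (- a)) * dyadic_average (2 * \<kappa> + 12) N q a g j \<zeta>"
proof -
  define n where "n = CARD('n)"
  define Q where "Q = p * N"
  have "1 * 1 < p * N" using p N by (intro mult_less_le_imp_less) auto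
  then have Q: "1 < Q" by (simp add: Q_def)
  define \<epsilon> where "\<epsilon> = q / Q"
  have \<epsilon>: "0 < \<epsilon>" "\<epsilon> * Q = q" using q Q by (auto simp: \<epsilon>_def)
  define Q' where "Q' = Q / (Q - 1)"
  have Q': "1 < Q'" "1 / Q + 1 / Q' = 1" "1 / Q' = 1 - 1 / Q" using Q by (auto simp: Q'_def field_simps)
  define \<rho> where "\<rho> = 2 * \<kappa> + 12"
  have \<rho>: "0 < \<rho>" using \<kappa> by (simp add: \<rho>_def)
  obtain C1 where C1: "0 < C1" and mean: "\<And>(g :: complex ^ 'n \<Rightarrow> complex) z. line_holomorphic g \<Longrightarrow> 1/2 \<le> norm z \<Longrightarrow> norm z < 1 \<Longrightarrow>
     ennreal (norm (g z) powr \<epsilon>) \<le> ennreal (C1 / (1 - norm z) ^ (CARD('n) + 1)) * (\<integral>\<^sup>+x\<in>ellipsoid_box (1/4) z. ennreal (norm (g x) powr \<epsilon>) \<partial>lborel)"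
    using ellipsoid_mean_le[of \<epsilon> "1/4", where 'n = 'n] \<epsilon>(1) by fastforce
  obtain C2 where C2: "0 < C2" "\<And>(\<zeta> :: complex ^ 'n) r. norm \<zeta> = 1 \<Longrightarrow> 0 < r \<Longrightarrow> emeasure dir_measure (nonisotropic_ball \<zeta> r) \<le> ennreal (C2 * r ^ n)"
    using emeasure_nonisotropic_ball_upper[where 'n = 'n] unfolding n_def by blast
  define V where "V = unit_vol TYPE('n)"
  have V: "0 < V" unfolding V_def by (rule unit_vol_pos)
  define B1 where "B1 = (8 powr \<bar>a - 1\<bar>) powr (1 / Q) * 4 powr (1 - 1 / Q)"
  define B2 where "B2 = A powr (1 / p) * (C2 * \<rho> ^ n)"
  define C where "C = C1 * 4 ^ (n + 1) * (V * (2 * n) * (B1 * B2))"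
  have B: "0 < B1" "0 < B2" using A C2 \<rho> by (auto simp: B1_def B2_def)
  have n: "0 < n" by (simp add: n_def)
  have C: "0 < C" using C1 V B n by (simp add: C_def)
  have main: "ennreal (norm (g z) powr q) \<le> ennreal (C powr Q * ((1/2) ^ j) powr (- a)) * dyadic_average \<rho> N q a g j \<zeta>"
    if g: "line_holomorphic g" and \<zeta>: "norm \<zeta> = 1" and z: "1/2 \<le> norm z" "norm z < 1"
      and lo: "(1/2) ^ j / 4 \<le> 1 - norm z" and hi: "1 - norm z \<le> 2 * (1/2) ^ j" and h: "norm (1 - hermitian z \<zeta>) \<le> \<kappa> * (1/2) ^ j"
    for g :: "complex ^ 'n \<Rightarrow> complex" and j \<zeta> z
  proof -
    define t where "t = (1/2 :: real) ^ j"
    have t: "0 < t" by (simp add: t_def)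
    let ?B = "nonisotropic_ball \<zeta> (\<rho> * t)"
    let ?E = "ellipsoid_box (1/4) z"
    define kx where "kx y = (if y \<in> ball 0 1 then g y else 0)" for y
    have [measurable]: "kx \<in> borel_measurable borel" unfolding kx_def[abs_def] by (rule line_holomorphic_borel[OF g])
    have "closed ?E" unfolding ellipsoid_box_def
      by (intro closed_Collect_conj closed_Collect_le continuous_intros)
    then have [measurable]: "?E \<in> sets borel" by simp
    have E: "norm x < 1 \<and> norm x \<in> shell j \<and> dir x \<in> ?B" if x: "x \<in> ?E" for x
    proof -
      have x1: "(1/2) * (1 - norm z) \<le> 1 - norm x" and x2: "1 - norm x \<le> (5/4) * (1 - norm z)"
        and x3: "norm (1 - hermitian x (dir z)) \<le> (5/4) * (1 - norm z)" using x by (auto simp: ellipsoid_box_def)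
      have nx: "norm x < 1" using x1 z by simp
      have nx0: "0 < norm x" using x2 z by argo
      have ndz: "norm (dir z) = 1" using z by (intro norm_dir) auto
      have y1: "norm (1 - hermitian (dir z) \<zeta>) \<le> \<kappa> * t + 2 * t"
        using hermitian_dir(1)[OF \<zeta>, of z] z h hi by (simp add: t_def)
      have y2: "norm (1 - hermitian x \<zeta>) \<le> 2 * (norm (1 - hermitian x (dir z)) + norm (1 - hermitian (dir z) \<zeta>))"
        using nx \<zeta> ndz by (intro nonisotropic_triangle) auto
      have y3: "norm (1 - hermitian (dir x) \<zeta>) \<le> norm (1 - hermitian x \<zeta>) + (1 - norm x)"
        using nx by (intro hermitian_dir(1)[OF \<zeta>]) simp
      have "1 - norm z \<le> 2 * t" using hi by (simp add: t_def)
      then have "norm (1 - hermitian x (dir z)) \<le> 5/2 * t" "1 - norm x \<le> 5/2 * t" using x2 x3 by auto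
      then have "norm (1 - hermitian (dir x) \<zeta>) \<le> 2 * (5/2 * t + (\<kappa> * t + 2 * t)) + 5/2 * t"
        using y1 y2 y3 by argo
      also have "\<dots> < \<rho> * t" using t by (simp add: \<rho>_def algebra_simps)
      finally have "norm (1 - hermitian \<zeta> (dir x)) < \<rho> * t" by (simp add: norm_one_minus_hermitian_commute[of \<zeta>])
      moreover have "norm (dir x) = 1" using nx0 by (intro norm_dir) auto
      moreover have "norm x \<in> shell j" using nx nx0 x1 x2 lo hi t unfolding shell_def t_def[symmetric] by auto
      ultimately show ?thesis using nx by (simp add: nonisotropic_ball_def)
    qed
    define G where "G = shell_integral q a g j"
    have [measurable]: "G \<in> borel_measurable borel_sphere" unfolding G_def by (rule shell_integral_measurable[OF g])
    have inner: "(\<integral>\<^sup>+r\<in>shell j. ennreal (norm (kx (r *\<^sub>R \<eta>)) powr \<epsilon>) \<partial>lborel) \<le> ennreal (B1 * (t * t powr (- a / Q))) * ennpowr (ennpowr (G \<eta>) (1 / N)) (1 / p)"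
      if \<eta>: "norm \<eta> = 1" for \<eta>
    proof -
      have "(\<integral>\<^sup>+r\<in>shell j. ennreal (norm (kx (r *\<^sub>R \<eta>)) powr \<epsilon>) \<partial>lborel)
         = (\<integral>\<^sup>+r. (ennreal (norm (kx (r *\<^sub>R \<eta>)) powr \<epsilon>) * indicator (shell j) r) * indicator (shell j) r \<partial>lborel)"
        by (intro nn_integral_cong) (simp add: indicator_def)
      also have "\<dots> \<le> ennpowr (\<integral>\<^sup>+r. ennpowr (ennreal (norm (kx (r *\<^sub>R \<eta>)) powr \<epsilon>) * indicator (shell j) r) Q \<partial>lborel) (1 / Q)
          * ennpowr (\<integral>\<^sup>+r. ennpowr (indicator (shell j) r) Q' \<partial>lborel) (1 / Q')"
        by (rule Holder_nn_integral[OF Q Q'(1,2)]) measurable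
      finally have h1: "(\<integral>\<^sup>+r\<in>shell j. ennreal (norm (kx (r *\<^sub>R \<eta>)) powr \<epsilon>) \<partial>lborel)
          \<le> ennpowr (\<integral>\<^sup>+r. ennpowr (ennreal (norm (kx (r *\<^sub>R \<eta>)) powr \<epsilon>) * indicator (shell j) r) Q \<partial>lborel) (1 / Q)
          * ennpowr (\<integral>\<^sup>+r. ennpowr (indicator (shell j) r) Q' \<partial>lborel) (1 / Q')" .
      have h2: "(\<integral>\<^sup>+r. ennpowr (indicator (shell j) r) Q' \<partial>lborel) = emeasure lborel (shell j)"
      proof -
        have "(\<integral>\<^sup>+r. ennpowr (indicator (shell j) r) Q' \<partial>lborel) = (\<integral>\<^sup>+r. indicator (shell j) r \<partial>lborel)"
          using Q' by (intro nn_integral_cong) (simp add: indicator_def)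
        then show ?thesis by simp
      qed
      have h3: "(\<integral>\<^sup>+r. ennpowr (ennreal (norm (kx (r *\<^sub>R \<eta>)) powr \<epsilon>) * indicator (shell j) r) Q \<partial>lborel) \<le> ennreal (8 powr \<bar>a - 1\<bar> * t powr (1 - a)) * G \<eta>"
      proof -
        have "(\<integral>\<^sup>+r. ennpowr (ennreal (norm (kx (r *\<^sub>R \<eta>)) powr \<epsilon>) * indicator (shell j) r) Q \<partial>lborel)
          \<le> (\<integral>\<^sup>+r. ennreal (8 powr \<bar>a - 1\<bar> * t powr (1 - a)) * (ennreal (norm (kx (r *\<^sub>R \<eta>)) powr q * (1 - r) powr (a - 1)) * indicator (shell j) r) \<partial>lborel)"
        proof (rule nn_integral_mono)
          fix r :: real
          show "ennpowr (ennreal (norm (kx (r *\<^sub>R \<eta>)) powr \<epsilon>) * indicator (shell j) r) Q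
            \<le> ennreal (8 powr \<bar>a - 1\<bar> * t powr (1 - a)) * (ennreal (norm (kx (r *\<^sub>R \<eta>)) powr q * (1 - r) powr (a - 1)) * indicator (shell j) r)"
          proof (cases "r \<in> shell j")
            case True
            have "t powr (1 - a) * t powr (a - 1) \<le> t powr (1 - a) * (8 powr \<bar>a - 1\<bar> * (1 - r) powr (a - 1))"
              using shell_powr_comparable(1)[OF True, of "a - 1"] by (intro mult_left_mono) (auto simp: t_def)
            moreover have "t powr (1 - a) * t powr (a - 1) = 1" using t by (simp add: powr_add[symmetric])
            ultimately have one: "1 \<le> 8 powr \<bar>a - 1\<bar> * t powr (1 - a) * (1 - r) powr (a - 1)" by (simp add: mult_ac)
            have "norm (kx (r *\<^sub>R \<eta>)) powr q \<le> (8 powr \<bar>a - 1\<bar> * t powr (1 - a)) * (norm (kx (r *\<^sub>R \<eta>)) powr q * (1 - r) powr (a - 1))"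
              using mult_right_mono[OF one, of "norm (kx (r *\<^sub>R \<eta>)) powr q"] by (simp add: mult_ac)
            then have "ennreal (norm (kx (r *\<^sub>R \<eta>)) powr q) \<le> ennreal (8 powr \<bar>a - 1\<bar> * t powr (1 - a)) * ennreal (norm (kx (r *\<^sub>R \<eta>)) powr q * (1 - r) powr (a - 1))"
              by (subst ennreal_mult[symmetric]) (auto intro: ennreal_leI)
            then show ?thesis using True Q \<epsilon>(2) by (simp add: ennpowr_ennreal powr_powr)
          qed (use Q in simp)
        qed
        also have "\<dots> = ennreal (8 powr \<bar>a - 1\<bar> * t powr (1 - a)) * (\<integral>\<^sup>+r\<in>shell j. ennreal (norm (kx (r *\<^sub>R \<eta>)) powr q * (1 - r) powr (a - 1)) \<partial>lborel)"
          by (rule nn_integral_cmult) measurable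
        also have "(\<integral>\<^sup>+r\<in>shell j. ennreal (norm (kx (r *\<^sub>R \<eta>)) powr q * (1 - r) powr (a - 1)) \<partial>lborel) = G \<eta>"
          unfolding G_def shell_integral_def using \<eta> by (intro nn_integral_cong) (auto simp: kx_def indicator_def shell_def)
        finally show ?thesis .
      qed
      have h4: "ennpowr (emeasure lborel (shell j)) (1 / Q') \<le> ennpowr (ennreal (4 * t)) (1 / Q')"
        using Q'(1) emeasure_shell[of j] unfolding t_def[symmetric] by (intro ennpowr_mono) auto
      have h5: "ennreal x * e * ennreal y = ennreal (x * y) * e" if "0 \<le> x" "0 \<le> y" for x y e
        using that by (simp add: ennreal_mult mult_ac)
      have "(\<integral>\<^sup>+r\<in>shell j. ennreal (norm (kx (r *\<^sub>R \<eta>)) powr \<epsilon>) \<partial>lborel)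
          \<le> ennpowr (ennreal (8 powr \<bar>a - 1\<bar> * t powr (1 - a)) * G \<eta>) (1 / Q) * ennpowr (ennreal (4 * t)) (1 / Q')"
        by (rule order_trans[OF h1[unfolded h2] mult_mono[OF ennpowr_mono[OF _ h3] h4]]) (use Q in auto)
      also have "ennpowr (ennreal (8 powr \<bar>a - 1\<bar> * t powr (1 - a)) * G \<eta>) (1 / Q) = ennreal ((8 powr \<bar>a - 1\<bar>) powr (1 / Q) * t powr ((1 - a) / Q)) * ennpowr (G \<eta>) (1 / Q)"
        using Q t by (simp add: ennpowr_mult ennpowr_ennreal powr_mult powr_powr)
      also have "ennpowr (ennreal (4 * t)) (1 / Q') = ennreal (4 powr (1 - 1 / Q) * t powr (1 - 1 / Q))"
        unfolding Q'(3) using Q t by (simp add: ennpowr_ennreal powr_mult)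
      also have "ennreal ((8 powr \<bar>a - 1\<bar>) powr (1 / Q) * t powr ((1 - a) / Q)) * ennpowr (G \<eta>) (1 / Q) * ennreal (4 powr (1 - 1 / Q) * t powr (1 - 1 / Q))
          = ennreal (((8 powr \<bar>a - 1\<bar>) powr (1 / Q) * t powr ((1 - a) / Q)) * (4 powr (1 - 1 / Q) * t powr (1 - 1 / Q))) * ennpowr (G \<eta>) (1 / Q)"
        by (rule h5) auto
      also have "((8 powr \<bar>a - 1\<bar>) powr (1 / Q) * t powr ((1 - a) / Q)) * (4 powr (1 - 1 / Q) * t powr (1 - 1 / Q)) = B1 * (t powr ((1 - a) / Q) * t powr (1 - 1 / Q))"
        by (simp add: B1_def mult_ac)
      also have "t powr ((1 - a) / Q) * t powr (1 - 1 / Q) = t * t powr (- a / Q)"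
      proof -
        have "(1 - a) / Q + (1 - 1 / Q) = 1 + - a / Q" using Q by (simp add: field_simps)
        then have "t powr ((1 - a) / Q) * t powr (1 - 1 / Q) = t powr (1 + - a / Q)" by (simp only: powr_add[symmetric])
        then show ?thesis using t by (simp only: powr_add) simp
      qed
      also have "ennpowr (G \<eta>) (1 / Q) = ennpowr (ennpowr (G \<eta>) (1 / N)) (1 / p)"
        using N p by (simp add: ennpowr_ennpowr Q_def mult.commute)
      finally show ?thesis .
    qed
    have mb [measurable]: "nonisotropic_ball \<zeta> (\<rho> * t) \<in> sets borel_sphere" by (rule sets_nonisotropic_ball)
    have "(\<integral>\<^sup>+x\<in>?E. ennreal (norm (g x) powr \<epsilon>) \<partial>lborel) = (\<integral>\<^sup>+x\<in>ball 0 1. ennreal (norm (kx x) powr \<epsilon>) * indicator ?E x \<partial>lborel)"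
      using E by (intro nn_integral_cong) (auto simp: indicator_def kx_def)
    also have "\<dots> = ennreal V * (\<integral>\<^sup>+\<eta>. (\<integral>\<^sup>+r\<in>{0<..<1}. ennreal (norm (kx (r *\<^sub>R \<eta>)) powr \<epsilon>) * indicator ?E (r *\<^sub>R \<eta>) * ennreal (2 * CARD('n) * r ^ (2 * CARD('n) - 1)) \<partial>lborel) \<partial>borel_sphere)"
      unfolding V_def by (rule nn_integral_polar) measurable
    also have "\<dots> \<le> ennreal V * (\<integral>\<^sup>+\<eta>. ennreal (2 * n * (B1 * (t * t powr (- a / Q)))) * (ennpowr (ennpowr (G \<eta>) (1 / N)) (1 / p) * indicator ?B \<eta>) \<partial>borel_sphere)"
    proof (intro mult_left_mono nn_integral_mono)
      fix \<eta> :: "complex ^ 'n" assume "\<eta> \<in> space borel_sphere"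
      then have \<eta>: "norm \<eta> = 1" by (simp add: space_borel_sphere)
      have de: "dir (r *\<^sub>R \<eta>) = \<eta>" if "0 < r" for r using that \<eta> by (simp add: dir_scaleR) (simp add: dir_def)
      have inB: "r \<in> shell j \<and> \<eta> \<in> ?B" if r: "0 < r" "r *\<^sub>R \<eta> \<in> ?E" for r
        using E[OF r(2)] r(1) \<eta> by (simp add: de)
      have "(\<integral>\<^sup>+r\<in>{0<..<1}. ennreal (norm (kx (r *\<^sub>R \<eta>)) powr \<epsilon>) * indicator ?E (r *\<^sub>R \<eta>) * ennreal (2 * CARD('n) * r ^ (2 * CARD('n) - 1)) \<partial>lborel)
         \<le> (\<integral>\<^sup>+r. ennreal (2 * n) * indicator ?B \<eta> * (ennreal (norm (kx (r *\<^sub>R \<eta>)) powr \<epsilon>) * indicator (shell j) r) \<partial>lborel)"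
      proof (rule nn_integral_mono)
        fix r :: real
        show "ennreal (norm (kx (r *\<^sub>R \<eta>)) powr \<epsilon>) * indicator ?E (r *\<^sub>R \<eta>) * ennreal (2 * CARD('n) * r ^ (2 * CARD('n) - 1)) * indicator {0<..<1} r
          \<le> ennreal (2 * n) * indicator ?B \<eta> * (ennreal (norm (kx (r *\<^sub>R \<eta>)) powr \<epsilon>) * indicator (shell j) r)"
        proof (cases "r \<in> {0<..<1} \<and> r *\<^sub>R \<eta> \<in> ?E")
          case True
          have "r ^ (2 * CARD('n) - 1) \<le> 1" using True by (intro power_le_one) auto
          then have "ennreal (2 * CARD('n) * r ^ (2 * CARD('n) - 1)) \<le> ennreal (2 * n)" unfolding n_def by (intro ennreal_leI) simp
          then have "ennreal (norm (kx (r *\<^sub>R \<eta>)) powr \<epsilon>) * ennreal (2 * CARD('n) * r ^ (2 * CARD('n) - 1)) \<le> ennreal (norm (kx (r *\<^sub>R \<eta>)) powr \<epsilon>) * ennreal (2 * n)"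
            by (rule mult_left_mono) simp
          then show ?thesis using True inB[of r] by (simp add: mult.commute)
        qed auto
      qed
      also have "\<dots> = ennreal (2 * n) * indicator ?B \<eta> * (\<integral>\<^sup>+r\<in>shell j. ennreal (norm (kx (r *\<^sub>R \<eta>)) powr \<epsilon>) \<partial>lborel)"
        by (rule nn_integral_cmult) measurable
      also have "\<dots> \<le> ennreal (2 * n) * indicator ?B \<eta> * (ennreal (B1 * (t * t powr (- a / Q))) * ennpowr (ennpowr (G \<eta>) (1 / N)) (1 / p))"
        by (intro mult_left_mono inner \<eta>) simp
      also have "\<dots> = ennreal (2 * n * (B1 * (t * t powr (- a / Q)))) * (ennpowr (ennpowr (G \<eta>) (1 / N)) (1 / p) * indicator ?B \<eta>)"
        using B t by (simp add: ennreal_mult mult_ac)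
      finally show "(\<integral>\<^sup>+r\<in>{0<..<1}. ennreal (norm (kx (r *\<^sub>R \<eta>)) powr \<epsilon>) * indicator ?E (r *\<^sub>R \<eta>) * ennreal (2 * CARD('n) * r ^ (2 * CARD('n) - 1)) \<partial>lborel)
         \<le> ennreal (2 * n * (B1 * (t * t powr (- a / Q)))) * (ennpowr (ennpowr (G \<eta>) (1 / N)) (1 / p) * indicator ?B \<eta>)" .
    qed simp
    also have "\<dots> = ennreal V * (ennreal (2 * n * (B1 * (t * t powr (- a / Q)))) * (\<integral>\<^sup>+\<eta>\<in>?B. ennpowr (ennpowr (G \<eta>) (1 / N)) (1 / p) \<partial>borel_sphere))"
      by (subst nn_integral_cmult) auto
    also have "(\<integral>\<^sup>+\<eta>\<in>?B. ennpowr (ennpowr (G \<eta>) (1 / N)) (1 / p) \<partial>borel_sphere)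
        \<le> ennreal (A powr (1 / p)) * emeasure borel_sphere ?B * ennpowr (avg (\<rho> * t) (\<lambda>\<eta>. ennpowr (G \<eta>) (1 / N)) \<zeta>) (1 / p)"
      using \<rho> t by (intro sphere_average_le_avg[OF _ \<zeta>]) auto
    also have "emeasure borel_sphere ?B \<le> ennreal (C2 * (\<rho> * t) ^ n)"
      unfolding emeasure_borel_sphere_ball using \<rho> t by (intro C2(2)[OF \<zeta>]) simp
    finally have I: "(\<integral>\<^sup>+x\<in>?E. ennreal (norm (g x) powr \<epsilon>) \<partial>lborel) \<le> ennreal V * (ennreal (2 * n * (B1 * (t * t powr (- a / Q)))) *
        (ennreal (A powr (1 / p)) * ennreal (C2 * (\<rho> * t) ^ n) * ennpowr (avg (\<rho> * t) (\<lambda>\<eta>. ennpowr (G \<eta>) (1 / N)) \<zeta>) (1 / p)))"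
      by (simp add: mult_left_mono mult_right_mono)
    define X where "X = avg (\<rho> * t) (\<lambda>\<eta>. ennpowr (G \<eta>) (1 / N)) \<zeta>"
    have "ennreal V * (ennreal (2 * n * (B1 * (t * t powr (- a / Q)))) * (ennreal (A powr (1 / p)) * ennreal (C2 * (\<rho> * t) ^ n) * ennpowr X (1 / p)))
       = ennreal (V * (2 * n * (B1 * (t * t powr (- a / Q)))) * (A powr (1 / p) * (C2 * (\<rho> * t) ^ n))) * ennpowr X (1 / p)"
      using V B C2 \<rho> t by (simp add: ennreal_mult mult.assoc)
    also have "V * (2 * n * (B1 * (t * t powr (- a / Q)))) * (A powr (1 / p) * (C2 * (\<rho> * t) ^ n)) = V * (2 * n) * (B1 * B2) * (t ^ (n + 1) * t powr (- a / Q))"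
      by (simp add: B2_def power_mult_distrib mult_ac)
    finally have I2: "(\<integral>\<^sup>+x\<in>?E. ennreal (norm (g x) powr \<epsilon>) \<partial>lborel) \<le> ennreal (V * (2 * n) * (B1 * B2) * (t ^ (n + 1) * t powr (- a / Q))) * ennpowr X (1 / p)"
      using I unfolding X_def[symmetric] by simp
    have "ennreal (norm (g z) powr \<epsilon>) \<le> ennreal (C1 / (1 - norm z) ^ (n + 1)) * (\<integral>\<^sup>+x\<in>?E. ennreal (norm (g x) powr \<epsilon>) \<partial>lborel)"
      unfolding n_def by (rule mean[OF g z])
    also have "\<dots> \<le> ennreal (C1 * 4 ^ (n + 1) / t ^ (n + 1)) * (ennreal (V * (2 * n) * (B1 * B2) * (t ^ (n + 1) * t powr (- a / Q))) * ennpowr X (1 / p))"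
    proof (rule mult_mono[OF _ I2])
      have "(t / 4) ^ (n + 1) \<le> (1 - norm z) ^ (n + 1)" using lo t by (intro power_mono) (auto simp: t_def)
      then have "C1 / (1 - norm z) ^ (n + 1) \<le> C1 / (t / 4) ^ (n + 1)" using C1 t z by (intro divide_left_mono) auto
      also have "\<dots> = C1 * 4 ^ (n + 1) / t ^ (n + 1)" by (simp add: power_divide)
      finally show "ennreal (C1 / (1 - norm z) ^ (n + 1)) \<le> ennreal (C1 * 4 ^ (n + 1) / t ^ (n + 1))" by (rule ennreal_leI)
    qed auto
    also have "\<dots> = ennreal (C1 * 4 ^ (n + 1) / t ^ (n + 1) * (V * (2 * n) * (B1 * B2) * (t ^ (n + 1) * t powr (- a / Q)))) * ennpowr X (1 / p)"
      using C1 V B t by (subst mult.assoc[symmetric], subst ennreal_mult[symmetric]) auto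
    also have "C1 * 4 ^ (n + 1) / t ^ (n + 1) * (V * (2 * n) * (B1 * B2) * (t ^ (n + 1) * t powr (- a / Q))) = C * t powr (- a / Q)"
      using t by (simp add: C_def)
    finally have fin: "ennreal (norm (g z) powr \<epsilon>) \<le> ennreal (C * t powr (- a / Q)) * ennpowr X (1 / p)" .
    have "ennpowr (ennreal (norm (g z) powr \<epsilon>)) Q \<le> ennpowr (ennreal (C * t powr (- a / Q)) * ennpowr X (1 / p)) Q"
      using Q by (intro ennpowr_mono fin) auto
    also have "ennpowr (ennreal (norm (g z) powr \<epsilon>)) Q = ennreal (norm (g z) powr q)"
      using Q \<epsilon>(2) by (simp add: ennpowr_ennreal powr_powr)
    also have "ennpowr (ennreal (C * t powr (- a / Q)) * ennpowr X (1 / p)) Q = ennreal (C powr Q * t powr (- a)) * ennpowr X N"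
    proof -
      have "1 / p * Q = N" using p by (simp add: Q_def)
      moreover have "(C * t powr (- a / Q)) powr Q = C powr Q * t powr (- a)" using C Q by (simp add: powr_mult powr_powr)
      ultimately show ?thesis using Q p C t by (simp add: ennpowr_mult ennpowr_ennreal ennpowr_ennpowr)
    qed
    finally show ?thesis by (simp add: dyadic_average_def X_def G_def t_def)
  qed
  have "0 < C powr Q" using C by simp
  then show ?thesis using main unfolding \<rho>_def by blast
qed

end

section \<open>Equivalence of the radial and area integrals\<close>

lemma ennreal_le_suminf: "F j \<le> (\<Sum>j. F j)" for F :: "nat \<Rightarrow> ennreal"
  using sum_le_suminf[of F "{j}"] by simp

lemma ennreal_mult_around: "0 \<le> x \<Longrightarrow> 0 \<le> y \<Longrightarrow> ennreal x * e * ennreal y = ennreal (x * y) * e"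
  by (simp add: ennreal_mult mult_ac)

lemma ennreal_nonneg_rep: "\<exists>x'\<ge>0. ennreal x = ennreal x'"
  by (cases "0 \<le> x") (auto simp: ennreal_neg intro: exI[of _ 0])

context muckenhoupt begin

text \<open>
  The half ball contributes a constant. A point of the admissible region at height about
  \<open>2\<^sup>-\<^sup>j\<close> lies in a cylinder around \<open>\<zeta>\<close> of volume proportional
  to \<open>2\<^sup>-\<^sup>j\<^sup>(\<^sup>n\<^sup>+\<^sup>1\<^sup>)\<close>, on which the integrand is at
  most the dyadic average divided by
  \<open>2\<^sup>-\<^sup>j\<^sup>(\<^sup>n\<^sup>+\<^sup>1\<^sup>)\<close>.
\<close>
lemma area_integral_le_dyadic:
  fixes f :: "complex ^ 'n \<Rightarrow> complex"
  assumes f: "line_holomorphic f" and q: "1 < q" and N: "1 \<le> N" and \<alpha>: "0 < \<alpha>"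
  shows "\<exists>C0 C. \<forall>\<zeta>. norm \<zeta> = 1 \<longrightarrow> area_integral \<alpha> k q s f \<zeta>
    \<le> ennreal C0 + ennreal C * (\<Sum>j. dyadic_average (2 * \<alpha> + 12) N q ((real k - s) * q) (IR_power (real k) f) j \<zeta>)"
proof -
  define n where "n = CARD('n)"
  have n: "1 \<le> n" by (simp add: n_def Suc_leI)
  define g where "g = IR_power (real k) f"
  define a where "a = (real k - s) * q"
  define b where "b = a - real n - 1"
  have g: "line_holomorphic g" unfolding g_def by (rule IR_power_line_holomorphic[OF f])
  obtain M where M: "0 \<le> M" "\<And>z. norm z \<le> 1/2 \<Longrightarrow> norm (g z) \<le> M"
    using line_holomorphic_bounded[OF g, of "1/2"] by auto
  obtain CP where CP: "0 < CP" and pw: "\<And>j \<zeta> z. norm \<zeta> = 1 \<Longrightarrow> 1/2 \<le> norm z \<Longrightarrow> norm z < 1 \<Longrightarrow>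
     (1/2) ^ j / 4 \<le> 1 - norm z \<Longrightarrow> 1 - norm z \<le> 2 * (1/2) ^ j \<Longrightarrow> norm (1 - hermitian z \<zeta>) \<le> \<alpha> * (1/2) ^ j \<Longrightarrow>
     ennreal (norm (g z) powr q) \<le> ennreal (CP * ((1/2) ^ j) powr (- a)) * dyadic_average (2 * \<alpha> + 12) N q a g j \<zeta>"
    using pointwise_le_dyadic_average[OF q N \<alpha>, of a] g by blast
  define i0 where "i0 = (undefined :: 'n)"
  define W0 where "W0 = cyl_vol TYPE('n) i0"
  have W0: "0 < W0" unfolding W0_def by (rule cyl_vol(3))
  define c1 where "c1 = M powr q * 2 powr \<bar>b\<bar>"
  define K1 where "K1 = CP * 4 powr \<bar>b\<bar>"
  define VW where "VW = \<alpha>\<^sup>2 * (4 * \<alpha>) ^ (n - 1) * W0"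
  have c1: "0 \<le> c1" and K1: "0 < K1" and VW: "0 < VW" using M CP \<alpha> W0 by (auto simp: c1_def K1_def VW_def)
  have "area_integral \<alpha> k q s f \<zeta> \<le> ennreal (c1 * unit_vol TYPE('n)) + ennreal (K1 * VW) * (\<Sum>j. dyadic_average (2 * \<alpha> + 12) N q a g j \<zeta>)"
    if \<zeta>: "norm \<zeta> = 1" for \<zeta> :: "complex ^ 'n"
  proof -
    define t where "t j = (1/2 :: real) ^ j" for j :: nat
    have t: "0 < t j" for j by (simp add: t_def)
    define D where "D j = {z. norm (hermitian z \<zeta> - 1) < \<alpha> * t j \<and> norm (orth_part \<zeta> z) < 2 * sqrt (\<alpha> * t j)}" for j
    define X where "X j = dyadic_average (2 * \<alpha> + 12) N q a g j \<zeta>" for j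
    have "open (D j)" for j unfolding D_def orth_part_def by (intro open_Collect_conj open_Collect_less continuous_intros)
    then have D [measurable]: "D j \<in> sets borel" for j by simp
    have volD: "emeasure lborel (D j) = ennreal (VW * t j ^ (n + 1))" for j
    proof -
      have at: "0 < \<alpha> * t j" using \<alpha> t[of j] by simp
      have e: "2 * n - 2 = 2 * (n - 1)" by simp
      have "(2 * sqrt (\<alpha> * t j)) ^ (2 * n - 2) = (4 * (\<alpha> * t j)) ^ (n - 1)"
        unfolding e power_mult using at by (simp add: power_mult_distrib)
      moreover have "(\<alpha> * t j)\<^sup>2 * (4 * (\<alpha> * t j)) ^ (n - 1) = \<alpha>\<^sup>2 * (4 * \<alpha>) ^ (n - 1) * (t j ^ 2 * t j ^ (n - 1))"
        by (simp add: power_mult_distrib mult_ac)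
      moreover have "t j ^ 2 * t j ^ (n - 1) = t j ^ (n + 1)" unfolding power_add[symmetric] using n by (simp add: add.commute)
      ultimately have "(\<alpha> * t j)\<^sup>2 * (2 * sqrt (\<alpha> * t j)) ^ (2 * n - 2) * W0 = VW * t j ^ (n + 1)"
        by (simp add: VW_def mult_ac)
      then show ?thesis using emeasure_cylinder[OF \<zeta>, of "\<alpha> * t j" "2 * sqrt (\<alpha> * t j)" 1 i0] at
        by (simp add: D_def W0_def n_def)
    qed
    have point: "ennreal (norm (g z) powr q * (1 - (norm z)\<^sup>2) powr b) * indicator (admissible_region \<alpha> \<zeta>) z
      \<le> ennreal c1 * indicator (ball 0 1) z + (\<Sum>j. ennreal (K1 / t j ^ (n + 1)) * X j * indicator (D j) z)" for z
    proof (cases "z \<in> admissible_region \<alpha> \<zeta>")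
      case True
      then have z: "norm z < 1" "norm (1 - hermitian z \<zeta>) < \<alpha> * (1 - norm z)" by (auto simp: admissible_region_def)
      show ?thesis
      proof (cases "norm z \<le> 1/2")
        case half: True
        have "(norm z)\<^sup>2 \<le> (1/2)\<^sup>2" using half by (intro power_mono) auto
        then have sq: "(norm z)\<^sup>2 \<le> 1/4" "0 \<le> (norm z)\<^sup>2" by (simp_all add: power2_eq_square)
        have cmp: "0 < u \<and> u \<le> 2 * 1 \<and> 1 \<le> 2 * u" if "x \<le> 1/4" "0 \<le> x" "u = 1 - x" for u x :: real
          using that by linarith
        have "(1 - (norm z)\<^sup>2) powr b \<le> 2 powr \<bar>b\<bar> * 1 powr b"
          using cmp[OF sq refl] by (intro powr_comparable) simp_all
        then have "norm (g z) powr q * (1 - (norm z)\<^sup>2) powr b \<le> c1"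
          unfolding c1_def using M half q by (intro mult_mono powr_mono2) auto
        then have "ennreal (norm (g z) powr q * (1 - (norm z)\<^sup>2) powr b) * indicator (admissible_region \<alpha> \<zeta>) z \<le> ennreal c1 * indicator (ball 0 1) z"
          using True z by (simp add: ennreal_leI)
        then show ?thesis by (rule order_trans) simp
      next
        case False
        obtain j where j: "t j / 2 < 1 - norm z" "1 - norm z \<le> t j"
          unfolding t_def by (rule dyadic_scale[of "1 - norm z"]) (use z in auto)
        have "\<alpha> * (1 - norm z) \<le> \<alpha> * t j" using j \<alpha> by (intro mult_left_mono) auto
        then have h: "norm (1 - hermitian z \<zeta>) < \<alpha> * t j" using z by simp
        have at: "0 < \<alpha> * t j" using \<alpha> t[of j] by simp
        have "norm (orth_part \<zeta> z) \<le> sqrt (2 * (\<alpha> * t j))" using h z by (intro norm_orth_part_le_sqrt[OF \<zeta>]) auto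
        also have "\<dots> < sqrt (4 * (\<alpha> * t j))" using at by (intro real_sqrt_less_mono) simp
        also have "\<dots> = 2 * sqrt (\<alpha> * t j)" by (simp add: real_sqrt_mult)
        finally have zD: "z \<in> D j" using h by (simp add: D_def norm_minus_commute)
        have u: "1 - (norm z)\<^sup>2 = (1 + norm z) * (1 - norm z)" by (simp add: power2_eq_square algebra_simps)
        have u1: "1 - norm z \<le> 1 - (norm z)\<^sup>2" unfolding u using z by (intro mult_le_cancel_right1[THEN iffD2]) auto
        have u2: "1 - (norm z)\<^sup>2 \<le> 2 * (1 - norm z)" unfolding u using z by (intro mult_right_mono) auto
        have wt: "(1 - (norm z)\<^sup>2) powr b \<le> 4 powr \<bar>b\<bar> * t j powr b"
        proof -
          have "0 < u \<and> u \<le> 4 * t \<and> t \<le> 4 * u" if "0 < t" "t / 2 < v" "v \<le> t" "v \<le> u" "u \<le> 2 * v" for t u v :: real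
            using that by linarith
          from this[OF t[of j] j u1 u2] show ?thesis using t[of j] by (intro powr_comparable) simp_all
        qed
        have "ennreal (norm (g z) powr q) \<le> ennreal (CP * t j powr (- a)) * X j"
          unfolding X_def t_def using j False z h t[of j] by (intro pw[OF \<zeta>]) (auto simp: t_def)
        then have "ennreal (norm (g z) powr q) * ennreal ((1 - (norm z)\<^sup>2) powr b) \<le> (ennreal (CP * t j powr (- a)) * X j) * ennreal (4 powr \<bar>b\<bar> * t j powr b)"
          using wt by (intro mult_mono ennreal_leI) auto
        also have "\<dots> = ennreal ((CP * t j powr (- a)) * (4 powr \<bar>b\<bar> * t j powr b)) * X j"
          using CP by (simp add: ennreal_mult mult_ac)
        also have "(CP * t j powr (- a)) * (4 powr \<bar>b\<bar> * t j powr b) = K1 / t j ^ (n + 1)"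
        proof -
          have "t j powr (- a) * t j powr b = t j powr (- real (n + 1))" unfolding powr_add[symmetric] by (simp add: b_def algebra_simps)
          also have "\<dots> = 1 / t j ^ (n + 1)" using t[of j] by (simp only: powr_minus powr_realpow) (simp add: divide_inverse)
          finally have "CP * 4 powr \<bar>b\<bar> * (t j powr (- a) * t j powr b) = K1 / t j ^ (n + 1)" by (simp add: K1_def)
          then show ?thesis by (simp add: mult_ac)
        qed
        finally have "ennreal (norm (g z) powr q * (1 - (norm z)\<^sup>2) powr b) * indicator (admissible_region \<alpha> \<zeta>) z
            \<le> ennreal (K1 / t j ^ (n + 1)) * X j * indicator (D j) z"
          using True zD by (simp add: ennreal_mult)
        also have "\<dots> \<le> (\<Sum>j. ennreal (K1 / t j ^ (n + 1)) * X j * indicator (D j) z)"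
          by (rule ennreal_le_suminf)
        finally show ?thesis by (rule order_trans) simp
      qed
    qed simp
    have "area_integral \<alpha> k q s f \<zeta> \<le> (\<integral>\<^sup>+(z :: complex ^ 'n). ennreal c1 * indicator (ball 0 1) z + (\<Sum>j. ennreal (K1 / t j ^ (n + 1)) * X j * indicator (D j) z) \<partial>lborel)"
      unfolding area_integral_def using point unfolding g_def a_def b_def n_def by (intro nn_integral_mono) simp
    also have "\<dots> = (\<integral>\<^sup>+(z :: complex ^ 'n). ennreal c1 * indicator (ball 0 1) z \<partial>lborel) + (\<integral>\<^sup>+z. (\<Sum>j. ennreal (K1 / t j ^ (n + 1)) * X j * indicator (D j) z) \<partial>lborel)"
      by (rule nn_integral_add) measurable
    also have "(\<integral>\<^sup>+(z :: complex ^ 'n). ennreal c1 * indicator (ball 0 1) z \<partial>lborel) = ennreal (c1 * unit_vol TYPE('n))"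
      using c1 unit_vol_pos[where 'n = 'n] by (subst nn_integral_cmult_indicator) (auto simp: emeasure_unit_ball ennreal_mult)
    also have "(\<integral>\<^sup>+z. (\<Sum>j. ennreal (K1 / t j ^ (n + 1)) * X j * indicator (D j) z) \<partial>lborel)
       = (\<Sum>j. \<integral>\<^sup>+z. ennreal (K1 / t j ^ (n + 1)) * X j * indicator (D j) z \<partial>lborel)"
      by (rule nn_integral_suminf) measurable
    also have "\<dots> = (\<Sum>j. ennreal (K1 * VW) * X j)"
    proof (rule suminf_cong)
      fix j
      have "(\<integral>\<^sup>+z. ennreal (K1 / t j ^ (n + 1)) * X j * indicator (D j) z \<partial>lborel) = ennreal (K1 / t j ^ (n + 1)) * X j * ennreal (VW * t j ^ (n + 1))"
        by (subst nn_integral_cmult_indicator) (auto simp: volD)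
      also have "\<dots> = ennreal (K1 / t j ^ (n + 1) * (VW * t j ^ (n + 1))) * X j"
        using K1 VW t[of j] by (intro ennreal_mult_around) auto
      also have "K1 / t j ^ (n + 1) * (VW * t j ^ (n + 1)) = K1 * VW" using t[of j] by simp
      finally show "(\<integral>\<^sup>+z. ennreal (K1 / t j ^ (n + 1)) * X j * indicator (D j) z \<partial>lborel) = ennreal (K1 * VW) * X j" .
    qed
    also have "\<dots> = ennreal (K1 * VW) * (\<Sum>j. X j)" by (rule ennreal_suminf_cmult)
    finally show ?thesis unfolding X_def .
  qed
  then show ?thesis unfolding a_def g_def by blast
qed

text \<open>
  Cauchy's inequality for \<open>c g\<^sub>k(c \<zeta>)\<close> on the circle of radius \<open>(1 - r) /
  2\<close> around \<open>r\<close>: the points of the circle are at height about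
  \<open>2\<^sup>-\<^sup>j\<close> over \<open>\<zeta>\<close>, and the derivative costs a factor
  \<open>2\<^sup>j\<close>, which the exponent \<open>a + q\<close> of the weight compensates. The factor
  16 is \<open>2 \<kappa> + 12\<close> for \<open>\<kappa> = 2\<close>.
\<close>
lemma derivative_radial_part_le_dyadic:
  fixes f :: "complex ^ 'n \<Rightarrow> complex"
  assumes f: "line_holomorphic f" and q: "1 < q" and N: "1 \<le> N"
  shows "\<exists>C. \<forall>\<zeta>. norm \<zeta> = 1 \<longrightarrow> radial_part (3/4) q (a + q) (IR_power (real (Suc k)) f) \<zeta>
    \<le> ennreal C * (\<Sum>j. dyadic_average 16 N q a (IR_power (real k) f) j \<zeta>)"
proof -
  define g where "g = IR_power (real k) f"
  define g' where "g' = IR_power (real (Suc k)) f"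
  have g: "line_holomorphic g" unfolding g_def by (rule IR_power_line_holomorphic[OF f])
  obtain CP where CP: "0 < CP" and pw: "\<And>j \<zeta> z. norm \<zeta> = 1 \<Longrightarrow> 1/2 \<le> norm z \<Longrightarrow> norm z < 1 \<Longrightarrow>
     (1/2) ^ j / 4 \<le> 1 - norm z \<Longrightarrow> 1 - norm z \<le> 2 * (1/2) ^ j \<Longrightarrow> norm (1 - hermitian z \<zeta>) \<le> 2 * (1/2) ^ j \<Longrightarrow>
     ennreal (norm (g z) powr q) \<le> ennreal (CP * ((1/2) ^ j) powr (- a)) * dyadic_average 16 N q a g j \<zeta>"
    using pointwise_le_dyadic_average[OF q N, of 2 a] g by auto
  define K1 where "K1 = CP * 4 powr q * 2 powr \<bar>a + q - 1\<bar>"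
  have K1: "0 < K1" using CP by (simp add: K1_def)
  have "radial_part (3/4) q (a + q) g' \<zeta> \<le> ennreal K1 * (\<Sum>j. dyadic_average 16 N q a g j \<zeta>)" if \<zeta>: "norm \<zeta> = 1" for \<zeta>
  proof -
    define t where "t j = (1/2 :: real) ^ j" for j :: nat
    have t: "0 < t j" for j by (simp add: t_def)
    define X where "X j = dyadic_average 16 N q a g j \<zeta>" for j
    have deriv: "((\<lambda>c. c * g (c *s \<zeta>)) has_field_derivative g' (c *s \<zeta>)) (at c)" if "norm c < 1" for c
      unfolding g_def g'_def by (rule IR_power_derivative[OF f _ that]) (simp add: \<zeta>)
    have point: "ennreal (norm (g' (r *\<^sub>R \<zeta>)) powr q * (1 - r) powr (a + q - 1)) * indicator {3/4<..<1} r
      \<le> (\<Sum>j. ennreal (K1 / t j) * X j * indicator {1 - t j..1} r)" for r :: real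
    proof (cases "r \<in> {3/4<..<1}")
      case True
      define \<tau> where "\<tau> = 1 - r"
      have \<tau>: "0 < \<tau>" "\<tau> < 1/4" "r = 1 - \<tau>" using True by (auto simp: \<tau>_def)
      obtain j where j: "t j / 2 < \<tau>" "\<tau> \<le> t j"
        unfolding t_def by (rule dyadic_scale[of \<tau>]) (use \<tau> in auto)
      have bd: "ennreal (norm (g' (r *\<^sub>R \<zeta>)) powr q) \<le> ennreal (CP * t j powr (- a) * (4 / t j) powr q) * X j"
      proof (cases "X j")
        case top
        have "0 < CP * t j powr (- a) * (4 / t j) powr q" using CP t[of j] by simp
        then show ?thesis using top CP t[of j] by (auto simp: ennreal_mult_top)
      next
        case (real x)
        define y where "y = CP * t j powr (- a) * x"
        have y: "0 \<le> y" using CP real by (simp add: y_def)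
        have nr: "norm (complex_of_real r) = r" using \<tau> by (simp only: norm_of_real)
        define \<phi> where "\<phi> c = c * g (c *s \<zeta>)" for c
        have sub: "norm c < 1" if "c \<in> cball (complex_of_real r) (\<tau> / 2)" for c
        proof -
          have "norm c \<le> norm (complex_of_real r) + norm (c - complex_of_real r)" by (rule norm_triangle_sub)
          moreover have "norm (c - complex_of_real r) \<le> \<tau> / 2" using that by (simp add: dist_norm norm_minus_commute)
          ultimately show ?thesis using \<tau> nr by linarith
        qed
        have hol: "\<phi> holomorphic_on cball (complex_of_real r) (\<tau> / 2)"
        proof (rule holomorphic_onI)
          fix c assume "c \<in> cball (complex_of_real r) (\<tau> / 2)"
          then have "(\<phi> has_field_derivative g' (c *s \<zeta>)) (at c)" unfolding \<phi>_def[abs_def] by (intro deriv sub)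
          then show "\<phi> field_differentiable at c within cball (complex_of_real r) (\<tau> / 2)"
            using field_differentiable_at_within field_differentiable_def by blast
        qed
        have circ: "norm (\<phi> c) \<le> y powr (1 / q)" if c: "norm (complex_of_real r - c) = \<tau> / 2" for c
        proof -
          have "norm c \<le> norm (complex_of_real r) + norm (c - complex_of_real r)" by (rule norm_triangle_sub)
          then have c1: "norm c \<le> r + \<tau> / 2" using c nr norm_minus_commute[of c "complex_of_real r"] by linarith
          have "norm (complex_of_real r) \<le> norm c + norm (complex_of_real r - c)" by (rule norm_triangle_sub)
          then have c2: "r - \<tau> / 2 \<le> norm c" using c nr by linarith
          have "norm (1 - c) \<le> norm (1 - complex_of_real r) + norm (complex_of_real r - c)"
            using norm_triangle_ineq[of "1 - complex_of_real r" "complex_of_real r - c"] by simp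
          moreover have "norm (1 - complex_of_real r) = \<tau>"
            using \<tau> norm_of_real[of "1 - r", where 'a = complex] by simp
          ultimately have c3: "norm (1 - c) \<le> 2 * t j" using c j \<tau> by linarith
          have nz: "norm (c *s \<zeta>) = norm c" using \<zeta> by (simp add: norm_vector_smult)
          have hz: "hermitian (c *s \<zeta>) \<zeta> = c" using \<zeta> by (simp add: hermitian_smult_left hermitian_self)
          have "ennreal (norm (g (c *s \<zeta>)) powr q) \<le> ennreal (CP * ((1/2) ^ j) powr (- a)) * dyadic_average 16 N q a g j \<zeta>"
            using c1 c2 c3 j \<tau> unfolding t_def by (intro pw[OF \<zeta>]) (simp_all add: nz hz)
          also have "\<dots> = ennreal y" using real CP unfolding X_def[symmetric] t_def[symmetric] by (simp add: y_def ennreal_mult)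
          finally have "norm (g (c *s \<zeta>)) powr q \<le> y" using y by simp
          then have "(norm (g (c *s \<zeta>)) powr q) powr (1 / q) \<le> y powr (1 / q)" using q by (intro powr_mono2) auto
          then have "norm (g (c *s \<zeta>)) \<le> y powr (1 / q)" using q by (simp add: powr_powr)
          moreover have "norm c * norm (g (c *s \<zeta>)) \<le> 1 * norm (g (c *s \<zeta>))" using c1 \<tau> by (intro mult_right_mono) auto
          ultimately show ?thesis by (simp add: \<phi>_def norm_mult)
        qed
        have "norm ((deriv ^^ 1) \<phi> (complex_of_real r)) \<le> fact 1 * y powr (1 / q) / (\<tau> / 2) ^ 1"
          using \<tau> hol circ by (intro Cauchy_inequality holomorphic_on_imp_continuous_on)
            (auto intro: holomorphic_on_subset)
        moreover have "deriv \<phi> (complex_of_real r) = g' (r *\<^sub>R \<zeta>)"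
          unfolding scaleR_eq_vector_smult \<phi>_def[abs_def] by (intro DERIV_imp_deriv deriv) (use nr \<tau> in linarith)
        ultimately have "norm (g' (r *\<^sub>R \<zeta>)) \<le> y powr (1 / q) * (2 / \<tau>)" by simp
        also have "\<dots> \<le> y powr (1 / q) * (4 / t j)" using j t[of j] \<tau> by (intro mult_left_mono) (auto simp: field_simps)
        finally have "norm (g' (r *\<^sub>R \<zeta>)) powr q \<le> (y powr (1 / q) * (4 / t j)) powr q" using q by (intro powr_mono2) auto
        also have "\<dots> = (y powr (1 / q)) powr q * (4 / t j) powr q" using t[of j] by (intro powr_mult)
        also have "(y powr (1 / q)) powr q = y" using q y by (simp add: powr_powr)
        also have "y * (4 / t j) powr q = CP * t j powr (- a) * (4 / t j) powr q * x" by (simp add: y_def mult_ac)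
        finally show ?thesis using real CP t[of j] by (simp add: ennreal_mult[symmetric] ennreal_leI)
      qed
      have wt: "(1 - r) powr (a + q - 1) \<le> 2 powr \<bar>a + q - 1\<bar> * t j powr (a + q - 1)"
        unfolding \<tau>_def[symmetric] by (intro powr_comparable; use t[of j] j \<tau> in linarith)
      have "ennreal (norm (g' (r *\<^sub>R \<zeta>)) powr q) * ennreal ((1 - r) powr (a + q - 1))
         \<le> (ennreal (CP * t j powr (- a) * (4 / t j) powr q) * X j) * ennreal (2 powr \<bar>a + q - 1\<bar> * t j powr (a + q - 1))"
        using bd wt by (intro mult_mono ennreal_leI) auto
      also have "\<dots> = ennreal ((CP * t j powr (- a) * (4 / t j) powr q) * (2 powr \<bar>a + q - 1\<bar> * t j powr (a + q - 1))) * X j"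
        using CP by (simp add: ennreal_mult mult_ac)
      also have "(CP * t j powr (- a) * (4 / t j) powr q) * (2 powr \<bar>a + q - 1\<bar> * t j powr (a + q - 1)) = K1 / t j"
      proof -
        have "t j powr (- a) * t j powr (- q) * t j powr (a + q - 1) = t j powr (- 1)" unfolding powr_add[symmetric] by simp
        also have "\<dots> = 1 / t j" using t[of j] by (simp add: powr_minus divide_inverse)
        finally have e: "t j powr (- a) * t j powr (- q) * t j powr (a + q - 1) = 1 / t j" .
        have "(4 / t j) powr q = 4 powr q * t j powr (- q)" using t[of j] by (simp add: powr_divide powr_minus_divide)
        then have "(CP * t j powr (- a) * (4 / t j) powr q) * (2 powr \<bar>a + q - 1\<bar> * t j powr (a + q - 1))
            = K1 * (t j powr (- a) * t j powr (- q) * t j powr (a + q - 1))" by (simp add: K1_def mult_ac)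
        then show ?thesis by (simp add: e)
      qed
      finally have "ennreal (norm (g' (r *\<^sub>R \<zeta>)) powr q * (1 - r) powr (a + q - 1)) * indicator {3/4<..<1} r
          \<le> ennreal (K1 / t j) * X j * indicator {1 - t j..1} r"
        using True j by (simp add: ennreal_mult \<tau>_def)
      also have "\<dots> \<le> (\<Sum>j. ennreal (K1 / t j) * X j * indicator {1 - t j..1} r)"
        by (rule ennreal_le_suminf)
      finally show ?thesis .
    qed simp
    have "radial_part (3/4) q (a + q) g' \<zeta> \<le> (\<integral>\<^sup>+r. (\<Sum>j. ennreal (K1 / t j) * X j * indicator {1 - t j..1} r) \<partial>lborel)"
      unfolding radial_part_def by (intro nn_integral_mono point)
    also have "\<dots> = (\<Sum>j. \<integral>\<^sup>+r. ennreal (K1 / t j) * X j * indicator {1 - t j..1} r \<partial>lborel)"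
      by (rule nn_integral_suminf) measurable
    also have "\<dots> = (\<Sum>j. ennreal K1 * X j)"
    proof (rule suminf_cong)
      fix j
      have "(\<integral>\<^sup>+r. ennreal (K1 / t j) * X j * indicator {1 - t j..1} r \<partial>lborel) = ennreal (K1 / t j) * X j * ennreal (t j)"
        using t[of j] by (subst nn_integral_cmult_indicator) auto
      also have "\<dots> = ennreal (K1 / t j * t j) * X j"
        using K1 t[of j] by (subst ennreal_mult) (auto simp: mult_ac)
      finally show "(\<integral>\<^sup>+r. ennreal (K1 / t j) * X j * indicator {1 - t j..1} r \<partial>lborel) = ennreal K1 * X j" using t[of j] by simp
    qed
    also have "\<dots> = ennreal K1 * (\<Sum>j. X j)" by (rule ennreal_suminf_cmult)
    finally show ?thesis unfolding X_def .
  qed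
  then show ?thesis unfolding g_def g'_def by blast
qed

text \<open>The additive constant is harmless because the measure is finite.\<close>
lemma power_integral_finite_mono:
  assumes P: "0 < P" and [measurable]: "Y \<in> borel_measurable borel_sphere"
    and le: "\<And>\<zeta>. norm \<zeta> = 1 \<Longrightarrow> Z \<zeta> \<le> ennreal C0 + ennreal C * Y \<zeta>"
    and fin: "(\<integral>\<^sup>+\<zeta>. ennpowr (Y \<zeta>) P \<partial>mu) < top"
  shows "(\<integral>\<^sup>+\<zeta>. ennpowr (Z \<zeta>) P \<partial>mu) < top"
proof -
  have "(\<integral>\<^sup>+\<zeta>. ennpowr (Z \<zeta>) P \<partial>mu) \<le> (\<integral>\<^sup>+\<zeta>. ennreal (2 powr P) * (ennpowr (ennreal C0) P + ennpowr (ennreal C) P * ennpowr (Y \<zeta>) P) \<partial>mu)"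
  proof (rule nn_integral_mono)
    fix \<zeta> assume "\<zeta> \<in> space mu"
    then have "ennpowr (Z \<zeta>) P \<le> ennpowr (ennreal C0 + ennreal C * Y \<zeta>) P"
      by (intro ennpowr_mono P le) (simp add: space_mu)
    also have "\<dots> \<le> ennreal (2 powr P) * (ennpowr (ennreal C0) P + ennpowr (ennreal C * Y \<zeta>) P)" by (rule ennpowr_add_le[OF P])
    finally show "ennpowr (Z \<zeta>) P \<le> ennreal (2 powr P) * (ennpowr (ennreal C0) P + ennpowr (ennreal C) P * ennpowr (Y \<zeta>) P)"
      by (simp add: ennpowr_mult[OF P])
  qed
  also have "\<dots> = ennreal (2 powr P) * (ennpowr (ennreal C0) P * emeasure mu (space mu) + ennpowr (ennreal C) P * (\<integral>\<^sup>+\<zeta>. ennpowr (Y \<zeta>) P \<partial>mu))"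
    by (subst nn_integral_cmult, measurable, subst nn_integral_add, measurable, subst nn_integral_cmult, measurable)
  also have "\<dots> < top"
  proof -
    have "emeasure mu (space mu) < top"
      using finite_measure.emeasure_finite[OF finite_measure_mu, of "space mu"] by (simp add: less_top[symmetric])
    then show ?thesis using fin P by (simp add: ennreal_mult_less_top ennpowr_less_top_iff)
  qed
  finally show ?thesis .
qed

lemma dyadic_average_measurable:
  assumes "line_holomorphic (g :: complex ^ 'n \<Rightarrow> complex)"
  shows "dyadic_average \<rho> N q a g j \<in> borel_measurable borel_sphere"
proof -
  note [measurable] = shell_integral_measurable[OF assms]
  have "(\<lambda>\<eta>. ennpowr (shell_integral q a g j \<eta>) (1 / N)) \<in> borel_measurable mu" by measurable
  from avg_measurable[OF this, of "\<rho> * (1/2) ^ j"] show ?thesis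
    unfolding dyadic_average_def[abs_def] by measurable
qed

text \<open>
  The averages are removed by the bound for sums of averages, and the sum of the shell integrals is at most
  a multiple of the radial integral. The exponent \<open>N\<close> depends on \<open>P\<close> only, so it
  can be fixed before the bound on \<open>Z\<close> is established.
\<close>
lemma integral_finite_of_dyadic_bound:
  assumes q: "1 < q" and P: "0 < P" and \<rho>: "0 < \<rho>"
  shows "\<exists>N\<ge>1. \<forall>k s (f :: complex ^ 'n \<Rightarrow> complex) Z. line_holomorphic f \<longrightarrow> 0 < (real k - s) * q \<longrightarrow>
     (\<exists>C0 C. \<forall>\<zeta>. norm \<zeta> = 1 \<longrightarrow> Z \<zeta> \<le> ennreal C0 + ennreal C * (\<Sum>j. dyadic_average \<rho> N q ((real k - s) * q) (IR_power (real k) f) j \<zeta>)) \<longrightarrow>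
     (\<integral>\<^sup>+\<zeta>. ennpowr (radial_integral k q s f \<zeta>) P \<partial>mu) < top \<longrightarrow> (\<integral>\<^sup>+\<zeta>. ennpowr (Z \<zeta>) P \<partial>mu) < top"
proof -
  obtain N Cm where N: "1 \<le> N" and Cm: "\<And>G r. (\<And>i. G i \<in> borel_measurable mu) \<Longrightarrow>
    (\<And>i. \<exists>c::real. \<forall>x\<in>space mu. G i x \<le> ennreal c) \<Longrightarrow> (\<And>i. 0 < r i) \<Longrightarrow> antimono r \<Longrightarrow>
    (\<integral>\<^sup>+x. ennpowr (\<Sum>i. ennpowr (avg (r i) (\<lambda>y. ennpowr (G i y) (1 / N)) x) N) P \<partial>mu)
      \<le> ennreal Cm * (\<integral>\<^sup>+x. ennpowr (\<Sum>i. G i x) P \<partial>mu)"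
    using avg_power_sum_bound[OF P] by blast
  show ?thesis
  proof (intro exI[of _ N] conjI N allI impI)
    fix k s and f :: "complex ^ 'n \<Rightarrow> complex" and Z
    assume f: "line_holomorphic f" and a: "0 < (real k - s) * q"
      and Z: "\<exists>C0 C. \<forall>\<zeta>. norm \<zeta> = 1 \<longrightarrow> Z \<zeta> \<le> ennreal C0 + ennreal C * (\<Sum>j. dyadic_average \<rho> N q ((real k - s) * q) (IR_power (real k) f) j \<zeta>)"
      and fin: "(\<integral>\<^sup>+\<zeta>. ennpowr (radial_integral k q s f \<zeta>) P \<partial>mu) < top"
    define g where "g = IR_power (real k) f"
    define a where "a = (real k - s) * q"
    have g: "line_holomorphic g" unfolding g_def by (rule IR_power_line_holomorphic[OF f])
    note [measurable] = shell_integral_measurable[OF g] dyadic_average_measurable[OF g] radial_integral_measurable[OF f]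
    obtain C2 where C2: "\<And>\<zeta>. norm \<zeta> = 1 \<Longrightarrow> radial_part 0 q a g \<zeta> \<le> ennreal C2 * radial_integral k q s f \<zeta>"
      using radial_integral_compare(2)[OF f q a, of 0] unfolding a_def g_def by auto
    have fin2: "(\<integral>\<^sup>+\<zeta>. ennpowr (\<Sum>j. shell_integral q a g j \<zeta>) P \<partial>mu) < top"
    proof (rule power_integral_finite_mono[OF P radial_integral_measurable[OF f] _ fin])
      fix \<zeta> :: "complex ^ 'n" assume \<zeta>: "norm \<zeta> = 1"
      have "(\<Sum>j. shell_integral q a g j \<zeta>) \<le> 6 * radial_part 0 q a g \<zeta>" by (rule suminf_shell_integral_le[OF g \<zeta>])
      also have "\<dots> \<le> 6 * (ennreal C2 * radial_integral k q s f \<zeta>)" by (intro mult_left_mono C2 \<zeta>) simp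
      also have "\<dots> = ennreal 0 + ennreal (6 * C2) * radial_integral k q s f \<zeta>" by (simp add: ennreal_mult' mult.assoc)
      finally show "(\<Sum>j. shell_integral q a g j \<zeta>) \<le> ennreal 0 + ennreal (6 * C2) * radial_integral k q s f \<zeta>" .
    qed
    have "(\<integral>\<^sup>+\<zeta>. ennpowr (\<Sum>j. dyadic_average \<rho> N q a g j \<zeta>) P \<partial>mu) \<le> ennreal Cm * (\<integral>\<^sup>+\<zeta>. ennpowr (\<Sum>j. shell_integral q a g j \<zeta>) P \<partial>mu)"
      unfolding dyadic_average_def
    proof (rule Cm)
      show "shell_integral q a g i \<in> borel_measurable mu" for i by measurable
      show "\<exists>c. \<forall>x\<in>space mu. shell_integral q a g i x \<le> ennreal c" for i
      proof -
        obtain c where "\<And>\<eta>. norm \<eta> = 1 \<Longrightarrow> shell_integral q a g i \<eta> \<le> ennreal c"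
          using shell_integral_bounded[OF g, of q a i] q by auto
        then show ?thesis by (intro exI[of _ c] ballI) (simp add: space_mu)
      qed
      show "0 < \<rho> * (1/2) ^ i" for i :: nat using \<rho> by simp
      show "antimono (\<lambda>i. \<rho> * (1/2) ^ i)" using \<rho> by (intro antimonoI mult_left_mono power_decreasing) auto
    qed
    also have "\<dots> < top" using fin2 by (simp add: ennreal_mult_less_top)
    finally have fin3: "(\<integral>\<^sup>+\<zeta>. ennpowr (\<Sum>j. dyadic_average \<rho> N q a g j \<zeta>) P \<partial>mu) < top" .
    obtain C0 C where "\<And>\<zeta>. norm \<zeta> = 1 \<Longrightarrow> Z \<zeta> \<le> ennreal C0 + ennreal C * (\<Sum>j. dyadic_average \<rho> N q a g j \<zeta>)"
      using Z unfolding a_def g_def by blast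
    moreover have "(\<lambda>\<zeta>. \<Sum>j. dyadic_average \<rho> N q a g j \<zeta>) \<in> borel_measurable borel_sphere" by measurable
    ultimately show "(\<integral>\<^sup>+\<zeta>. ennpowr (Z \<zeta>) P \<partial>mu) < top"
      by (rule power_integral_finite_mono[OF P _ _ fin3, rotated])
  qed
qed

lemma radial_finite_imp_area_finite:
  fixes f :: "complex ^ 'n \<Rightarrow> complex"
  assumes f: "line_holomorphic f" and q: "1 < q" and P: "0 < P" and \<alpha>: "1 < \<alpha>" and k: "s < real k"
    and fin: "(\<integral>\<^sup>+\<zeta>. ennpowr (radial_integral k q s f \<zeta>) P \<partial>mu) < top"
  shows "(\<integral>\<^sup>+\<zeta>. ennpowr (area_integral \<alpha> k q s f \<zeta>) P \<partial>mu) < top"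
proof -
  have \<rho>: "0 < 2 * \<alpha> + 12" and a: "0 < (real k - s) * q" using \<alpha> k q by auto
  obtain N where N: "1 \<le> N" and main: "\<And>k s (f :: complex ^ 'n \<Rightarrow> complex) Z. line_holomorphic f \<Longrightarrow> 0 < (real k - s) * q \<Longrightarrow>
     (\<exists>C0 C. \<forall>\<zeta>. norm \<zeta> = 1 \<longrightarrow> Z \<zeta> \<le> ennreal C0 + ennreal C * (\<Sum>j. dyadic_average (2 * \<alpha> + 12) N q ((real k - s) * q) (IR_power (real k) f) j \<zeta>)) \<Longrightarrow>
     (\<integral>\<^sup>+\<zeta>. ennpowr (radial_integral k q s f \<zeta>) P \<partial>mu) < top \<Longrightarrow> (\<integral>\<^sup>+\<zeta>. ennpowr (Z \<zeta>) P \<partial>mu) < top"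
    using integral_finite_of_dyadic_bound[OF q P \<rho>] by blast
  show ?thesis using \<alpha> by (intro main[OF f a _ fin] area_integral_le_dyadic[OF f q N]) simp
qed

lemma radial_finite_imp_Suc:
  fixes f :: "complex ^ 'n \<Rightarrow> complex"
  assumes f: "line_holomorphic f" and q: "1 < q" and P: "0 < P" and k: "s < real k"
    and fin: "(\<integral>\<^sup>+\<zeta>. ennpowr (radial_integral k q s f \<zeta>) P \<partial>mu) < top"
  shows "(\<integral>\<^sup>+\<zeta>. ennpowr (radial_integral (Suc k) q s f \<zeta>) P \<partial>mu) < top"
proof -
  define a where "a = (real k - s) * q"
  have a: "0 < a" "(real (Suc k) - s) * q = a + q" using q k by (auto simp: a_def algebra_simps)
  then have a': "0 < (real (Suc k) - s) * q" using q by simp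
  obtain C0 C where c: "\<And>\<zeta>. norm \<zeta> = 1 \<Longrightarrow> radial_integral (Suc k) q s f \<zeta> \<le> ennreal C0 + ennreal C * radial_part (3/4) q (a + q) (IR_power (real (Suc k)) f) \<zeta>"
    using radial_integral_compare(1)[OF f q a', of "3/4"] unfolding a(2) by auto
  obtain N where N: "1 \<le> N" and main: "\<And>k s (f :: complex ^ 'n \<Rightarrow> complex) Z. line_holomorphic f \<Longrightarrow> 0 < (real k - s) * q \<Longrightarrow>
     (\<exists>C0 C. \<forall>\<zeta>. norm \<zeta> = 1 \<longrightarrow> Z \<zeta> \<le> ennreal C0 + ennreal C * (\<Sum>j. dyadic_average 16 N q ((real k - s) * q) (IR_power (real k) f) j \<zeta>)) \<Longrightarrow>
     (\<integral>\<^sup>+\<zeta>. ennpowr (radial_integral k q s f \<zeta>) P \<partial>mu) < top \<Longrightarrow> (\<integral>\<^sup>+\<zeta>. ennpowr (Z \<zeta>) P \<partial>mu) < top"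
    using integral_finite_of_dyadic_bound[OF q P, of 16] by auto
  obtain C' where c': "\<And>\<zeta>. norm \<zeta> = 1 \<Longrightarrow> radial_part (3/4) q (a + q) (IR_power (real (Suc k)) f) \<zeta>
    \<le> ennreal C' * (\<Sum>j. dyadic_average 16 N q a (IR_power (real k) f) j \<zeta>)"
    using derivative_radial_part_le_dyadic[OF f q N] by blast
  have "radial_integral (Suc k) q s f \<zeta> \<le> ennreal C0 + ennreal (max C 0 * C') * (\<Sum>j. dyadic_average 16 N q a (IR_power (real k) f) j \<zeta>)"
    if \<zeta>: "norm \<zeta> = 1" for \<zeta>
  proof -
    (* A negative constant counts as 0, and products of constants need nonnegative factors. *)
    have "ennreal C = ennreal (max C 0)" by (cases "0 \<le> C") (auto simp: max_def ennreal_neg)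
    then have "radial_integral (Suc k) q s f \<zeta> \<le> ennreal C0 + ennreal (max C 0) * radial_part (3/4) q (a + q) (IR_power (real (Suc k)) f) \<zeta>"
      using c[OF \<zeta>] by simp
    also have "\<dots> \<le> ennreal C0 + ennreal (max C 0) * (ennreal C' * (\<Sum>j. dyadic_average 16 N q a (IR_power (real k) f) j \<zeta>))"
      by (intro add_left_mono mult_left_mono c' \<zeta>) simp
    finally show ?thesis by (simp add: ennreal_mult' mult.assoc)
  qed
  then show ?thesis using a(1) unfolding a_def by (intro main[OF f _ _ fin]) blast+
qed

lemma radial_Suc_finite_imp:
  fixes f :: "complex ^ 'n \<Rightarrow> complex"
  assumes f: "line_holomorphic f" and q: "1 < q" and P: "0 < P" and k: "s < real k"
    and fin: "(\<integral>\<^sup>+\<zeta>. ennpowr (radial_integral (Suc k) q s f \<zeta>) P \<partial>mu) < top"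
  shows "(\<integral>\<^sup>+\<zeta>. ennpowr (radial_integral k q s f \<zeta>) P \<partial>mu) < top"
proof -
  define a where "a = (real k - s) * q"
  have a: "0 < (real k - s) * q" "(real (Suc k) - s) * q = a + q" using q k by (auto simp: a_def algebra_simps)
  then have a': "0 < (real (Suc k) - s) * q" using q by (simp add: a_def)
  obtain C0 C where c: "\<And>\<zeta>. norm \<zeta> = 1 \<Longrightarrow> radial_integral k q s f \<zeta> \<le> ennreal C0 + ennreal C * radial_part (1/2) q a (IR_power (real k) f) \<zeta>"
    using radial_integral_compare(1)[OF f q a(1), of "1/2"] unfolding a_def by auto
  obtain D0 D where d: "\<And>\<zeta>. norm \<zeta> = 1 \<Longrightarrow> radial_part (1/2) q a (IR_power (real k) f) \<zeta> \<le> ennreal D0 + ennreal D * radial_part 0 q (a + q) (IR_power (real (Suc k)) f) \<zeta>"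
    using radial_part_le_derivative[OF f q, of a k] a(1) unfolding a_def by auto
  obtain E where e: "\<And>\<zeta>. norm \<zeta> = 1 \<Longrightarrow> radial_part 0 q (a + q) (IR_power (real (Suc k)) f) \<zeta> \<le> ennreal E * radial_integral (Suc k) q s f \<zeta>"
    using radial_integral_compare(2)[OF f q a', of 0] unfolding a(2) by auto
  obtain c0 c1 d0 d1 e1 where nn: "0 \<le> c0" "0 \<le> c1" "0 \<le> d0" "0 \<le> d1" "0 \<le> e1"
    and eq: "ennreal C0 = ennreal c0" "ennreal C = ennreal c1" "ennreal D0 = ennreal d0" "ennreal D = ennreal d1" "ennreal E = ennreal e1"
    using ennreal_nonneg_rep by metis
  show ?thesis
  proof (rule power_integral_finite_mono[OF P radial_integral_measurable[OF f] _ fin])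
    fix \<zeta> :: "complex ^ 'n" assume \<zeta>: "norm \<zeta> = 1"
    have "radial_integral k q s f \<zeta> \<le> ennreal c0 + ennreal c1 * (ennreal d0 + ennreal d1 * (ennreal e1 * radial_integral (Suc k) q s f \<zeta>))"
      using c[OF \<zeta>] d[OF \<zeta>] e[OF \<zeta>] unfolding eq by (meson add_left_mono mult_left_mono order_trans zero_le)
    also have "\<dots> = ennreal (c0 + c1 * d0) + ennreal (c1 * d1 * e1) * radial_integral (Suc k) q s f \<zeta>"
    proof -
      have "ennreal (c0 + c1 * d0) = ennreal c0 + ennreal c1 * ennreal d0" "ennreal (c1 * d1 * e1) = ennreal c1 * ennreal d1 * ennreal e1"
        using nn by (simp_all add: ennreal_mult)
      then show ?thesis by (simp only: distrib_left add.assoc mult.assoc)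
    qed
    finally show "radial_integral k q s f \<zeta> \<le> ennreal (c0 + c1 * d0) + ennreal (c1 * d1 * e1) * radial_integral (Suc k) q s f \<zeta>" .
  qed
qed

lemma area_finite_imp_radial_finite:
  fixes f :: "complex ^ 'n \<Rightarrow> complex"
  assumes f: "line_holomorphic f" and q: "1 < q" and P: "0 < P" and \<alpha>: "1 < \<alpha>" and k: "s < real k"
    and fin: "(\<integral>\<^sup>+\<zeta>. ennpowr (area_integral \<alpha> k q s f \<zeta>) P \<partial>mu) < top"
  shows "(\<integral>\<^sup>+\<zeta>. ennpowr (radial_integral k q s f \<zeta>) P \<partial>mu) < top"
proof -
  have a: "0 < (real k - s) * q" using q k by simp
  obtain C0 C where c: "\<And>\<zeta>. norm \<zeta> = 1 \<Longrightarrow> radial_integral k q s f \<zeta> \<le> ennreal C0 + ennreal C * radial_part (1/2) q ((real k - s) * q) (IR_power (real k) f) \<zeta>"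
    using radial_integral_compare(1)[OF f q a, of "1/2"] by auto
  obtain D where d: "\<And>\<zeta>. norm \<zeta> = 1 \<Longrightarrow> radial_part (1/2) q ((real k - s) * q) (IR_power (real k) f) \<zeta> \<le> ennreal D * area_integral \<alpha> k q s f \<zeta>"
    using radial_part_le_area[OF f q \<alpha>] by blast
  have eq: "ennreal C = ennreal (max C 0)" by (cases "0 \<le> C") (auto simp: max_def ennreal_neg)
  show ?thesis
  proof (rule power_integral_finite_mono[OF P area_integral_measurable[OF f] _ fin])
    fix \<zeta> :: "complex ^ 'n" assume \<zeta>: "norm \<zeta> = 1"
    have "radial_integral k q s f \<zeta> \<le> ennreal C0 + ennreal (max C 0) * (ennreal D * area_integral \<alpha> k q s f \<zeta>)"
      using c[OF \<zeta>] d[OF \<zeta>] unfolding eq by (meson add_left_mono mult_left_mono order_trans zero_le)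
    then show "radial_integral k q s f \<zeta> \<le> ennreal C0 + ennreal (max C 0 * D) * area_integral \<alpha> k q s f \<zeta>"
      by (simp add: ennreal_mult' mult.assoc)
  qed
qed

text \<open>
  Consecutive orders are equivalent, and \<open>[s]\<^sup>+\<close> is the least integer above
  \<open>s\<close>.
\<close>
lemma radial_finite_independent:
  fixes f :: "complex ^ 'n \<Rightarrow> complex"
  assumes f: "line_holomorphic f" and q: "1 < q" and P: "0 < P" and s: "0 \<le> s" and k: "s < real k"
  shows "(\<integral>\<^sup>+\<zeta>. ennpowr (radial_integral k q s f \<zeta>) P \<partial>mu) < top
    \<longleftrightarrow> (\<integral>\<^sup>+\<zeta>. ennpowr (radial_integral (nat \<lfloor>s\<rfloor> + 1) q s f \<zeta>) P \<partial>mu) < top"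
proof -
  let ?I = "\<lambda>k. (\<integral>\<^sup>+\<zeta>. ennpowr (radial_integral k q s f \<zeta>) P \<partial>mu) < top"
  let ?m = "nat \<lfloor>s\<rfloor> + 1"
  have m: "s < real ?m" using s by linarith
  have "?m \<le> k" using k s by linarith
  then show ?thesis
  proof (induction k rule: dec_induct)
    case (step i)
    then have "s < real i" using m by linarith
    then show ?case
      using step.IH radial_finite_imp_Suc[OF f q P] radial_Suc_finite_imp[OF f q P] by blast
  qed simp
qed

end

lemma HF_norm_finite_iff:
  assumes "1 < p"
  shows "HF_norm p q s w f < top \<longleftrightarrow>
    (\<integral>\<^sup>+\<zeta>. ennpowr (radial_integral (nat \<lfloor>s\<rfloor> + 1) q s f \<zeta>) (p / q) * ennreal (w \<zeta>) \<partial>sphere_measure) < top"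
  unfolding HF_norm_def using assms by (intro ennpowr_less_top_iff) simp

text \<open>The functional is Borel measurable, so membership is only a matter of finiteness.\<close>
lemma in_Lp_A_functional_iff:
  fixes f :: "complex ^ 'n \<Rightarrow> complex"
  assumes f: "line_holomorphic f" and p: "1 < p" and q: "1 < q"
  shows "in_Lp p w (A_functional \<alpha> k q s f) \<longleftrightarrow>
    (\<integral>\<^sup>+\<zeta>. ennpowr (if \<alpha> = 1 then radial_integral k q s f \<zeta> else area_integral \<alpha> k q s f \<zeta>) (p / q) * ennreal (w \<zeta>) \<partial>sphere_measure) < top"
proof -
  note [measurable] = radial_integral_measurable[OF f] area_integral_measurable[OF f]
  have "A_functional \<alpha> k q s f \<in> borel_measurable borel_sphere"
    unfolding A_functional_def[abs_def] by measurable
  then have m: "A_functional \<alpha> k q s f \<in> borel_measurable sphere_measure"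
    unfolding sphere_measure_eq by (rule measurable_completion)
  have e: "ennpowr (A_functional \<alpha> k q s f \<zeta>) p
      = ennpowr (if \<alpha> = 1 then radial_integral k q s f \<zeta> else area_integral \<alpha> k q s f \<zeta>) (p / q)" for \<zeta>
    unfolding A_functional_def using p q by (subst ennpowr_ennpowr) auto
  show ?thesis unfolding in_Lp_def e using m by simp
qed

lemma ball_average_borel_sphere:
  assumes "AE x in borel_sphere. g x = h x"
  shows "ball_average (nonisotropic_ball \<zeta> r) g
    = (\<integral>\<^sup>+\<eta>\<in>nonisotropic_ball \<zeta> r. h \<eta> \<partial>borel_sphere) / emeasure borel_sphere (nonisotropic_ball \<zeta> r)"
proof -
  have "(\<integral>\<^sup>+\<eta>\<in>nonisotropic_ball \<zeta> r. g \<eta> \<partial>borel_sphere) = (\<integral>\<^sup>+\<eta>\<in>nonisotropic_ball \<zeta> r. h \<eta> \<partial>borel_sphere)"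
    using assms by (intro nn_integral_cong_AE) auto
  then show ?thesis
    unfolding ball_average_def sphere_measure_eq nn_integral_completion
    by (simp add: emeasure_completion sets_nonisotropic_ball sets_completionI_sets)
qed

theorem theorem2p9:
  fixes p q s :: real
    and w :: "complex ^ 'n \<Rightarrow> real"
    and f :: "complex ^ 'n \<Rightarrow> complex"
  assumes "1 < p" and "1 < q" and "0 \<le> s"
    and "Ap_weight p w"
    and "holomorphic_on_ball f"
  shows "(f \<in> HF_space p q s w \<longleftrightarrow>
            (\<exists>\<alpha>\<ge>1. \<exists>k::nat. real k > s \<and> in_Lp p w (A_functional \<alpha> k q s f))) \<and>
         ((\<exists>\<alpha>\<ge>1. \<exists>k::nat. real k > s \<and> in_Lp p w (A_functional \<alpha> k q s f)) \<longleftrightarrow>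
            (\<forall>\<alpha>\<ge>1. \<forall>k::nat. real k > s \<longrightarrow> in_Lp p w (A_functional \<alpha> k q s f)))"
proof -
  have f: "line_holomorphic f" by (rule holomorphic_on_ball_imp_line_holomorphic) fact
  define P where "P = p / q"
  have P: "0 < P" using assms(1,2) by (simp add: P_def)
  let ?m = "nat \<lfloor>s\<rfloor> + 1"
  have m: "s < real ?m" using assms(3) by linarith
  obtain A where A: "0 < A" and Ap: "\<And>\<zeta> r. norm \<zeta> = 1 \<Longrightarrow> 0 < r \<Longrightarrow>
      ball_average (nonisotropic_ball \<zeta> r) (\<lambda>\<eta>. ennreal (w \<eta>)) *
        ennpowr (ball_average (nonisotropic_ball \<zeta> r) (\<lambda>\<eta>. ennpowr (ennreal (w \<eta>)) (- 1 / (p - 1)))) (p - 1) \<le> ennreal A"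
    using assms(4) unfolding Ap_weight_def by auto
  have "w \<in> borel_measurable (completion borel_sphere)"
    using assms(4) unfolding Ap_weight_def sphere_measure_eq by blast
  (* The weight is measurable for the completed measure only; the Borel representative changes no integral. *)
  then obtain w0 where w0: "w0 \<in> borel_measurable borel_sphere" and ww: "AE x in borel_sphere. w x = w0 x"
    using completion_ex_borel_measurable_real by blast
  define W where "W x = ennreal (w0 x)" for x
  have [measurable]: "W \<in> borel_measurable borel_sphere" unfolding W_def[abs_def] using w0 by measurable
  have wW: "AE x in borel_sphere. ennreal (w x) = W x" using ww by eventually_elim (simp add: W_def)
  have wW': "AE x in borel_sphere. ennpowr (ennreal (w x)) (- 1 / (p - 1)) = ennpowr (W x) (- 1 / (p - 1))"
    using wW by eventually_elim simp
  have tr: "(\<integral>\<^sup>+\<zeta>. F \<zeta> * ennreal (w \<zeta>) \<partial>sphere_measure) = (\<integral>\<^sup>+\<zeta>. W \<zeta> * F \<zeta> \<partial>borel_sphere)" for F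
    unfolding sphere_measure_eq nn_integral_completion using wW
    by (intro nn_integral_cong_AE) (auto simp: mult.commute)
  let ?R = "\<lambda>k. (\<integral>\<^sup>+\<zeta>. W \<zeta> * ennpowr (radial_integral k q s f \<zeta>) P \<partial>borel_sphere) < top"
  let ?S = "\<lambda>\<alpha> k. (\<integral>\<^sup>+\<zeta>. W \<zeta> * ennpowr (area_integral \<alpha> k q s f \<zeta>) P \<partial>borel_sphere) < top"
  have main: "?R k = ?R ?m \<and> (1 < \<alpha> \<longrightarrow> ?S \<alpha> k = ?R ?m)" if k: "s < real k" for k \<alpha>
  proof (cases "(\<integral>\<^sup>+\<eta>. W \<eta> \<partial>borel_sphere) = 0")
    case True
    then have "AE \<eta> in borel_sphere. W \<eta> = 0" by (subst (asm) nn_integral_0_iff_AE) auto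
    then have "(\<integral>\<^sup>+\<zeta>. W \<zeta> * F \<zeta> \<partial>borel_sphere) = (\<integral>\<^sup>+\<zeta>. 0 \<partial>(borel_sphere :: (complex ^ 'n) measure))" for F
      by (intro nn_integral_cong_AE) auto
    then show ?thesis by simp
  next
    case False
    interpret muckenhoupt p W A
    proof
      show "W \<in> borel_measurable borel_sphere" by fact
      show "(\<integral>\<^sup>+\<eta>\<in>nonisotropic_ball \<zeta> r. W \<eta> \<partial>borel_sphere) / emeasure borel_sphere (nonisotropic_ball \<zeta> r) *
        ennpowr ((\<integral>\<^sup>+\<eta>\<in>nonisotropic_ball \<zeta> r. ennpowr (W \<eta>) (- 1 / (p - 1)) \<partial>borel_sphere) /
         emeasure borel_sphere (nonisotropic_ball \<zeta> r)) (p - 1) \<le> ennreal A" if "norm \<zeta> = 1" "0 < r" for \<zeta> r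
        using Ap[OF that] unfolding ball_average_borel_sphere[OF wW] ball_average_borel_sphere[OF wW'] .
    qed (use assms A False in \<open>auto simp: W_def\<close>)
    note [measurable] = radial_integral_measurable[OF f] area_integral_measurable[OF f]
    have R: "?R k \<longleftrightarrow> (\<integral>\<^sup>+\<zeta>. ennpowr (radial_integral k q s f \<zeta>) P \<partial>mu) < top" for k
      unfolding mu_def by (subst nn_integral_density) auto
    have S: "?S \<alpha> k \<longleftrightarrow> (\<integral>\<^sup>+\<zeta>. ennpowr (area_integral \<alpha> k q s f \<zeta>) P \<partial>mu) < top"
      unfolding mu_def by (subst nn_integral_density) auto
    show ?thesis
      unfolding R S using radial_finite_independent[OF f assms(2) P assms(3) k]
        radial_finite_imp_area_finite[OF f assms(2) P _ k] area_finite_imp_radial_finite[OF f assms(2) P _ k] by blast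
  qed
  have HF: "f \<in> HF_space p q s w \<longleftrightarrow> ?R ?m"
    unfolding HF_space_def using assms(5) by (simp add: HF_norm_finite_iff[OF assms(1)] tr P_def)
  have L: "in_Lp p w (A_functional \<alpha> k q s f) \<longleftrightarrow> ?R ?m" if "1 \<le> \<alpha>" "s < real k" for \<alpha> k
    unfolding in_Lp_A_functional_iff[OF f assms(1,2)] tr using main[OF that(2), of \<alpha>] that(1)
    by (cases "\<alpha> = 1") (auto simp: P_def)
  show ?thesis unfolding HF using L m by (meson order_refl)
qed

end
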